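(* Let $k$ be a field of characteristic zero, $G$ a finite group, $\chi\colon G\to k^\times$ a character, $n\ge2$, and $g_1\in\mathcal Z(G)$ an element of the center of $G$ such that $\chi(g_1)$ is a primitive $n$-th root of $1$. Let $\xi\in k$, let $\alpha\in\mathrm{Aut}(k[G])$ be defined by $\alpha(g)=\chi(g)g$ for $g\in G$, and let $A=k[G][x,\alpha]/\langle x^n-\xi(g_1^n-1)\rangle$. Let $C_n\subseteq k$ be the set of all $n$-th roots of $1$. The Hochschild homology $\mathrm{HH}_*(A)$ of $A$ over $k$ is given as follows, for all $m\ge0$. (1) If $\xi=0$, then, with $K=k[G]$, $$\mathrm{HH}_0(A)=\frac K{[K,K]},\quad \mathrm{HH}_{2m+1}(A)=\bigoplus_{w\in C_n\setminus\{1\}}\frac{K^w}{[K,K]^w_{\alpha^{(m+1)n}}}x^{n-1},\quad \mathrm{HH}_{2m+2}(A)=\bigoplus_{w\in C_n\setminus\{1\}}\frac{K^w}{[K,K]^w_{\alpha^{(m+1)n}}}.$$ (2) If $\xi\ne0$ and $\chi^n$ is the trivial character, then, with $K=k[G]$, $$\mathrm{HH}_0(A)=\frac{K^1}{[K,K]^1}\oplus\bigoplus_{w\in C_n\setminus\{1\}}\frac{K^w}{[K,K]^w+K^w(g_1^n-1)},$$ $$\mathrm{HH}_{2m+1}(A)=\bigoplus_{w\in C_n\setminus\{1\}}\frac{\{\lambda\in K^w:\lambda(g_1^n-1)\in[K,K]^w\}}{[K,K]^w}x^{n-1},$$ $$\mathrm{HH}_{2m+2}(A)=\bigoplus_{w\in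 C_n\setminus\{1\}}\frac{K^w}{[K,K]^w+K^w(g_1^n-1)}.$$ (3) If $\xi\ne0$ and $\chi^n$ is not the trivial character, then, with $K=k[G/\langle g_1^n\rangle]$ and $\widetilde\alpha$ the automorphism of $K$ induced by $\alpha$, $$\mathrm{HH}_0(A)=\frac K{[K,K]},\quad \mathrm{HH}_{2m+1}(A)=\bigoplus_{w\in C_n\setminus\{1\}}\frac{K^w}{[K,K]^w_{\widetilde\alpha^{(m+1)n}}}x^{n-1},\quad \mathrm{HH}_{2m+2}(A)=\bigoplus_{w\in C_n\setminus\{1\}}\frac{K^w}{[K,K]^w_{\widetilde\alpha^{(m+1)n}}}.$$
   Context: For a $k$-algebra $K$ with automorphism $\alpha$, the Ore extension $K[x,\alpha]$ is the algebra generated by $K$ and $x$ subject to $x\lambda=\alpha(\lambda)x$ for $\lambda\in K$. $[K,K]_{\alpha^j}$ is the $k$-subspace of $K$ generated by all $\lambda'\alpha^j(\lambda)-\lambda\lambda'$ ($\lambda,\lambda'\in K$), and $[K,K]=[K,K]_{\alpha^0}$. For $w\in k$, $K^w$ is the eigenspace of $\alpha$ (in case (3), of $\widetilde\alpha$) on $K$ of eigenvalue $w$; $[K,K]^w_{\alpha^j}=K^w\cap[K,K]_{\alpha^j}$ and $[K,K]^w=K^w\cap[K,K]$; similarly with $\widetilde\alpha$ in place of $\alpha$ in case (3). $\langle g_1^n\rangle$ is the (central) subgroup of $G$ generated by $g_1^n$. $\mathrm{HH}_*(A)$ is the (absolute) Hochschild homology of the $k$-algebra $A$ with coefficients in $A$.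 Equalities are isomorphisms of $k$-vector spaces; the factor $x^{n-1}$ is a label recording that classes are represented by elements of $Kx^{n-1}\subseteq A$. *)

theory Defs
  imports "HOL-Algebra.Algebra" "HOL-Algebra.Algebraic_Closure_Type"
begin

text \<open>
  The ground field \<open>k\<close> is the type \<open>'k\<close>; vector spaces and algebras over it (not
  necessarily commutative) are records of type \<^typ>\<open>('k, 'v) module\<close>.  For plain vector
  spaces the multiplicative fields of the record are irrelevant.
\<close>

section \<open>Vector spaces\<close>

definition kspan :: "('k::field, 'v) module \<Rightarrow> 'v set \<Rightarrow> 'v set"
  where "kspan M S = \<Inter>{W. submodule W (ring_of_type_algebra :: 'k ring) M \<and> S \<subseteq> W}"

text \<open>The same construction serves for the quotient of a vector space by a subspace
  and for the quotient of an algebra by a two-sided ideal.\<close>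

definition kquot :: "('k, 'v) module \<Rightarrow> 'v set \<Rightarrow> ('k, 'v set) module"
  where "kquot M W =
    \<lparr>carrier = carrier (M Quot W), monoid.mult = monoid.mult (M Quot W), one = one (M Quot W),
     ring.zero = ring.zero (M Quot W), add = ring.add (M Quot W),
     module.smult = (\<lambda>c Y. \<Union>x\<in>Y. W +>\<^bsub>M\<^esub> (c \<odot>\<^bsub>M\<^esub> x))\<rparr>"

text \<open>The subquotient \<open>V / W\<close> of \<open>M\<close>, for subspaces \<open>W\<close> \<open>\<subseteq>\<close> \<open>V\<close> of \<open>M\<close>.\<close>

definition ksubquot :: "('k, 'v) module \<Rightarrow> 'v set \<Rightarrow> 'v set \<Rightarrow> ('k, 'v set) module"
  where "ksubquot M V W = kquot (M\<lparr>carrier := V\<rparr>) W"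

definition kiso :: "('k, 'v) module \<Rightarrow> ('k, 'w) module \<Rightarrow> bool"  (infix \<open>\<cong>\<^sub>k\<close> 50)
  where "M \<cong>\<^sub>k N \<longleftrightarrow>
    (\<exists>f \<in> iso (add_monoid M) (add_monoid N).
       \<forall>c. \<forall>x \<in> carrier M. f (c \<odot>\<^bsub>M\<^esub> x) = c \<odot>\<^bsub>N\<^esub> f x)"

definition kdirect_sum :: "'i set \<Rightarrow> ('i \<Rightarrow> ('k, 'v) module) \<Rightarrow> ('k, 'i \<Rightarrow> 'v) module"
  where "kdirect_sum I M =
    \<lparr>carrier = {f \<in> \<Pi>\<^sub>E i\<in>I. carrier (M i). finite {i \<in> I. f i \<noteq> \<zero>\<^bsub>M i\<^esub>}},
     monoid.mult = undefined, one = undefined,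
     ring.zero = (\<lambda>i\<in>I. \<zero>\<^bsub>M i\<^esub>),
     add = (\<lambda>f g. \<lambda>i\<in>I. f i \<oplus>\<^bsub>M i\<^esub> g i),
     module.smult = (\<lambda>c f. \<lambda>i\<in>I. c \<odot>\<^bsub>M i\<^esub> f i)\<rparr>"

definition kplus :: "('k, 'v) module \<Rightarrow> ('k, 'w) module \<Rightarrow> ('k, 'v \<times> 'w) module"
    (infixr \<open>\<oplus>\<^sub>k\<close> 65)
  where "M \<oplus>\<^sub>k N =
    \<lparr>carrier = carrier M \<times> carrier N,
     monoid.mult = undefined, one = undefined,
     ring.zero = (\<zero>\<^bsub>M\<^esub>, \<zero>\<^bsub>N\<^esub>),
     add = (\<lambda>(x, y) (x', y'). (x \<oplus>\<^bsub>M\<^esub> x', y \<oplus>\<^bsub>N\<^esub> y')),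
     module.smult = (\<lambda>c (x, y). (c \<odot>\<^bsub>M\<^esub> x, c \<odot>\<^bsub>N\<^esub> y))\<rparr>"

definition fin_funs :: "'s set \<Rightarrow> ('s \<Rightarrow> 'k::field) set"
  where "fin_funs S = {f. finite {s. f s \<noteq> 0} \<and> {s. f s \<noteq> 0} \<subseteq> S}"

definition basis_elt :: "'s \<Rightarrow> 's \<Rightarrow> 'k::field"
  where "basis_elt s = (\<lambda>t. if t = s then 1 else 0)"

definition free_space :: "'s set \<Rightarrow> ('k::field, 's \<Rightarrow> 'k) module"
  where "free_space S =
    \<lparr>carrier = fin_funs S, monoid.mult = undefined, one = undefined,
     ring.zero = (\<lambda>s. 0), add = (\<lambda>f g s. f s + g s), module.smult = (\<lambda>c f s. c * f s)\<rparr>"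

section \<open>Hochschild homology\<close>

definition tuples :: "('k, 'a) module \<Rightarrow> nat \<Rightarrow> 'a list set"
  where "tuples A m = {as. length as = m \<and> set as \<subseteq> carrier A}"

definition tensor_relations :: "('k::field, 'a) module \<Rightarrow> nat \<Rightarrow> ('a list \<Rightarrow> 'k) set"
  where "tensor_relations A m = kspan (free_space (tuples A m))
    ({(\<lambda>t. basis_elt (us @ (a \<oplus>\<^bsub>A\<^esub> b) # vs) t - basis_elt (us @ a # vs) t
            - basis_elt (us @ b # vs) t) | us a b vs.
        us @ a # vs \<in> tuples A m \<and> b \<in> carrier A} \<union>
     {(\<lambda>t. basis_elt (us @ (c \<odot>\<^bsub>A\<^esub> a) # vs) t - c * basis_elt (us @ a # vs) t) | us c a vs.
        us @ a # vs \<in> tuples A m})"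

text \<open>\<open>A \<otimes> \<dots> \<otimes> A\<close> over \<open>k\<close>, with \<open>m\<close> factors; the class of \<^term>\<open>basis_elt [a\<^sub>1, a\<^sub>2]\<close>
  is \<open>a\<^sub>1 \<otimes> a\<^sub>2\<close>.\<close>

definition tensor_power ::
    "('k::field, 'a) module \<Rightarrow> nat \<Rightarrow> ('k, ('a list \<Rightarrow> 'k) set) module"
  where "tensor_power A m = kquot (free_space (tuples A m)) (tensor_relations A m)"

text \<open>For \<open>as = [a\<^sub>0, \<dots>, a\<^sub>m]\<close>: \<open>[a\<^sub>0, \<dots>, a\<^sub>i a\<^sub>i\<^sub>+\<^sub>1, \<dots>, a\<^sub>m]\<close> if \<open>i < m\<close>,
  and \<open>[a\<^sub>m a\<^sub>0, a\<^sub>1, \<dots>, a\<^sub>m\<^sub>-\<^sub>1]\<close> if \<open>i = m\<close>.\<close>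

definition hochschild_face :: "('k, 'a) module \<Rightarrow> nat \<Rightarrow> 'a list \<Rightarrow> 'a list"
  where "hochschild_face A i as =
    (if Suc i < length as
     then take i as @ [as ! i \<otimes>\<^bsub>A\<^esub> as ! Suc i] @ drop (i + 2) as
     else (last as \<otimes>\<^bsub>A\<^esub> hd as) # butlast (tl as))"

definition hochschild_free_boundary ::
    "('k::field, 'a) module \<Rightarrow> ('a list \<Rightarrow> 'k) \<Rightarrow> ('a list \<Rightarrow> 'k)"
  where "hochschild_free_boundary A f =
    (\<lambda>t. \<Sum>as\<in>{as. f as \<noteq> 0}. f as *
      (\<Sum>i<length as. (-1) ^ i * basis_elt (hochschild_face A i as) t))"

text \<open>The unnormalized standard complex has \<^term>\<open>tensor_power A (m + 1)\<close> in degree \<open>m\<close>;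
  \<open>hochschild_boundary A m\<close>, used for \<open>m > 0\<close> only, maps degree \<open>m\<close> to degree \<open>m - 1\<close>.\<close>

definition hochschild_boundary ::
    "('k::field, 'a) module \<Rightarrow> nat \<Rightarrow> ('a list \<Rightarrow> 'k) set \<Rightarrow> ('a list \<Rightarrow> 'k) set"
  where "hochschild_boundary A m Y =
    (\<Union>f\<in>Y. tensor_relations A m +>\<^bsub>free_space (tuples A m)\<^esub> hochschild_free_boundary A f)"

definition hochschild_cycles :: "('k::field, 'a) module \<Rightarrow> nat \<Rightarrow> ('a list \<Rightarrow> 'k) set set"
  where "hochschild_cycles A m =
    {Y \<in> carrier (tensor_power A (m + 1)).
       m > 0 \<longrightarrow> hochschild_boundary A m Y = \<zero>\<^bsub>tensor_power A m\<^esub>}"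

definition hochschild_boundaries :: "('k::field, 'a) module \<Rightarrow> nat \<Rightarrow> ('a list \<Rightarrow> 'k) set set"
  where "hochschild_boundaries A m =
    hochschild_boundary A (m + 1) ` carrier (tensor_power A (m + 2))"

definition HH :: "nat \<Rightarrow> ('k::field, 'a) module \<Rightarrow> ('k, ('a list \<Rightarrow> 'k) set set) module"
  where "HH m A =
    ksubquot (tensor_power A (m + 1)) (hochschild_cycles A m) (hochschild_boundaries A m)"

section \<open>Group algebras, Ore extensions, twisted commutators\<close>

definition group_algebra :: "('g, 'b) monoid_scheme \<Rightarrow> ('k::field, 'g \<Rightarrow> 'k) module"
  where "group_algebra G =
    \<lparr>carrier = fin_funs (carrier G),
     monoid.mult = (\<lambda>f h z. \<Sum>x\<in>{x. f x \<noteq> 0}. \<Sum>y\<in>{y. h y \<noteq> 0}.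
               if x \<otimes>\<^bsub>G\<^esub> y = z then f x * h y else 0),
     one = basis_elt \<one>\<^bsub>G\<^esub>,
     ring.zero = (\<lambda>s. 0), add = (\<lambda>f h s. f s + h s), module.smult = (\<lambda>c f s. c * f s)\<rparr>"

text \<open>The linear map with \<open>g \<mapsto> \<chi>(g) g\<close>.\<close>

definition char_aut :: "('g \<Rightarrow> 'k::field) \<Rightarrow> ('g \<Rightarrow> 'k) \<Rightarrow> ('g \<Rightarrow> 'k)"
  where "char_aut \<chi> f = (\<lambda>g. \<chi> g * f g)"

definition group_algebra_proj ::
    "('g, 'b) monoid_scheme \<Rightarrow> 'g set \<Rightarrow> ('g \<Rightarrow> 'k::field) \<Rightarrow> ('g set \<Rightarrow> 'k)"
  where "group_algebra_proj G N f =
    (\<lambda>C. if C \<in> carrier (G Mod N) then \<Sum>g\<in>{g \<in> C. f g \<noteq> 0}. f g else 0)"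

text \<open>The map that an endomorphism \<open>\<alpha>\<close> of \<open>k[G]\<close>, preserving the kernel of
  \<open>\<pi>: k[G] \<rightarrow> k[G/N]\<close>, induces on \<open>k[G/N]\<close>; it is evaluated on an arbitrary \<open>\<pi>\<close>-preimage.\<close>

definition induced_on_quotient ::
    "('g, 'b) monoid_scheme \<Rightarrow> 'g set \<Rightarrow> (('g \<Rightarrow> 'k::field) \<Rightarrow> ('g \<Rightarrow> 'k)) \<Rightarrow>
     ('g set \<Rightarrow> 'k) \<Rightarrow> ('g set \<Rightarrow> 'k)"
  where "induced_on_quotient G N \<alpha> F =
    group_algebra_proj G N
      (\<alpha> (inv_into (carrier (group_algebra G)) (group_algebra_proj G N) F))"

text \<open>\<open>K[x, \<alpha>]\<close>: the sequence \<open>p\<close> stands for \<open>\<Sum> p\<^sub>i x\<^sup>i\<close> (coefficients on the left), and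
  \<open>x \<lambda> = \<alpha>(\<lambda>) x\<close>.\<close>

definition ore_extension ::
    "('k::field, 'a) module \<Rightarrow> ('a \<Rightarrow> 'a) \<Rightarrow> ('k, nat \<Rightarrow> 'a) module"
  where "ore_extension K \<alpha> =
    \<lparr>carrier = up K,
     monoid.mult = (\<lambda>p q m. \<Oplus>\<^bsub>K\<^esub>i\<in>{..m}. p i \<otimes>\<^bsub>K\<^esub> (\<alpha> ^^ i) (q (m - i))),
     one = (\<lambda>i. if i = 0 then \<one>\<^bsub>K\<^esub> else \<zero>\<^bsub>K\<^esub>),
     ring.zero = (\<lambda>i. \<zero>\<^bsub>K\<^esub>),
     add = (\<lambda>p q i. p i \<oplus>\<^bsub>K\<^esub> q i),
     module.smult = (\<lambda>c p i. c \<odot>\<^bsub>K\<^esub> p i)\<rparr>"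

text \<open>\<open>a x\<^sup>j\<close>; the subspace \<open>V x\<^sup>j\<close> is \<open>ore_monom K j ` V\<close>.\<close>

definition ore_monom :: "('k::field, 'a) module \<Rightarrow> nat \<Rightarrow> 'a \<Rightarrow> nat \<Rightarrow> 'a"
  where "ore_monom K j a = (\<lambda>i. if i = j then a else \<zero>\<^bsub>K\<^esub>)"

text \<open>\<open>k[G][x, \<alpha>] / \<langle>x\<^sup>n - \<xi> (g\<^sub>1\<^sup>n - 1)\<rangle>\<close> with \<open>\<alpha>(g) = \<chi>(g) g\<close>.\<close>

definition rank_one_algebra ::
    "('g, 'b) monoid_scheme \<Rightarrow> ('g \<Rightarrow> 'k::field) \<Rightarrow> nat \<Rightarrow> 'g \<Rightarrow> 'k \<Rightarrow>
     ('k, (nat \<Rightarrow> 'g \<Rightarrow> 'k) set) module"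
  where "rank_one_algebra G \<chi> n g\<^sub>1 \<xi> =
    (let K = group_algebra G;
         R = ore_extension K (char_aut \<chi>);
         x = ore_monom K 1 \<one>\<^bsub>K\<^esub>;
         r = \<xi> \<odot>\<^bsub>K\<^esub> (basis_elt (g\<^sub>1 [^]\<^bsub>G\<^esub> n) \<ominus>\<^bsub>K\<^esub> \<one>\<^bsub>K\<^esub>)
     in kquot R (Idl\<^bsub>R\<^esub> {x [^]\<^bsub>R\<^esub> n \<ominus>\<^bsub>R\<^esub> ore_monom K 0 r}))"

definition eigenspace :: "('k, 'a) module \<Rightarrow> ('a \<Rightarrow> 'a) \<Rightarrow> 'k \<Rightarrow> 'a set"
  where "eigenspace K \<alpha> w = {l \<in> carrier K. \<alpha> l = w \<odot>\<^bsub>K\<^esub> l}"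

text \<open>\<open>[K, K]\<^sub>\<beta>\<close>, to be used with \<open>\<beta> = \<alpha>\<^sup>j\<close>.\<close>

definition twisted_commutators :: "('k::field, 'a) module \<Rightarrow> ('a \<Rightarrow> 'a) \<Rightarrow> 'a set"
  where "twisted_commutators K \<beta> = kspan K
    {(l' \<otimes>\<^bsub>K\<^esub> \<beta> l) \<ominus>\<^bsub>K\<^esub> (l \<otimes>\<^bsub>K\<^esub> l') | l l'. l \<in> carrier K \<and> l' \<in> carrier K}"

definition commutators :: "('k::field, 'a) module \<Rightarrow> 'a set"
  where "commutators K = twisted_commutators K id"

definition nth_roots_of_one :: "nat \<Rightarrow> 'k::field set"
  where "nth_roots_of_one n = {w. w ^ n = 1}"

end

theory Submission
  imports Defs "HOL-Library.Function_Algebras"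
begin

text \<open>
  Write \<open>K = k[G]\<close>, \<open>c = g\<^sub>1\<^sup>n\<close>, and \<open>A\<^sub>t\<close> for the algebra \<open>A\<close> as a bimodule over itself whose right
  action is twisted by the \<open>t\<close>-th power of the automorphism \<open>h \<mapsto> \<chi>(h)\<^sup>n h\<close>, \<open>x \<mapsto> x\<close>.

  If \<open>x\<^sup>n = \<xi> (c - 1)\<close> is compatible with \<open>x\<^sup>n h = \<chi>(h)\<^sup>n h x\<^sup>n\<close> (that is, if \<open>\<xi> = 0\<close> or \<open>\<chi>\<^sup>n = 1\<close>), then
  \<open>A\<close> is free over \<open>K\<close> with basis \<open>1, x, \<dots>, x\<^sup>n\<^sup>-\<^sup>1\<close>, and there is an exact sequence of bimodules
  \<open>0 \<rightarrow> A\<^sub>t\<^sub>+\<^sub>1 \<rightarrow> A \<otimes>\<^sub>K A \<rightarrow> A \<otimes>\<^sub>K A \<rightarrow> A\<^sub>t \<rightarrow> 0\<close> (\<open>resolution\<close>), with suitable twists in the middle: the last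
  map multiplies, the middle one is \<open>1 \<otimes> 1 \<mapsto> x \<otimes> 1 - 1 \<otimes> x\<close>, and the first is \<open>1 \<mapsto> \<Sum> x\<^sup>i \<otimes> x\<^sup>n\<^sup>-\<^sup>1\<^sup>-\<^sup>i\<close>.
  The order of \<open>G\<close> is invertible, so averaging over \<open>G\<close> makes the two middle terms relatively
  projective and hence acyclic (\<open>P_acyclic\<close>). A diagram chase (\<open>bimod_seq\<close>) then shifts the homology of \<open>A\<close>
  with coefficients in \<open>A\<^sub>t\<close> in positive degrees by two to that with coefficients in \<open>A\<^sub>t\<^sub>+\<^sub>1\<close> (\<open>H_shift_iter\<close>), and
  expresses degrees 0, 1 and 2 through the commutator quotients of the four bimodules.

  Conjugation by the central element \<open>g\<^sub>1\<close> multiplies the component of \<open>x\<^sup>i\<close> by a power of \<open>\<chi>(g\<^sub>1)\<close> that is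
  trivial for a single \<open>i < n\<close>. In the commutator quotients all other components die (\<open>weight_kill_P\<close>), and
  what is left of the sequence is \<open>K\<close> modulo twisted commutators, with the two maps
  \<open>k \<mapsto> \<xi> (c - 1) (\<alpha>(k) - k)\<close> and \<open>k \<mapsto> \<Sum> \<alpha>\<^sup>i(k)\<close> over \<open>i < n\<close> (\<open>H_zero\<close>, \<open>H_one\<close>, \<open>H_two\<close>). Both respect the
  eigenspaces \<open>K\<^sup>w\<close>. The norm \<open>\<Sum> w\<^sup>i\<close> is zero if \<open>w\<close> is an \<open>n\<close>-th root of unity other than 1, and nonzero
  otherwise; so only those eigenspaces contribute in positive degrees (\<open>odd_presents\<close>, \<open>even_presents\<close>).

  If \<open>\<xi> \<noteq> 0\<close> and \<open>\<chi>(h)\<^sup>n \<noteq> 1\<close> for some \<open>h\<close>, then \<open>x\<^sup>n\<close> both commutes with \<open>h\<close>, being \<open>\<xi> (c - 1)\<close>, and satisfies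
  \<open>x\<^sup>n h = \<chi>(h)\<^sup>n h x\<^sup>n\<close>. Hence \<open>c = 1\<close> and \<open>x\<^sup>n = 0\<close> in \<open>A\<close> (\<open>same_image_J\<close>), and \<open>A\<close> is the algebra with
  \<open>\<xi> = 0\<close> attached to \<open>G / \<langle>c\<rangle>\<close>.

  The homology of the problem is defined by tensor powers as quotients of free spaces. It is
  compared with chains in the double dual, where a tensor is evaluation at its factors and maps are
  verified on multilinear functionals (\<open>HH_presents\<close>).
\<close>

section \<open>Vector spaces of functions\<close>

text \<open>Chains, tensors and algebra elements are all functions into the field, so that one
  explicit scaling serves for every space and the abstract theory of vector spaces applies to it
  once and for all.\<close>

definition sc :: "'k::field \<Rightarrow> ('i \<Rightarrow> 'k) \<Rightarrow> 'i \<Rightarrow> 'k" where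
  "sc c f = (\<lambda>x. c * f x)"

global_interpretation fv: vector_space sc
  by unfold_locales (auto simp: sc_def fun_eq_iff algebra_simps)

lemma sc_apply: "sc c f x = c * f x"
  by (simp add: sc_def)

lemma sum_fun_apply: "(\<Sum>i\<in>I. F i) x = (\<Sum>i\<in>I. F i x)"
  by (induction I rule: infinite_finite_induct) (auto simp: plus_fun_apply zero_fun_apply)

lemmas fun_ap = plus_fun_apply zero_fun_apply sc_apply minus_apply uminus_apply sum_fun_apply

text \<open>Functions stand for vectors here; sums are not to be evaluated pointwise unless this
  is asked for.\<close>

declare plus_fun_apply [simp del] zero_fun_apply [simp del] minus_apply [simp del]
  uminus_apply [simp del]

definition lin :: "(('i \<Rightarrow> 'k::field) \<Rightarrow> 'j \<Rightarrow> 'k) \<Rightarrow> bool" where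
  "lin F \<longleftrightarrow> (\<forall>x y. F (x + y) = F x + F y) \<and> (\<forall>c x. F (sc c x) = sc c (F x))"

lemma linI:
  assumes "\<And>x y. F (x + y) = F x + F y" "\<And>c x. F (sc c x) = sc c (F x)"
  shows "lin F"
  using assms by (simp add: lin_def)

lemma lin_add: "lin F \<Longrightarrow> F (x + y) = F x + F y"
  and lin_sc: "lin F \<Longrightarrow> F (sc c x) = sc c (F x)"
  by (simp_all add: lin_def)

lemma lin_zero: "lin F \<Longrightarrow> F 0 = 0"
  using lin_sc[of F 0 0] by (simp add: fv.scale_zero_left)

lemma lin_minus: "lin F \<Longrightarrow> F (- x) = - F x"
  using lin_sc[of F "- 1" x] by simp

lemma lin_diff:
  assumes "lin F"
  shows "F (x - y) = F x - F y"
  using lin_add[OF assms, of x "- y"] lin_minus[OF assms, of y] by simp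

lemma lin_sum:
  assumes "lin F"
  shows "F (\<Sum>i\<in>I. f i) = (\<Sum>i\<in>I. F (f i))"
  by (induction I rule: infinite_finite_induct) (auto simp: lin_zero[OF assms] lin_add[OF assms])

lemma lin_comp: "lin F \<Longrightarrow> lin G \<Longrightarrow> lin (\<lambda>x. F (G x))"
  by (simp add: lin_def)

lemma lin_add_fun: "lin F \<Longrightarrow> lin G \<Longrightarrow> lin (\<lambda>x. F x + G x)"
  by (simp add: lin_def algebra_simps fv.scale_right_distrib)

lemma lin_diff_fun: "lin F \<Longrightarrow> lin G \<Longrightarrow> lin (\<lambda>x. F x - G x)"
  by (simp add: lin_def algebra_simps fv.scale_right_diff_distrib)

lemma lin_sc_fun: "lin F \<Longrightarrow> lin (\<lambda>x. sc c (F x))"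
  by (simp add: lin_def fv.scale_right_distrib mult.commute)

lemma lin_id: "lin (\<lambda>x. x)"
  by (simp add: lin_def)

lemma lin_const_zero: "lin (\<lambda>x. 0)"
  by (simp add: lin_def)

lemma lin_sum_fun: "(\<And>i. i \<in> I \<Longrightarrow> lin (F i)) \<Longrightarrow> lin (\<lambda>x. \<Sum>i\<in>I. F i x)"
  by (induction I rule: infinite_finite_induct) (auto intro: lin_const_zero lin_add_fun)

lemma lin_span_image:
  assumes F: "lin F" and "\<And>x. x \<in> S \<Longrightarrow> F x \<in> V" and V: "fv.subspace V" and "x \<in> fv.span S"
  shows "F x \<in> V"
  using assms(4)
proof (induction rule: fv.span_induct_alt)
  case base
  then show ?case using V by (simp add: lin_zero[OF F] fv.subspace_0)
next
  case (step c x y)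
  then show ?case
    using V assms(2) by (simp add: lin_add[OF F] lin_sc[OF F] fv.subspace_add fv.subspace_scale)
qed

lemma lin_eq_on_span:
  assumes F: "lin F" and H: "lin H" and eq: "\<And>x. x \<in> S \<Longrightarrow> F x = H x" and "x \<in> fv.span S"
  shows "F x = H x"
  using assms(4)
proof (induction rule: fv.span_induct_alt)
  case base
  then show ?case by (simp add: lin_zero[OF F] lin_zero[OF H])
next
  case (step c x y)
  then show ?case
    by (simp add: lin_add[OF F] lin_sc[OF F] lin_add[OF H] lin_sc[OF H] eq)
qed

lemma subspace_vimage:
  assumes F: "lin F" and V: "fv.subspace V"
  shows "fv.subspace {x. F x \<in> V}"
  using V by (simp add: fv.subspace_def lin_zero[OF F] lin_add[OF F] lin_sc[OF F])

lemma subspace_image: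
  assumes F: "lin F" and V: "fv.subspace V"
  shows "fv.subspace (F ` V)"
  unfolding fv.subspace_def
proof (intro conjI ballI allI)
  show "0 \<in> F ` V" using V lin_zero[OF F] by (metis fv.subspace_0 imageI)
  show "x + y \<in> F ` V" if "x \<in> F ` V" "y \<in> F ` V" for x y
    using V that by (metis (no_types, lifting) fv.subspace_add imageE imageI lin_add[OF F])
  show "sc c x \<in> F ` V" if "x \<in> F ` V" for c x
    using V that by (metis (no_types, lifting) fv.subspace_scale imageE imageI lin_sc[OF F])
qed

lemma subspace_kernel: "lin F \<Longrightarrow> fv.subspace {x. F x = 0}"
  using subspace_vimage[of F "{0}"] by (simp add: fv.subspace_def)

lemma fin_funs_subspace: "fv.subspace (fin_funs S :: ('a \<Rightarrow> 'b::field) set)"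
  unfolding fv.subspace_def
proof (intro conjI ballI allI)
  show "0 \<in> fin_funs S" by (simp add: fin_funs_def fun_ap)
next
  fix f g :: "'a \<Rightarrow> 'b" assume "f \<in> fin_funs S" "g \<in> fin_funs S"
  moreover have "{s. (f + g) s \<noteq> 0} \<subseteq> {s. f s \<noteq> 0} \<union> {s. g s \<noteq> 0}" by (auto simp: fun_ap)
  ultimately show "f + g \<in> fin_funs S"
    unfolding fin_funs_def by (blast intro: finite_subset)
next
  fix c f assume "f \<in> fin_funs S"
  moreover have "{s. sc c f s \<noteq> 0} \<subseteq> {s. f s \<noteq> 0}" by (auto simp: fun_ap)
  ultimately show "sc c f \<in> fin_funs S"
    unfolding fin_funs_def by (blast intro: finite_subset)
qed

lemma basis_elt_fin_funs: "s \<in> S \<Longrightarrow> basis_elt s \<in> fin_funs S"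
  by (auto simp: fin_funs_def basis_elt_def)

lemma fin_funs_expand:
  assumes "finite I" "{s. f s \<noteq> 0} \<subseteq> I"
  shows "f = (\<Sum>s\<in>I. sc (f s) (basis_elt s))"
proof
  fix x
  have "(\<Sum>s\<in>I. sc (f s) (basis_elt s)) x = (\<Sum>s\<in>I. if s = x then f s else 0)"
    unfolding sum_fun_apply by (intro sum.cong) (auto simp: basis_elt_def fun_ap)
  also have "\<dots> = f x"
    using assms by (auto simp: sum.delta)
  finally show "f x = (\<Sum>s\<in>I. sc (f s) (basis_elt s)) x" ..
qed

lemma fin_funs_eq_span: "fin_funs S = fv.span (basis_elt ` S)"
proof
  show "fv.span (basis_elt ` S) \<subseteq> fin_funs S"
    by (intro fv.span_minimal fin_funs_subspace) (auto intro: basis_elt_fin_funs)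
  show "fin_funs S \<subseteq> fv.span (basis_elt ` S)"
  proof
    fix f assume f: "f \<in> fin_funs S"
    then have "f = (\<Sum>s\<in>{s. f s \<noteq> 0}. sc (f s) (basis_elt s))"
      by (intro fin_funs_expand) (auto simp: fin_funs_def)
    also have "\<dots> \<in> fv.span (basis_elt ` S)"
      using f by (intro fv.span_sum fv.span_scale fv.span_base) (auto simp: fin_funs_def)
    finally show "f \<in> fv.span (basis_elt ` S)" .
  qed
qed

text \<open>Linear extension from the basis \<open>B\<close> to all functions: coefficients off
  \<open>B\<close> are discarded, so the extension is linear on the whole function space,
  without side conditions.\<close>

definition extend :: "'b set \<Rightarrow> ('b \<Rightarrow> 'j \<Rightarrow> 'k) \<Rightarrow> ('b \<Rightarrow> 'k::field) \<Rightarrow> 'j \<Rightarrow> 'k" where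
  "extend B F f = (\<Sum>b\<in>B. sc (f b) (F b))"

lemma lin_extend: "lin (extend B F)"
  by (auto simp: lin_def extend_def sum.distrib fv.scale_left_distrib fv.scale_sum_right fun_ap)

lemma extend_basis_elt: "finite B \<Longrightarrow> b \<in> B \<Longrightarrow> extend B F (basis_elt b) = F b"
proof -
  assume B: "finite B" "b \<in> B"
  have "extend B F (basis_elt b) = (\<Sum>c\<in>B. if c = b then F c else 0)"
    unfolding extend_def by (intro sum.cong) (auto simp: basis_elt_def fun_eq_iff fun_ap)
  then show ?thesis using B by simp
qed

lemma extend_in: "fv.subspace V \<Longrightarrow> (\<And>b. b \<in> B \<Longrightarrow> F b \<in> V) \<Longrightarrow> extend B F f \<in> V"
  unfolding extend_def by (intro fv.subspace_sum fv.subspace_scale) auto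

text \<open>Extend a basis of \<open>W\<close> by \<open>f\<close> and take the dual functional
  of \<open>f\<close>. This is what allows tensors to be told apart by multilinear
  functionals.\<close>

lemma functional_separates:
  fixes f :: "'i \<Rightarrow> 'k::field"
  assumes W: "fv.subspace W" and f: "f \<notin> W"
  obtains l :: "('i \<Rightarrow> 'k) \<Rightarrow> 'k"
    where "\<And>x y. l (x + y) = l x + l y" "\<And>c x. l (sc c x) = c * l x"
      "\<And>w. w \<in> W \<Longrightarrow> l w = 0" "l f \<noteq> 0"
proof -
  obtain B where B: "B \<subseteq> W" "fv.independent B" "W \<subseteq> fv.span B"
    using fv.maximal_independent_subset[of W] by auto
  have sB: "fv.span B = W"
    using B W by (metis fv.span_minimal subset_antisym)
  have ind: "fv.independent (insert f B)"
    using B(2) f sB by (simp add: fv.independent_insert)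
  interpret vp: vector_space_pair "sc :: 'k \<Rightarrow> ('i \<Rightarrow> 'k) \<Rightarrow> 'i \<Rightarrow> 'k" "(*) :: 'k \<Rightarrow> 'k \<Rightarrow> 'k"
    by unfold_locales (auto simp: algebra_simps)
  obtain l where l: "Vector_Spaces.linear sc (*) l"
      "\<forall>x\<in>insert f B. l x = (if x = f then 1 else 0)"
    using vp.linear_independent_extend[OF ind, of "\<lambda>x. if x = f then 1 else 0"] by auto
  have fB: "f \<notin> B" using f B by auto
  have 1: "l (x + y) = l x + l y" for x y using l(1) by (rule vp.linear_add)
  have 2: "l (sc c x) = c * l x" for c x using l(1) by (rule vp.linear_scale)
  have "l w = 0" if "w \<in> W" for w
  proof -
    have "w \<in> fv.span B" using that sB by simp
    then show ?thesis
    proof (induction rule: fv.span_induct_alt)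
      case base
      then show ?case using 2[of 0 0] by simp
    next
      case (step c x y)
      then show ?case using l(2) fB by (auto simp: 1 2)
    qed
  qed
  then show thesis using that 1 2 l(2) by (metis insertI1 one_neq_zero)
qed

section \<open>Presentations\<close>

text \<open>A presentation \<open>Z \<rightarrow> M\<close> with kernel \<open>B\<close>: the
  vector space \<open>M\<close>, of whatever type, is handled as the pair of subspaces \<open>B
  \<subseteq> Z\<close> of a function space.\<close>

definition presents ::
    "('i \<Rightarrow> 'k::field) set \<Rightarrow> ('i \<Rightarrow> 'k) set \<Rightarrow> ('k, 'v) module \<Rightarrow> (('i \<Rightarrow> 'k) \<Rightarrow> 'v) \<Rightarrow> bool"
  where "presents Z B M \<psi> \<longleftrightarrow>
    \<psi> ` Z = carrier M \<and>
    (\<forall>z\<in>Z. \<forall>z'\<in>Z. \<psi> (z + z') = \<psi> z \<oplus>\<^bsub>M\<^esub> \<psi> z' \<and> (\<psi> z = \<psi> z' \<longleftrightarrow> z - z' \<in> B)) \<and>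
    (\<forall>c. \<forall>z\<in>Z. \<psi> (sc c z) = c \<odot>\<^bsub>M\<^esub> \<psi> z)"

text \<open>An isomorphism \<open>Z / B \<cong> Z' / B'\<close> given by a linear relation
  instead of a map. Diagram chases produce such relations directly, with no choice of
  preimages.\<close>

definition qiso ::
    "('i \<Rightarrow> 'k::field) set \<Rightarrow> ('i \<Rightarrow> 'k) set \<Rightarrow> ('j \<Rightarrow> 'k) set \<Rightarrow> ('j \<Rightarrow> 'k) set \<Rightarrow> bool"
  where "qiso Z B Z' B' \<longleftrightarrow> (\<exists>R.
    R \<subseteq> Z \<times> Z' \<and> Z \<subseteq> Domain R \<and> Z' \<subseteq> Range R \<and>
    (\<forall>x y x' y'. (x, x') \<in> R \<longrightarrow> (y, y') \<in> R \<longrightarrow> (x + y, x' + y') \<in> R) \<and>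
    (\<forall>c x x'. (x, x') \<in> R \<longrightarrow> (sc c x, sc c x') \<in> R) \<and>
    (\<forall>x x'. (x, x') \<in> R \<longrightarrow> (x \<in> B \<longleftrightarrow> x' \<in> B')))"

lemma qisoI:
  assumes "\<And>x y. Q x y \<Longrightarrow> x \<in> Z \<and> y \<in> Z'"
    "\<And>x. x \<in> Z \<Longrightarrow> \<exists>y. Q x y" "\<And>y. y \<in> Z' \<Longrightarrow> \<exists>x. Q x y"
    "\<And>x y x' y'. Q x x' \<Longrightarrow> Q y y' \<Longrightarrow> Q (x + y) (x' + y')"
    "\<And>c x x'. Q x x' \<Longrightarrow> Q (sc c x) (sc c x')"
    "\<And>x y. Q x y \<Longrightarrow> x \<in> B \<Longrightarrow> y \<in> B'"  "\<And>x y. Q x y \<Longrightarrow> y \<in> B' \<Longrightarrow> x \<in> B"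
  shows "qiso Z B Z' B'"
  unfolding qiso_def
  apply (rule exI[of _ "{(x, y). Q x y}"])
  using assms by blast

lemma qiso_lin:
  assumes F: "lin F" and "F ` Z = Z'" and "\<And>z. z \<in> Z \<Longrightarrow> z \<in> B \<longleftrightarrow> F z \<in> B'"
    and Z: "fv.subspace Z"
  shows "qiso Z B Z' B'"
  by (rule qisoI[where Q = "\<lambda>x y. x \<in> Z \<and> y = F x"])
    (use assms in \<open>auto simp: lin_add lin_sc fv.subspace_add fv.subspace_scale\<close>)

lemma qiso_refl: "fv.subspace Z \<Longrightarrow> qiso Z B Z B"
  by (rule qiso_lin[where F = "\<lambda>x. x"]) (auto simp: lin_id)

lemma qiso_sym: "qiso Z B Z' B' \<Longrightarrow> qiso Z' B' Z B"
  unfolding qiso_def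
proof (elim exE)
  fix R assume R: "R \<subseteq> Z \<times> Z' \<and> Z \<subseteq> Domain R \<and> Z' \<subseteq> Range R \<and>
    (\<forall>x y x' y'. (x, x') \<in> R \<longrightarrow> (y, y') \<in> R \<longrightarrow> (x + y, x' + y') \<in> R) \<and>
    (\<forall>c x x'. (x, x') \<in> R \<longrightarrow> (sc c x, sc c x') \<in> R) \<and>
    (\<forall>x x'. (x, x') \<in> R \<longrightarrow> (x \<in> B \<longleftrightarrow> x' \<in> B'))"
  show "\<exists>R. R \<subseteq> Z' \<times> Z \<and> Z' \<subseteq> Domain R \<and> Z \<subseteq> Range R \<and>
    (\<forall>x y x' y'. (x, x') \<in> R \<longrightarrow> (y, y') \<in> R \<longrightarrow> (x + y, x' + y') \<in> R) \<and>
    (\<forall>c x x'. (x, x') \<in> R \<longrightarrow> (sc c x, sc c x') \<in> R) \<and>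
    (\<forall>x x'. (x, x') \<in> R \<longrightarrow> (x \<in> B' \<longleftrightarrow> x' \<in> B))"
    by (rule exI[of _ "R\<inverse>"]) (use R in blast)
qed

lemma qiso_trans: 
  assumes "qiso Z B Z' B'" "qiso Z' B' Z'' B''"
  shows "qiso Z B Z'' B''"
proof -
  obtain R where R: "R \<subseteq> Z \<times> Z'" "Z \<subseteq> Domain R" "Z' \<subseteq> Range R"
    "\<And>x y x' y'. (x, x') \<in> R \<Longrightarrow> (y, y') \<in> R \<Longrightarrow> (x + y, x' + y') \<in> R"
    "\<And>c x x'. (x, x') \<in> R \<Longrightarrow> (sc c x, sc c x') \<in> R"
    "\<And>x x'. (x, x') \<in> R \<Longrightarrow> x \<in> B \<longleftrightarrow> x' \<in> B'"
    using assms(1) unfolding qiso_def by blast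
  obtain S where S: "S \<subseteq> Z' \<times> Z''" "Z' \<subseteq> Domain S" "Z'' \<subseteq> Range S"
    "\<And>x y x' y'. (x, x') \<in> S \<Longrightarrow> (y, y') \<in> S \<Longrightarrow> (x + y, x' + y') \<in> S"
    "\<And>c x x'. (x, x') \<in> S \<Longrightarrow> (sc c x, sc c x') \<in> S"
    "\<And>x x'. (x, x') \<in> S \<Longrightarrow> x \<in> B' \<longleftrightarrow> x' \<in> B''"
    using assms(2) unfolding qiso_def by blast
  show ?thesis
  proof (rule qisoI[where Q = "\<lambda>x z. \<exists>y. (x, y) \<in> R \<and> (y, z) \<in> S"])
    fix x assume "x \<in> Z"
    then obtain y where "(x, y) \<in> R" using R(2) by auto
    moreover then obtain z where "(y, z) \<in> S" using R(1) S(2) by blast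
    ultimately show "\<exists>z y. (x, y) \<in> R \<and> (y, z) \<in> S" by blast
  next
    fix z assume "z \<in> Z''"
    then obtain y where "(y, z) \<in> S" using S(3) by auto
    moreover then obtain x where "(x, y) \<in> R" using S(1) R(3) by blast
    ultimately show "\<exists>x y. (x, y) \<in> R \<and> (y, z) \<in> S" by blast
  next
    fix x y x' y' assume "\<exists>u. (x, u) \<in> R \<and> (u, x') \<in> S" "\<exists>u. (y, u) \<in> R \<and> (u, y') \<in> S"
    then show "\<exists>u. (x + y, u) \<in> R \<and> (u, x' + y') \<in> S" using R(4) S(4) by blast
  next
    fix c x x' assume "\<exists>u. (x, u) \<in> R \<and> (u, x') \<in> S"
    then show "\<exists>u. (sc c x, u) \<in> R \<and> (u, sc c x') \<in> S" using R(5) S(5) by blast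
  qed (use R(1,6) S(1,6) in blast)+
qed

text \<open>A relation as in \<open>qiso\<close> becomes single-valued after passing to the
  presented quotients.\<close>

lemma kiso_of_presents:
  assumes M: "presents Z B M \<psi>" and N: "presents Z' B' N \<psi>'" and q: "qiso Z B Z' B'"
    and Z: "fv.subspace Z" and Z': "fv.subspace Z'"
  shows "M \<cong>\<^sub>k N"
proof -
  obtain R where R: "R \<subseteq> Z \<times> Z'" "Z \<subseteq> Domain R" "Z' \<subseteq> Range R"
    "\<And>x y x' y'. (x, x') \<in> R \<Longrightarrow> (y, y') \<in> R \<Longrightarrow> (x + y, x' + y') \<in> R"
    "\<And>c x x'. (x, x') \<in> R \<Longrightarrow> (sc c x, sc c x') \<in> R"
    "\<And>x x'. (x, x') \<in> R \<Longrightarrow> x \<in> B \<longleftrightarrow> x' \<in> B'"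
    using q unfolding qiso_def by blast
  define f where "f m = \<psi>' (SOME z'. \<exists>z. (z, z') \<in> R \<and> \<psi> z = m)" for m
  have diff: "(x - y, x' - y') \<in> R" if "(x, x') \<in> R" "(y, y') \<in> R" for x y x' y'
    using R(4)[OF that(1) R(5)[OF that(2), of "- 1"]] by simp
  have same: "\<psi> x = \<psi> y \<longleftrightarrow> \<psi>' x' = \<psi>' y'" if "(x, x') \<in> R" "(y, y') \<in> R" for x y x' y'
  proof -
    have "x \<in> Z" "y \<in> Z" "x' \<in> Z'" "y' \<in> Z'" using that R(1) by auto
    then show ?thesis using M N R(6)[OF diff[OF that]] by (simp add: presents_def)
  qed
  have fR: "f (\<psi> x) = \<psi>' x'" if "(x, x') \<in> R" for x x'
  proof -
    have "\<exists>z. (z, SOME z'. \<exists>z. (z, z') \<in> R \<and> \<psi> z = \<psi> x) \<in> R \<and>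
        \<psi> z = \<psi> x"
      by (rule someI_ex[of "\<lambda>z'. \<exists>z. (z, z') \<in> R \<and> \<psi> z = \<psi> x"])
        (use that in blast)
    then obtain z where "(z, SOME z'. \<exists>z. (z, z') \<in> R \<and> \<psi> z = \<psi> x) \<in> R" "\<psi> z = \<psi> x"
      by blast
    then show ?thesis using same[OF _ that] by (simp add: f_def)
  qed
  have pick: "\<exists>x x'. (x, x') \<in> R \<and> m = \<psi> x \<and> f m = \<psi>' x' \<and> x \<in> Z \<and> x' \<in> Z'"
    if "m \<in> carrier M" for m
  proof -
    have "m \<in> \<psi> ` Z" using M that by (simp add: presents_def)
    then obtain x where "x \<in> Z" "m = \<psi> x" by (elim imageE)
    moreover then obtain x' where "(x, x') \<in> R" using R(2) by blast
    ultimately show ?thesis using fR R(1) by blast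
  qed
  have "f \<in> iso (add_monoid M) (add_monoid N)"
    unfolding iso_def hom_def
  proof (simp, intro conjI ballI, goal_cases)
    case 1
    have "f m \<in> carrier N" if "m \<in> carrier M" for m
      using pick[OF that] N by (auto simp: presents_def)
    then show ?case by simp
  next
    case (2 m m')
    obtain x x' where x: "(x, x') \<in> R" "m = \<psi> x" "f m = \<psi>' x'" "x \<in> Z" "x' \<in> Z'"
      using pick 2 by meson
    obtain y y' where y: "(y, y') \<in> R" "m' = \<psi> y" "f m' = \<psi>' y'" "y \<in> Z" "y' \<in> Z'"
      using pick 2 by meson
    have "f (\<psi> (x + y)) = \<psi>' (x' + y')" using R(4)[OF x(1) y(1)] by (rule fR)
    then show ?case using M N x y by (simp add: presents_def)
  next
    case 3
    have inj: "inj_on f (carrier M)"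
    proof (rule inj_onI)
      fix m m' assume m: "m \<in> carrier M" and m': "m' \<in> carrier M" and eq: "f m = f m'"
      obtain x x' where x: "(x, x') \<in> R" "m = \<psi> x" "f m = \<psi>' x'" "x \<in> Z" "x' \<in> Z'"
        using pick m by meson
      obtain y y' where y: "(y, y') \<in> R" "m' = \<psi> y" "f m' = \<psi>' y'" "y \<in> Z" "y' \<in> Z'"
        using pick m' by meson
      show "m = m'" using same[OF x(1) y(1)] x y eq by simp
    qed
    have "carrier N \<subseteq> f ` carrier M"
    proof
      fix b assume "b \<in> carrier N"
      then have "b \<in> \<psi>' ` Z'" using N by (simp add: presents_def)
      then obtain x' where x': "x' \<in> Z'" "b = \<psi>' x'" by (elim imageE)
      then obtain x where "(x, x') \<in> R" using R(3) by blast
      moreover then have "\<psi> x \<in> carrier M" using R(1) M by (auto simp: presents_def)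
      ultimately show "b \<in> f ` carrier M" using fR x' by (metis imageI)
    qed
    moreover have "f ` carrier M \<subseteq> carrier N"
      using pick N by (fastforce simp: presents_def)
    ultimately show ?case using inj by (auto simp: bij_betw_def)
  qed
  moreover have "f (c \<odot>\<^bsub>M\<^esub> m) = c \<odot>\<^bsub>N\<^esub> f m" if m: "m \<in> carrier M" for c m
  proof -
    obtain x x' where x: "(x, x') \<in> R" "m = \<psi> x" "f m = \<psi>' x'" "x \<in> Z" "x' \<in> Z'"
      using pick[OF m] by blast
    have "f (\<psi> (sc c x)) = \<psi>' (sc c x')" using R(5)[OF x(1)] by (rule fR)
    then show ?thesis using M N x by (simp add: presents_def)
  qed
  ultimately show ?thesis unfolding kiso_def by blast
qed

lemma presents_ksubquot:
  assumes M: "presents Z B M \<psi>" and Z: "fv.subspace Z"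
    and Z1: "fv.subspace Z1" and B1: "fv.subspace B1"
    and sub: "B \<subseteq> B1" "B1 \<subseteq> Z1" "Z1 \<subseteq> Z"
  shows "presents Z1 B1 (ksubquot M (\<psi> ` Z1) (\<psi> ` B1)) (\<lambda>z. \<psi> ` {b + z | b. b \<in> B1})"
proof -
  let ?N = "ksubquot M (\<psi> ` Z1) (\<psi> ` B1)"
  let ?f = "\<lambda>z. \<psi> ` {b + z | b. b \<in> B1}"
  have add: "\<psi> (z + z') = \<psi> z \<oplus>\<^bsub>M\<^esub> \<psi> z'" if "z \<in> Z" "z' \<in> Z" for z z'
    using M that by (simp add: presents_def)
  have eq: "\<psi> z = \<psi> z' \<longleftrightarrow> z - z' \<in> B" if "z \<in> Z" "z' \<in> Z" for z z'
    using M that by (simp add: presents_def)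
  have smult: "\<psi> (sc c z) = c \<odot>\<^bsub>M\<^esub> \<psi> z" if "z \<in> Z" for z c
    using M that by (simp add: presents_def)
  have coset: "(\<psi> ` B1) +>\<^bsub>M\<^esub> \<psi> z = ?f z" if "z \<in> Z1" for z
  proof -
    have "(\<psi> ` B1) +>\<^bsub>M\<^esub> \<psi> z = (\<Union>b\<in>B1. {\<psi> b \<oplus>\<^bsub>M\<^esub> \<psi> z})"
      by (auto simp: a_r_coset_def r_coset_def)
    also have "\<dots> = (\<Union>b\<in>B1. {\<psi> (b + z)})"
      using that sub by (intro SUP_cong refl) (auto simp: add subset_iff)
    finally show ?thesis by auto
  qed
  have coset': "W +>\<^bsub>M\<lparr>carrier := V\<rparr>\<^esub> y = W +>\<^bsub>M\<^esub> y" for V W y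
    by (simp add: a_r_coset_def r_coset_def)
  have "carrier ?N = (\<lambda>y. (\<psi> ` B1) +>\<^bsub>M\<^esub> y) ` (\<psi> ` Z1)"
    by (auto simp: ksubquot_def kquot_def FactRing_def A_RCOSETS_def RCOSETS_def a_r_coset_def
        r_coset_def image_def)
  then have car: "carrier ?N = {?f z | z. z \<in> Z1}"
    by (simp add: Setcompr_eq_image image_image coset cong: image_cong)
  have addN: "?f (z + z') = ?f z \<oplus>\<^bsub>?N\<^esub> ?f z'" if z: "z \<in> Z1" "z' \<in> Z1" for z z'
  proof -
    have "?f z \<oplus>\<^bsub>?N\<^esub> ?f z' = (\<Union>b\<in>B1. \<Union>b'\<in>B1. {\<psi> (b + z) \<oplus>\<^bsub>M\<^esub> \<psi> (b' + z')})"
      by (auto simp: ksubquot_def kquot_def FactRing_def set_add_def set_mult_def)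
    also have "\<dots> = (\<Union>b\<in>B1. \<Union>b'\<in>B1. {\<psi> ((b + b') + (z + z'))})"
    proof (intro SUP_cong refl)
      fix b b' assume "b \<in> B1" "b' \<in> B1"
      then have "b + z \<in> Z1" "b' + z' \<in> Z1" using z sub(2) Z1 by (auto intro: fv.subspace_add)
      then have "b + z \<in> Z" "b' + z' \<in> Z" using sub(3) by auto
      then show "{\<psi> (b + z) \<oplus>\<^bsub>M\<^esub> \<psi> (b' + z')} = {\<psi> ((b + b') + (z + z'))}"
        by (simp add: algebra_simps flip: add)
    qed
    also have "\<dots> = ?f (z + z')"
    proof (intro subset_antisym subsetI)
      fix y assume "y \<in> (\<Union>b\<in>B1. \<Union>b'\<in>B1. {\<psi> ((b + b') + (z + z'))})"
      then show "y \<in> ?f (z + z')" using fv.subspace_add[OF B1] by fast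
    next
      fix y assume "y \<in> ?f (z + z')"
      then obtain b where "b \<in> B1" "y = \<psi> ((b + 0) + (z + z'))" by auto
      then show "y \<in> (\<Union>b\<in>B1. \<Union>b'\<in>B1. {\<psi> ((b + b') + (z + z'))})"
        using fv.subspace_0[OF B1] by blast
    qed
    finally show ?thesis ..
  qed
  have eqN: "?f z = ?f z' \<longleftrightarrow> z - z' \<in> B1" if z: "z \<in> Z1" "z' \<in> Z1" for z z'
  proof
    assume "?f z = ?f z'"
    moreover have "\<psi> z \<in> ?f z" using fv.subspace_0[OF B1] by (auto intro!: image_eqI[of _ _ z] exI[of _ 0])
    ultimately obtain b where b: "b \<in> B1" "\<psi> z = \<psi> (b + z')" by auto
    then have "z - (b + z') \<in> B"
      using z sub Z1 by (subst eq[symmetric]) (auto intro!: subsetD[OF sub(3)] fv.subspace_add)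
    then have "z - (b + z') + b \<in> B1" using b(1) sub B1 by (blast intro: fv.subspace_add)
    then show "z - z' \<in> B1" by (simp add: algebra_simps)
  next
    have le: "?f z \<subseteq> ?f z'" if "z - z' \<in> B1" for z z'
    proof safe
      fix b assume "b \<in> B1"
      then have "b + (z - z') \<in> B1" using that B1 by (simp add: fv.subspace_add)
      then show "\<psi> (b + z) \<in> ?f z'"
        by (intro image_eqI[of _ _ "b + (z - z') + z'"] CollectI exI[of _ "b + (z - z')"]) auto
    qed
    assume d: "z - z' \<in> B1"
    then have "z' - z \<in> B1" using fv.subspace_neg[OF B1 d] by simp
    then show "?f z = ?f z'" using le d by blast
  qed
  have smN: "?f (sc c z) = c \<odot>\<^bsub>?N\<^esub> ?f z" if z: "z \<in> Z1" for z c
  proof -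
    have "c \<odot>\<^bsub>?N\<^esub> ?f z = (\<Union>b\<in>B1. (\<psi> ` B1) +>\<^bsub>M\<^esub> (c \<odot>\<^bsub>M\<^esub> \<psi> (b + z)))"
      by (auto simp: ksubquot_def kquot_def coset')
    also have "\<dots> = (\<Union>b\<in>B1. ?f (sc c z))"
    proof (intro SUP_cong refl)
      fix b assume b: "b \<in> B1"
      then have bz: "b + z \<in> Z1" using z sub Z1 by (auto intro: fv.subspace_add)
      then have "c \<odot>\<^bsub>M\<^esub> \<psi> (b + z) = \<psi> (sc c (b + z))"
        using sub by (subst smult) auto
      moreover have "sc c (b + z) \<in> Z1" using bz Z1 by (simp add: fv.subspace_scale)
      moreover have "sc c (b + z) - sc c z \<in> B1" using b B1 by (simp add: fv.scale_right_distrib fv.subspace_scale)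
      ultimately show "(\<psi> ` B1) +>\<^bsub>M\<^esub> (c \<odot>\<^bsub>M\<^esub> \<psi> (b + z)) = ?f (sc c z)"
        using eqN[of "sc c (b + z)" "sc c z"] z Z1 by (simp add: coset fv.subspace_scale)
    qed
    also have "\<dots> = ?f (sc c z)" using fv.subspace_0[OF B1] by auto
    finally show ?thesis ..
  qed
  show ?thesis unfolding presents_def using car addN eqN smN by auto
qed

lemma ksubquot_carrier: "ksubquot M (carrier M) W = kquot M W"
  by (simp add: ksubquot_def)

section \<open>Hochschild chains with coefficients\<close>

text \<open>The Hochschild boundary on functionals, by recursion over the list of arguments. For
  a chain \<open>p \<otimes> a\<^sub>1 \<otimes> \<dots> \<otimes> a\<^sub>m\<close> with
  coefficient \<open>p\<close> in a bimodule, \<open>hQ\<close> collects the faces that multiply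
  neighbours \<open>a\<^sub>i a\<^sub>i\<^sub>+\<^sub>1\<close> and the last face
  \<open>a\<^sub>m p\<close>, with alternating signs; \<open>hD\<close> adds the first face
  \<open>p a\<^sub>1\<close>. The recursive form makes \<open>d\<^sup>2 = 0\<close> and the
  contracting homotopy below short inductions, without double sums.\<close>

fun hQ :: "('a \<Rightarrow> 'a \<Rightarrow> 'a) \<Rightarrow> ('a \<Rightarrow> 'p \<Rightarrow> 'p) \<Rightarrow> ('p \<Rightarrow> 'a list \<Rightarrow> 'k::ring) \<Rightarrow> 'p \<Rightarrow> 'a list \<Rightarrow> 'k"
where
  "hQ mul lm \<phi> p [] = 0"
| "hQ mul lm \<phi> p [a] = \<phi> (lm a p) []"
| "hQ mul lm \<phi> p (a # b # r) = \<phi> p (mul a b # r) - hQ mul lm (\<lambda>q l. \<phi> q (a # l)) p (b # r)"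

fun hD :: "('a \<Rightarrow> 'a \<Rightarrow> 'a) \<Rightarrow> ('a \<Rightarrow> 'p \<Rightarrow> 'p) \<Rightarrow> ('p \<Rightarrow> 'a \<Rightarrow> 'p) \<Rightarrow>
    ('p \<Rightarrow> 'a list \<Rightarrow> 'k::ring) \<Rightarrow> 'p \<Rightarrow> 'a list \<Rightarrow> 'k"
where
  "hD mul lm rm \<phi> p [] = 0"
| "hD mul lm rm \<phi> p (a # r) = \<phi> (rm p a) r - hQ mul lm \<phi> p (a # r)"

lemma hQ_diff: "hQ mul lm (\<lambda>q l. \<phi> q l - \<psi> q l) p as = hQ mul lm \<phi> p as - hQ mul lm \<psi> p as"
proof (induction as arbitrary: \<phi> \<psi>)
  case (Cons a as)
  show ?case
    by (cases as) (use Cons[of "\<lambda>q l. \<phi> q (a # l)" "\<lambda>q l. \<psi> q (a # l)"] in \<open>simp_all\<close>)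
qed simp

lemma hQ_add: "hQ mul lm (\<lambda>q l. \<phi> q l + \<psi> q l) p as = hQ mul lm \<phi> p as + hQ mul lm \<psi> p as"
proof (induction as arbitrary: \<phi> \<psi>)
  case (Cons a as)
  show ?case
    by (cases as) (use Cons[of "\<lambda>q l. \<phi> q (a # l)" "\<lambda>q l. \<psi> q (a # l)"] in \<open>simp_all\<close>)
qed simp

lemma hQ_zero: "hQ mul lm (\<lambda>q l. 0) p as = 0"
  using hQ_diff[of mul lm "\<lambda>q l. 0" "\<lambda>q l. 0" p as] by simp

lemma hQ_scale: "hQ mul lm (\<lambda>q l. c * \<phi> q l) p as = c * hQ mul lm \<phi> p as"
proof (induction as arbitrary: \<phi>)
  case (Cons a as)
  show ?case
    by (cases as) (use Cons[of "\<lambda>q l. \<phi> q (a # l)"] in \<open>simp_all add: algebra_simps\<close>)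
qed simp

lemma hQ_sum: "hQ mul lm (\<lambda>q l. \<Sum>i\<in>I. \<phi> i q l) p as = (\<Sum>i\<in>I. hQ mul lm (\<phi> i) p as)"
  by (induction I rule: infinite_finite_induct) (simp_all add: hQ_zero hQ_add)

lemma hQ_pull:
  assumes "\<And>a p. f (lm a p) = lm' a (f p)"
  shows "hQ mul lm' \<phi> (f p) as = hQ mul lm (\<lambda>q l. \<phi> (f q) l) p as"
proof (induction as arbitrary: \<phi>)
  case (Cons a as)
  show ?case
    by (cases as) (use Cons[of "\<lambda>q l. \<phi> q (a # l)"] in \<open>simp_all add: assms\<close>)
qed simp

text \<open>Double faces that leave \<open>a\<close> untouched cancel in pairs; the others
  multiply \<open>a\<close> and \<open>b\<close>, or let both act on \<open>p\<close>, as
  \<open>mul a b\<close> does.\<close>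

lemma hQ_hQ:
  assumes assoc: "\<And>a b c. mul (mul a b) c = mul a (mul b c)"
    and lm: "\<And>a b p. lm (mul a b) p = lm a (lm b p)"
  shows "hQ mul lm (\<lambda>q l. hQ mul lm \<phi> q (a # l)) p (b # r) = hQ mul lm \<phi> p (mul a b # r)"
proof (induction r arbitrary: \<phi> a b)
  case Nil
  show ?case by (simp add: lm)
next
  case (Cons c r)
  show ?case
    using Cons[of "\<lambda>q l. \<phi> q (a # l)" b c]
    by (simp add: hQ_diff assoc)
qed

lemma hD_hD:
  assumes assoc: "\<And>a b c. mul (mul a b) c = mul a (mul b c)"
    and lm: "\<And>a b p. lm (mul a b) p = lm a (lm b p)"
    and rm: "\<And>a b p. rm p (mul a b) = rm (rm p a) b"
    and lr: "\<And>a b p. rm (lm a p) b = lm a (rm p b)"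
  shows "hD mul lm rm (hD mul lm rm \<phi>) p as = 0"
proof (cases as)
  case (Cons a r)
  show ?thesis
  proof (cases r)
    case Nil
    then show ?thesis using Cons by simp
  next
    case r: (Cons b r')
    have "hQ mul lm (\<lambda>q l. hD mul lm rm \<phi> q (a # l)) p (b # r') =
        hQ mul lm (\<lambda>q l. \<phi> (rm q a) l) p (b # r') - hQ mul lm \<phi> p (mul a b # r')"
      by (simp add: hQ_diff hQ_hQ[of mul lm, OF assoc lm])
    moreover have "hQ mul lm \<phi> (rm p a) (b # r') = hQ mul lm (\<lambda>q l. \<phi> (rm q a) l) p (b # r')"
      by (rule hQ_pull) (rule lr)
    ultimately show ?thesis using Cons r by (simp add: rm)
  qed
qed simp

definition linf :: "(('i \<Rightarrow> 'k::field) \<Rightarrow> 'k) \<Rightarrow> bool" where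
  "linf l \<longleftrightarrow> (\<forall>x y. l (x + y) = l x + l y) \<and> (\<forall>c x. l (sc c x) = c * l x)"

lemma linf_lin: "linf l \<Longrightarrow> lin F \<Longrightarrow> linf (\<lambda>x. l (F x))"
  by (simp add: linf_def lin_def)

lemma linf_diff_fun: "linf l \<Longrightarrow> linf l' \<Longrightarrow> linf (\<lambda>x. l x - l' x)"
  by (simp add: linf_def algebra_simps)

lemma linf_zero_fun: "linf (\<lambda>x. 0)"
  by (simp add: linf_def)

lemma linf_add_fun: "linf l \<Longrightarrow> linf l' \<Longrightarrow> linf (\<lambda>x. l x + l' x)"
  by (simp add: linf_def algebra_simps)

lemma linf_sum_fun: "(\<And>i. i \<in> I \<Longrightarrow> linf (l i)) \<Longrightarrow> linf (\<lambda>x. \<Sum>i\<in>I. l i x)"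
  by (induction I rule: infinite_finite_induct) (auto intro: linf_zero_fun linf_add_fun)

lemma linf_add: "linf l \<Longrightarrow> l (x + y) = l x + l y"
  and linf_sc: "linf l \<Longrightarrow> l (sc c x) = c * l x"
  by (simp_all add: linf_def)

lemma linf_zero: "linf l \<Longrightarrow> l 0 = 0"
  using linf_sc[of l 0 0] by simp

lemma linf_diff: "linf l \<Longrightarrow> l (x - y) = l x - l y"
  using linf_add[of l x "sc (- 1) y"] linf_sc[of l "- 1" y] by simp

lemma linf_sum: "linf l \<Longrightarrow> l (\<Sum>i\<in>I. f i) = (\<Sum>i\<in>I. l (f i))"
proof (induction I rule: infinite_finite_induct)
  case (insert x F)
  then show ?case using linf_add[of l "f x" "sum f F"] by simp
qed (simp_all add: linf_zero)

text \<open>Multilinearity in the coefficient and in every entry of the list, for lists of all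
  lengths at once.\<close>

definition ml :: "(('i \<Rightarrow> 'k::field) \<Rightarrow> ('b \<Rightarrow> 'k) list \<Rightarrow> 'k) \<Rightarrow> bool" where
  "ml \<phi> \<longleftrightarrow> (\<forall>as. linf (\<lambda>p. \<phi> p as)) \<and> (\<forall>p us vs. linf (\<lambda>a. \<phi> p (us @ a # vs)))"

lemma ml_first: "ml \<phi> \<Longrightarrow> linf (\<lambda>p. \<phi> p as)"
  by (simp add: ml_def)

lemma ml_rest: "ml \<phi> \<Longrightarrow> linf (\<lambda>a. \<phi> p (us @ a # vs))"
  by (simp add: ml_def)

lemma ml_head: "ml \<phi> \<Longrightarrow> linf (\<lambda>a. \<phi> p (a # vs))"
  using ml_rest[of \<phi> p "[]" vs] by simp

lemma ml_shift: assumes "ml \<phi>" shows "ml (\<lambda>q l. \<phi> q (a # l))"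
  unfolding ml_def
proof (intro conjI allI)
  show "linf (\<lambda>p. \<phi> p (a # as))" for as by (rule ml_first[OF assms])
  show "linf (\<lambda>b. \<phi> p (a # us @ b # vs))" for p us vs
    using ml_rest[OF assms, of p "a # us" vs] by simp
qed

lemma ml_pull:
  assumes "ml \<phi>" "lin F"
  shows "ml (\<lambda>q l. \<phi> (F q) l)"
  unfolding ml_def
proof (intro conjI allI)
  show "linf (\<lambda>p. \<phi> (F p) as)" for as
    by (rule linf_lin[OF ml_first[OF assms(1)] assms(2)])
  show "linf (\<lambda>a. \<phi> (F p) (us @ a # vs))" for p us vs
    by (rule ml_rest[OF assms(1)])
qed

lemma ml_sum: "(\<And>i. i \<in> I \<Longrightarrow> ml (\<phi> i)) \<Longrightarrow> ml (\<lambda>q l. \<Sum>i\<in>I. \<phi> i q l)"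
  unfolding ml_def by (auto intro!: linf_sum_fun)

text \<open>The pure tensor \<open>p \<otimes> a\<^sub>1 \<otimes> \<dots> \<otimes>
  a\<^sub>m\<close>, encoded as evaluation at \<open>(p, [a\<^sub>1, \<dots>,
  a\<^sub>m])\<close> of multilinear functionals, that is, as an element of the double dual. The
  value 0 on other functionals makes \<open>ev\<close> itself multilinear, and a map between
  tensor powers is then the transpose \<open>tr\<close> of a map between functionals.\<close>

definition ev :: "('i \<Rightarrow> 'k::field) \<Rightarrow> ('b \<Rightarrow> 'k) list \<Rightarrow>
    (('i \<Rightarrow> 'k) \<Rightarrow> ('b \<Rightarrow> 'k) list \<Rightarrow> 'k) \<Rightarrow> 'k" where
  "ev p as = (\<lambda>\<phi>. if ml \<phi> then \<phi> p as else 0)"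

definition tens :: "('b \<Rightarrow> 'k::field) set \<Rightarrow> ('i \<Rightarrow> 'k) set \<Rightarrow> nat \<Rightarrow>
    ((('i \<Rightarrow> 'k) \<Rightarrow> ('b \<Rightarrow> 'k) list \<Rightarrow> 'k) \<Rightarrow> 'k) set" where
  "tens A M m = fv.span {ev p as | p as. p \<in> M \<and> set as \<subseteq> A \<and> length as = m}"

definition tr :: "((('j \<Rightarrow> 'k::field) \<Rightarrow> ('c \<Rightarrow> 'k) list \<Rightarrow> 'k) \<Rightarrow> (('i \<Rightarrow> 'k) \<Rightarrow> ('b \<Rightarrow> 'k) list \<Rightarrow> 'k)) \<Rightarrow>
    ((('i \<Rightarrow> 'k) \<Rightarrow> ('b \<Rightarrow> 'k) list \<Rightarrow> 'k) \<Rightarrow> 'k) \<Rightarrow>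
    ((('j \<Rightarrow> 'k) \<Rightarrow> ('c \<Rightarrow> 'k) list \<Rightarrow> 'k) \<Rightarrow> 'k)" where
  "tr L \<tau> = (\<lambda>\<phi>. if ml \<phi> then \<tau> (L \<phi>) else 0)"

lemma lin_tr: "lin (tr L)"
  by (auto simp: lin_def tr_def fun_eq_iff fun_ap)

lemma subspace_tens: "fv.subspace (tens A M m)"
  by (simp add: tens_def)

lemma ev_tens: "p \<in> M \<Longrightarrow> set as \<subseteq> A \<Longrightarrow> length as = m \<Longrightarrow> ev p as \<in> tens A M m"
  unfolding tens_def by (rule fv.span_base) auto

lemma lin_ev_first: "lin (\<lambda>p. ev p as)"
  by (auto simp: lin_def ev_def fun_eq_iff fun_ap dest: ml_first linf_add linf_sc)

lemma lin_ev_rest: "lin (\<lambda>a. ev p (us @ a # vs))"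
  by (rule linI) (auto simp: ev_def fun_eq_iff fun_ap linf_add[OF ml_rest] linf_sc[OF ml_rest])

lemma tr_ev: "(\<And>\<phi>. ml \<phi> \<Longrightarrow> ml (L \<phi>)) \<Longrightarrow> tr L (ev p as) = (\<lambda>\<phi>. if ml \<phi> then L \<phi> p as else 0)"
  by (auto simp: tr_def ev_def)

lemma tr_tr: "(\<And>\<phi>. ml \<phi> \<Longrightarrow> ml (L \<phi>)) \<Longrightarrow> tr L (tr L' \<tau>) = tr (\<lambda>\<phi>. L' (L \<phi>)) \<tau>"
  by (auto simp: tr_def)

lemma tens_eqI:
  assumes "lin F" "lin H"
    "\<And>p as. p \<in> M \<Longrightarrow> set as \<subseteq> A \<Longrightarrow> length as = m \<Longrightarrow> F (ev p as) = H (ev p as)"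
    "\<tau> \<in> tens A M m"
  shows "F \<tau> = H \<tau>"
  using assms(4) unfolding tens_def
  by (rule lin_eq_on_span[OF assms(1,2), rotated]) (use assms(3) in auto)

lemma tens_mapI:
  assumes "lin F" "fv.subspace V"
    "\<And>p as. p \<in> M \<Longrightarrow> set as \<subseteq> A \<Longrightarrow> length as = m \<Longrightarrow> F (ev p as) \<in> V"
    "\<tau> \<in> tens A M m"
  shows "F \<tau> \<in> V"
  using assms(4) unfolding tens_def
  by (rule lin_span_image[OF assms(1) _ assms(2), rotated]) (use assms(3) in auto)

definition coef :: "(('i \<Rightarrow> 'k::field) \<Rightarrow> ('j \<Rightarrow> 'k)) \<Rightarrow>
    ((('i \<Rightarrow> 'k) \<Rightarrow> ('b \<Rightarrow> 'k) list \<Rightarrow> 'k) \<Rightarrow> 'k) \<Rightarrow> ((('j \<Rightarrow> 'k) \<Rightarrow> ('b \<Rightarrow> 'k) list \<Rightarrow> 'k) \<Rightarrow> 'k)" where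
  "coef f = tr (\<lambda>\<phi> q l. \<phi> (f q) l)"

lemma lin_coef: "lin (coef f)"
  by (simp add: coef_def lin_tr)

lemma coef_ev: "lin f \<Longrightarrow> coef f (ev p as) = ev (f p) as"
  unfolding coef_def by (subst tr_ev) (auto simp: ml_pull ev_def)

lemma coef_tens:
  assumes "lin f" "\<And>p. p \<in> M \<Longrightarrow> f p \<in> N" "\<tau> \<in> tens A M m"
  shows "coef f \<tau> \<in> tens A N m"
  by (rule tens_mapI[OF lin_coef subspace_tens _ assms(3)]) (simp add: coef_ev assms ev_tens)

lemma coef_coef_eq:
  assumes "lin f" "lin g" "lin h" "\<And>p. p \<in> M \<Longrightarrow> f (g p) = h p" "\<tau> \<in> tens A M m"
  shows "coef f (coef g \<tau>) = coef h \<tau>"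
  by (rule tens_eqI[OF lin_comp[OF lin_coef lin_coef] lin_coef _ assms(5)]) (simp add: coef_ev assms)

lemma coef_id:
  assumes "lin f" "\<And>p. p \<in> M \<Longrightarrow> f p = p" "\<tau> \<in> tens A M m"
  shows "coef f \<tau> = \<tau>"
  by (rule tens_eqI[OF lin_coef lin_id _ assms(3)]) (simp add: coef_ev assms)

section \<open>Bimodules\<close>

text \<open>The linearity and associativity laws hold without membership conditions. This can be
  arranged because multiplications defined by linear extension ignore coefficients outside the
  basis.\<close>

locale alg =
  fixes A :: "('b \<Rightarrow> 'k::field) set" and mul :: "('b \<Rightarrow> 'k) \<Rightarrow> ('b \<Rightarrow> 'k) \<Rightarrow> 'b \<Rightarrow> 'k"
  assumes A_sub: "fv.subspace A"
    and mul_closed: "a \<in> A \<Longrightarrow> b \<in> A \<Longrightarrow> mul a b \<in> A"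
    and mul_lin1: "lin (\<lambda>a. mul a b)" and mul_lin2: "lin (mul a)"
    and mul_assoc: "mul (mul a b) c = mul a (mul b c)"

locale bimod = alg A mul for A :: "('b \<Rightarrow> 'k::field) set" and mul +
  fixes M :: "('i \<Rightarrow> 'k) set" and lm :: "('b \<Rightarrow> 'k) \<Rightarrow> ('i \<Rightarrow> 'k) \<Rightarrow> 'i \<Rightarrow> 'k"
    and rm :: "('i \<Rightarrow> 'k) \<Rightarrow> ('b \<Rightarrow> 'k) \<Rightarrow> 'i \<Rightarrow> 'k"
  assumes M_sub: "fv.subspace M"
    and lm_closed: "a \<in> A \<Longrightarrow> p \<in> M \<Longrightarrow> lm a p \<in> M"
    and rm_closed: "a \<in> A \<Longrightarrow> p \<in> M \<Longrightarrow> rm p a \<in> M"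
    and lm_lin1: "lin (\<lambda>a. lm a p)" and lm_lin2: "lin (lm a)"
    and rm_lin1: "lin (rm p)" and rm_lin2: "lin (\<lambda>p. rm p a)"
    and lm_mul: "lm (mul a b) p = lm a (lm b p)"
    and rm_mul: "rm p (mul a b) = rm (rm p a) b"
    and lm_rm: "rm (lm a p) b = lm a (rm p b)"
begin

abbreviation "Q \<equiv> hQ mul lm"
abbreviation "D \<equiv> hD mul lm rm"

definition bd where "bd = tr D"

lemma ml_hQ_first: "ml \<phi> \<Longrightarrow> linf (\<lambda>p. Q \<phi> p as)"
proof (induction as arbitrary: \<phi>)
  case Nil
  then show ?case by (simp add: linf_zero_fun)
next
  case (Cons a as)
  show ?case
  proof (cases as)
    case Nil
    then show ?thesis using linf_lin[OF ml_first[OF Cons.prems] lm_lin2] by simp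
  next
    case C: (Cons b r)
    then show ?thesis
      using Cons.IH[OF ml_shift[OF Cons.prems, of a]] ml_first[OF Cons.prems]
      by (auto intro: linf_diff_fun)
  qed
qed

lemma linf_hQ_family:
  assumes "\<And>q l. linf (\<lambda>a. \<phi> a q l)"
  shows "linf (\<lambda>a. Q (\<phi> a) p as)"
proof -
  have "\<phi> (x + y) = (\<lambda>q l. \<phi> x q l + \<phi> y q l)" for x y
    by (intro ext) (rule linf_add[OF assms])
  moreover have "\<phi> (sc c x) = (\<lambda>q l. c * \<phi> x q l)" for c x
    by (intro ext) (rule linf_sc[OF assms])
  ultimately show ?thesis by (simp add: linf_def hQ_add hQ_scale)
qed

lemma ml_hQ_rest: "ml \<phi> \<Longrightarrow> linf (\<lambda>a. Q \<phi> p (us @ a # vs))"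
proof (induction us arbitrary: \<phi>)
  case Nil
  show ?case
  proof (cases vs)
    case vs: Nil
    have "lin (\<lambda>a. lm a p)" by (rule lm_lin1)
    then show ?thesis using linf_lin[OF ml_first[OF Nil, of "[]"], of "\<lambda>a. lm a p"] vs by simp
  next
    case (Cons b r)
    have "linf (\<lambda>a. \<phi> p (mul a b # r))"
      using linf_lin[OF ml_head[OF Nil] mul_lin1] by simp
    moreover have "linf (\<lambda>a. Q (\<lambda>q l. \<phi> q (a # l)) p (b # r))"
      by (rule linf_hQ_family) (rule ml_head[OF Nil])
    ultimately show ?thesis using Cons by (auto intro: linf_diff_fun)
  qed
next
  case (Cons u us)
  note IH = Cons.IH[OF ml_shift[OF Cons.prems, of u]]
  show ?case
  proof (cases us)
    case Nil
    have "linf (\<lambda>a. \<phi> p (mul u a # vs))"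
      using linf_lin[OF ml_head[OF Cons.prems] mul_lin2] by simp
    then show ?thesis using IH Nil by (auto intro: linf_diff_fun)
  next
    case C: (Cons v us')
    have "linf (\<lambda>a. \<phi> p (mul u v # us' @ a # vs))"
      using ml_rest[OF Cons.prems, of p "mul u v # us'" vs] by simp
    then show ?thesis using IH C by (auto intro: linf_diff_fun)
  qed
qed

lemma ml_D: assumes "ml \<phi>" shows "ml (D \<phi>)"
  unfolding ml_def
proof (intro conjI allI)
  fix as show "linf (\<lambda>p. D \<phi> p as)"
  proof (cases as)
    case (Cons a r)
    then show ?thesis
      using linf_lin[OF ml_first[OF assms, of r] rm_lin2, of a] ml_hQ_first[OF assms, of as]
      by (auto intro: linf_diff_fun)
  qed (simp add: linf_zero_fun)
next
  fix p us vs show "linf (\<lambda>a. D \<phi> p (us @ a # vs))"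
  proof (cases us)
    case Nil
    then show ?thesis
      using linf_lin[OF ml_first[OF assms, of vs] rm_lin1, of p] ml_hQ_rest[OF assms, of p us vs]
      by (auto intro: linf_diff_fun)
  next
    case (Cons u us')
    then show ?thesis
      using ml_rest[OF assms, of "rm p u" us' vs] ml_hQ_rest[OF assms, of p us vs]
      by (auto intro: linf_diff_fun)
  qed
qed

lemma lin_bd: "lin bd"
  by (simp add: bd_def lin_tr)

lemma bd_ev: "bd (ev p as) = (\<lambda>\<phi>. if ml \<phi> then D \<phi> p as else 0)"
  by (simp add: bd_def tr_ev ml_D)

lemma bd_bd: "\<tau> \<in> tens A M m \<Longrightarrow> bd (bd \<tau>) = 0"
proof (erule tens_eqI[OF lin_comp[OF lin_bd lin_bd] lin_const_zero, rotated])
  fix p :: "'i \<Rightarrow> 'k" and as :: "('b \<Rightarrow> 'k) list"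
  have "bd (bd (ev p as)) = tr (\<lambda>\<phi>. D (D \<phi>)) (ev p as)"
    by (simp add: bd_def tr_tr ml_D)
  also have "\<dots> = 0"
    by (subst tr_ev) (auto simp: ml_D fun_eq_iff fun_ap
        hD_hD[of mul lm rm, OF mul_assoc lm_mul rm_mul lm_rm])
  finally show "bd (bd (ev p as)) = 0" .
qed

lemma hQ_tens:
  assumes "p \<in> M" "set as \<subseteq> A" "as \<noteq> []"
  shows "set pre \<subseteq> A \<Longrightarrow> (\<lambda>\<phi>. if ml \<phi> then Q (\<lambda>q l. \<phi> q (pre @ l)) p as else 0)
    \<in> tens A M (length pre + length as - 1)"
  using assms(2,3)
proof (induction as arbitrary: pre)
  case (Cons a as)
  show ?case
  proof (cases as)
    case Nil
    have "(\<lambda>\<phi>. if ml \<phi> then Q (\<lambda>q l. \<phi> q (pre @ l)) p (a # as) else 0) = ev (lm a p) pre"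
      unfolding ev_def Nil by (intro ext) simp
    then show ?thesis using Cons Nil assms by (simp add: ev_tens lm_closed)
  next
    case C: (Cons b r)
    have "(\<lambda>\<phi>. if ml \<phi> then Q (\<lambda>q l. \<phi> q (pre @ l)) p (a # as) else 0) =
        ev p (pre @ mul a b # r) -
        (\<lambda>\<phi>. if ml \<phi> then Q (\<lambda>q l. \<phi> q ((pre @ [a]) @ l)) p as else 0)"
      using C by (auto simp: ev_def fun_eq_iff fun_ap)
    also have "\<dots> \<in> tens A M (length pre + length (a # as) - 1)"
    proof (rule fv.subspace_diff[OF subspace_tens])
      show "ev p (pre @ mul a b # r) \<in> tens A M (length pre + length (a # as) - 1)"
        using Cons.prems C assms by (auto intro!: ev_tens mul_closed)
      show "(\<lambda>\<phi>. if ml \<phi> then Q (\<lambda>q l. \<phi> q ((pre @ [a]) @ l)) p as else 0)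
          \<in> tens A M (length pre + length (a # as) - 1)"
        using Cons.IH[of "pre @ [a]"] Cons.prems C by simp
    qed
    finally show ?thesis .
  qed
qed simp

lemma bd_tens: "\<tau> \<in> tens A M (Suc m) \<Longrightarrow> bd \<tau> \<in> tens A M m"
proof (erule tens_mapI[OF lin_bd subspace_tens, rotated])
  fix p :: "'i \<Rightarrow> 'k" and as :: "('b \<Rightarrow> 'k) list"
  assume p: "p \<in> M" "set as \<subseteq> A" "length as = Suc m"
  then obtain a r where ar: "as = a # r" by (cases as) auto
  have "bd (ev p as) = ev (rm p a) r - (\<lambda>\<phi>. if ml \<phi> then Q \<phi> p as else 0)"
    unfolding bd_ev using ar by (auto simp: ev_def fun_eq_iff fun_ap)
  also have "\<dots> \<in> tens A M m"
    using p ar hQ_tens[of p as "[]", unfolded append_Nil]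
    by (intro fv.subspace_diff[OF subspace_tens] ev_tens rm_closed) auto
  finally show "bd (ev p as) \<in> tens A M m" .
qed

lemma bd_0: "\<tau> \<in> tens A M 0 \<Longrightarrow> bd \<tau> = 0"
  by (erule tens_eqI[OF lin_bd lin_const_zero, rotated]) (auto simp: bd_ev fun_eq_iff fun_ap)

definition cyc where "cyc m = {\<tau> \<in> tens A M m. bd \<tau> = 0}"
definition bnd where "bnd m = bd ` tens A M (Suc m)"

lemma subspace_cyc: "fv.subspace (cyc m)"
proof -
  have "cyc m = tens A M m \<inter> {\<tau>. bd \<tau> = 0}" by (auto simp: cyc_def)
  then show ?thesis using fv.subspace_inter[OF subspace_tens subspace_kernel[OF lin_bd]] by simp
qed

lemma subspace_bnd: "fv.subspace (bnd m)"
  by (simp add: bnd_def subspace_image lin_bd subspace_tens)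

lemma bnd_cyc: "bnd m \<subseteq> cyc m"
  by (auto simp: bnd_def cyc_def bd_bd bd_tens)

text \<open>The commutator space \<open>[A, M]\<close>, whose quotient is the homology in degree
  0.\<close>

definition comm where "comm = fv.span {rm p a - lm a p | p a. p \<in> M \<and> a \<in> A}"

lemma subspace_comm: "fv.subspace comm"
  by (simp add: comm_def)

lemma comm_sub: "comm \<subseteq> M"
  unfolding comm_def
  by (intro fv.span_minimal M_sub) (auto intro!: fv.subspace_diff[OF M_sub] rm_closed lm_closed)

lemma tens_0: "tens A M 0 = (\<lambda>p. ev p []) ` M"
proof
  show "tens A M 0 \<subseteq> (\<lambda>p. ev p []) ` M"
    unfolding tens_def
    by (intro fv.span_minimal subspace_image lin_ev_first M_sub) auto
  show "(\<lambda>p. ev p []) ` M \<subseteq> tens A M 0"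
    by (auto intro: ev_tens)
qed

lemma bnd_0: "bnd 0 = (\<lambda>p. ev p []) ` comm"
proof -
  let ?S = "{ev p as | p as. p \<in> M \<and> set as \<subseteq> A \<and> length as = Suc 0}"
  let ?C = "{rm p a - lm a p | p a. p \<in> M \<and> a \<in> A}"
  have im: "F ` fv.span S = fv.span (F ` S)" if "lin F" for F :: "('x \<Rightarrow> 'k) \<Rightarrow> 'y \<Rightarrow> 'k" and S
  proof
    show "F ` fv.span S \<subseteq> fv.span (F ` S)"
      using lin_span_image[OF that, of S "fv.span (F ` S)"]
      by (auto intro: fv.span_base)
    show "fv.span (F ` S) \<subseteq> F ` fv.span S"
      by (intro fv.span_minimal subspace_image that) (auto intro: fv.span_base)
  qed
  have bd1: "bd (ev p [a]) = ev (rm p a - lm a p) []" for p a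
    unfolding bd_ev lin_diff[OF lin_ev_first] by (auto simp: ev_def fun_eq_iff fun_ap)
  have "bd ` ?S = (\<lambda>p. ev p []) ` ?C"
  proof (intro subset_antisym subsetI)
    fix x assume "x \<in> bd ` ?S"
    then obtain p as where "p \<in> M" "set as \<subseteq> A" "length as = Suc 0" "x = bd (ev p as)" by auto
    moreover then obtain a where "as = [a]" by (auto simp: length_Suc_conv)
    ultimately show "x \<in> (\<lambda>p. ev p []) ` ?C" by (auto simp: bd1)
  next
    fix x :: "(('i \<Rightarrow> 'k) \<Rightarrow> ('b \<Rightarrow> 'k) list \<Rightarrow> 'k) \<Rightarrow> 'k"
    assume "x \<in> (\<lambda>p. ev p []) ` ?C"
    then obtain p a where pa: "p \<in> M" "a \<in> A" "x = ev (rm p a - lm a p) []" by auto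
    then have "x = bd (ev p [a])" by (simp add: bd1)
    moreover have "ev p [a] \<in> ?S" using pa by (intro CollectI exI[of _ p] exI[of _ "[a]"]) auto
    ultimately show "x \<in> bd ` ?S" by (rule image_eqI)
  qed
  then show ?thesis
    unfolding bnd_def tens_def comm_def by (simp add: im lin_bd lin_ev_first)
qed

end

lemma ev_Nil_inj:
  assumes "ev p [] = ev q []"
  shows "p = q"
proof
  fix i
  define \<phi> :: "('a \<Rightarrow> 'b) \<Rightarrow> ('c \<Rightarrow> 'b) list \<Rightarrow> 'b" where
    "\<phi> r l = (if l = [] then r i else 0)" for r l
  have "ml \<phi>" by (auto simp: ml_def linf_def \<phi>_def fun_ap)
  then show "p i = q i" using fun_cong[OF assms, of \<phi>] by (simp add: ev_def \<phi>_def)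
qed

lemma coef_bd:
  assumes M: "bimod A mul M lm rm" and N: "bimod A mul N lm' rm'" and f: "lin f"
    and fl: "\<And>a p. f (lm a p) = lm' a (f p)" and fr: "\<And>a p. f (rm p a) = rm' (f p) a"
    and \<tau>: "\<tau> \<in> tens A M m"
  shows "bimod.bd mul lm' rm' (coef f \<tau>) = coef f (bimod.bd mul lm rm \<tau>)"
proof (rule tens_eqI[OF lin_comp[OF bimod.lin_bd[OF N] lin_coef]
      lin_comp[OF lin_coef bimod.lin_bd[OF M]] _ \<tau>])
  fix p as
  have "hD mul lm' rm' \<phi> (f p) as = hD mul lm rm (\<lambda>q l. \<phi> (f q) l) p as" for \<phi>
    using hQ_pull[of f lm lm' mul \<phi> p as, OF fl] by (cases as) (simp_all add: fr)
  then show "bimod.bd mul lm' rm' (coef f (ev p as)) = coef f (bimod.bd mul lm rm (ev p as))"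
    unfolding coef_ev[OF f] bimod.bd_ev[OF N] bimod.bd_ev[OF M]
    unfolding coef_def tr_def by (intro ext) (auto simp: ml_pull[OF _ f] simp del: hD.simps)
qed

text \<open>Suppose that right multiplication \<open>M \<otimes> A \<rightarrow> M\<close> has a
  section \<open>p \<mapsto> \<Sum>\<^sub>i f\<^sub>i(p) \<otimes> c\<^sub>i\<close> of
  bimodules (tensors over the ground field, \<open>A\<close> acting on the left of the first and
  on the right of the second factor). Inserting the section in front of a chain, \<open>p
  \<otimes> a\<^sub>1 \<otimes> \<dots> \<mapsto> \<Sum>\<^sub>i f\<^sub>i(p) \<otimes>
  c\<^sub>i \<otimes> a\<^sub>1 \<otimes> \<dots>\<close>, is then a contracting homotopy in
  positive degrees. The assumption \<open>right\<close> states compatibility of the section with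
  the right action after pairing with multilinear functionals, since an equation between tensors
  means nothing else.\<close>

lemma (in bimod) acyclic:
  fixes I :: "'x set"
  assumes fin: "\<And>i. i \<in> I \<Longrightarrow> lin (f i)" "\<And>i p. i \<in> I \<Longrightarrow> p \<in> M \<Longrightarrow> f i p \<in> M"
    and c: "\<And>i. i \<in> I \<Longrightarrow> c i \<in> A"
    and unit: "\<And>p. p \<in> M \<Longrightarrow> (\<Sum>i\<in>I. rm (f i p) (c i)) = p"
    and left: "\<And>i a p. i \<in> I \<Longrightarrow> f i (lm a p) = lm a (f i p)"
    and right: "\<And>\<phi> p a l. ml \<phi> \<Longrightarrow> p \<in> M \<Longrightarrow> a \<in> A \<Longrightarrow>
      (\<Sum>i\<in>I. \<phi> (f i (rm p a)) (c i # l)) = (\<Sum>i\<in>I. \<phi> (f i p) (mul (c i) a # l))"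
    and z: "z \<in> cyc (Suc m)"
  shows "z \<in> bnd (Suc m)"
proof -
  define s where "s \<phi> = (\<lambda>p l. \<Sum>i\<in>I. \<phi> (f i p) (c i # l))"
    for \<phi> :: "('i \<Rightarrow> 'k) \<Rightarrow> ('b \<Rightarrow> 'k) list \<Rightarrow> 'k"
  have ml_s: "ml (s \<phi>)" if "ml \<phi>" for \<phi>
    unfolding s_def
  proof (rule ml_sum)
    fix i assume "i \<in> I"
    then show "ml (\<lambda>q l. \<phi> (f i q) (c i # l))"
      using ml_pull[OF ml_shift[OF that, of "c i"], of "f i"] fin(1) by simp
  qed
  have s_tens: "tr s \<tau> \<in> tens A M (Suc m)" if "\<tau> \<in> tens A M m" for \<tau> m
  proof (rule tens_mapI[OF lin_tr subspace_tens _ that])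
    fix p as assume "p \<in> M" "set as \<subseteq> A" "length as = m"
    moreover have "tr s (ev p as) = (\<Sum>i\<in>I. ev (f i p) (c i # as))"
      by (subst tr_ev[OF ml_s]) (auto simp: s_def ev_def fun_eq_iff fun_ap)
    ultimately show "tr s (ev p as) \<in> tens A M (Suc m)"
      using fin c by (auto intro!: fv.subspace_sum[OF subspace_tens] ev_tens)
  qed
  have hom: "s (D \<phi>) p (a # r) + D (s \<phi>) p (a # r) = \<phi> p (a # r)"
    if "ml \<phi>" "p \<in> M" "a \<in> A" for \<phi> p a r
  proof -
    have Qs: "Q (s \<phi>) p l = (\<Sum>i\<in>I. Q (\<lambda>q l. \<phi> q (c i # l)) (f i p) l)" for l
      unfolding s_def hQ_sum
    proof (intro sum.cong refl)
      fix i assume "i \<in> I"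
      then show "Q (\<lambda>q l. \<phi> (f i q) (c i # l)) p l = Q (\<lambda>q l. \<phi> q (c i # l)) (f i p) l"
        using hQ_pull[of "f i" lm lm mul "\<lambda>q l. \<phi> q (c i # l)" p l] left by simp
    qed
    have "(\<Sum>i\<in>I. \<phi> (rm (f i p) (c i)) (a # r)) = \<phi> (\<Sum>i\<in>I. rm (f i p) (c i)) (a # r)"
      by (rule linf_sum[OF ml_first[OF that(1), of "a # r"], symmetric])
    then have "s (D \<phi>) p (a # r) = \<phi> p (a # r) -
        (\<Sum>i\<in>I. \<phi> (f i p) (mul (c i) a # r)) + Q (s \<phi>) p (a # r)"
      by (simp add: s_def[of "D \<phi>"] Qs sum_subtractf unit that)
    moreover have "D (s \<phi>) p (a # r) =
        (\<Sum>i\<in>I. \<phi> (f i p) (mul (c i) a # r)) - Q (s \<phi>) p (a # r)"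
      using right[OF that, of r] by (simp add: s_def)
    ultimately show ?thesis by simp
  qed
  have "bd (tr s \<tau>) + tr s (bd \<tau>) = \<tau>" if "\<tau> \<in> tens A M (Suc m)" for \<tau>
  proof (rule tens_eqI[OF _ lin_id _ that])
    show "lin (\<lambda>\<tau>. bd (tr s \<tau>) + tr s (bd \<tau>))"
      by (intro lin_add_fun lin_comp[OF lin_bd lin_tr] lin_comp[OF lin_tr lin_bd])
    fix p as assume *: "p \<in> M" "set as \<subseteq> A" "length as = Suc m"
    then obtain a r where ar: "as = a # r" by (cases as) auto
    have "bd (tr s (ev p as)) + tr s (bd (ev p as)) = tr (\<lambda>\<phi>. s (D \<phi>)) (ev p as) + tr (\<lambda>\<phi>. D (s \<phi>)) (ev p as)"
      by (simp add: bd_def tr_tr ml_D ml_s)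
    also have "\<dots> = ev p as"
    proof -
      have "tr (\<lambda>\<phi>. s (D \<phi>)) (ev p as) = (\<lambda>\<phi>. if ml \<phi> then s (D \<phi>) p as else 0)"
        "tr (\<lambda>\<phi>. D (s \<phi>)) (ev p as) = (\<lambda>\<phi>. if ml \<phi> then D (s \<phi>) p as else 0)"
        by (rule tr_ev, simp add: ml_D ml_s)+
      moreover have "s (D \<phi>) p as + D (s \<phi>) p as = \<phi> p as" if "ml \<phi>" for \<phi>
        using hom[OF that *(1)] * ar by simp
      ultimately show ?thesis by (auto simp: ev_def fun_eq_iff plus_fun_apply)
    qed
    finally show "bd (tr s (ev p as)) + tr s (bd (ev p as)) = ev p as" .
  qed
  from this[of z] have "z = bd (tr s z)"
    using z by (simp add: cyc_def lin_zero[OF lin_tr])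
  then show ?thesis using z s_tens by (auto simp: bnd_def cyc_def)
qed

section \<open>Dimension shifting\<close>

text \<open>An exact sequence of complexes \<open>0 \<rightarrow> X3 \<rightarrow> X2
  \<rightarrow> X1 \<rightarrow> X0 \<rightarrow> 0\<close> whose two middle terms have no
  homology in positive degrees. The connecting relations then identify the homology of
  \<open>X0\<close> in degree \<open>m + 2\<close> with that of \<open>X3\<close> in degree
  \<open>m\<close>, up to a correction for \<open>m = 0\<close>.\<close>

locale four_term =
  fixes X0 :: "nat \<Rightarrow> ('w0 \<Rightarrow> 'k::field) set" and X1 :: "nat \<Rightarrow> ('w1 \<Rightarrow> 'k) set"
    and X2 :: "nat \<Rightarrow> ('w2 \<Rightarrow> 'k) set" and X3 :: "nat \<Rightarrow> ('w3 \<Rightarrow> 'k) set"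
    and b0 b1 b2 b3 e d1 d2
  assumes sub: "fv.subspace (X0 m)" "fv.subspace (X1 m)" "fv.subspace (X2 m)" "fv.subspace (X3 m)"
    and lin: "lin b0" "lin b1" "lin b2" "lin b3" "lin e" "lin d1" "lin d2"
    and b0: "x0 \<in> X0 (Suc m) \<Longrightarrow> b0 x0 \<in> X0 m"
    and b1: "x1 \<in> X1 (Suc m) \<Longrightarrow> b1 x1 \<in> X1 m"
    and b2: "x2 \<in> X2 (Suc m) \<Longrightarrow> b2 x2 \<in> X2 m"
    and b3: "x3 \<in> X3 (Suc m) \<Longrightarrow> b3 x3 \<in> X3 m"
    and bb0: "x0 \<in> X0 m \<Longrightarrow> b0 (b0 x0) = 0"
    and bb1: "x1 \<in> X1 m \<Longrightarrow> b1 (b1 x1) = 0"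
    and bb2: "x2 \<in> X2 m \<Longrightarrow> b2 (b2 x2) = 0"
    and e: "x1 \<in> X1 m \<Longrightarrow> e x1 \<in> X0 m"
    and d1: "x2 \<in> X2 m \<Longrightarrow> d1 x2 \<in> X1 m"
    and d2: "x3 \<in> X3 m \<Longrightarrow> d2 x3 \<in> X2 m"
    and eb: "x1 \<in> X1 m \<Longrightarrow> b0 (e x1) = e (b1 x1)"
    and d1b: "x2 \<in> X2 m \<Longrightarrow> b1 (d1 x2) = d1 (b2 x2)"
    and d2b: "x3 \<in> X3 m \<Longrightarrow> b2 (d2 x3) = d2 (b3 x3)"
    and ed1: "x2 \<in> X2 m \<Longrightarrow> e (d1 x2) = 0"
    and d1d2: "x3 \<in> X3 m \<Longrightarrow> d1 (d2 x3) = 0"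
    and e_surj: "x0 \<in> X0 m \<Longrightarrow> \<exists>x1\<in>X1 m. e x1 = x0"
    and e_ker: "x1 \<in> X1 m \<Longrightarrow> e x1 = 0 \<Longrightarrow> \<exists>x2\<in>X2 m. x1 = d1 x2"
    and d1_ker: "x2 \<in> X2 m \<Longrightarrow> d1 x2 = 0 \<Longrightarrow> \<exists>x3\<in>X3 m. x2 = d2 x3"
    and d2_inj: "x3 \<in> X3 m \<Longrightarrow> d2 x3 = 0 \<Longrightarrow> x3 = 0"
    and ac1: "x1 \<in> X1 (Suc m) \<Longrightarrow> b1 x1 = 0 \<Longrightarrow> \<exists>y1\<in>X1 (Suc (Suc m)). x1 = b1 y1"
    and ac2: "x2 \<in> X2 (Suc m) \<Longrightarrow> b2 x2 = 0 \<Longrightarrow> \<exists>y2\<in>X2 (Suc (Suc m)). x2 = b2 y2"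
    and low0: "x0 \<in> X0 0 \<Longrightarrow> b0 x0 = 0"
    and low3: "x3 \<in> X3 0 \<Longrightarrow> b3 x3 = 0"
begin

text \<open>If \<open>x\<close> bounds, its lift differs from a boundary by some \<open>d1
  q1\<close>, and then \<open>p1 - b2 q1\<close> lies in the kernel of
  \<open>d1\<close>.\<close>

lemma boundary_shift:
  assumes x: "x \<in> b0 ` X0 (Suc (Suc m))" and p0: "p0 \<in> X1 (Suc m)" "e p0 = x"
    and p1: "p1 \<in> X2 m" "b1 p0 = d1 p1"
  shows "\<exists>q1\<in>X2 (Suc m). \<exists>y\<in>X3 m. p1 = b2 q1 + d2 y"
proof -
  obtain x' where x': "x' \<in> X0 (Suc (Suc m))" "x = b0 x'" using x by auto
  then obtain p' where p': "p' \<in> X1 (Suc (Suc m))" "e p' = x'" using e_surj by blast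
  have "e (p0 - b1 p') = 0"
    using eb[OF p'(1)] p' p0 x' by (simp add: lin_diff[OF lin(5)])
  moreover have "p0 - b1 p' \<in> X1 (Suc m)" using p0 b1[OF p'(1)] sub by (simp add: fv.subspace_diff)
  ultimately obtain q1 where q1: "q1 \<in> X2 (Suc m)" "p0 - b1 p' = d1 q1" using e_ker by blast
  have "b1 (p0 - b1 p') = b1 p0" using bb1[OF p'(1)] by (simp add: lin_diff[OF lin(2)])
  then have "d1 (p1 - b2 q1) = 0" using q1 p1 d1b[OF q1(1)] by (simp add: lin_diff[OF lin(6)])
  moreover have "p1 - b2 q1 \<in> X2 m" using p1 b2[OF q1(1)] sub by (simp add: fv.subspace_diff)
  ultimately obtain y where "y \<in> X3 m" "p1 - b2 q1 = d2 y" using d1_ker by blast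
  then have "y \<in> X3 m" "p1 = b2 q1 + d2 y" by (simp_all add: algebra_simps)
  then show ?thesis using q1 by blast
qed

text \<open>Conversely, subtracting \<open>d1 q1\<close> turns the lift into a cycle of the
  acyclic complex \<open>X1\<close>.\<close>

lemma boundary_shift_back:
  assumes p0: "p0 \<in> X1 (Suc m)" "e p0 = x"
    and q1: "q1 \<in> X2 (Suc m)" and eq: "b1 p0 = d1 (b2 q1)"
  shows "x \<in> b0 ` X0 (Suc (Suc m))"
proof -
  have "b1 (p0 - d1 q1) = 0" using eq d1b[OF q1] by (simp add: lin_diff[OF lin(2)])
  moreover have "p0 - d1 q1 \<in> X1 (Suc m)" using p0 d1[OF q1] sub by (simp add: fv.subspace_diff)
  ultimately obtain q0 where q0: "q0 \<in> X1 (Suc (Suc m))" "p0 - d1 q1 = b1 q0" using ac1 by blast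
  have "e (p0 - d1 q1) = x" using p0 ed1[OF q1] by (simp add: lin_diff[OF lin(5)])
  then have "x = b0 (e q0)" using q0 eb by simp
  then show ?thesis using e[OF q0(1)] by blast
qed

text \<open>A cycle \<open>x\<close> of degree 1 lifts along \<open>e\<close>; the boundary of
  the lift comes from degree 0 of \<open>X2\<close>. Stopping the chase there gives a
  subquotient of \<open>X2\<close> in degree 0, which involves no higher chains once the
  complexes come from bimodules.\<close>

lemma shift_one:
  "qiso {x \<in> X0 1. b0 x = 0} (b0 ` X0 2)
     {p \<in> X2 0. d1 p \<in> b1 ` X1 1} {b2 q + d2 y | q y. q \<in> X2 1 \<and> y \<in> X3 0}"
proof (rule qisoI[where Q = "\<lambda>x p. x \<in> X0 1 \<and> p \<in> X2 0 \<and> (\<exists>p0\<in>X1 1. e p0 = x \<and> b1 p0 = d1 p)"])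
  fix x p assume *: "x \<in> X0 1 \<and> p \<in> X2 0 \<and> (\<exists>p0\<in>X1 1. e p0 = x \<and> b1 p0 = d1 p)"
  then obtain p0 where p0: "p0 \<in> X1 1" "e p0 = x" "b1 p0 = d1 p" by blast
  then have "b0 x = 0" using eb[OF p0(1)] ed1 * by auto
  then show "x \<in> {x \<in> X0 1. b0 x = 0} \<and> p \<in> {p \<in> X2 0. d1 p \<in> b1 ` X1 1}"
    using * p0 by (auto simp: image_iff) metis
next
  fix x assume x: "x \<in> {x \<in> X0 1. b0 x = 0}"
  then obtain p0 where p0: "p0 \<in> X1 1" "e p0 = x" using e_surj by blast
  then have "e (b1 p0) = 0" using eb[OF p0(1)] x by simp
  then obtain p where "p \<in> X2 0" "b1 p0 = d1 p" using e_ker b1 p0 by (metis One_nat_def)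
  then show "\<exists>p. x \<in> X0 1 \<and> p \<in> X2 0 \<and> (\<exists>p0\<in>X1 1. e p0 = x \<and> b1 p0 = d1 p)"
    using x p0 by blast
next
  fix p assume "p \<in> {p \<in> X2 0. d1 p \<in> b1 ` X1 1}"
  then obtain p0 where "p \<in> X2 0" "p0 \<in> X1 1" "d1 p = b1 p0" by blast
  then show "\<exists>x. x \<in> X0 1 \<and> p \<in> X2 0 \<and> (\<exists>p0\<in>X1 1. e p0 = x \<and> b1 p0 = d1 p)"
    using e[of p0 1] by auto
next
  fix x y x' y'
  assume "x \<in> X0 1 \<and> x' \<in> X2 0 \<and> (\<exists>p0\<in>X1 1. e p0 = x \<and> b1 p0 = d1 x')"
    "y \<in> X0 1 \<and> y' \<in> X2 0 \<and> (\<exists>p0\<in>X1 1. e p0 = y \<and> b1 p0 = d1 y')"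
  then obtain p q where "p \<in> X1 1" "e p = x" "b1 p = d1 x'" "q \<in> X1 1" "e q = y" "b1 q = d1 y'"
     "x \<in> X0 1" "x' \<in> X2 0" "y \<in> X0 1" "y' \<in> X2 0" by blast
  then show "x + y \<in> X0 1 \<and> x' + y' \<in> X2 0 \<and> (\<exists>p0\<in>X1 1. e p0 = x + y \<and> b1 p0 = d1 (x' + y'))"
    using sub by (auto intro!: bexI[of _ "p + q"] simp: fv.subspace_add lin_add[OF lin(2)]
        lin_add[OF lin(5)] lin_add[OF lin(6)])
next
  fix c x x' assume "x \<in> X0 1 \<and> x' \<in> X2 0 \<and> (\<exists>p0\<in>X1 1. e p0 = x \<and> b1 p0 = d1 x')"
  then obtain p where "p \<in> X1 1" "e p = x" "b1 p = d1 x'" "x \<in> X0 1" "x' \<in> X2 0" by blast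
  then show "sc c x \<in> X0 1 \<and> sc c x' \<in> X2 0 \<and> (\<exists>p0\<in>X1 1. e p0 = sc c x \<and> b1 p0 = d1 (sc c x'))"
    using sub by (auto intro!: bexI[of _ "sc c p"] simp: fv.subspace_scale lin_sc[OF lin(2)]
        lin_sc[OF lin(5)] lin_sc[OF lin(6)])
next
  fix x p assume "x \<in> X0 1 \<and> p \<in> X2 0 \<and> (\<exists>p0\<in>X1 1. e p0 = x \<and> b1 p0 = d1 p)"
  then obtain p0 where p0: "p \<in> X2 0" "p0 \<in> X1 (Suc 0)" "e p0 = x" "b1 p0 = d1 p" by auto
  {
    assume "x \<in> b0 ` X0 2"
    then show "p \<in> {b2 q + d2 y | q y. q \<in> X2 1 \<and> y \<in> X3 0}"
      using boundary_shift[of x 0 p0 p] p0 by (auto simp: numeral_2_eq_2)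
  next
    assume "p \<in> {b2 q + d2 y | q y. q \<in> X2 1 \<and> y \<in> X3 0}"
    then obtain q y where "p = b2 q + d2 y" "q \<in> X2 (Suc 0)" "y \<in> X3 0" by auto
    then show "x \<in> b0 ` X0 2"
      using boundary_shift_back[of p0 0 x q] p0 d1d2[of y 0] by (simp add: numeral_2_eq_2 lin_add[OF lin(6)])
  }
qed

text \<open>The same chase carried one step further. In positive degree \<open>m\<close> the
  condition on \<open>y\<close> says that \<open>y\<close> is a cycle; in degree 0 it is a
  genuine restriction, because \<open>X2\<close> has homology there.\<close>

lemma shift_two:
  "qiso {x \<in> X0 (Suc (Suc m)). b0 x = 0} (b0 ` X0 (Suc (Suc (Suc m))))
     {y \<in> X3 m. d2 y \<in> b2 ` X2 (Suc m)} (b3 ` X3 (Suc m))"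
proof (rule qisoI[where Q = "\<lambda>x y. x \<in> X0 (Suc (Suc m)) \<and> y \<in> X3 m \<and>
    (\<exists>p0\<in>X1 (Suc (Suc m)). \<exists>p1\<in>X2 (Suc m). e p0 = x \<and> b1 p0 = d1 p1 \<and> b2 p1 = d2 y)"], goal_cases)
  case (1 x y)
  then obtain p0 p1 where p: "p0 \<in> X1 (Suc (Suc m))" "p1 \<in> X2 (Suc m)" "e p0 = x" "b1 p0 = d1 p1"
    "b2 p1 = d2 y" by blast
  have "b0 x = 0" using eb[OF p(1)] ed1[OF p(2)] p by simp
  moreover have "d2 y \<in> b2 ` X2 (Suc m)" using p(2,5) by (metis imageI)
  ultimately show ?case using 1 by blast
next
  case (2 x)
  then obtain p0 where p0: "p0 \<in> X1 (Suc (Suc m))" "e p0 = x" using e_surj by blast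
  then have "e (b1 p0) = 0" using eb[OF p0(1)] 2 by simp
  then obtain p1 where p1: "p1 \<in> X2 (Suc m)" "b1 p0 = d1 p1" using e_ker b1[OF p0(1)] by blast
  then have "d1 (b2 p1) = 0" using d1b[OF p1(1)] bb1[OF p0(1)] by simp
  then obtain y where "y \<in> X3 m" "b2 p1 = d2 y" using d1_ker b2[OF p1(1)] by blast
  then show ?case using p0 p1 2 by blast
next
  case (3 y)
  then obtain p1 where p1: "p1 \<in> X2 (Suc m)" "y \<in> X3 m" "d2 y = b2 p1" by blast
  have "b1 (d1 p1) = 0" using d1b[OF p1(1)] p1 d1d2 by (metis)
  then obtain p0 where p0: "p0 \<in> X1 (Suc (Suc m))" "d1 p1 = b1 p0" using ac1 d1[OF p1(1)] by blast
  show ?case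
    by (rule exI[of _ "e p0"]) (use p0 p1 e in metis)
next
  case (4 x y x' y')
  then obtain p q p' q' where "p \<in> X1 (Suc (Suc m))" "p' \<in> X2 (Suc m)" "e p = x" "b1 p = d1 p'" "b2 p' = d2 x'"
    "q \<in> X1 (Suc (Suc m))" "q' \<in> X2 (Suc m)" "e q = y" "b1 q = d1 q'" "b2 q' = d2 y'"
    by blast
  then show ?case
    using 4 sub by (auto intro!: bexI[of _ "p + q"] bexI[of _ "p' + q'"] simp: fv.subspace_add
        lin_add[OF lin(2)] lin_add[OF lin(3)] lin_add[OF lin(5)] lin_add[OF lin(6)] lin_add[OF lin(7)])
next
  case (5 c x x')
  then obtain p p' where "p \<in> X1 (Suc (Suc m))" "p' \<in> X2 (Suc m)" "e p = x" "b1 p = d1 p'" "b2 p' = d2 x'"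
    by blast
  then show ?case
    using 5 sub by (auto intro!: bexI[of _ "sc c p"] bexI[of _ "sc c p'"] simp: fv.subspace_scale
        lin_sc[OF lin(2)] lin_sc[OF lin(3)] lin_sc[OF lin(5)] lin_sc[OF lin(6)] lin_sc[OF lin(7)])
next
  case (6 x y)
  then obtain p0 p1 where p: "p0 \<in> X1 (Suc (Suc m))" "p1 \<in> X2 (Suc m)" "e p0 = x" "b1 p0 = d1 p1"
    "b2 p1 = d2 y" by blast
  obtain q1 y' where q: "q1 \<in> X2 (Suc (Suc m))" "y' \<in> X3 (Suc m)" "p1 = b2 q1 + d2 y'"
    using boundary_shift[of x "Suc m" p0 p1] p 6 by blast
  then have "d2 (y - b3 y') = 0"
    using p(5) d2b[OF q(2)] bb2[OF q(1)] by (simp add: lin_add[OF lin(3)] lin_diff[OF lin(7)])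
  moreover have "y - b3 y' \<in> X3 m" using 6 b3[OF q(2)] sub by (simp add: fv.subspace_diff)
  ultimately have "y = b3 y'" using d2_inj[of "y - b3 y'" m] by simp
  then show ?case using q by blast
next
  case (7 x y)
  then obtain p0 p1 where p: "p0 \<in> X1 (Suc (Suc m))" "p1 \<in> X2 (Suc m)" "e p0 = x" "b1 p0 = d1 p1"
    "b2 p1 = d2 y" by blast
  obtain y' where y': "y' \<in> X3 (Suc m)" "y = b3 y'" using 7 by blast
  have "b2 (p1 - d2 y') = 0" using p y' d2b[OF y'(1)] by (simp add: lin_diff[OF lin(3)])
  moreover have "p1 - d2 y' \<in> X2 (Suc m)" using p d2[OF y'(1)] sub by (simp add: fv.subspace_diff)
  ultimately obtain q where q: "q \<in> X2 (Suc (Suc m))" "p1 - d2 y' = b2 q" using ac2 by blast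
  have "d1 (p1 - d2 y') = d1 p1" using d1d2[OF y'(1)] by (simp add: lin_diff[OF lin(6)])
  then show ?case using boundary_shift_back[of p0 "Suc m" x q] p q by simp
qed

lemma shift_two_cycles:
  "qiso {x \<in> X0 (Suc (Suc (Suc m))). b0 x = 0} (b0 ` X0 (Suc (Suc (Suc (Suc m)))))
     {y \<in> X3 (Suc m). b3 y = 0} (b3 ` X3 (Suc (Suc m)))"
proof -
  have "d2 y \<in> b2 ` X2 (Suc (Suc m)) \<longleftrightarrow> b3 y = 0" if y: "y \<in> X3 (Suc m)" for y
  proof
    assume "d2 y \<in> b2 ` X2 (Suc (Suc m))"
    then have "b2 (d2 y) = 0" using bb2 by auto
    then show "b3 y = 0" using d2b[OF y] d2_inj[OF b3[OF y]] by simp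
  next
    assume "b3 y = 0"
    then have "b2 (d2 y) = 0" using d2b[OF y] by (simp add: lin_zero[OF lin(7)])
    then show "d2 y \<in> b2 ` X2 (Suc (Suc m))" using ac2[OF d2[OF y]] by blast
  qed
  then have "{y \<in> X3 (Suc m). d2 y \<in> b2 ` X2 (Suc (Suc m))} = {y \<in> X3 (Suc m). b3 y = 0}" by auto
  then show ?thesis using shift_two[of "Suc m"] by simp
qed

end

text \<open>A contraction \<open>h0, h1, h2\<close> by linear maps, with no compatibility with
  the actions, is enough: it splits the sequence over the ground field, so the induced sequences
  of chains with coefficients stay exact.\<close>

locale bimod_seq =
  B0: bimod A mul M0 lm0 rm0 + B1: bimod A mul M1 lm1 rm1 +
  B2: bimod A mul M2 lm2 rm2 + B3: bimod A mul M3 lm3 rm3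
  for A :: "('b \<Rightarrow> 'k::field) set" and mul
    and M0 :: "('i0 \<Rightarrow> 'k) set" and lm0 rm0 and M1 :: "('i1 \<Rightarrow> 'k) set" and lm1 rm1
    and M2 :: "('i2 \<Rightarrow> 'k) set" and lm2 rm2 and M3 :: "('i3 \<Rightarrow> 'k) set" and lm3 rm3 +
  fixes e d1 d2 h0 h1 h2
  assumes lins: "lin e" "lin d1" "lin d2" "lin h0" "lin h1" "lin h2"
    and maps: "p1 \<in> M1 \<Longrightarrow> e p1 \<in> M0" "p2 \<in> M2 \<Longrightarrow> d1 p2 \<in> M1" "p3 \<in> M3 \<Longrightarrow> d2 p3 \<in> M2"
      "p0 \<in> M0 \<Longrightarrow> h0 p0 \<in> M1" "p1 \<in> M1 \<Longrightarrow> h1 p1 \<in> M2" "p2 \<in> M2 \<Longrightarrow> h2 p2 \<in> M3"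
    and left: "e (lm1 a p1) = lm0 a (e p1)" "d1 (lm2 a p2) = lm1 a (d1 p2)" "d2 (lm3 a p3) = lm2 a (d2 p3)"
    and right: "e (rm1 p1 a) = rm0 (e p1) a" "d1 (rm2 p2 a) = rm1 (d1 p2) a" "d2 (rm3 p3 a) = rm2 (d2 p3) a"
    and comp: "p2 \<in> M2 \<Longrightarrow> e (d1 p2) = 0" "p3 \<in> M3 \<Longrightarrow> d1 (d2 p3) = 0"
    and contr: "p0 \<in> M0 \<Longrightarrow> e (h0 p0) = p0" "p1 \<in> M1 \<Longrightarrow> p1 = d1 (h1 p1) + h0 (e p1)"
      "p2 \<in> M2 \<Longrightarrow> p2 = d2 (h2 p2) + h1 (d1 p2)" "p3 \<in> M3 \<Longrightarrow> h2 (d2 p3) = p3"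
    and acyc: "B1.cyc (Suc m) \<subseteq> B1.bnd (Suc m)" "B2.cyc (Suc m) \<subseteq> B2.bnd (Suc m)"
begin

lemma coef_zero: 
  assumes "lin f" "lin g" "\<And>p. p \<in> M \<Longrightarrow> f (g p) = 0" "\<tau> \<in> tens A M m"
  shows "coef f (coef g \<tau>) = 0"
  using assms(4) by (rule tens_eqI[OF lin_comp[OF lin_coef lin_coef] lin_const_zero, rotated])
    (simp add: coef_ev assms lin_zero[OF lin_ev_first])

lemma coef_split:
  assumes "lin f" "lin g" "lin f'" "lin g'" "\<And>p. p \<in> M \<Longrightarrow> p = f (g p) + f' (g' p)" "\<tau> \<in> tens A M m"
  shows "\<tau> = coef f (coef g \<tau>) + coef f' (coef g' \<tau>)"
proof (rule tens_eqI[OF lin_id _ _ assms(6)])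
  show "lin (\<lambda>\<tau>. coef f (coef g \<tau>) + coef f' (coef g' \<tau>))"
    by (intro lin_add_fun lin_comp[OF lin_coef lin_coef])
  show "ev p as = coef f (coef g (ev p as)) + coef f' (coef g' (ev p as))" if "p \<in> M" for p as
  proof -
    have "coef f (coef g (ev p as)) + coef f' (coef g' (ev p as)) = ev (f (g p) + f' (g' p)) as"
      by (simp add: coef_ev assms(1-4) lin_add[OF lin_ev_first])
    then show ?thesis using assms(5)[OF that] by simp
  qed
qed

sublocale four_term "tens A M0" "tens A M1" "tens A M2" "tens A M3" B0.bd B1.bd B2.bd B3.bd
  "coef e" "coef d1" "coef d2"
proof (unfold_locales, goal_cases)
  case (22 x1 m) then show ?case using coef_bd[OF B1.bimod_axioms B0.bimod_axioms lins(1) left(1) right(1)] by blast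
next
  case (23 x m) then show ?case using coef_bd[OF B2.bimod_axioms B1.bimod_axioms lins(2) left(2) right(2)] by blast
next
  case (24 x m) then show ?case using coef_bd[OF B3.bimod_axioms B2.bimod_axioms lins(3) left(3) right(3)] by blast
next
  case (25 x m) then show ?case using coef_zero lins comp by blast
next
  case (26 x m) then show ?case using coef_zero lins comp by blast
next
  case (27 x m)
  have "coef e (coef h0 x) = x" using coef_coef_eq[OF lins(1,4) lin_id contr(1) 27] coef_id[OF lin_id refl 27] by simp
  then show ?case using coef_tens[OF lins(4) maps(4) 27] by blast
next
  case (28 x m)
  have "x = coef d1 (coef h1 x) + coef h0 (coef e x)"
    using coef_split[OF lins(2,5,4,1) contr(2) 28(1)] .
  then have "x = coef d1 (coef h1 x)" using 28(2) by (simp add: lin_zero[OF lin_coef])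
  then show ?case using coef_tens[OF lins(5) maps(5) 28(1)] by blast
next
  case (29 x m)
  have "x = coef d2 (coef h2 x) + coef h1 (coef d1 x)"
    using coef_split[OF lins(3,6,5,2) contr(3) 29(1)] .
  then have "x = coef d2 (coef h2 x)" using 29(2) by (simp add: lin_zero[OF lin_coef])
  then show ?case using coef_tens[OF lins(6) maps(6) 29(1)] by blast
next
  case (30 x m)
  have "coef h2 (coef d2 x) = x" using coef_coef_eq[OF lins(6,3) lin_id contr(4) 30(1)] coef_id[OF lin_id refl 30(1)] by simp
  then show ?case using 30 by (simp add: lin_zero[OF lin_coef])
next
  case (31 x m) then show ?case using acyc(1)[of m] unfolding B1.cyc_def B1.bnd_def by blast
next
  case (32 x m) then show ?case using acyc(2)[of m] unfolding B2.cyc_def B2.bnd_def by blast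
qed (auto simp: subspace_tens lin_coef B0.lin_bd B1.lin_bd B2.lin_bd B3.lin_bd B0.bd_tens B1.bd_tens
    B2.bd_tens B3.bd_tens B0.bd_bd B1.bd_bd B2.bd_bd B0.bd_0 B3.bd_0
    intro: coef_tens[OF lins(1) maps(1)] coef_tens[OF lins(2) maps(2)] coef_tens[OF lins(3) maps(3)])

lemma homology_shift: "qiso (B0.cyc (m + 3)) (B0.bnd (m + 3)) (B3.cyc (m + 1)) (B3.bnd (m + 1))"
  using shift_two_cycles[of m] by (simp add: B0.cyc_def B0.bnd_def B3.cyc_def B3.bnd_def eval_nat_numeral)

lemma homology_two:
  "qiso (B0.cyc 2) (B0.bnd 2) {y \<in> M3. d2 y \<in> B2.comm} B3.comm"
proof -
  have inj2: "coef d2 (ev y []) \<in> B2.bnd 0 \<longleftrightarrow> d2 y \<in> B2.comm" for y :: "'i3 \<Rightarrow> 'k"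
    unfolding B2.bnd_0 coef_ev[OF lins(3)] using ev_Nil_inj by blast
  have "qiso {y \<in> M3. d2 y \<in> B2.comm} B3.comm
      {y \<in> tens A M3 0. coef d2 y \<in> B2.bnd 0} (B3.bnd 0)"
  proof (rule qiso_lin[OF lin_ev_first[of "[]"]])
    show "(\<lambda>p. ev p []) ` {y \<in> M3. d2 y \<in> B2.comm} = {y \<in> tens A M3 0. coef d2 y \<in> B2.bnd 0}"
      unfolding B3.tens_0 using inj2 by auto
    show "z \<in> B3.comm \<longleftrightarrow> ev z [] \<in> B3.bnd 0" for z :: "'i3 \<Rightarrow> 'k"
      unfolding B3.bnd_0 using ev_Nil_inj by blast
    have "fv.subspace (M3 \<inter> {y. d2 y \<in> B2.comm})"
      by (intro fv.subspace_inter B3.M_sub subspace_vimage lins B2.subspace_comm)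
    then show "fv.subspace {y \<in> M3. d2 y \<in> B2.comm}" by (simp add: Int_def)
  qed
  from qiso_sym[OF this] shift_two[of 0]
  show ?thesis
    by (auto intro: qiso_trans simp: B0.cyc_def B0.bnd_def B2.bnd_def B3.bnd_def numeral_2_eq_2)
qed

lemma homology_one:
  "qiso (B0.cyc 1) (B0.bnd 1) {p \<in> M2. d1 p \<in> B1.comm} {d2 y + q | y q. y \<in> M3 \<and> q \<in> B2.comm}"
proof -
  let ?B = "{d2 y + q | y q. y \<in> M3 \<and> q \<in> B2.comm}"
  let ?B' = "{B2.bd q + coef d2 y | q y. q \<in> tens A M2 1 \<and> y \<in> tens A M3 0}"
  have inj1: "coef d1 (ev y []) \<in> B1.bnd 0 \<longleftrightarrow> d1 y \<in> B1.comm" for y :: "'i2 \<Rightarrow> 'k"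
    unfolding B1.bnd_0 coef_ev[OF lins(2)] using ev_Nil_inj by blast
  have B': "?B' = (\<lambda>p. ev p []) ` ?B"
  proof -
    have "?B' = {b + coef d2 y | b y. b \<in> B2.bnd 0 \<and> y \<in> tens A M3 0}"
      by (auto simp: B2.bnd_def)
    also have "\<dots> = {ev q [] + ev (d2 y) [] | q y. q \<in> B2.comm \<and> y \<in> M3}"
      unfolding B2.bnd_0 B3.tens_0 coef_ev[OF lins(3), symmetric] by blast
    also have "\<dots> = {ev (d2 y + q) [] | y q. y \<in> M3 \<and> q \<in> B2.comm}"
      unfolding lin_add[OF lin_ev_first] by (auto simp: add.commute)
    also have "\<dots> = (\<lambda>p. ev p []) ` ?B" by blast
    finally show ?thesis .
  qed
  have "qiso {p \<in> M2. d1 p \<in> B1.comm} ?B {y \<in> tens A M2 0. coef d1 y \<in> B1.bnd 0} ?B'"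
  proof (rule qiso_lin[OF lin_ev_first[of "[]"]])
    show "(\<lambda>p. ev p []) ` {y \<in> M2. d1 y \<in> B1.comm} = {y \<in> tens A M2 0. coef d1 y \<in> B1.bnd 0}"
      unfolding B2.tens_0 using inj1 by auto
    show "z \<in> ?B \<longleftrightarrow> ev z [] \<in> ?B'" for z :: "'i2 \<Rightarrow> 'k"
      unfolding B' using ev_Nil_inj by blast
    have "fv.subspace (M2 \<inter> {y. d1 y \<in> B1.comm})"
      by (intro fv.subspace_inter B2.M_sub subspace_vimage lins B1.subspace_comm)
    then show "fv.subspace {y \<in> M2. d1 y \<in> B1.comm}" by (simp add: Int_def)
  qed
  from qiso_sym[OF this] shift_one
  show ?thesis
    by (auto intro: qiso_trans simp: B0.cyc_def B0.bnd_def B1.bnd_def numeral_2_eq_2)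
qed

end

lemma (in bimod) homology_zero: "qiso (cyc 0) (bnd 0) M comm"
proof -
  have "qiso M comm (cyc 0) (bnd 0)"
  proof (rule qiso_lin[OF lin_ev_first[of "[]"] _ _ M_sub])
    show "(\<lambda>p. ev p []) ` M = cyc 0"
      using bd_0 tens_0 by (auto simp: cyc_def)
    show "z \<in> comm \<longleftrightarrow> ev z [] \<in> bnd 0" for z
      unfolding bnd_0 using ev_Nil_inj by blast
  qed
  then show ?thesis by (rule qiso_sym)
qed

section \<open>The model algebra and its bimodules\<close>

lemma lin_extend_family:
  assumes "\<And>b. b \<in> B \<Longrightarrow> lin (F b)"
  shows "lin (\<lambda>x. extend B (\<lambda>b. F b x) f)"
  unfolding extend_def by (intro lin_sum_fun lin_sc_fun assms)

definition restr :: "'b set \<Rightarrow> ('b \<Rightarrow> 'k::field) \<Rightarrow> 'b \<Rightarrow> 'k" where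
  "restr B = extend B basis_elt"

lemma extend_restr [simp]: "finite B \<Longrightarrow> extend B F (restr B f) = extend B F f"
  unfolding restr_def extend_def[of B basis_elt f] lin_sum[OF lin_extend] lin_sc[OF lin_extend]
  by (simp add: extend_basis_elt extend_def[of B F f])

lemma lin_ext_eq:
  assumes B: "finite B" and "lin F" "lin H" "F (restr B a) = F a" "H (restr B a) = H a"
    and eq: "\<And>b. b \<in> B \<Longrightarrow> F (basis_elt b) = H (basis_elt b)"
  shows "F a = H a"
proof -
  have "F (restr B a) = H (restr B a)"
    unfolding restr_def extend_def lin_sum[OF assms(2)] lin_sum[OF assms(3)]
      lin_sc[OF assms(2)] lin_sc[OF assms(3)]
    by (intro sum.cong refl) (simp add: eq)
  then show ?thesis using assms by simp
qed

lemma lin_fin_funs_eq: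
  assumes "lin F" "lin H" "\<And>b. b \<in> B \<Longrightarrow> F (basis_elt b) = H (basis_elt b)" "a \<in> fin_funs B"
  shows "F a = H a"
  using assms(4) unfolding fin_funs_eq_span
  by (rule lin_eq_on_span[OF assms(1,2), rotated]) (use assms(3) in auto)

lemma lin_fin_funs_in:
  assumes "lin F" "fv.subspace V" "\<And>b. b \<in> B \<Longrightarrow> F (basis_elt b) \<in> V" "a \<in> fin_funs B"
  shows "F a \<in> V"
  using assms(4) unfolding fin_funs_eq_span
  by (rule lin_span_image[OF assms(1) _ assms(2), rotated]) (use assms(3) in auto)

text \<open>The quotient algebra in normal form: basis \<open>g x\<^sup>m\<close> with \<open>m
  < n\<close>, relations \<open>x g = \<chi>(g) g x\<close> and \<open>x\<^sup>n = \<xi> (c -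
  1)\<close> where \<open>c = g\<^sub>1\<^sup>n\<close>. These are consistent only if
  \<open>x\<^sup>n\<close> commutes with \<open>G\<close>, whence the assumption
  \<open>xi\<close>.\<close>

locale model = group G for G :: "('g, 'h) monoid_scheme" (structure) +
  fixes \<chi> :: "'g \<Rightarrow> 'k::field_char_0" and n :: nat and g1 :: 'g and \<xi> :: 'k
  assumes fin: "finite (carrier G)"
    and chi_mult: "g \<in> carrier G \<Longrightarrow> h \<in> carrier G \<Longrightarrow> \<chi> (g \<otimes> h) = \<chi> g * \<chi> h"
    and chi_nz: "g \<in> carrier G \<Longrightarrow> \<chi> g \<noteq> 0"
    and n_pos: "0 < n"
    and g1: "g1 \<in> carrier G"
    and g1_central: "g \<in> carrier G \<Longrightarrow> g1 \<otimes> g = g \<otimes> g1"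
    and chi_g1: "\<chi> g1 ^ n = 1" "0 < j \<Longrightarrow> j < n \<Longrightarrow> \<chi> g1 ^ j \<noteq> 1"
    and xi: "g \<in> carrier G \<Longrightarrow> \<xi> = 0 \<or> \<chi> g ^ n = 1"
begin

lemma chi_one [simp]: "\<chi> \<one> = 1"
  using chi_mult[of \<one> \<one>] chi_nz[of \<one>] by simp

lemma chi_inv: "g \<in> carrier G \<Longrightarrow> \<chi> (inv g) = inverse (\<chi> g)"
  using chi_mult[of g "inv g"] by (simp add: inverse_unique)

lemma chi_pow: "g \<in> carrier G \<Longrightarrow> \<chi> (g [^] (m::nat)) = \<chi> g ^ m"
  by (induction m) (simp_all add: chi_mult)

definition c where "c = g1 [^] n"

lemma c_closed [simp]: "c \<in> carrier G"
  by (simp add: c_def g1)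

lemma chi_c [simp]: "\<chi> c = 1"
  by (simp add: c_def chi_pow g1 chi_g1)

lemma c_central: "g \<in> carrier G \<Longrightarrow> c \<otimes> g = g \<otimes> c"
proof -
  assume g: "g \<in> carrier G"
  have "g1 [^] m \<otimes> g = g \<otimes> g1 [^] m" for m :: nat
  proof (induction m)
    case (Suc m)
    have "g1 [^] Suc m \<otimes> g = g1 [^] m \<otimes> (g1 \<otimes> g)" using g g1 by (simp add: m_assoc)
    also have "\<dots> = (g1 [^] m \<otimes> g) \<otimes> g1" using g g1 by (simp add: g1_central m_assoc)
    also have "\<dots> = g \<otimes> g1 [^] Suc m" using Suc g g1 by (simp add: m_assoc)
    finally show ?case .
  qed (use g in simp)
  then show ?thesis by (simp add: c_def)
qed

lemma c_swap: "g \<in> carrier G \<Longrightarrow> h \<in> carrier G \<Longrightarrow> g \<otimes> c \<otimes> h = g \<otimes> h \<otimes> c"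
  by (simp add: m_assoc c_central)

lemma xi_chi: "g \<in> carrier G \<Longrightarrow> \<xi> * \<chi> g ^ (m + n) = \<xi> * \<chi> g ^ m"
  using xi[of g] by (auto simp: power_add)

lemma xi_chi': "g \<in> carrier G \<Longrightarrow> \<chi> g ^ (m + n) * \<xi> = \<chi> g ^ m * \<xi>"
  using xi_chi by (simp add: mult.commute)

lemma xi_chi_mult: "g \<in> carrier G \<Longrightarrow> \<xi> * \<chi> g ^ (n * t + m) = \<xi> * \<chi> g ^ m"
proof (induction t)
  case (Suc t)
  then show ?case using xi_chi[of g "n * t + m"] by (auto simp: algebra_simps)
qed simp

text \<open>The normal form of \<open>g (x\<^sup>n)\<^sup>k\<close> times a fixed lower-order
  label. Powers of \<open>x\<close> beyond \<open>n - 1\<close> are never basis elements;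
  \<open>mon\<close> and \<open>mon2\<close> below are defined for all exponents, which removes
  the case distinction from the multiplication.\<close>

primrec pw :: "nat \<Rightarrow> 'g \<Rightarrow> 'x \<Rightarrow> 'g \<times> 'x \<Rightarrow> 'k" where
  "pw 0 g x = basis_elt (g, x)"
| "pw (Suc k) g x = sc \<xi> (pw k (g \<otimes> c) x - pw k g x)"

text \<open>The element \<open>g x\<^sup>m\<close> of the algebra.\<close>

definition mon :: "'g \<Rightarrow> nat \<Rightarrow> 'g \<times> nat \<Rightarrow> 'k" where
  "mon g m = pw (m div n) g (m mod n)"

text \<open>The element \<open>g x\<^sup>i \<otimes> x\<^sup>j\<close> of \<open>A
  \<otimes>\<^sub>K A\<close>. Overflow in either exponent produces the same central factor,
  which may be moved to the front.\<close>

definition mon2 :: "'g \<Rightarrow> nat \<Rightarrow> nat \<Rightarrow> 'g \<times> nat \<times> nat \<Rightarrow> 'k" where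
  "mon2 g i j = pw (i div n + j div n) g (i mod n, j mod n)"

definition B1 where "B1 = carrier G \<times> {..<n}"
definition B2 where "B2 = carrier G \<times> {..<n} \<times> {..<n}"

lemma fin_B [simp]: "finite B1" "finite B2"
  by (simp_all add: B1_def B2_def fin)

lemma mon_small: "m < n \<Longrightarrow> mon g m = basis_elt (g, m)"
  by (simp add: mon_def)

lemma mon2_small: "i < n \<Longrightarrow> j < n \<Longrightarrow> mon2 g i j = basis_elt (g, i, j)"
  by (simp add: mon2_def)

lemma mon_add_n: "mon g (m + n) = sc \<xi> (mon (g \<otimes> c) m - mon g m)"
  using n_pos by (simp add: mon_def)

lemma mon2_add_n1: "mon2 g (i + n) j = sc \<xi> (mon2 (g \<otimes> c) i j - mon2 g i j)"
  using n_pos by (simp add: mon2_def)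

lemma mon2_add_n2: "mon2 g i (j + n) = sc \<xi> (mon2 (g \<otimes> c) i j - mon2 g i j)"
  using n_pos by (simp add: mon2_def)

text \<open>All identities between monomials hold by definition for small exponents and are
  preserved by the recursion \<open>x\<^sup>m\<^sup>+\<^sup>n = \<xi> (c - 1)
  x\<^sup>m\<close>.\<close>

lemma n_induct [case_names small step]:
  assumes "\<And>m. m < n \<Longrightarrow> P m" "\<And>m. P m \<Longrightarrow> P (m + n)"
  shows "P m"
proof (induction m rule: less_induct)
  case (less m)
  show ?case
  proof (cases "m < n")
    case False
    then show ?thesis using assms(2)[OF less.IH[of "m - n"]] n_pos by simp
  qed (rule assms)
qed

lemma lin_mon:
  assumes F: "lin F" and small: "\<And>g m. g \<in> carrier G \<Longrightarrow> m < n \<Longrightarrow> F (basis_elt (g, m)) = \<Phi> g m"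
    and rec: "\<And>g m. g \<in> carrier G \<Longrightarrow> \<Phi> g (m + n) = sc \<xi> (\<Phi> (g \<otimes> c) m - \<Phi> g m)"
  shows "g \<in> carrier G \<Longrightarrow> F (mon g m) = \<Phi> g m"
proof (induction m arbitrary: g rule: n_induct)
  case (small m)
  then show ?case using assms(2) by (simp add: mon_small)
next
  case (step m)
  then show ?case by (simp add: mon_add_n rec lin_sc[OF F] lin_diff[OF F])
qed

lemma lin_mon2:
  assumes F: "lin F"
    and small: "\<And>g i j. g \<in> carrier G \<Longrightarrow> i < n \<Longrightarrow> j < n \<Longrightarrow> F (basis_elt (g, i, j)) = \<Phi> g i j"
    and rec1: "\<And>g i j. g \<in> carrier G \<Longrightarrow> \<Phi> g (i + n) j = sc \<xi> (\<Phi> (g \<otimes> c) i j - \<Phi> g i j)"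
    and rec2: "\<And>g i j. g \<in> carrier G \<Longrightarrow> \<Phi> g i (j + n) = sc \<xi> (\<Phi> (g \<otimes> c) i j - \<Phi> g i j)"
  shows "g \<in> carrier G \<Longrightarrow> F (mon2 g i j) = \<Phi> g i j"
proof (induction i arbitrary: g rule: n_induct)
  case i: (small i)
  show ?case using i(2)
  proof (induction j arbitrary: g rule: n_induct)
    case (small j)
    then show ?case using assms(2) i by (simp add: mon2_small)
  next
    case (step j)
    then show ?case by (simp add: mon2_add_n2 rec2 lin_sc[OF F] lin_diff[OF F])
  qed
next
  case (step i)
  then show ?case by (simp add: mon2_add_n1 rec1 lin_sc[OF F] lin_diff[OF F])
qed

definition AA where "AA = (fin_funs B1 :: ('g \<times> nat \<Rightarrow> 'k) set)"
definition PP where "PP = (fin_funs B2 :: ('g \<times> nat \<times> nat \<Rightarrow> 'k) set)"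
definition KK where "KK = (fin_funs (carrier G) :: ('g \<Rightarrow> 'k) set)"

lemma subspaces: "fv.subspace AA" "fv.subspace PP" "fv.subspace KK"
  by (simp_all add: AA_def PP_def KK_def fin_funs_subspace)

lemma mon_AA: "g \<in> carrier G \<Longrightarrow> mon g m \<in> AA"
proof (induction m arbitrary: g rule: n_induct)
  case (small m)
  then show ?case by (simp add: mon_small AA_def B1_def basis_elt_fin_funs)
next
  case (step m)
  then show ?case by (simp add: mon_add_n fv.subspace_scale fv.subspace_diff subspaces)
qed

lemma mon2_PP: "g \<in> carrier G \<Longrightarrow> mon2 g i j \<in> PP"
proof (induction i arbitrary: g rule: n_induct)
  case i: (small i)
  show ?case using i(2)
  proof (induction j arbitrary: g rule: n_induct)
    case (small j)
    then show ?case using i by (simp add: mon2_small PP_def B2_def basis_elt_fin_funs)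
  next
    case (step j)
    then show ?case by (simp add: mon2_add_n2 fv.subspace_scale fv.subspace_diff subspaces)
  qed
next
  case (step i)
  then show ?case by (simp add: mon2_add_n1 fv.subspace_scale fv.subspace_diff subspaces)
qed

text \<open>The right action on \<open>A\<close> twisted by the \<open>t\<close>-th power of the
  automorphism \<open>h \<mapsto> \<chi>(h)\<^sup>n h\<close>, \<open>x \<mapsto> x\<close>. For
  \<open>t = 0\<close> it is the multiplication of \<open>A\<close>.\<close>

definition rA :: "nat \<Rightarrow> ('g \<times> nat \<Rightarrow> 'k) \<Rightarrow> ('g \<times> nat \<Rightarrow> 'k) \<Rightarrow> 'g \<times> nat \<Rightarrow> 'k" where
  "rA t p a = extend B1 (\<lambda>(h, l).
     extend B1 (\<lambda>(g, i). sc (\<chi> h ^ (n * t + i)) (mon (g \<otimes> h) (i + l))) p) a"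

definition lA :: "('g \<times> nat \<Rightarrow> 'k) \<Rightarrow> ('g \<times> nat \<Rightarrow> 'k) \<Rightarrow> 'g \<times> nat \<Rightarrow> 'k" where
  "lA = rA 0"

text \<open>The right action on \<open>A \<otimes>\<^sub>K A\<close> twisted by \<open>h
  \<mapsto> \<chi>(h)\<^sup>s h\<close>. The twist \<open>s = 1\<close> describes \<open>A
  \<otimes>\<^sub>K V \<otimes>\<^sub>K A\<close> for the bimodule \<open>V = K
  x\<close>.\<close>

definition rP :: "nat \<Rightarrow> ('g \<times> nat \<times> nat \<Rightarrow> 'k) \<Rightarrow> ('g \<times> nat \<Rightarrow> 'k) \<Rightarrow> 'g \<times> nat \<times> nat \<Rightarrow> 'k" where
  "rP s p a = extend B1 (\<lambda>(h, l).
     extend B2 (\<lambda>(g, i, j). sc (\<chi> h ^ (s + i + j)) (mon2 (g \<otimes> h) i (j + l))) p) a"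

definition lP :: "('g \<times> nat \<Rightarrow> 'k) \<Rightarrow> ('g \<times> nat \<times> nat \<Rightarrow> 'k) \<Rightarrow> 'g \<times> nat \<times> nat \<Rightarrow> 'k" where
  "lP a p = extend B1 (\<lambda>(h, l).
     extend B2 (\<lambda>(g, i, j). sc (\<chi> g ^ l) (mon2 (h \<otimes> g) (l + i) j)) p) a"

lemma lin_rA: "lin F \<Longrightarrow> lin (\<lambda>x. rA t (F x) a)" "lin F \<Longrightarrow> lin (\<lambda>x. rA t p (F x))"
proof -
  have 1: "lin (\<lambda>p. rA t p a)" unfolding rA_def case_prod_beta
    by (intro lin_extend_family lin_extend)
  have 2: "lin (rA t p)" unfolding rA_def[abs_def] by (rule lin_extend)
  show "lin F \<Longrightarrow> lin (\<lambda>x. rA t (F x) a)" using lin_comp[OF 1] by blast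
  show "lin F \<Longrightarrow> lin (\<lambda>x. rA t p (F x))" using lin_comp[OF 2] by blast
qed

lemma lin_lA: "lin F \<Longrightarrow> lin (\<lambda>x. lA (F x) a)" "lin F \<Longrightarrow> lin (\<lambda>x. lA p (F x))"
  unfolding lA_def by (rule lin_rA, assumption)+

lemma lin_rP: "lin F \<Longrightarrow> lin (\<lambda>x. rP s (F x) a)" "lin H \<Longrightarrow> lin (\<lambda>x. rP s p (H x))"
proof -
  have 1: "lin (\<lambda>p. rP s p a)" unfolding rP_def case_prod_beta
    by (intro lin_extend_family lin_extend)
  have 2: "lin (rP s p)" unfolding rP_def[abs_def] by (rule lin_extend)
  show "lin F \<Longrightarrow> lin (\<lambda>x. rP s (F x) a)" using lin_comp[OF 1] by blast
  show "lin H \<Longrightarrow> lin (\<lambda>x. rP s p (H x))" using lin_comp[OF 2] by blast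
qed

lemma lin_lP: "lin F \<Longrightarrow> lin (\<lambda>x. lP (F x) p)" "lin H \<Longrightarrow> lin (\<lambda>x. lP a (H x))"
proof -
  have 1: "lin (\<lambda>a. lP a p)" unfolding lP_def[abs_def] by (rule lin_extend)
  have 2: "lin (lP a)" unfolding lP_def[abs_def] case_prod_beta
    by (intro lin_extend_family lin_extend)
  show "lin F \<Longrightarrow> lin (\<lambda>x. lP (F x) p)" using lin_comp[OF 1] by blast
  show "lin H \<Longrightarrow> lin (\<lambda>x. lP a (H x))" using lin_comp[OF 2] by blast
qed

lemmas lins = lin_id lin_rA lin_lA lin_rP lin_lP

lemma restr_simps [simp]:
  "rA t (restr B1 p) a = rA t p a" "rA t p (restr B1 a) = rA t p a"
  "lA (restr B1 p) a = lA p a" "lA p (restr B1 a) = lA p a"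
  "rP s (restr B2 q) a = rP s q a" "rP s q (restr B1 a) = rP s q a"
  "lP (restr B1 a) q = lP a q" "lP a (restr B2 q) = lP a q"
  by (simp_all add: lA_def rA_def rP_def lP_def)

lemma rA_mon:
  assumes "g \<in> carrier G" "h \<in> carrier G"
  shows "rA t (mon g i) (mon h l) = sc (\<chi> h ^ (n * t + i)) (mon (g \<otimes> h) (i + l))"
proof -
  have base: "rA t (mon g i) (basis_elt (h, l)) = sc (\<chi> h ^ (n * t + i)) (mon (g \<otimes> h) (i + l))"
    if h: "h \<in> carrier G" and l: "l < n" and g: "g \<in> carrier G" for g h l
  proof (rule lin_mon[OF lin_rA(1)[OF lin_id] _ _ g])
    fix g m assume g: "g \<in> carrier G" and m: "m < n"
    show "rA t (basis_elt (g, m)) (basis_elt (h, l)) = sc (\<chi> h ^ (n * t + m)) (mon (g \<otimes> h) (m + l))"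
      using g m h l by (simp add: rA_def extend_basis_elt B1_def fin)
  next
    fix g m assume g: "g \<in> carrier G"
    have "mon (g \<otimes> h) (m + n + l) = sc \<xi> (mon (g \<otimes> h \<otimes> c) (m + l) - mon (g \<otimes> h) (m + l))"
      using mon_add_n[of "g \<otimes> h" "m + l"] by (simp add: ac_simps)
    then show "sc (\<chi> h ^ (n * t + (m + n))) (mon (g \<otimes> h) (m + n + l)) =
       sc \<xi> (sc (\<chi> h ^ (n * t + m)) (mon (g \<otimes> c \<otimes> h) (m + l)) -
             sc (\<chi> h ^ (n * t + m)) (mon (g \<otimes> h) (m + l)))"
      using xi_chi[OF h, of "n * t + m"]
      by (simp add: c_swap g h mult.commute add.assoc flip: fv.scale_right_diff_distrib)
  qed
  show ?thesis
  proof (rule lin_mon[OF lin_rA(2)[OF lin_id] _ _ assms(2)])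
    fix h l assume "h \<in> carrier G" "l < n"
    then show "rA t (mon g i) (basis_elt (h, l)) = sc (\<chi> h ^ (n * t + i)) (mon (g \<otimes> h) (i + l))"
      using base assms by simp
  next
    fix h m assume h: "h \<in> carrier G"
    have "mon (g \<otimes> h) (i + (m + n)) = sc \<xi> (mon (g \<otimes> h \<otimes> c) (i + m) - mon (g \<otimes> h) (i + m))"
      using mon_add_n[of "g \<otimes> h" "i + m"] by (simp add: ac_simps)
    then show "sc (\<chi> h ^ (n * t + i)) (mon (g \<otimes> h) (i + (m + n))) =
       sc \<xi> (sc (\<chi> (h \<otimes> c) ^ (n * t + i)) (mon (g \<otimes> (h \<otimes> c)) (i + m)) -
             sc (\<chi> h ^ (n * t + i)) (mon (g \<otimes> h) (i + m)))"
      using h assms by (simp add: chi_mult m_assoc mult.commute flip: fv.scale_right_diff_distrib)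
  qed
qed

lemma lA_mon:
  assumes "g \<in> carrier G" "h \<in> carrier G"
  shows "lA (mon g i) (mon h l) = sc (\<chi> h ^ i) (mon (g \<otimes> h) (i + l))"
  using rA_mon[OF assms, of 0] by (simp add: lA_def)

lemma rP_mon:
  assumes "g \<in> carrier G" "h \<in> carrier G"
  shows "rP s (mon2 g i j) (mon h l) = sc (\<chi> h ^ (s + i + j)) (mon2 (g \<otimes> h) i (j + l))"
proof -
  have base: "rP s (mon2 g i j) (basis_elt (h, l)) = sc (\<chi> h ^ (s + i + j)) (mon2 (g \<otimes> h) i (j + l))"
    if h: "h \<in> carrier G" and l: "l < n" and g: "g \<in> carrier G" for g h l
  proof (rule lin_mon2[OF lin_rP(1)[OF lin_id] _ _ _ g])
    fix g i j assume g: "g \<in> carrier G" and m: "i < n" "j < n"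
    show "rP s (basis_elt (g, i, j)) (basis_elt (h, l)) = sc (\<chi> h ^ (s + i + j)) (mon2 (g \<otimes> h) i (j + l))"
      using g m h l by (simp add: rP_def extend_basis_elt B1_def B2_def fin)
  next
    fix g i j assume g: "g \<in> carrier G"
    show "sc (\<chi> h ^ (s + (i + n) + j)) (mon2 (g \<otimes> h) (i + n) (j + l)) =
       sc \<xi> (sc (\<chi> h ^ (s + i + j)) (mon2 (g \<otimes> c \<otimes> h) i (j + l)) -
             sc (\<chi> h ^ (s + i + j)) (mon2 (g \<otimes> h) i (j + l)))"
      using xi_chi[OF h, of "s + i + j"]
      by (simp add: mon2_add_n1 c_swap g h ac_simps flip: fv.scale_right_diff_distrib)
  next
    fix g i j assume g: "g \<in> carrier G"
    have "mon2 (g \<otimes> h) i (j + n + l) = sc \<xi> (mon2 (g \<otimes> h \<otimes> c) i (j + l) - mon2 (g \<otimes> h) i (j + l))"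
      using mon2_add_n2[of "g \<otimes> h" i "j + l"] by (simp add: ac_simps)
    then show "sc (\<chi> h ^ (s + i + (j + n))) (mon2 (g \<otimes> h) i (j + n + l)) =
       sc \<xi> (sc (\<chi> h ^ (s + i + j)) (mon2 (g \<otimes> c \<otimes> h) i (j + l)) -
             sc (\<chi> h ^ (s + i + j)) (mon2 (g \<otimes> h) i (j + l)))"
      using xi_chi[OF h, of "s + i + j"]
      by (simp add: c_swap g h ac_simps flip: fv.scale_right_diff_distrib)
  qed
  show ?thesis
  proof (rule lin_mon[OF lin_rP(2)[OF lin_id] _ _ assms(2)])
    fix h l assume "h \<in> carrier G" "l < n"
    then show "rP s (mon2 g i j) (basis_elt (h, l)) = sc (\<chi> h ^ (s + i + j)) (mon2 (g \<otimes> h) i (j + l))"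
      using base assms by simp
  next
    fix h m assume h: "h \<in> carrier G"
    have "mon2 (g \<otimes> h) i (j + (m + n)) = sc \<xi> (mon2 (g \<otimes> h \<otimes> c) i (j + m) - mon2 (g \<otimes> h) i (j + m))"
      using mon2_add_n2[of "g \<otimes> h" i "j + m"] by (simp add: ac_simps)
    then show "sc (\<chi> h ^ (s + i + j)) (mon2 (g \<otimes> h) i (j + (m + n))) =
       sc \<xi> (sc (\<chi> (h \<otimes> c) ^ (s + i + j)) (mon2 (g \<otimes> (h \<otimes> c)) i (j + m)) -
             sc (\<chi> h ^ (s + i + j)) (mon2 (g \<otimes> h) i (j + m)))"
      using h assms by (simp add: chi_mult m_assoc mult.commute flip: fv.scale_right_diff_distrib)
  qed
qed

lemma lP_mon:
  assumes "g \<in> carrier G" "h \<in> carrier G"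
  shows "lP (mon h l) (mon2 g i j) = sc (\<chi> g ^ l) (mon2 (h \<otimes> g) (l + i) j)"
proof -
  have base: "lP (basis_elt (h, l)) (mon2 g i j) = sc (\<chi> g ^ l) (mon2 (h \<otimes> g) (l + i) j)"
    if h: "h \<in> carrier G" and l: "l < n" and g: "g \<in> carrier G" for g h l
  proof (rule lin_mon2[OF lin_lP(2)[OF lin_id] _ _ _ g])
    fix g i j assume g: "g \<in> carrier G" and m: "i < n" "j < n"
    show "lP (basis_elt (h, l)) (basis_elt (g, i, j)) = sc (\<chi> g ^ l) (mon2 (h \<otimes> g) (l + i) j)"
      using g m h l by (simp add: lP_def extend_basis_elt B1_def B2_def fin)
  next
    fix g i j assume g: "g \<in> carrier G"
    have "mon2 (h \<otimes> g) (l + (i + n)) j = sc \<xi> (mon2 (h \<otimes> g \<otimes> c) (l + i) j - mon2 (h \<otimes> g) (l + i) j)"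
      using mon2_add_n1[of "h \<otimes> g" "l + i"] by (simp add: ac_simps)
    then show "sc (\<chi> g ^ l) (mon2 (h \<otimes> g) (l + (i + n)) j) =
       sc \<xi> (sc (\<chi> (g \<otimes> c) ^ l) (mon2 (h \<otimes> (g \<otimes> c)) (l + i) j) -
             sc (\<chi> g ^ l) (mon2 (h \<otimes> g) (l + i) j))"
      using h g by (simp add: chi_mult m_assoc mult.commute flip: fv.scale_right_diff_distrib)
  next
    fix g i j assume g: "g \<in> carrier G"
    show "sc (\<chi> g ^ l) (mon2 (h \<otimes> g) (l + i) (j + n)) =
       sc \<xi> (sc (\<chi> (g \<otimes> c) ^ l) (mon2 (h \<otimes> (g \<otimes> c)) (l + i) j) -
             sc (\<chi> g ^ l) (mon2 (h \<otimes> g) (l + i) j))"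
      using h g by (simp add: mon2_add_n2 chi_mult m_assoc mult.commute flip: fv.scale_right_diff_distrib)
  qed
  show ?thesis
  proof (rule lin_mon[OF lin_lP(1)[OF lin_id] _ _ assms(2)])
    fix h l assume "h \<in> carrier G" "l < n"
    then show "lP (basis_elt (h, l)) (mon2 g i j) = sc (\<chi> g ^ l) (mon2 (h \<otimes> g) (l + i) j)"
      using base assms by simp
  next
    fix h m assume h: "h \<in> carrier G"
    have "mon2 (h \<otimes> g) (m + n + i) j = sc \<xi> (mon2 (h \<otimes> g \<otimes> c) (m + i) j - mon2 (h \<otimes> g) (m + i) j)"
      using mon2_add_n1[of "h \<otimes> g" "m + i"] by (simp add: ac_simps)
    then show "sc (\<chi> g ^ (m + n)) (mon2 (h \<otimes> g) (m + n + i) j) =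
       sc \<xi> (sc (\<chi> g ^ m) (mon2 (h \<otimes> c \<otimes> g) (m + i) j) -
             sc (\<chi> g ^ m) (mon2 (h \<otimes> g) (m + i) j))"
      using xi_chi[OF assms(1), of m] h assms
      by (simp add: c_swap mult.commute flip: fv.scale_right_diff_distrib)
  qed
qed

lemma B1_basis: "b \<in> B1 \<Longrightarrow> \<exists>g m. g \<in> carrier G \<and> m < n \<and> b = (g, m) \<and> basis_elt b = mon g m"
  by (auto simp: B1_def mon_small)

lemma B2_basis: "b \<in> B2 \<Longrightarrow> \<exists>g i j. g \<in> carrier G \<and> i < n \<and> j < n \<and> b = (g, i, j) \<and> basis_elt b = mon2 g i j"
  by (auto simp: B2_def mon2_small)

text \<open>An operation that ignores coefficients outside the basis is unchanged by \<open>restr\<close>; this is what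
  allows identities to be checked on monomials without membership conditions.\<close>

lemma eq1:
  assumes "lin F" "lin H" "\<And>a. F (restr B1 a) = F a" "\<And>a. H (restr B1 a) = H a"
    "\<And>g m. g \<in> carrier G \<Longrightarrow> m < n \<Longrightarrow> F (mon g m) = H (mon g m)"
  shows "F a = H a"
  by (rule lin_ext_eq[OF fin_B(1) assms(1-4)]) (use B1_basis assms(5) in fastforce)

lemma eq2:
  assumes "lin F" "lin H" "\<And>a. F (restr B2 a) = F a" "\<And>a. H (restr B2 a) = H a"
    "\<And>g i j. g \<in> carrier G \<Longrightarrow> i < n \<Longrightarrow> j < n \<Longrightarrow> F (mon2 g i j) = H (mon2 g i j)"
  shows "F a = H a"
  by (rule lin_ext_eq[OF fin_B(2) assms(1-4)]) (use B2_basis assms(5) in fastforce)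

lemma eqA:
  assumes "lin F" "lin H" "\<And>g m. g \<in> carrier G \<Longrightarrow> m < n \<Longrightarrow> F (mon g m) = H (mon g m)" "a \<in> AA"
  shows "F a = H a"
  by (rule lin_fin_funs_eq[OF assms(1,2) _ assms(4)[unfolded AA_def]]) (use B1_basis assms(3) in fastforce)

lemma eqP:
  assumes "lin F" "lin H" "\<And>g i j. g \<in> carrier G \<Longrightarrow> i < n \<Longrightarrow> j < n \<Longrightarrow> F (mon2 g i j) = H (mon2 g i j)" "a \<in> PP"
  shows "F a = H a"
  by (rule lin_fin_funs_eq[OF assms(1,2) _ assms(4)[unfolded PP_def]]) (use B2_basis assms(3) in fastforce)

lemma inA:
  assumes "lin F" "fv.subspace V" "\<And>g m. g \<in> carrier G \<Longrightarrow> m < n \<Longrightarrow> F (mon g m) \<in> V" "a \<in> AA"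
  shows "F a \<in> V"
  by (rule lin_fin_funs_in[OF assms(1,2) _ assms(4)[unfolded AA_def]]) (use B1_basis assms(3) in fastforce)

lemma inP:
  assumes "lin F" "fv.subspace V" "\<And>g i j. g \<in> carrier G \<Longrightarrow> i < n \<Longrightarrow> j < n \<Longrightarrow> F (mon2 g i j) \<in> V" "a \<in> PP"
  shows "F a \<in> V"
  by (rule lin_fin_funs_in[OF assms(1,2) _ assms(4)[unfolded PP_def]]) (use B2_basis assms(3) in fastforce)

lemmas act_simps = rA_mon lA_mon rP_mon lP_mon lin_sc[OF lin_rA(1)[OF lin_id]] lin_sc[OF lin_rA(2)[OF lin_id]]
  lin_sc[OF lin_lA(1)[OF lin_id]] lin_sc[OF lin_lA(2)[OF lin_id]]
  lin_sc[OF lin_rP(1)[OF lin_id]] lin_sc[OF lin_rP(2)[OF lin_id]]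
  lin_sc[OF lin_lP(1)[OF lin_id]] lin_sc[OF lin_lP(2)[OF lin_id]]

lemma rA_assoc: "rA t p (lA a b) = rA t (rA t p a) b"
proof (rule eq1[where a = p])
  fix g i assume g: "g \<in> carrier G"
  show "rA t (mon g i) (lA a b) = rA t (rA t (mon g i) a) b"
  proof (rule eq1[where a = a])
    fix h l assume h: "h \<in> carrier G"
    show "rA t (mon g i) (lA (mon h l) b) = rA t (rA t (mon g i) (mon h l)) b"
      by (rule eq1[where a = b])
        (use g h in \<open>auto intro!: lins lin_sc_fun simp: act_simps m_assoc chi_mult power_add power_mult_distrib ac_simps\<close>)
  qed (auto intro!: lins)
qed (auto intro!: lins)

lemma lA_rA: "rA t (lA a p) b = lA a (rA t p b)"
proof (rule eq1[where a = p])
  fix g i assume g: "g \<in> carrier G"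
  show "rA t (lA a (mon g i)) b = lA a (rA t (mon g i) b)"
  proof (rule eq1[where a = a])
    fix h l assume h: "h \<in> carrier G"
    show "rA t (lA (mon h l) (mon g i)) b = lA (mon h l) (rA t (mon g i) b)"
      by (rule eq1[where a = b])
        (use g h in \<open>auto intro!: lins lin_sc_fun simp: act_simps m_assoc chi_mult power_add power_mult_distrib ac_simps\<close>)
  qed (auto intro!: lins)
qed (auto intro!: lins)

lemma rP_assoc: "rP s p (lA a b) = rP s (rP s p a) b"
proof (rule eq2[where a = p])
  fix g i j assume g: "g \<in> carrier G"
  show "rP s (mon2 g i j) (lA a b) = rP s (rP s (mon2 g i j) a) b"
  proof (rule eq1[where a = a])
    fix h l assume h: "h \<in> carrier G"
    show "rP s (mon2 g i j) (lA (mon h l) b) = rP s (rP s (mon2 g i j) (mon h l)) b"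
      by (rule eq1[where a = b])
        (use g h in \<open>auto intro!: lins lin_sc_fun simp: act_simps m_assoc chi_mult power_add power_mult_distrib ac_simps\<close>)
  qed (auto intro!: lins)
qed (auto intro!: lins)

lemma lP_assoc: "lP (lA a b) p = lP a (lP b p)"
proof (rule eq2[where a = p])
  fix g i j assume g: "g \<in> carrier G"
  show "lP (lA a b) (mon2 g i j) = lP a (lP b (mon2 g i j))"
  proof (rule eq1[where a = a])
    fix h l assume h: "h \<in> carrier G"
    show "lP (lA (mon h l) b) (mon2 g i j) = lP (mon h l) (lP b (mon2 g i j))"
      by (rule eq1[where a = b])
        (use g h in \<open>auto intro!: lins lin_sc_fun simp: act_simps m_assoc chi_mult power_add power_mult_distrib ac_simps\<close>)
  qed (auto intro!: lins)
qed (auto intro!: lins)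

lemma lP_rP: "rP s (lP a p) b = lP a (rP s p b)"
proof (rule eq2[where a = p])
  fix g i j assume g: "g \<in> carrier G"
  show "rP s (lP a (mon2 g i j)) b = lP a (rP s (mon2 g i j) b)"
  proof (rule eq1[where a = a])
    fix h l assume h: "h \<in> carrier G"
    show "rP s (lP (mon h l) (mon2 g i j)) b = lP (mon h l) (rP s (mon2 g i j) b)"
      by (rule eq1[where a = b])
        (use g h in \<open>auto intro!: lins lin_sc_fun simp: act_simps m_assoc chi_mult power_add power_mult_distrib ac_simps\<close>)
  qed (auto intro!: lins)
qed (auto intro!: lins)

lemma rA_closed: "rA t p a \<in> AA"
  unfolding rA_def by (intro extend_in subspaces)
    (auto simp: B1_def intro!: extend_in subspaces fv.subspace_scale mon_AA)

lemma rP_closed: "rP s p a \<in> PP"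
  unfolding rP_def by (intro extend_in subspaces)
    (auto simp: B1_def B2_def intro!: extend_in subspaces fv.subspace_scale mon2_PP)

lemma lP_closed: "lP a p \<in> PP"
  unfolding lP_def by (intro extend_in subspaces)
    (auto simp: B1_def B2_def intro!: extend_in subspaces fv.subspace_scale mon2_PP)

lemma bimod_A: "bimod AA lA AA lA (rA t)"
proof unfold_locales
  show "lin (lA a)" "lin (\<lambda>a. lA a b)" "lin (rA t p)" "lin (\<lambda>p. rA t p a)" for a b p
    by (auto intro!: lins)
  show "lA (lA a b) d = lA a (lA b d)" for a b d
    using lA_rA[of 0] by (simp add: lA_def)
qed (auto simp: subspaces rA_closed lA_def rA_assoc[unfolded lA_def] lA_rA[unfolded lA_def])

lemma bimod_P: "bimod AA lA PP lP (rP s)"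
proof unfold_locales
  show "lin (lA a)" "lin (\<lambda>a. lA a b)" "lin (rP s p)" "lin (\<lambda>p. rP s p a)"
    "lin (lP a)" "lin (\<lambda>a. lP a p)" for a b p
    by (auto intro!: lins)
  show "lA (lA a b) d = lA a (lA b d)" for a b d
    using lA_rA[of 0] by (simp add: lA_def)
qed (auto simp: subspaces rA_closed[of 0, folded lA_def] rP_closed lP_closed rP_assoc lP_rP lP_assoc)

end

section \<open>The periodic resolution\<close>

context model
begin

text \<open>The multiplication \<open>A \<otimes>\<^sub>K A \<rightarrow> A\<close>.\<close>

definition eps :: "('g \<times> nat \<times> nat \<Rightarrow> 'k) \<Rightarrow> 'g \<times> nat \<Rightarrow> 'k" where
  "eps = extend B2 (\<lambda>(g, i, j). mon g (i + j))"
text \<open>The Koszul differential \<open>1 \<otimes> 1 \<mapsto> x \<otimes> 1 - 1 \<otimes>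
  x\<close>.\<close>

definition del1 :: "('g \<times> nat \<times> nat \<Rightarrow> 'k) \<Rightarrow> 'g \<times> nat \<times> nat \<Rightarrow> 'k" where
  "del1 = extend B2 (\<lambda>(g, i, j). mon2 g (i + 1) j - mon2 g i (j + 1))"
text \<open>The noncommutative derivative of \<open>x\<^sup>n\<close>: \<open>1 \<mapsto> \<Sum>
  x\<^sup>i \<otimes> x\<^sup>n\<^sup>-\<^sup>1\<^sup>-\<^sup>i\<close>.\<close>

definition del2 :: "('g \<times> nat \<Rightarrow> 'k) \<Rightarrow> 'g \<times> nat \<times> nat \<Rightarrow> 'k" where
  "del2 = extend B1 (\<lambda>(g, m). \<Sum>i<n. mon2 g (m + i) (n - 1 - i))"
text \<open>A contraction of the sequence, linear on the left: \<open>hh1\<close> replaces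
  \<open>x\<^sup>i \<otimes> x\<^sup>j\<close> by a primitive for \<open>del1\<close> of
  \<open>x\<^sup>i \<otimes> x\<^sup>j - x\<^sup>i\<^sup>+\<^sup>j \<otimes> 1\<close>, and
  \<open>hh2\<close> reads off the coefficient of \<open>1 \<otimes>
  x\<^sup>n\<^sup>-\<^sup>1\<close>.\<close>

definition hh0 :: "('g \<times> nat \<Rightarrow> 'k) \<Rightarrow> 'g \<times> nat \<times> nat \<Rightarrow> 'k" where
  "hh0 = extend B1 (\<lambda>(g, m). mon2 g m 0)"
definition hh1 :: "('g \<times> nat \<times> nat \<Rightarrow> 'k) \<Rightarrow> 'g \<times> nat \<times> nat \<Rightarrow> 'k" where
  "hh1 = extend B2 (\<lambda>(g, i, j). - (\<Sum>l<j. mon2 g (i + l) (j - 1 - l)))"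
definition hh2 :: "('g \<times> nat \<times> nat \<Rightarrow> 'k) \<Rightarrow> 'g \<times> nat \<Rightarrow> 'k" where
  "hh2 = extend B2 (\<lambda>(g, i, j). if j = n - 1 then mon g i else 0)"

lemma lin_maps: "lin eps" "lin del1" "lin del2" "lin hh0" "lin hh1" "lin hh2"
  by (simp_all add: eps_def del1_def del2_def hh0_def hh1_def hh2_def lin_extend)

lemma lin_map_comp:
  "lin F \<Longrightarrow> lin (\<lambda>x. eps (F x))" "lin F \<Longrightarrow> lin (\<lambda>x. del1 (F x))" "lin H \<Longrightarrow> lin (\<lambda>x. del2 (H x))"
  "lin H \<Longrightarrow> lin (\<lambda>x. hh0 (H x))" "lin F \<Longrightarrow> lin (\<lambda>x. hh1 (F x))" "lin F \<Longrightarrow> lin (\<lambda>x. hh2 (F x))"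
  by (rule lin_comp[OF lin_maps(1)], assumption) (rule lin_comp[OF lin_maps(2)], assumption,
    rule lin_comp[OF lin_maps(3)], assumption, rule lin_comp[OF lin_maps(4)], assumption,
    rule lin_comp[OF lin_maps(5)], assumption, rule lin_comp[OF lin_maps(6)], assumption)

lemma restr_maps [simp]:
  "eps (restr B2 p) = eps p" "del1 (restr B2 p) = del1 p" "del2 (restr B1 a) = del2 a"
  "hh0 (restr B1 a) = hh0 a" "hh1 (restr B2 p) = hh1 p" "hh2 (restr B2 p) = hh2 p"
  by (simp_all add: eps_def del1_def del2_def hh0_def hh1_def hh2_def)

lemma eps_mon: "g \<in> carrier G \<Longrightarrow> eps (mon2 g i j) = mon g (i + j)"
proof (rule lin_mon2[OF lin_maps(1)])
  show "mon g (i + n + j) = sc \<xi> (mon (g \<otimes> c) (i + j) - mon g (i + j))" for g i j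
    using mon_add_n[of g "i + j"] by (simp add: ac_simps)
  show "mon g (i + (j + n)) = sc \<xi> (mon (g \<otimes> c) (i + j) - mon g (i + j))" for g i j
    using mon_add_n[of g "i + j"] by (simp add: ac_simps)
qed (auto simp: eps_def extend_basis_elt B2_def fin)

lemma del1_mon: "g \<in> carrier G \<Longrightarrow> del1 (mon2 g i j) = mon2 g (i + 1) j - mon2 g i (j + 1)"
proof (rule lin_mon2[OF lin_maps(2)])
  show "mon2 g (i + n + 1) j - mon2 g (i + n) (j + 1) = sc \<xi> (mon2 (g \<otimes> c) (i + 1) j -
       mon2 (g \<otimes> c) i (j + 1) - (mon2 g (i + 1) j - mon2 g i (j + 1)))" for g i j
    using mon2_add_n1[of g "i + 1" j] mon2_add_n1[of g i "j + 1"]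
    by (simp add: ac_simps fv.scale_right_diff_distrib)
  show "mon2 g (i + 1) (j + n) - mon2 g i (j + n + 1) = sc \<xi> (mon2 (g \<otimes> c) (i + 1) j -
       mon2 (g \<otimes> c) i (j + 1) - (mon2 g (i + 1) j - mon2 g i (j + 1)))" for g i j
    using mon2_add_n2[of g "i + 1" j] mon2_add_n2[of g i "j + 1"]
    by (simp add: ac_simps fv.scale_right_diff_distrib)
qed (auto simp: del1_def extend_basis_elt B2_def fin)

lemma del2_mon: "g \<in> carrier G \<Longrightarrow> del2 (mon g m) = (\<Sum>i<n. mon2 g (m + i) (n - 1 - i))"
proof (rule lin_mon[OF lin_maps(3)])
  show "(\<Sum>i<n. mon2 g (m + n + i) (n - 1 - i)) = sc \<xi> ((\<Sum>i<n. mon2 (g \<otimes> c) (m + i) (n - 1 - i)) -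
       (\<Sum>i<n. mon2 g (m + i) (n - 1 - i)))" for g m
  proof -
    have "mon2 g (m + n + i) j = sc \<xi> (mon2 (g \<otimes> c) (m + i) j - mon2 g (m + i) j)" for i j
      using mon2_add_n1[of g "m + i" j] by (simp add: ac_simps)
    then show ?thesis by (simp add: fv.scale_right_diff_distrib sum_subtractf fv.scale_sum_right)
  qed
qed (auto simp: del2_def extend_basis_elt B1_def fin)

lemma hh0_mon: "g \<in> carrier G \<Longrightarrow> hh0 (mon g m) = mon2 g m 0"
  by (rule lin_mon[OF lin_maps(4)])
     (auto simp: hh0_def extend_basis_elt B1_def fin mon2_add_n1)

lemma hh1_mon: "g \<in> carrier G \<Longrightarrow> j < n \<Longrightarrow>
  hh1 (mon2 g i j) = - (\<Sum>l<j. mon2 g (i + l) (j - 1 - l))"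
proof (induction i arbitrary: g rule: n_induct)
  case (small i)
  then show ?case by (simp add: mon2_small hh1_def extend_basis_elt B2_def fin)
next
  case (step i)
  have "mon2 g (i + n + l) k = sc \<xi> (mon2 (g \<otimes> c) (i + l) k - mon2 g (i + l) k)" for l k
    using mon2_add_n1[of g "i + l" k] by (simp add: ac_simps)
  then show ?case
    using step by (simp add: mon2_add_n1 lin_sc[OF lin_maps(5)] lin_diff[OF lin_maps(5)]
        fv.scale_right_diff_distrib sum_subtractf fv.scale_sum_right)
qed

lemma hh2_mon: "g \<in> carrier G \<Longrightarrow> j < n \<Longrightarrow> hh2 (mon2 g i j) = (if j = n - 1 then mon g i else 0)"
proof (induction i arbitrary: g rule: n_induct)
  case (small i)
  then show ?case by (simp add: mon2_small hh2_def extend_basis_elt B2_def fin)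
next
  case (step i)
  then show ?case
    by (simp add: mon2_add_n1 lin_sc[OF lin_maps(6)] lin_diff[OF lin_maps(6)] mon_add_n)
qed

lemma maps_closed: "eps p \<in> AA" "del1 p \<in> PP" "del2 a \<in> PP" "hh0 a \<in> PP" "hh1 p \<in> PP" "hh2 p \<in> AA"
  unfolding eps_def del1_def del2_def hh0_def hh1_def hh2_def
  by (auto intro!: extend_in subspaces mon_AA mon2_PP fv.subspace_diff fv.subspace_sum fv.subspace_neg
      fv.subspace_0 simp: B1_def B2_def)

lemmas map_simps = eps_mon del1_mon del2_mon hh0_mon hh1_mon hh2_mon

lemmas op_simps = act_simps map_simps
  lin_sc[OF lin_maps(1)] lin_sc[OF lin_maps(2)] lin_sc[OF lin_maps(3)]
  lin_diff[OF lin_lP(2)[OF lin_id]] lin_diff[OF lin_rP(1)[OF lin_id]]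
  lin_sum[OF lin_lP(2)[OF lin_id]] lin_sum[OF lin_rP(1)[OF lin_id]]

lemma eps_left: "eps (lP a p) = lA a (eps p)"
proof (rule eq2[where a = p])
  fix g i j assume g: "g \<in> carrier G"
  show "eps (lP a (mon2 g i j)) = lA a (eps (mon2 g i j))"
    by (rule eq1[where a = a])
      (use g in \<open>auto intro!: lins lin_map_comp lin_sc_fun lin_diff_fun lin_sum_fun simp: op_simps ac_simps\<close>)
qed (auto intro!: lins lin_map_comp)

lemma del1_left: "del1 (lP a p) = lP a (del1 p)"
proof (rule eq2[where a = p])
  fix g i j assume g: "g \<in> carrier G"
  show "del1 (lP a (mon2 g i j)) = lP a (del1 (mon2 g i j))"
    by (rule eq1[where a = a])
      (use g in \<open>auto intro!: lins lin_map_comp lin_sc_fun lin_diff_fun lin_sum_fun simp: op_simps ac_simps fv.scale_right_diff_distrib\<close>)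
qed (auto intro!: lins lin_map_comp)

lemma del2_left: "del2 (lA a p) = lP a (del2 p)"
proof (rule eq1[where a = p])
  fix g i assume g: "g \<in> carrier G"
  show "del2 (lA a (mon g i)) = lP a (del2 (mon g i))"
    by (rule eq1[where a = a])
      (use g in \<open>auto intro!: lins lin_map_comp lin_sc_fun lin_diff_fun lin_sum_fun simp: op_simps ac_simps fv.scale_sum_right\<close>)
qed (auto intro!: lins lin_map_comp)

lemma eps_right: "eps (rP (n * t) p a) = rA t (eps p) a"
proof (rule eq2[where a = p])
  fix g i j assume g: "g \<in> carrier G"
  show "eps (rP (n * t) (mon2 g i j) a) = rA t (eps (mon2 g i j)) a"
    by (rule eq1[where a = a])
      (use g in \<open>auto intro!: lins lin_map_comp lin_sc_fun lin_diff_fun lin_sum_fun simp: op_simps ac_simps\<close>)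
qed (auto intro!: lins lin_map_comp)

lemma del1_right: "del1 (rP (Suc s) p a) = rP s (del1 p) a"
proof (rule eq2[where a = p])
  fix g i j assume g: "g \<in> carrier G"
  show "del1 (rP (Suc s) (mon2 g i j) a) = rP s (del1 (mon2 g i j)) a"
    by (rule eq1[where a = a])
      (use g in \<open>auto intro!: lins lin_map_comp lin_sc_fun lin_diff_fun lin_sum_fun simp: op_simps ac_simps fv.scale_right_diff_distrib\<close>)
qed (auto intro!: lins lin_map_comp)

text \<open>Moving a power of \<open>x\<close> across \<open>\<Sum> x\<^sup>i \<otimes> x\<^sup>n\<^sup>-\<^sup>1\<^sup>-\<^sup>i\<close>; the two ends
  \<open>x\<^sup>n \<otimes> 1\<close> and \<open>1 \<otimes> x\<^sup>n\<close> of the telescope agree.\<close>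

lemma slide: "(\<Sum>i<n. mon2 g (m + l + i) (n - 1 - i)) = (\<Sum>i<n. mon2 g (m + i) (n - 1 - i + l))"
proof (induction l arbitrary: m)
  case (Suc l)
  define F where "F i = mon2 g (m + i) (n - i + l)" for i
  have "(\<Sum>i<n. mon2 g (m + Suc l + i) (n - 1 - i)) = (\<Sum>i<n. mon2 g (m + 1 + i) (n - 1 - i + l))"
    using Suc[of "m + 1"] by simp
  also have "\<dots> = (\<Sum>i<n. F (Suc i))"
    by (simp add: F_def)
  also have "\<dots> = (\<Sum>i<n. F i)"
  proof -
    have "F n = F 0" using mon2_add_n1[of g m l] mon2_add_n2[of g m l] by (simp add: F_def add.commute)
    then show ?thesis using sum.lessThan_Suc_shift[of F n] sum.lessThan_Suc[of F n]
      by (simp add: add.commute)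
  qed
  also have "\<dots> = (\<Sum>i<n. mon2 g (m + i) (n - 1 - i + Suc l))"
    by (intro sum.cong refl) (auto simp: F_def intro!: arg_cong[where f = "mon2 g _"])
  finally show ?case .
qed simp

text \<open>The twist \<open>n (t + 1)\<close> on the left is consumed by the twist \<open>n t +
  1\<close> and the total degree \<open>n - 1\<close> of \<open>\<Sum> x\<^sup>i \<otimes>
  x\<^sup>n\<^sup>-\<^sup>1\<^sup>-\<^sup>i\<close>; this is where the automorphism of the
  algebra enters.\<close>

lemma del2_right: "del2 (rA (Suc t) p a) = rP (Suc (n * t)) (del2 p) a"
proof (rule eq1[where a = p])
  fix g m assume g: "g \<in> carrier G"
  show "del2 (rA (Suc t) (mon g m) a) = rP (Suc (n * t)) (del2 (mon g m)) a"
  proof (rule eq1[where a = a])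
    fix h l assume h: "h \<in> carrier G"
    have "rP (Suc (n * t)) (del2 (mon g m)) (mon h l) =
        (\<Sum>i<n. sc (\<chi> h ^ (Suc (n * t) + (m + i) + (n - 1 - i))) (mon2 (g \<otimes> h) (m + i) (n - 1 - i + l)))"
      using g h by (simp add: op_simps)
    also have "\<dots> = (\<Sum>i<n. sc (\<chi> h ^ (n * Suc t + m)) (mon2 (g \<otimes> h) (m + i) (n - 1 - i + l)))"
      by (intro sum.cong refl arg_cong2[where f = sc] arg_cong2[where f = "(^)"]) auto
    also have "\<dots> = sc (\<chi> h ^ (n * Suc t + m)) (\<Sum>i<n. mon2 (g \<otimes> h) (m + l + i) (n - 1 - i))"
      by (simp only: fv.scale_sum_right slide)
    finally show "del2 (rA (Suc t) (mon g m) (mon h l)) = rP (Suc (n * t)) (del2 (mon g m)) (mon h l)"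
      using g h by (simp add: op_simps)
  qed (auto intro!: lins lin_map_comp)
qed (auto intro!: lins lin_map_comp)

lemma telescope: "(\<Sum>l<j. mon2 g (Suc (i + l)) (j - 1 - l) - mon2 g (i + l) (j - l)) = mon2 g (i + j) 0 - mon2 g i j"
proof -
  have "(\<Sum>l<j. mon2 g (Suc (i + l)) (j - 1 - l) - mon2 g (i + l) (j - l)) =
     (\<Sum>l<j. mon2 g (i + Suc l) (j - Suc l) - mon2 g (i + l) (j - l))" by simp
  also have "\<dots> = mon2 g (i + j) 0 - mon2 g i j"
    using sum_lessThan_telescope[of "\<lambda>l. mon2 g (i + l) (j - l)" j] by simp
  finally show ?thesis .
qed

lemma del1_telescope:
  "g \<in> carrier G \<Longrightarrow> del1 (\<Sum>l<j. mon2 g (i + l) (j - 1 - l)) = mon2 g (i + j) 0 - mon2 g i j"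
proof -
  assume g: "g \<in> carrier G"
  have "del1 (\<Sum>l<j. mon2 g (i + l) (j - 1 - l)) =
      (\<Sum>l<j. mon2 g (Suc (i + l)) (j - 1 - l) - mon2 g (i + l) (j - l))"
    unfolding lin_sum[OF lin_maps(2)]
    by (intro sum.cong refl) (auto simp: del1_mon g Suc_diff_Suc)
  then show ?thesis using telescope[of g i j] by simp
qed

lemma eps_del1: "p \<in> PP \<Longrightarrow> eps (del1 p) = 0"
  by (erule eqP[rotated 3])
    (auto intro!: lins lin_map_comp lin_const_zero simp: op_simps lin_diff[OF lin_maps(1)])

lemma del1_del2: "a \<in> AA \<Longrightarrow> del1 (del2 a) = 0"
proof (erule eqA[rotated 3])
  fix g m assume g: "g \<in> carrier G"
  have "del1 (del2 (mon g m)) = mon2 g (m + n) 0 - mon2 g m n"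
    using del1_telescope[OF g, of m n] g by (simp add: del2_mon)
  then show "del1 (del2 (mon g m)) = 0"
    using mon2_add_n1[of g m 0] mon2_add_n2[of g m 0] by simp
qed (auto intro!: lins lin_map_comp lin_const_zero)

lemma contr0: "a \<in> AA \<Longrightarrow> eps (hh0 a) = a"
  by (erule eqA[rotated 3]) (auto intro!: lins lin_map_comp simp: op_simps)

lemma contr1: "p \<in> PP \<Longrightarrow> p = del1 (hh1 p) + hh0 (eps p)"
  by (erule eqP[rotated 3])
    (auto intro!: lins lin_map_comp lin_add_fun simp: op_simps lin_minus[OF lin_maps(2)] del1_telescope[simplified]
      simp del: del1_mon)

lemma contr2: "p \<in> PP \<Longrightarrow> p = del2 (hh2 p) + hh1 (del1 p)"
proof (erule eqP[rotated 3])
  fix g i j assume *: "g \<in> carrier G" "i < n" "j < n"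
  have h: "hh1 (mon2 g (i + 1) j) = - (\<Sum>l<j. mon2 g (i + Suc l) (j - Suc l))"
    using hh1_mon[OF *(1,3), of "i + 1"] by simp
  show "mon2 g i j = del2 (hh2 (mon2 g i j)) + hh1 (del1 (mon2 g i j))"
  proof (cases "j = n - 1")
    case False
    then have "hh1 (mon2 g i (j + 1)) = - (\<Sum>l<Suc j. mon2 g (i + l) (j - l))"
      using hh1_mon[OF *(1), of "j + 1" i] * by simp
    then show ?thesis using h * False
      by (simp add: hh2_mon lin_zero[OF lin_maps(3)] del1_mon lin_diff[OF lin_maps(5)]
          sum.lessThan_Suc_shift del: sum.lessThan_Suc)
  next
    case True
    then have "mon2 g i (j + 1) = sc \<xi> (mon2 (g \<otimes> c) i 0 - mon2 g i 0)"
      using mon2_add_n2[of g i 0] n_pos by simp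
    then have "hh1 (mon2 g i (j + 1)) = 0"
      using * n_pos by (simp add: lin_sc[OF lin_maps(5)] lin_diff[OF lin_maps(5)] hh1_mon)
    moreover have "del2 (hh2 (mon2 g i j)) = (\<Sum>l<Suc j. mon2 g (i + l) (j - l))"
      using * True n_pos by (simp add: hh2_mon del2_mon)
    ultimately show ?thesis using h *
      by (simp add: del1_mon lin_diff[OF lin_maps(5)] sum.lessThan_Suc_shift del: sum.lessThan_Suc)
  qed
qed (auto intro!: lins lin_map_comp lin_add_fun)

lemma contr3: "a \<in> AA \<Longrightarrow> hh2 (del2 a) = a"
proof (erule eqA[rotated 3])
  fix g m assume g: "g \<in> carrier G"
  have "hh2 (del2 (mon g m)) = (\<Sum>i<n. if i = 0 then mon g (m + i) else 0)"
    unfolding del2_mon[OF g] lin_sum[OF lin_maps(6)]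
    by (intro sum.cong refl) (use n_pos g in \<open>auto simp: hh2_mon\<close>)
  also have "\<dots> = mon g m" using n_pos by (simp add: sum.delta)
  finally show "hh2 (del2 (mon g m)) = mon g m" .
qed (auto intro!: lins lin_map_comp)

text \<open>Averaging over \<open>G\<close> splits \<open>A \<otimes> A \<rightarrow> A
  \<otimes>\<^sub>K A\<close>: the section sends \<open>a \<otimes> x\<^sup>j\<close> to
  \<open>|G|\<^sup>-\<^sup>1 \<Sum>\<^sub>h a h\<^sup>-\<^sup>1 \<otimes> h x\<^sup>j\<close>.
  Here \<open>sec s (j, h)\<close> is the first factor of the summand with second factor
  \<open>h x\<^sup>j\<close>.\<close>

definition sec :: "nat \<Rightarrow> nat \<times> 'g \<Rightarrow> ('g \<times> nat \<times> nat \<Rightarrow> 'k) \<Rightarrow> 'g \<times> nat \<times> nat \<Rightarrow> 'k" where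
  "sec s = (\<lambda>(j, h). extend B2 (\<lambda>(g, i, j'). if j' = j
     then sc (inverse (of_nat (card (carrier G))) * \<chi> (inv h) ^ (s + i)) (mon2 (g \<otimes> inv h) i 0) else 0))"

lemma lin_sec: "lin (sec s b)"
  by (simp add: sec_def case_prod_beta lin_extend)

lemma restr_sec [simp]: "sec s b (restr B2 p) = sec s b p"
  by (simp add: sec_def case_prod_beta)

lemma sec_mon:
  assumes h: "h \<in> carrier G" and j': "j' < n"
  shows "g \<in> carrier G \<Longrightarrow> sec s (j, h) (mon2 g i j') = (if j' = j
     then sc (inverse (of_nat (card (carrier G))) * \<chi> (inv h) ^ (s + i)) (mon2 (g \<otimes> inv h) i 0) else 0)"
proof (induction i arbitrary: g rule: n_induct)
  case (small i)
  then show ?case using assms by (simp add: mon2_small sec_def extend_basis_elt B2_def fin)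
next
  case (step i)
  let ?W = "\<lambda>i. inverse (of_nat (card (carrier G))) * \<chi> (inv h) ^ (s + i)"
  have "\<xi> * \<chi> (inv h) ^ (s + (i + n)) = \<xi> * \<chi> (inv h) ^ (s + i)"
    using xi_chi[of "inv h" "s + i"] h by (simp add: add.assoc)
  then have W: "?W (i + n) * \<xi> = \<xi> * ?W i"
    by (simp only: mult.commute[of _ \<xi>] mult.left_commute[of \<xi>])
  show ?case
  proof (cases "j' = j")
    case True
    have "sec s (j, h) (mon2 g (i + n) j') =
        sc \<xi> (sc (?W i) (mon2 (g \<otimes> c \<otimes> inv h) i 0) - sc (?W i) (mon2 (g \<otimes> inv h) i 0))"
      using step True by (simp add: mon2_add_n1 lin_sc[OF lin_sec] lin_diff[OF lin_sec])
    also have "\<dots> = sc (?W (i + n)) (mon2 (g \<otimes> inv h) (i + n) 0)"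
      unfolding mon2_add_n1 fv.scale_scale W fv.scale_right_diff_distrib
      using step h by (simp only: fv.scale_scale c_swap inv_closed)
    finally show ?thesis using True by simp
  next
    case False
    then show ?thesis using step by (simp add: mon2_add_n1 lin_sc[OF lin_sec] lin_diff[OF lin_sec])
  qed
qed

lemma sec_PP: "h \<in> carrier G \<Longrightarrow> sec s (j, h) p \<in> PP"
  unfolding sec_def by (auto simp: B2_def intro!: extend_in subspaces fv.subspace_scale mon2_PP fv.subspace_0)

lemma order_nz: "(of_nat (card (carrier G)) :: 'k) \<noteq> 0"
  using fin one_closed by auto

lemma bij_right_mult: "h \<in> carrier G \<Longrightarrow> bij_betw (\<lambda>g. g \<otimes> h) (carrier G) (carrier G)"
  by (rule bij_betwI[where g = "\<lambda>g. g \<otimes> inv h"]) (auto simp: m_assoc)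

abbreviation wt :: "nat \<Rightarrow> 'g \<Rightarrow> 'k" where
  "wt s h \<equiv> inverse (of_nat (card (carrier G))) * \<chi> (inv h) ^ s"

lemma sec_sum:
  assumes ml: "ml \<phi>"
  shows "g \<in> carrier G \<Longrightarrow> (\<Sum>(j', h)\<in>{..<n} \<times> carrier G. \<phi> (sec s (j', h) (mon2 g i j)) (mon h j' # L)) =
    (\<Sum>h\<in>carrier G. wt (s + i) h * \<phi> (mon2 (g \<otimes> inv h) i 0) (mon h j # L))"
proof (induction j arbitrary: g rule: n_induct)
  case (small j)
  have "(\<Sum>(j', h)\<in>{..<n} \<times> carrier G. \<phi> (sec s (j', h) (mon2 g i j)) (mon h j' # L)) =
    (\<Sum>(j', h)\<in>{..<n} \<times> carrier G. if j' = j then wt (s + i) h * \<phi> (mon2 (g \<otimes> inv h) i 0) (mon h j # L) else 0)"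
    using small by (intro sum.cong refl)
      (auto simp: sec_mon linf_sc[OF ml_first[OF ml]] linf_zero[OF ml_first[OF ml]])
  also have "\<dots> = (\<Sum>j'<n. \<Sum>h\<in>carrier G. if j' = j then wt (s + i) h * \<phi> (mon2 (g \<otimes> inv h) i 0) (mon h j # L) else 0)"
    by (rule sum.cartesian_product[symmetric])
  also have "\<dots> = (\<Sum>j'<n. if j' = j then \<Sum>h\<in>carrier G. wt (s + i) h * \<phi> (mon2 (g \<otimes> inv h) i 0) (mon h j # L) else 0)"
    by (intro sum.cong refl) auto
  finally show ?case using small by (simp add: sum.delta)
next
  case (step j)
  let ?T = "\<lambda>g h j. wt (s + i) h * \<phi> (mon2 (g \<otimes> inv h) i 0) (mon h j # L)"
  have "(\<Sum>(j', h)\<in>{..<n} \<times> carrier G. \<phi> (sec s (j', h) (mon2 g i (j + n))) (mon h j' # L)) =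
    \<xi> * ((\<Sum>h\<in>carrier G. ?T (g \<otimes> c) h j) - (\<Sum>h\<in>carrier G. ?T g h j))"
    using step.IH[of "g \<otimes> c", symmetric] step.IH[of g, symmetric] step.prems
    by (simp add: mon2_add_n2 lin_sc[OF lin_sec] lin_diff[OF lin_sec] linf_sc[OF ml_first[OF ml]]
        linf_diff[OF ml_first[OF ml]] case_prod_beta sum_subtractf sum_distrib_left right_diff_distrib)
  also have "(\<Sum>h\<in>carrier G. ?T (g \<otimes> c) h j) = (\<Sum>h\<in>carrier G. ?T (g \<otimes> c) (h \<otimes> c) j)"
    using sum.reindex_bij_betw[OF bij_right_mult[OF c_closed], of "\<lambda>h. ?T (g \<otimes> c) h j"] by simp
  also have "\<dots> = (\<Sum>h\<in>carrier G. wt (s + i) h * \<phi> (mon2 (g \<otimes> inv h) i 0) (mon (h \<otimes> c) j # L))"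
  proof (intro sum.cong refl)
    fix h assume h: "h \<in> carrier G"
    have "c \<otimes> (inv c \<otimes> inv h) = inv h" using h by (simp flip: m_assoc)
    then have "g \<otimes> c \<otimes> inv (h \<otimes> c) = g \<otimes> inv h"
      using h step.prems by (simp add: inv_mult_group m_assoc)
    moreover have "\<chi> (inv (h \<otimes> c)) = \<chi> (inv h)" using h by (simp add: chi_inv chi_mult)
    ultimately show "?T (g \<otimes> c) (h \<otimes> c) j = wt (s + i) h * \<phi> (mon2 (g \<otimes> inv h) i 0) (mon (h \<otimes> c) j # L)"
      by simp
  qed
  finally show ?case
    by (simp add: mon_add_n linf_sc[OF ml_head[OF ml]] linf_diff[OF ml_head[OF ml]]
        sum_subtractf sum_distrib_left right_diff_distrib ac_simps)
qed

text \<open>The section by averaging is compatible with the right action because \<open>h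
  \<mapsto> h k\<close> permutes \<open>G\<close>; so \<open>A \<otimes>\<^sub>K A\<close>, with
  any twist, is projective relative to the ground field.\<close>

lemma P_acyclic: "bimod.cyc AA lA PP lP (rP s) (Suc m) \<subseteq> bimod.bnd AA lA PP lP (rP s) (Suc m)"
proof
  interpret bimod AA lA PP lP "rP s" by (rule bimod_P)
  let ?I = "{..<n} \<times> carrier G" and ?c = "\<lambda>(j, h). mon h j"
  fix z assume "z \<in> cyc (Suc m)"
  then show "z \<in> bnd (Suc m)"
  proof (rule acyclic[where I = ?I and f = "sec s" and c = ?c, rotated -1])
    show "lin (sec s b)" for b by (rule lin_sec)
    show "sec s b p \<in> PP" if "b \<in> ?I" for b p using that by (auto intro: sec_PP)
    show "?c b \<in> AA" if "b \<in> ?I" for b using that by (auto intro: mon_AA)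
    show "(\<Sum>b\<in>?I. rP s (sec s b p) (?c b)) = p" if "p \<in> PP" for p
    proof (rule eqP[OF _ lin_id _ that])
      show "lin (\<lambda>p. \<Sum>b\<in>?I. rP s (sec s b p) (?c b))"
        by (intro lin_sum_fun lins lin_sec)
      fix g i j assume g: "g \<in> carrier G" and ij: "i < n" "j < n"
      have "(\<Sum>b\<in>?I. rP s (sec s b (mon2 g i j)) (?c b)) =
          (\<Sum>(j', h)\<in>?I. if j' = j then sc (inverse (of_nat (card (carrier G)))) (mon2 g i j) else 0)"
      proof (intro sum.cong refl, clarify)
        fix j' h assume h: "h \<in> carrier G"
        have "rP s (sec s (j, h) (mon2 g i j)) (mon h j) =
          sc (wt (s + i) h * \<chi> h ^ (s + i)) (mon2 (g \<otimes> inv h \<otimes> h) i j)"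
          using g h ij by (simp add: sec_mon act_simps)
        also have "\<dots> = sc (inverse (of_nat (card (carrier G)))) (mon2 g i j)"
          using g h chi_nz[OF h] by (simp add: m_assoc chi_inv power_inverse)
        finally show "rP s (sec s (j', h) (mon2 g i j)) (mon h j') =
            (if j' = j then sc (inverse (of_nat (card (carrier G)))) (mon2 g i j) else 0)"
          using g h ij by (auto simp: sec_mon lin_zero[OF lin_rP(1)[OF lin_id]])
      qed
      also have "\<dots> = (\<Sum>j'<n. \<Sum>h\<in>carrier G. if j' = j then sc (inverse (of_nat (card (carrier G)))) (mon2 g i j) else 0)"
        by (rule sum.cartesian_product[symmetric])
      also have "\<dots> = (\<Sum>j'<n. if j' = j then \<Sum>h\<in>carrier G. sc (inverse (of_nat (card (carrier G)))) (mon2 g i j) else 0)"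
        by (intro sum.cong refl) auto
      also have "\<dots> = (\<Sum>h\<in>carrier G. sc (inverse (of_nat (card (carrier G)))) (mon2 g i j))"
        using ij by (simp add: sum.delta)
      also have "\<dots> = mon2 g i j"
        using order_nz unfolding fv.scale_sum_left[symmetric]
        by simp
      finally show "(\<Sum>b\<in>?I. rP s (sec s b (mon2 g i j)) (?c b)) = mon2 g i j" .
    qed
    show "sec s b (lP a p) = lP a (sec s b p)" if b: "b \<in> ?I" for b a p
    proof (rule eq2[where a = p])
      fix g i j assume g: "g \<in> carrier G" "i < n" "j < n"
      show "sec s b (lP a (mon2 g i j)) = lP a (sec s b (mon2 g i j))"
      proof (rule eq1[where a = a])
        fix k l assume k: "k \<in> carrier G"
        obtain j' h where b': "b = (j', h)" "h \<in> carrier G" using b by auto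
        have "\<chi> g * \<chi> (inv h) = \<chi> (g \<otimes> inv h)" using g b' by (simp add: chi_mult)
        then have "\<chi> g ^ l * \<chi> (inv h) ^ l = \<chi> (g \<otimes> inv h) ^ l" by (metis power_mult_distrib)
        then show "sec s b (lP (mon k l) (mon2 g i j)) = lP (mon k l) (sec s b (mon2 g i j))"
          using k g b' by (auto simp: act_simps sec_mon lin_sc[OF lin_sec] m_assoc power_add ac_simps
              lin_zero[OF lin_lP(2)[OF lin_id]])
      qed (auto intro!: lins lin_comp[OF lin_sec])
    qed (auto intro!: lins lin_comp[OF lin_sec] lin_sec)
    show "(\<Sum>b\<in>?I. \<phi> (sec s b (rP s p a)) (?c b # L)) = (\<Sum>b\<in>?I. \<phi> (sec s b p) (lA (?c b) a # L))"
      if ml: "ml \<phi>" and p: "p \<in> PP" and a: "a \<in> AA" for \<phi> p a L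
    proof -
      define F where "F p a = (\<lambda>u::unit. (\<Sum>b\<in>?I. \<phi> (sec s b (rP s p a)) (?c b # L)))" for p a
      define H where "H p a = (\<lambda>u::unit. (\<Sum>b\<in>?I. \<phi> (sec s b p) (lA (?c b) a # L)))" for p a
      note L = linf_add[OF ml_first[OF ml]] linf_sc[OF ml_first[OF ml]] linf_add[OF ml_head[OF ml]]
        linf_sc[OF ml_head[OF ml]] lin_add[OF lin_sec] lin_sc[OF lin_sec] sum.distrib sum_distrib_left
        lin_add[OF lin_rP(1)[OF lin_id]] lin_add[OF lin_rP(2)[OF lin_id]] lin_add[OF lin_lA(2)[OF lin_id]]
      have linF: "lin (\<lambda>p. F p a)" "lin (F p)" "lin (\<lambda>p. H p a)" "lin (H p)" for p a
        unfolding lin_def F_def H_def by (auto simp: L act_simps fun_eq_iff fun_ap)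
      have "F p a = H p a"
      proof (rule eqP[OF linF(1,3) _ p])
        fix g i j assume g: "g \<in> carrier G" "j < n"
        show "F (mon2 g i j) a = H (mon2 g i j) a"
        proof (rule eqA[OF linF(2,4) _ a])
          fix k m assume k: "k \<in> carrier G"
          let ?T = "\<lambda>g h. wt (s + i) h * \<phi> (mon2 (g \<otimes> inv h) i 0) (mon h (j + m) # L)"
          have "F (mon2 g i j) (mon k m) () = \<chi> k ^ (s + i + j) * (\<Sum>h\<in>carrier G. ?T (g \<otimes> k) h)"
            using g k sec_sum[OF ml, of "g \<otimes> k" s i "j + m" L]
            by (simp add: F_def act_simps lin_sc[OF lin_sec] linf_sc[OF ml_first[OF ml]]
                case_prod_beta flip: sum_distrib_left)
          also have "(\<Sum>h\<in>carrier G. ?T (g \<otimes> k) h) = (\<Sum>h\<in>carrier G. ?T (g \<otimes> k) (h \<otimes> k))"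
            using sum.reindex_bij_betw[OF bij_right_mult[OF k], of "\<lambda>h. ?T (g \<otimes> k) h"] by simp
          also have "\<chi> k ^ (s + i + j) * \<dots> = (\<Sum>h\<in>carrier G.
             wt (s + i) h * \<phi> (mon2 (g \<otimes> inv h) i 0) (sc (\<chi> k ^ j) (mon (h \<otimes> k) (j + m)) # L))"
            unfolding sum_distrib_left
          proof (intro sum.cong refl)
            fix h assume h: "h \<in> carrier G"
            have "k \<otimes> (inv k \<otimes> inv h) = inv h" using h k by (simp flip: m_assoc)
            then have 1: "g \<otimes> k \<otimes> inv (h \<otimes> k) = g \<otimes> inv h"
              using h g k by (simp add: inv_mult_group m_assoc)
            have "\<chi> k ^ (s + i + j) * \<chi> (inv (h \<otimes> k)) ^ (s + i) = \<chi> k ^ j * \<chi> (inv h) ^ (s + i)"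
              using h k chi_nz[OF k] chi_nz[OF h]
              by (simp add: chi_inv chi_mult power_mult_distrib power_add power_inverse field_simps)
            then have E: "\<chi> k ^ (s + i + j) * wt (s + i) (h \<otimes> k) = \<chi> k ^ j * wt (s + i) h"
              by (simp only: mult.left_commute[of _ "inverse _"])
            have "\<chi> k ^ (s + i + j) * (wt (s + i) (h \<otimes> k) * y) = wt (s + i) h * (\<chi> k ^ j * y)" for y
            proof -
              have "\<chi> k ^ (s + i + j) * (wt (s + i) (h \<otimes> k) * y) =
                  (\<chi> k ^ (s + i + j) * wt (s + i) (h \<otimes> k)) * y"
                by (rule mult.assoc[symmetric])
              also have "\<dots> = wt (s + i) h * (\<chi> k ^ j * y)" unfolding E by (simp only: mult_ac)
              finally show ?thesis .
            qed
            then show "\<chi> k ^ (s + i + j) * ?T (g \<otimes> k) (h \<otimes> k) =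
              wt (s + i) h * \<phi> (mon2 (g \<otimes> inv h) i 0) (sc (\<chi> k ^ j) (mon (h \<otimes> k) (j + m)) # L)"
              unfolding 1 linf_sc[OF ml_head[OF ml]] by blast
          qed
          also have "\<dots> = (\<Sum>(j', h)\<in>?I. \<phi> (sec s (j', h) (mon2 g i j)) (lA (mon h j') (mon k m) # L))"
          proof -
            have "(\<Sum>(j', h)\<in>?I. \<phi> (sec s (j', h) (mon2 g i j)) (lA (mon h j') (mon k m) # L)) =
              (\<Sum>(j', h)\<in>?I. if j' = j then wt (s + i) h * \<phi> (mon2 (g \<otimes> inv h) i 0) (sc (\<chi> k ^ j) (mon (h \<otimes> k) (j + m)) # L) else 0)"
              using g k by (intro sum.cong refl)
                (auto simp: sec_mon act_simps linf_sc[OF ml_first[OF ml]] linf_zero[OF ml_first[OF ml]])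
            also have "\<dots> = (\<Sum>j'<n. \<Sum>h\<in>carrier G. if j' = j then wt (s + i) h * \<phi> (mon2 (g \<otimes> inv h) i 0) (sc (\<chi> k ^ j) (mon (h \<otimes> k) (j + m)) # L) else 0)"
              by (rule sum.cartesian_product[symmetric])
            also have "\<dots> = (\<Sum>j'<n. if j' = j then \<Sum>h\<in>carrier G. wt (s + i) h * \<phi> (mon2 (g \<otimes> inv h) i 0) (sc (\<chi> k ^ j) (mon (h \<otimes> k) (j + m)) # L) else 0)"
              by (intro sum.cong refl) auto
            finally show ?thesis using g by (simp add: sum.delta)
          qed
          also have "\<dots> = H (mon2 g i j) (mon k m) ()" by (simp add: H_def case_prod_beta)
          finally show "F (mon2 g i j) (mon k m) = H (mon2 g i j) (mon k m)" by (simp add: fun_eq_iff)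
        qed
      qed
      then show ?thesis by (simp add: F_def H_def fun_eq_iff)
    qed
  qed
qed

text \<open>The end terms are \<open>A\<close> with twist \<open>t\<close> and \<open>A\<close>
  with twist \<open>t + 1\<close>. Splicing these sequences for \<open>t = 0, 1, 2,
  \<dots>\<close> would give a resolution of \<open>A\<close>, periodic up to twist.\<close>

lemma resolution: "bimod_seq AA lA AA lA (rA t) PP lP (rP (n * t)) PP lP (rP (Suc (n * t)))
  AA lA (rA (Suc t)) eps del1 del2 hh0 hh1 hh2"
proof -
  interpret a0: bimod AA lA AA lA "rA t" by (rule bimod_A)
  interpret a1: bimod AA lA PP lP "rP (n * t)" by (rule bimod_P)
  interpret a2: bimod AA lA PP lP "rP (Suc (n * t))" by (rule bimod_P)
  interpret a3: bimod AA lA AA lA "rA (Suc t)" by (rule bimod_A)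
  show ?thesis
    by unfold_locales (auto simp: lin_maps maps_closed eps_left del1_left del2_left eps_right del1_right
        del2_right eps_del1 del1_del2 contr0 contr3 intro: contr1 contr2 subsetD[OF P_acyclic])
qed

end

section \<open>Commutator quotients\<close>

context model
begin

text \<open>The coefficient of \<open>x\<^sup>r\<close>.\<close>

definition cf :: "nat \<Rightarrow> ('g \<times> nat \<Rightarrow> 'k) \<Rightarrow> 'g \<Rightarrow> 'k" where
  "cf r a = (\<lambda>g. a (g, r))"

definition tc_gen :: "nat \<Rightarrow> 'g \<Rightarrow> 'g \<Rightarrow> 'g \<Rightarrow> 'k" where
  "tc_gen j g h = sc (\<chi> h ^ j) (basis_elt (g \<otimes> h)) - basis_elt (h \<otimes> g)"

text \<open>The space \<open>[K, K]\<^bsub>\<alpha>\<^sup>j\<^esub>\<close>, spanned by the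
  twisted commutators of group elements.\<close>

definition TC :: "nat \<Rightarrow> ('g \<Rightarrow> 'k) set" where
  "TC j = fv.span {tc_gen j g h | g h. g \<in> carrier G \<and> h \<in> carrier G}"

text \<open>Multiplication by \<open>x\<^sup>n = \<xi> (c - 1)\<close>.\<close>

definition Wu :: "('g \<Rightarrow> 'k) \<Rightarrow> 'g \<Rightarrow> 'k" where
  "Wu = extend (carrier G) (\<lambda>g. sc \<xi> (basis_elt (g \<otimes> c) - basis_elt g))"

definition aut_minus :: "('g \<Rightarrow> 'k) \<Rightarrow> 'g \<Rightarrow> 'k" where
  "aut_minus k = (\<lambda>g. (\<chi> g - 1) * k g)"

definition nrm :: "('g \<Rightarrow> 'k) \<Rightarrow> 'g \<Rightarrow> 'k" where
  "nrm k = (\<lambda>g. (\<Sum>i<n. \<chi> g ^ i) * k g)"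

text \<open>The \<open>x\<^sup>0\<close>-part of \<open>[A, A]\<close> with twist
  \<open>t\<close>: besides the twisted commutators of \<open>K\<close> it contains the
  commutators of \<open>k x\<^sup>n\<^sup>-\<^sup>1\<close> with \<open>x\<close>, which reach
  degree 0 through \<open>x\<^sup>n = \<xi> (c - 1)\<close>.\<close>

definition TU :: "nat \<Rightarrow> ('g \<Rightarrow> 'k) set" where
  "TU t = {x + Wu (aut_minus k) | x k. x \<in> TC (n * t) \<and> k \<in> KK}"

lemma lin_K: "lin (cf r)" "lin Wu" "lin aut_minus" "lin nrm"
  by (auto simp: lin_def cf_def Wu_def aut_minus_def nrm_def fun_eq_iff fun_ap algebra_simps
      lin_add[OF lin_extend] lin_sc[OF lin_extend])

lemma aut_minus_basis: "aut_minus (basis_elt g) = sc (\<chi> g - 1) (basis_elt g)"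
  by (auto simp: aut_minus_def basis_elt_def fun_eq_iff fun_ap)

lemma nrm_basis: "nrm (basis_elt g) = sc (\<Sum>i<n. \<chi> g ^ i) (basis_elt g)"
  by (auto simp: nrm_def basis_elt_def fun_eq_iff fun_ap)

lemma Wu_basis: "g \<in> carrier G \<Longrightarrow> Wu (basis_elt g) = sc \<xi> (basis_elt (g \<otimes> c) - basis_elt g)"
  by (simp add: Wu_def extend_basis_elt fin)

lemma basis_KK: "g \<in> carrier G \<Longrightarrow> basis_elt g \<in> KK"
  by (simp add: KK_def basis_elt_fin_funs)

lemma inK:
  assumes "lin F" "fv.subspace V" "\<And>g. g \<in> carrier G \<Longrightarrow> F (basis_elt g) \<in> V" "a \<in> KK"
  shows "F a \<in> V"
  by (rule lin_fin_funs_in[OF assms(1,2) _ assms(4)[unfolded KK_def]]) (use assms(3) in auto)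

lemma eqK:
  assumes "lin F" "lin H" "\<And>g. g \<in> carrier G \<Longrightarrow> F (basis_elt g) = H (basis_elt g)" "a \<in> KK"
  shows "F a = H a"
  by (rule lin_fin_funs_eq[OF assms(1,2) _ assms(4)[unfolded KK_def]]) (use assms(3) in auto)

lemma subspace_TC: "fv.subspace (TC j)"
  by (simp add: TC_def)

lemma subspace_TU: "fv.subspace (TU t)"
proof -
  have "TU t = {x + y | x y. x \<in> TC (n * t) \<and> y \<in> (\<lambda>k. Wu (aut_minus k)) ` KK}"
    by (auto simp: TU_def)
  moreover have "fv.subspace ((\<lambda>k. Wu (aut_minus k)) ` KK)"
    by (intro subspace_image lin_comp[OF lin_K(2,3)] subspaces)
  ultimately show ?thesis using fv.subspace_sums[OF subspace_TC] by simp
qed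

lemma TC_gen: "g \<in> carrier G \<Longrightarrow> h \<in> carrier G \<Longrightarrow> tc_gen j g h \<in> TC j"
  unfolding TC_def by (rule fv.span_base) auto

lemma TC_TU: "x \<in> TC (n * t) \<Longrightarrow> x \<in> TU t"
  unfolding TU_def
  by (intro CollectI exI[of _ x] exI[of _ 0])
    (simp add: lin_zero[OF lin_K(2)] lin_zero[OF lin_K(3)] fv.subspace_0 subspaces)

lemma WU_TU: "k \<in> KK \<Longrightarrow> Wu (aut_minus k) \<in> TU t"
  unfolding TU_def
  by (intro CollectI exI[of _ 0] exI[of _ k]) (simp add: fv.subspace_0 subspace_TC)

lemma TC_KK: "TC j \<subseteq> KK"
  unfolding TC_def tc_gen_def
  by (intro fv.span_minimal subspaces) (auto intro!: fv.subspace_diff fv.subspace_scale subspaces basis_KK)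

lemma Wu_KK: "Wu k \<in> KK"
  unfolding Wu_def by (intro extend_in subspaces) (auto intro!: fv.subspace_diff fv.subspace_scale subspaces basis_KK)

lemma aut_minus_KK: "k \<in> KK \<Longrightarrow> aut_minus k \<in> KK"
  by (erule inK[OF lin_K(3) subspaces(3), rotated])
    (auto simp: aut_minus_basis intro!: fv.subspace_scale subspaces basis_KK)

lemma cf_mon_small: "m < n \<Longrightarrow> cf r (mon g m) = (if m = r then basis_elt g else 0)"
  by (auto simp: mon_small cf_def basis_elt_def fun_eq_iff fun_ap)

lemma cf_mon_add: "cf r (mon g (m + n)) = sc \<xi> (cf r (mon (g \<otimes> c) m) - cf r (mon g m))"
  by (simp add: mon_add_n lin_sc[OF lin_K(1)] lin_diff[OF lin_K(1)])

lemma cf_KK: "a \<in> AA \<Longrightarrow> cf r a \<in> KK"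
  by (erule inA[OF lin_K(1) subspaces(3), rotated])
    (auto simp: cf_mon_small intro: basis_KK fv.subspace_0 subspaces)

text \<open>Modulo commutators \<open>g x\<^sup>i \<otimes> x\<^sup>j\<close> may be rotated to
  \<open>x\<^sup>j g x\<^sup>i \<otimes> 1\<close>; \<open>Th\<close> records the first factor,
  an element of \<open>A\<close>.\<close>

definition Th :: "('g \<times> nat \<times> nat \<Rightarrow> 'k) \<Rightarrow> 'g \<times> nat \<Rightarrow> 'k" where
  "Th = extend B2 (\<lambda>(g, i, j). sc (\<chi> g ^ j) (mon g (i + j)))"

lemma lin_Th: "lin Th"
  by (simp add: Th_def lin_extend)

lemma Th_mon: "g \<in> carrier G \<Longrightarrow> Th (mon2 g i j) = sc (\<chi> g ^ j) (mon g (i + j))"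
proof (rule lin_mon2[OF lin_Th])
  fix g i j assume g: "g \<in> carrier G"
  have *: "mon g (i + j + n) = sc \<xi> (mon (g \<otimes> c) (i + j) - mon g (i + j))"
    by (rule mon_add_n)
  show "sc (\<chi> g ^ j) (mon g (i + n + j)) = sc \<xi> (sc (\<chi> (g \<otimes> c) ^ j) (mon (g \<otimes> c) (i + j)) -
       sc (\<chi> g ^ j) (mon g (i + j)))"
    using * g by (simp add: ac_simps chi_mult mult.commute flip: fv.scale_right_diff_distrib)
  show "sc (\<chi> g ^ (j + n)) (mon g (i + (j + n))) = sc \<xi> (sc (\<chi> (g \<otimes> c) ^ j) (mon (g \<otimes> c) (i + j)) -
       sc (\<chi> g ^ j) (mon g (i + j)))"
    using * g xi_chi[OF g, of j] by (simp add: ac_simps chi_mult mult.commute flip: fv.scale_right_diff_distrib)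
qed (auto simp: Th_def extend_basis_elt B2_def fin)

lemma Th_AA: "p \<in> PP \<Longrightarrow> Th p \<in> AA"
  by (erule inP[OF lin_Th subspaces(1), rotated])
    (auto simp: Th_mon intro!: fv.subspace_scale subspaces mon_AA)

text \<open>For \<open>m < n\<close> only \<open>m = r\<close> contributes, with a generator of
  \<open>TC (s + r)\<close>. The recursion for larger \<open>m\<close> respects the shape of the
  element, as \<open>c\<close> is central and \<open>\<xi> \<chi>(h)\<^sup>n =
  \<xi>\<close>.\<close>

lemma twisted_commutator_coeff:
  assumes r: "r < n"
  shows "g \<in> carrier G \<Longrightarrow> h \<in> carrier G \<Longrightarrow>
    cf r (sc (\<chi> h ^ (s + m)) (mon (g \<otimes> h) m) - mon (h \<otimes> g) m) \<in> TC (s + r)"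
proof (induction m arbitrary: g rule: n_induct)
  case (small m)
  show ?case
  proof (cases "m = r")
    case True
    then show ?thesis using TC_gen[OF small(2,3), of "s + r"] small
      by (simp add: lin_diff[OF lin_K(1)] lin_sc[OF lin_K(1)] cf_mon_small tc_gen_def)
  next
    case False
    then show ?thesis using small fv.subspace_0[OF subspace_TC]
      by (simp add: lin_diff[OF lin_K(1)] lin_sc[OF lin_K(1)] cf_mon_small)
  qed
next
  case (step m)
  have eq: "sc (\<chi> h ^ (s + (m + n))) (mon (g \<otimes> h) (m + n)) =
      sc \<xi> (sc (\<chi> h ^ (s + m)) (mon (g \<otimes> c \<otimes> h) m) - sc (\<chi> h ^ (s + m)) (mon (g \<otimes> h) m))"
    using xi_chi'[OF step(3), of "s + m"] step
    by (simp add: mon_add_n add.assoc c_swap mult.commute flip: fv.scale_right_diff_distrib)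
  have "sc (\<chi> h ^ (s + (m + n))) (mon (g \<otimes> h) (m + n)) - mon (h \<otimes> g) (m + n) =
     sc \<xi> ((sc (\<chi> h ^ (s + m)) (mon (g \<otimes> c \<otimes> h) m) - mon (h \<otimes> (g \<otimes> c)) m) -
       (sc (\<chi> h ^ (s + m)) (mon (g \<otimes> h) m) - mon (h \<otimes> g) m))"
    unfolding eq mon_add_n[of "h \<otimes> g"] using step
    by (simp add: m_assoc algebra_simps fv.scale_right_diff_distrib fv.scale_right_distrib)
  moreover have "cf r (sc \<xi> (x - y)) = sc \<xi> (cf r x - cf r y)" for x y
    by (simp add: lin_sc[OF lin_K(1)] lin_diff[OF lin_K(1)])
  ultimately show ?case
    using fv.subspace_scale[OF subspace_TC fv.subspace_diff[OF subspace_TC step.IH[of "g \<otimes> c"] step.IH[of g]]]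
      step by simp
qed

definition commA where "commA t = bimod.comm AA AA lA (rA t)"
definition commP where "commP s = bimod.comm AA PP lP (rP s)"

lemma subspace_comm: "fv.subspace (commA t)" "fv.subspace (commP s)"
  by (simp_all add: commA_def commP_def bimod.subspace_comm[OF bimod_A] bimod.subspace_comm[OF bimod_P])

lemma commA_gen: "p \<in> AA \<Longrightarrow> a \<in> AA \<Longrightarrow> rA t p a - lA a p \<in> commA t"
  unfolding commA_def bimod.comm_def[OF bimod_A] by (rule fv.span_base) auto

lemma commP_gen: "p \<in> PP \<Longrightarrow> a \<in> AA \<Longrightarrow> rP s p a - lP a p \<in> commP s"
  unfolding commP_def bimod.comm_def[OF bimod_P] by (rule fv.span_base) auto

lemma commA_image:
  assumes "lin F" "fv.subspace V"
    "\<And>g i h l. g \<in> carrier G \<Longrightarrow> h \<in> carrier G \<Longrightarrow> i < n \<Longrightarrow> l < n \<Longrightarrow>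
      F (rA t (mon g i) (mon h l) - lA (mon h l) (mon g i)) \<in> V" "p \<in> commA t"
  shows "F p \<in> V"
proof (rule lin_span_image[OF assms(1) _ assms(2) assms(4)[unfolded commA_def bimod.comm_def[OF bimod_A]]])
  fix x assume "x \<in> {rA t p a - lA a p | p a. p \<in> AA \<and> a \<in> AA}"
  then obtain p a where x: "x = rA t p a - lA a p" "p \<in> AA" "a \<in> AA" by blast
  have "F (rA t p a - lA a p) \<in> V"
  proof (rule inA[OF _ assms(2) _ x(2)])
    fix g i assume g: "g \<in> carrier G" "i < n"
    show "F (rA t (mon g i) a - lA a (mon g i)) \<in> V"
      by (rule inA[OF _ assms(2) _ x(3)])
        (auto intro!: lin_comp[OF assms(1)] lins lin_diff_fun assms(3) g)
  qed (intro lin_comp[OF assms(1)] lins lin_diff_fun)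
  then show "F x \<in> V" by (simp add: x)
qed

lemma commP_image:
  assumes "lin F" "fv.subspace V"
    "\<And>g i j h l. g \<in> carrier G \<Longrightarrow> h \<in> carrier G \<Longrightarrow>
      F (rP s (mon2 g i j) (mon h l) - lP (mon h l) (mon2 g i j)) \<in> V" "p \<in> commP s"
  shows "F p \<in> V"
proof (rule lin_span_image[OF assms(1) _ assms(2) assms(4)[unfolded commP_def bimod.comm_def[OF bimod_P]]])
  fix x assume "x \<in> {rP s p a - lP a p | p a. p \<in> PP \<and> a \<in> AA}"
  then obtain p a where x: "x = rP s p a - lP a p" "p \<in> PP" "a \<in> AA" by blast
  have "F (rP s p a - lP a p) \<in> V"
  proof (rule inP[OF _ assms(2) _ x(2)])
    fix g i j assume g: "g \<in> carrier G" "i < n"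
    show "F (rP s (mon2 g i j) a - lP a (mon2 g i j)) \<in> V"
      by (rule inA[OF _ assms(2) _ x(3)])
        (auto intro!: lin_comp[OF assms(1)] lins lin_diff_fun assms(3) g)
  qed (intro lin_comp[OF assms(1)] lins lin_diff_fun)
  then show "F x \<in> V" by (simp add: x)
qed

lemma commP_coeff:
  assumes r: "r < n" and p: "p \<in> commP s"
  shows "cf r (Th p) \<in> TC (s + r)"
proof (rule commP_image[OF lin_comp[OF lin_K(1) lin_Th] subspace_TC _ p])
  fix g i j h l assume g: "g \<in> carrier G" and h: "h \<in> carrier G"
  have "Th (rP s (mon2 g i j) (mon h l) - lP (mon h l) (mon2 g i j)) =
    sc (\<chi> g ^ (j + l) * \<chi> h ^ j) (sc (\<chi> h ^ (s + (i + j + l))) (mon (g \<otimes> h) (i + j + l)) - mon (h \<otimes> g) (i + j + l))"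
    using g h by (simp add: act_simps lin_diff[OF lin_Th] lin_sc[OF lin_Th] Th_mon chi_mult
        power_add power_mult_distrib fv.scale_right_diff_distrib ac_simps)
  then show "cf r (Th (rP s (mon2 g i j) (mon h l) - lP (mon h l) (mon2 g i j))) \<in> TC (s + r)"
    unfolding lin_sc[OF lin_K(1)]
    using twisted_commutator_coeff[OF r g h, of s "i + j + l"]
    by (simp only: lin_sc[OF lin_K(1)] fv.subspace_scale[OF subspace_TC])
qed

text \<open>The commutator of \<open>g g\<^sub>1\<^sup>-\<^sup>1 x\<^sup>i \<otimes> 1\<close>
  with the central element \<open>g\<^sub>1\<close> is
  \<open>\<chi>(g\<^sub>1)\<^sup>s\<^sup>+\<^sup>i - 1\<close> times \<open>g x\<^sup>i
  \<otimes> 1\<close>. As \<open>\<chi>(g\<^sub>1)\<close> is a primitive root of unity, this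
  and the analogue for \<open>A\<close> reduce all commutator quotients to a single power of
  \<open>x\<close>.\<close>

lemma weight_kill_P:
  assumes g: "g \<in> carrier G" and w: "\<chi> g1 ^ (s + i) \<noteq> 1"
  shows "mon2 g i 0 \<in> commP s"
proof -
  let ?g = "g \<otimes> inv g1"
  have "g1 \<otimes> ?g = g" "?g \<otimes> g1 = g"
    using g g1 g1_central[of "g \<otimes> inv g1"] by (simp_all add: m_assoc)
  then have "rP s (mon2 ?g i 0) (mon g1 0) - lP (mon g1 0) (mon2 ?g i 0) = sc (\<chi> g1 ^ (s + i) - 1) (mon2 g i 0)"
    using g g1 by (simp add: act_simps fv.scale_left_diff_distrib)
  then have "sc (\<chi> g1 ^ (s + i) - 1) (mon2 g i 0) \<in> commP s"
    using commP_gen[of "mon2 ?g i 0" "mon g1 0" s] g g1 by (simp add: mon2_PP mon_AA)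
  from fv.subspace_scale[OF subspace_comm(2) this, of "inverse (\<chi> g1 ^ (s + i) - 1)"]
  show ?thesis using w by simp
qed

lemma weight_kill_A:
  assumes g: "g \<in> carrier G" and w: "\<chi> g1 ^ (n * t + i) \<noteq> 1"
  shows "mon g i \<in> commA t"
proof -
  let ?g = "g \<otimes> inv g1"
  have "g1 \<otimes> ?g = g" "?g \<otimes> g1 = g"
    using g g1 g1_central[of "g \<otimes> inv g1"] by (simp_all add: m_assoc)
  then have "rA t (mon ?g i) (mon g1 0) - lA (mon g1 0) (mon ?g i) = sc (\<chi> g1 ^ (n * t + i) - 1) (mon g i)"
    using g g1 by (simp add: act_simps fv.scale_left_diff_distrib)
  then have "sc (\<chi> g1 ^ (n * t + i) - 1) (mon g i) \<in> commA t"
    using commA_gen[of "mon ?g i" "mon g1 0" t] g g1 by (simp add: mon_AA)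
  from fv.subspace_scale[OF subspace_comm(1) this, of "inverse (\<chi> g1 ^ (n * t + i) - 1)"]
  show ?thesis using w by simp
qed

text \<open>The element \<open>k x\<^sup>r\<close>.\<close>

definition att :: "nat \<Rightarrow> ('g \<Rightarrow> 'k) \<Rightarrow> 'g \<times> nat \<Rightarrow> 'k" where
  "att r = extend (carrier G) (\<lambda>g. mon g r)"

lemma lin_at: "lin (att r)"
  by (simp add: att_def lin_extend)

lemma at_basis: "g \<in> carrier G \<Longrightarrow> att r (basis_elt g) = mon g r"
  by (simp add: att_def extend_basis_elt fin)

lemma at_AA: "att r k \<in> AA"
  unfolding att_def by (intro extend_in subspaces mon_AA)

lemma cf_at: "r < n \<Longrightarrow> k \<in> KK \<Longrightarrow> cf r (att r k) = k"
  by (rule eqK[OF lin_comp[OF lin_K(1) lin_at] lin_id]) (auto simp: at_basis cf_mon_small)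

lemma Th_hh0: "a \<in> AA \<Longrightarrow> Th (hh0 a) = a"
  by (rule eqA[OF lin_comp[OF lin_Th lin_maps(4)] lin_id]) (auto simp: hh0_mon Th_mon)

text \<open>Modulo commutators \<open>p\<close> may be rotated to \<open>a \<otimes> 1\<close>,
  then only the component \<open>x\<^sup>r\<close> of \<open>a\<close> survives, and that
  component lies in the commutators of \<open>K\<close>.\<close>

lemma coeff_commP:
  assumes r: "r < n" and w: "\<And>i. i < n \<Longrightarrow> i \<noteq> r \<Longrightarrow> \<chi> g1 ^ (s + i) \<noteq> 1"
    and p: "p \<in> PP" and tc: "cf r (Th p) \<in> TC (s + r)"
  shows "p \<in> commP s"
proof -
  \<comment> \<open>Rotation by a power of \<open>x\<close>.\<close>
  have 1: "p - hh0 (Th p) \<in> commP s"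
  proof (rule inP[OF _ subspace_comm(2) _ p])
    show "lin (\<lambda>p. p - hh0 (Th p))" by (intro lin_diff_fun lin_id lin_map_comp lin_Th)
    fix g i j assume g: "g \<in> carrier G"
    show "mon2 g i j - hh0 (Th (mon2 g i j)) \<in> commP s"
      using commP_gen[of "mon2 g i 0" "mon \<one> j" s] g
      by (simp add: mon2_PP mon_AA act_simps Th_mon lin_sc[OF lin_maps(4)] hh0_mon add.commute)
  qed
  \<comment> \<open>Conjugation by \<open>g\<^sub>1\<close>.\<close>
  have 2: "hh0 a - hh0 (att r (cf r a)) \<in> commP s" if "a \<in> AA" for a
  proof (rule inA[OF _ subspace_comm(2) _ that])
    show "lin (\<lambda>a. hh0 a - hh0 (att r (cf r a)))"
      by (intro lin_diff_fun lin_id lin_map_comp lin_comp[OF lin_at lin_K(1)])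
    fix g m assume g: "g \<in> carrier G" "m < n"
    show "hh0 (mon g m) - hh0 (att r (cf r (mon g m))) \<in> commP s"
      using g w fv.subspace_0[OF subspace_comm(2)]
      by (auto simp: cf_mon_small at_basis lin_zero[OF lin_at] lin_zero[OF lin_maps(4)] hh0_mon
          intro: weight_kill_P)
  qed
  have 3: "hh0 (att r k) \<in> commP s" if "k \<in> TC (s + r)" for k
  proof (rule lin_span_image[OF lin_comp[OF lin_maps(4) lin_at] _ subspace_comm(2) that[unfolded TC_def]])
    fix x assume "x \<in> {tc_gen (s + r) g h | g h. g \<in> carrier G \<and> h \<in> carrier G}"
    then obtain g h where gh: "g \<in> carrier G" "h \<in> carrier G" "x = tc_gen (s + r) g h" by blast
    then show "hh0 (att r x) \<in> commP s"
      using commP_gen[of "mon2 g r 0" "mon h 0" s]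
      by (simp add: tc_gen_def act_simps mon2_PP mon_AA lin_diff[OF lin_maps(4)] lin_diff[OF lin_at]
          lin_sc[OF lin_maps(4)] lin_sc[OF lin_at] at_basis hh0_mon)
  qed
  have "p = (p - hh0 (Th p)) + (hh0 (Th p) - hh0 (att r (cf r (Th p)))) + hh0 (att r (cf r (Th p)))"
    by simp
  also have "\<dots> \<in> commP s"
    by (intro fv.subspace_add subspace_comm(2) 1 2 3 tc Th_AA p)
  finally show ?thesis .
qed

lemma chi_g1_weight: "0 < i \<Longrightarrow> i < n \<Longrightarrow> \<chi> g1 ^ (n * t + i) \<noteq> 1"
  using chi_g1 by (simp add: power_add power_mult)

text \<open>The weight \<open>\<chi>(g\<^sub>1)\<^sup>s\<^sup>+\<^sup>i\<close> is trivial for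
  exactly one \<open>i < n\<close>: for \<open>i = 0\<close> if \<open>s = n t\<close>, and for
  \<open>i = n - 1\<close> if \<open>s = n t + 1\<close>.\<close>

lemma commP0_iff: "p \<in> PP \<Longrightarrow> p \<in> commP (n * t) \<longleftrightarrow> cf 0 (Th p) \<in> TC (n * t)"
  using commP_coeff[of 0 p "n * t"] coeff_commP[of 0 "n * t" p] n_pos chi_g1_weight by auto

lemma commP1_iff: "p \<in> PP \<Longrightarrow> p \<in> commP (Suc (n * t)) \<longleftrightarrow> cf (n - 1) (Th p) \<in> TC (n * Suc t)"
proof -
  assume p: "p \<in> PP"
  have e: "Suc (n * t) + (n - 1) = n * Suc t" using n_pos by simp
  have "\<chi> g1 ^ (Suc (n * t) + i) \<noteq> 1" if "i < n" "i \<noteq> n - 1" for i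
    using chi_g1_weight[of "Suc i" t] that by simp
  then show ?thesis
    using commP_coeff[of "n - 1" p "Suc (n * t)"] coeff_commP[of "n - 1" "Suc (n * t)" p] n_pos p
    unfolding e by auto
qed

text \<open>The commutator of \<open>z x\<^sup>n\<^sup>-\<^sup>i\<close> with
  \<open>x\<^sup>i\<close>; the factor \<open>\<chi>(z)\<^sup>i - 1\<close> is divisible by
  \<open>\<chi>(z) - 1\<close>.\<close>

lemma Wu_pow:
  assumes g: "g \<in> carrier G"
  shows "sc (\<xi> * (\<chi> g ^ i - 1)) (basis_elt (g \<otimes> c) - basis_elt g) \<in> TU t"
proof -
  have e: "\<chi> g ^ i - 1 = (\<Sum>j<i. \<chi> g ^ j) * (\<chi> g - 1)"
    by (simp add: power_diff_1_eq mult.commute)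
  have "Wu (aut_minus (sc (\<Sum>j<i. \<chi> g ^ j) (basis_elt g))) \<in> TU t"
    using g by (intro WU_TU fv.subspace_scale subspaces basis_KK)
  then show ?thesis using g
    by (simp add: lin_sc[OF lin_K(2)] lin_sc[OF lin_K(3)] aut_minus_basis Wu_basis e mult_ac)
qed

text \<open>A commutator of \<open>g x\<^sup>i\<close> and \<open>h x\<^sup>l\<close> has a
  component in degree 0 only if \<open>i + l\<close> is 0 or \<open>n\<close>. In the latter
  case it splits into commutators in \<open>K\<close>, multiplied by \<open>\<xi> (c -
  1)\<close>, and the commutator of a power of \<open>x\<close>.\<close>

lemma commA_coeff:
  assumes p: "p \<in> commA t"
  shows "cf 0 p \<in> TU t"
proof (rule commA_image[OF lin_K(1) subspace_TU _ p])
  fix g i h l assume g: "g \<in> carrier G" and h: "h \<in> carrier G" and il: "i < n" "l < n"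
  let ?x = "rA t (mon g i) (mon h l) - lA (mon h l) (mon g i)"
  have x: "?x = sc (\<chi> h ^ (n * t + i)) (mon (g \<otimes> h) (i + l)) - sc (\<chi> g ^ l) (mon (h \<otimes> g) (i + l))"
    using g h by (simp add: act_simps add.commute)
  consider "i + l = 0" | "0 < i + l" "i + l < n" | "i + l = n" | "n < i + l" by linarith
  then show "cf 0 ?x \<in> TU t"
  proof cases
    case 1
    then show ?thesis using TC_TU[OF TC_gen[OF g h]] il
      unfolding x by (simp add: lin_diff[OF lin_K(1)] lin_sc[OF lin_K(1)] cf_mon_small tc_gen_def)
  next
    case 2
    then show ?thesis using fv.subspace_0[OF subspace_TU]
      unfolding x by (auto simp add: lin_diff[OF lin_K(1)] lin_sc[OF lin_K(1)] cf_mon_small)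
  next
    case 4
    then obtain m where "i + l = m + n" "0 < m" "m < n" using il
      by (metis add.commute add_less_cancel_left add_less_mono less_imp_add_positive)
    then show ?thesis using fv.subspace_0[OF subspace_TU]
      unfolding x by (simp add: lin_diff[OF lin_K(1)] lin_sc[OF lin_K(1)] cf_mon_small cf_mon_add)
  next
    case 3
    \<comment> \<open>The only degree in which \<open>x\<^sup>n = \<xi> (c - 1)\<close> contributes to the coefficient of \<open>x\<^sup>0\<close>.\<close>
    define z where "z = h \<otimes> g"
    have z: "z \<in> carrier G" "\<chi> z = \<chi> h * \<chi> g" using g h by (simp_all add: z_def chi_mult)
    have xh: "\<xi> * \<chi> h ^ (n * t + i) = \<xi> * \<chi> h ^ i" by (rule xi_chi_mult[OF h])
    have "\<xi> * \<chi> g ^ (i + l) = \<xi>" using xi_chi[OF g, of 0] 3 by simp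
    then have xg: "\<xi> * \<chi> h ^ i = \<xi> * \<chi> g ^ l * \<chi> z ^ i"
      by (simp add: z power_mult_distrib power_add mult_ac) (metis mult.assoc mult.commute)
    have "cf 0 ?x = sc (\<xi> * \<chi> h ^ i) (basis_elt (g \<otimes> h \<otimes> c) - basis_elt (g \<otimes> h)) -
        sc (\<xi> * \<chi> g ^ l) (basis_elt (z \<otimes> c) - basis_elt z)"
      using 3 cf_mon_add[of 0 "g \<otimes> h" 0] cf_mon_add[of 0 "h \<otimes> g" 0] n_pos xh
      unfolding x by (simp add: lin_diff[OF lin_K(1)] lin_sc[OF lin_K(1)] cf_mon_small z_def mult.commute)
    also have "\<dots> = sc (\<xi> * \<chi> h ^ i) ((basis_elt (g \<otimes> c \<otimes> h) - basis_elt (h \<otimes> (g \<otimes> c))) - 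
        (basis_elt (g \<otimes> h) - basis_elt (h \<otimes> g))) + sc (\<xi> * \<chi> h ^ i - \<xi> * \<chi> g ^ l) (basis_elt (z \<otimes> c) - basis_elt z)"
    proof -
      have "h \<otimes> (g \<otimes> c) = z \<otimes> c" using g h by (simp add: z_def m_assoc)
      then show ?thesis unfolding c_swap[OF g h]
        by (simp add: z_def fv.scale_right_diff_distrib fv.scale_left_diff_distrib)
    qed
    also have "sc (\<xi> * \<chi> h ^ i) ((basis_elt (g \<otimes> c \<otimes> h) - basis_elt (h \<otimes> (g \<otimes> c))) - 
        (basis_elt (g \<otimes> h) - basis_elt (h \<otimes> g))) = sc (\<xi> * \<chi> h ^ i) (tc_gen (n * t) (g \<otimes> c) h - tc_gen (n * t) g h)"
    proof -
      have "\<xi> * \<chi> h ^ i * \<chi> h ^ (n * t) = \<xi> * \<chi> h ^ i"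
        using xh by (simp add: power_add mult_ac)
      then show ?thesis
        unfolding tc_gen_def fv.scale_right_diff_distrib fv.scale_scale by (simp only: add.commute)
    qed
    also have "\<xi> * \<chi> h ^ i - \<xi> * \<chi> g ^ l = \<chi> g ^ l * (\<xi> * (\<chi> z ^ i - 1))"
      unfolding xg by (simp add: algebra_simps)
    finally have "cf 0 ?x = sc (\<xi> * \<chi> h ^ i) (tc_gen (n * t) (g \<otimes> c) h - tc_gen (n * t) g h) +
        sc (\<chi> g ^ l) (sc (\<xi> * (\<chi> z ^ i - 1)) (basis_elt (z \<otimes> c) - basis_elt z))"
      by simp
    also have "\<dots> \<in> TU t"
      by (intro fv.subspace_add fv.subspace_scale fv.subspace_diff subspace_TU TC_TU TC_gen Wu_pow
          g h z m_closed c_closed)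
    finally show ?thesis .
  qed
qed

lemma coeff_commA:
  assumes p: "p \<in> AA" and tu: "cf 0 p \<in> TU t"
  shows "p \<in> commA t"
proof -
  have 1: "a - att 0 (cf 0 a) \<in> commA t" if "a \<in> AA" for a
  proof (rule inA[OF _ subspace_comm(1) _ that])
    show "lin (\<lambda>a. a - att 0 (cf 0 a))"
      by (intro lin_diff_fun lin_id lin_comp[OF lin_at lin_K(1)])
    fix g m assume g: "g \<in> carrier G" "m < n"
    show "mon g m - att 0 (cf 0 (mon g m)) \<in> commA t"
      using g chi_g1_weight[of m t] fv.subspace_0[OF subspace_comm(1)]
      by (cases "m = 0") (auto simp: cf_mon_small at_basis lin_zero[OF lin_at] intro: weight_kill_A)
  qed
  have 2: "att 0 k \<in> commA t" if "k \<in> TC (n * t)" for k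
  proof (rule lin_span_image[OF lin_at _ subspace_comm(1) that[unfolded TC_def]])
    fix x assume "x \<in> {tc_gen (n * t) g h | g h. g \<in> carrier G \<and> h \<in> carrier G}"
    then obtain g h where gh: "g \<in> carrier G" "h \<in> carrier G" "x = tc_gen (n * t) g h" by blast
    then show "att 0 x \<in> commA t"
      using commA_gen[of "mon g 0" "mon h 0" t]
      by (simp add: tc_gen_def act_simps mon_AA lin_diff[OF lin_at] lin_sc[OF lin_at] at_basis)
  qed
  have 3: "att 0 (Wu (aut_minus k)) \<in> commA t" if "k \<in> KK" for k
  proof (rule inK[OF lin_comp[OF lin_at lin_comp[OF lin_K(2,3)]] subspace_comm(1) _ that])
    fix g assume g: "g \<in> carrier G"
    \<comment> \<open>The commutator of \<open>g x\<^sup>n\<^sup>-\<^sup>1\<close> with \<open>x\<close>.\<close>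
    have "rA t (mon g (n - 1)) (mon \<one> 1) - lA (mon \<one> 1) (mon g (n - 1)) = mon g n - sc (\<chi> g) (mon g n)"
      using g n_pos by (simp add: act_simps)
    then have "mon g n - sc (\<chi> g) (mon g n) \<in> commA t"
      using commA_gen[of "mon g (n - 1)" "mon \<one> 1" t] g by (simp add: mon_AA)
    then have "- (mon g n - sc (\<chi> g) (mon g n)) \<in> commA t"
      using fv.subspace_neg subspace_comm(1) by blast
    moreover have "att 0 (Wu (aut_minus (basis_elt g))) = sc (\<chi> g - 1) (mon g n)"
      using g mon_add_n[of g 0] by (simp add: aut_minus_basis Wu_basis lin_sc[OF lin_K(2)] lin_sc[OF lin_at]
          lin_diff[OF lin_at] at_basis)
    moreover have "sc (\<chi> g - 1) (mon g n) = - (mon g n - sc (\<chi> g) (mon g n))"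
      by (simp add: fv.scale_left_diff_distrib)
    ultimately show "att 0 (Wu (aut_minus (basis_elt g))) \<in> commA t" by simp
  qed
  obtain x k where xk: "cf 0 p = x + Wu (aut_minus k)" "x \<in> TC (n * t)" "k \<in> KK"
    using tu by (auto simp: TU_def)
  have "p = (p - att 0 (cf 0 p)) + (att 0 x + att 0 (Wu (aut_minus k)))"
    by (simp add: xk(1) lin_add[OF lin_at])
  also have "\<dots> \<in> commA t"
    by (intro fv.subspace_add subspace_comm(1) 1 2 3 p xk)
  finally show ?thesis .
qed

lemma commA_iff: "p \<in> AA \<Longrightarrow> p \<in> commA t \<longleftrightarrow> cf 0 p \<in> TU t"
  using commA_coeff coeff_commA by blast

lemma cf_mon_Suc: "g \<in> carrier G \<Longrightarrow> cf 0 (mon g (Suc m)) = Wu (cf (n - 1) (mon g m))"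
proof (induction m arbitrary: g rule: n_induct)
  case (small m)
  show ?case
  proof (cases "m = n - 1")
    case True
    then show ?thesis using small n_pos cf_mon_add[of 0 g 0] by (simp add: cf_mon_small Wu_basis)
  next
    case False
    then show ?thesis using small n_pos by (simp add: cf_mon_small lin_zero[OF lin_K(2)])
  qed
next
  case (step m)
  then show ?case using cf_mon_add[of 0 g "Suc m"]
    by (simp add: cf_mon_add lin_sc[OF lin_K(2)] lin_diff[OF lin_K(2)])
qed

text \<open>Under the identification of the commutator quotients with quotients of
  \<open>K\<close>, the differential \<open>del1\<close> becomes \<open>k \<mapsto> -\<xi> (c -
  1) (\<alpha>(k) - k)\<close> and \<open>del2\<close> becomes the norm \<open>k \<mapsto>
  \<Sum>\<^sub>i \<alpha>\<^sup>i(k)\<close> over \<open>i < n\<close>.\<close>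

lemma small_del1: "p \<in> PP \<Longrightarrow> cf 0 (Th (del1 p)) = - Wu (aut_minus (cf (n - 1) (Th p)))"
proof -
  assume p: "p \<in> PP"
  have "cf 0 (Th (del1 p)) = sc (- 1) (Wu (aut_minus (cf (n - 1) (Th p))))"
  proof (rule eqP[OF _ _ _ p])
    show "lin (\<lambda>p. cf 0 (Th (del1 p)))"
      by (rule lin_comp[OF lin_K(1) lin_comp[OF lin_Th lin_maps(2)]])
    show "lin (\<lambda>p. sc (- 1) (Wu (aut_minus (cf (n - 1) (Th p)))))"
      by (rule lin_sc_fun[OF lin_comp[OF lin_K(2) lin_comp[OF lin_K(3) lin_comp[OF lin_K(1) lin_Th]]]])
    fix g i j assume g: "g \<in> carrier G"
    have am: "aut_minus (cf (n - 1) (mon g m)) = sc (\<chi> g - 1) (cf (n - 1) (mon g m))" if "g \<in> carrier G" for g m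
      using that
    proof (induction m arbitrary: g rule: n_induct)
      case (small m)
      then show ?case by (simp add: cf_mon_small aut_minus_basis lin_zero[OF lin_K(3)])
    next
      case (step m)
      then show ?case
        by (simp add: cf_mon_add lin_sc[OF lin_K(3)] lin_diff[OF lin_K(3)] chi_mult mult.commute
            flip: fv.scale_right_diff_distrib)
    qed
    define k where "k = cf (n - 1) (mon g (i + j))"
    have amk: "aut_minus k = sc (\<chi> g - 1) k" unfolding k_def by (rule am[OF g])
    have Wk: "cf 0 (mon g (Suc (i + j))) = Wu k" unfolding k_def by (rule cf_mon_Suc[OF g])
    have "cf 0 (Th (del1 (mon2 g i j))) = sc (\<chi> g ^ j) (Wu k) - sc (\<chi> g ^ Suc j) (Wu k)"
      using g Wk by (simp add: del1_mon Th_mon lin_diff[OF lin_Th] lin_diff[OF lin_K(1)] lin_sc[OF lin_K(1)])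
    also have "\<dots> = sc (- 1 * (\<chi> g ^ j * (\<chi> g - 1))) (Wu k)"
      unfolding fv.scale_left_diff_distrib[symmetric] by (simp add: algebra_simps)
    also have "\<dots> = sc (- 1) (Wu (aut_minus (sc (\<chi> g ^ j) k)))"
      unfolding lin_sc[OF lin_K(3)] amk lin_sc[OF lin_K(2)] fv.scale_scale ..
    also have "sc (\<chi> g ^ j) k = cf (n - 1) (Th (mon2 g i j))"
      unfolding Th_mon[OF g] lin_sc[OF lin_K(1)] k_def ..
    finally show "cf 0 (Th (del1 (mon2 g i j))) = sc (- 1) (Wu (aut_minus (cf (n - 1) (Th (mon2 g i j)))))" .
  qed
  then show ?thesis by simp
qed

lemma small_del2: "a \<in> AA \<Longrightarrow> cf (n - 1) (Th (del2 a)) = nrm (cf 0 a)"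
proof (erule eqA[rotated 3])
  show "lin (\<lambda>a. cf (n - 1) (Th (del2 a)))" "lin (\<lambda>a. nrm (cf 0 a))"
    by (auto intro!: lin_comp[OF lin_K(1)] lin_comp[OF lin_Th] lin_comp[OF lin_K(4)] lin_map_comp lin_id lin_K)
  fix g m assume g: "g \<in> carrier G" and m: "m < n"
  have "cf (n - 1) (Th (del2 (mon g m))) = (\<Sum>i<n. sc (\<chi> g ^ (n - 1 - i)) (cf (n - 1) (mon g (m + (n - 1)))))"
    unfolding del2_mon[OF g] lin_sum[OF lin_Th] lin_sum[OF lin_K(1)] Th_mon[OF g] lin_sc[OF lin_K(1)]
    by (intro sum.cong refl) simp
  also have "\<dots> = sc (\<Sum>i<n. \<chi> g ^ (n - 1 - i)) (cf (n - 1) (mon g (m + (n - 1))))"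
    by (simp add: fv.scale_sum_left)
  also have "(\<Sum>i<n. \<chi> g ^ (n - 1 - i)) = (\<Sum>i<n. \<chi> g ^ i)"
    using sum.nat_diff_reindex[of "\<lambda>i. \<chi> g ^ i" n] by simp
  also have "sc (\<Sum>i<n. \<chi> g ^ i) (cf (n - 1) (mon g (m + (n - 1)))) = nrm (cf 0 (mon g m))"
  proof (cases m)
    case 0
    then show ?thesis using n_pos by (simp add: cf_mon_small nrm_basis)
  next
    case (Suc m')
    have "m + (n - 1) = m' + n" using Suc n_pos by simp
    then show ?thesis using Suc m by (simp add: cf_mon_add cf_mon_small lin_zero[OF lin_K(4)])
  qed
  finally show "cf (n - 1) (Th (del2 (mon g m))) = nrm (cf 0 (mon g m))" .
qed

text \<open>Cycles and boundaries of the Hochschild complex of \<open>A\<close> with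
  coefficients in \<open>A\<close>, twisted by \<open>t\<close>.\<close>

definition HZ where "HZ t m = bimod.cyc AA lA AA lA (rA t) m"
definition HB where "HB t m = bimod.bnd AA lA AA lA (rA t) m"

lemma H_shift: "qiso (HZ t (m + 3)) (HB t (m + 3)) (HZ (Suc t) (m + 1)) (HB (Suc t) (m + 1))"
  unfolding HZ_def HB_def by (rule bimod_seq.homology_shift[OF resolution])

lemma H_zero: "qiso (HZ t 0) (HB t 0) KK (TU t)"
proof -
  have "qiso AA (commA t) KK (TU t)"
  proof (rule qiso_lin[OF lin_K(1)[of 0] _ _ subspaces(1)])
    have "KK \<subseteq> cf 0 ` AA"
    proof
      fix k assume "k \<in> KK"
      then have "k = cf 0 (att 0 k)" using n_pos by (simp add: cf_at)
      then show "k \<in> cf 0 ` AA" using at_AA by blast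
    qed
    then show "cf 0 ` AA = KK" using cf_KK by auto
  qed (rule commA_iff)
  then show ?thesis
    using qiso_trans[OF bimod.homology_zero[OF bimod_A]] by (simp add: HZ_def HB_def commA_def)
qed

lemma H_one: "qiso (HZ t 1) (HB t 1) {k \<in> KK. Wu (aut_minus k) \<in> TC (n * t)}
  {nrm k + x | k x. k \<in> KK \<and> x \<in> TC (n * Suc t)}"
proof -
  let ?Z = "{p \<in> PP. del1 p \<in> commP (n * t)}"
  let ?B = "{del2 y + q | y q. y \<in> AA \<and> q \<in> commP (Suc (n * t))}"
  let ?F = "\<lambda>p. cf (n - 1) (Th p)"
  have F: "lin ?F" by (rule lin_comp[OF lin_K(1) lin_Th])
  have d1: "del1 p \<in> commP (n * t) \<longleftrightarrow> Wu (aut_minus (?F p)) \<in> TC (n * t)" if "p \<in> PP" for p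
  proof -
    have "- x \<in> TC (n * t) \<longleftrightarrow> x \<in> TC (n * t)" for x
      using fv.subspace_neg[OF subspace_TC, of x] fv.subspace_neg[OF subspace_TC, of "- x"] by auto
    then show ?thesis using commP0_iff[OF maps_closed(2)] small_del1[OF that] by simp
  qed
  have "qiso ?Z ?B {k \<in> KK. Wu (aut_minus k) \<in> TC (n * t)} {nrm k + x | k x. k \<in> KK \<and> x \<in> TC (n * Suc t)}"
  proof (rule qiso_lin[OF F])
    have "{k \<in> KK. Wu (aut_minus k) \<in> TC (n * t)} \<subseteq> ?F ` ?Z"
    proof
      fix k assume k: "k \<in> {k \<in> KK. Wu (aut_minus k) \<in> TC (n * t)}"
      define p where "p = hh0 (att (n - 1) k)"
      have "?F p = k" "p \<in> PP" using k n_pos by (simp_all add: p_def Th_hh0 at_AA cf_at maps_closed)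
      then show "k \<in> ?F ` ?Z" using k d1[of p] by (intro image_eqI[of _ _ p]) auto
    qed
    then show "?F ` ?Z = {k \<in> KK. Wu (aut_minus k) \<in> TC (n * t)}"
      using d1 cf_KK Th_AA by auto
    have "fv.subspace (PP \<inter> {p. del1 p \<in> commP (n * t)})"
      by (intro fv.subspace_inter subspaces subspace_vimage lin_maps subspace_comm)
    then show "fv.subspace ?Z" by (simp add: Int_def)
    fix p assume p: "p \<in> ?Z"
    show "p \<in> ?B \<longleftrightarrow> ?F p \<in> {nrm k + x | k x. k \<in> KK \<and> x \<in> TC (n * Suc t)}"
    proof
      assume "p \<in> ?B"
      then obtain y q where y: "p = del2 y + q" "y \<in> AA" "q \<in> commP (Suc (n * t))" by blast
      then have "?F q \<in> TC (n * Suc t)"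
        using commP1_iff[of q] bimod.comm_sub[OF bimod_P, of "Suc (n * t)"] by (auto simp: commP_def)
      moreover have "?F p = nrm (cf 0 y) + ?F q" 
        using lin_add[OF F, of "del2 y" q] small_del2[OF y(2)] y(1) by simp
      ultimately show "?F p \<in> {nrm k + x | k x. k \<in> KK \<and> x \<in> TC (n * Suc t)}" using cf_KK y by blast
    next
      assume "?F p \<in> {nrm k + x | k x. k \<in> KK \<and> x \<in> TC (n * Suc t)}"
      then obtain k x where k: "?F p = nrm k + x" "k \<in> KK" "x \<in> TC (n * Suc t)" by blast
      define y where "y = att 0 k"
      have y: "y \<in> AA" "cf 0 y = k" using k n_pos by (simp_all add: y_def at_AA cf_at)
      then have "?F (p - del2 y) = x"
        using lin_diff[OF F, of p "del2 y"] small_del2[OF y(1)] k by simp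
      moreover have "p - del2 y \<in> PP" using p maps_closed by (simp add: fv.subspace_diff subspaces)
      ultimately have "p - del2 y \<in> commP (Suc (n * t))" using commP1_iff k by simp
      moreover have "p = del2 y + (p - del2 y)" by simp
      ultimately show "p \<in> ?B" using y by blast
    qed
  qed
  then show ?thesis
    using qiso_trans[OF bimod_seq.homology_one[OF resolution]] by (simp add: HZ_def HB_def commP_def)
qed

lemma H_two: "qiso (HZ t 2) (HB t 2) {k \<in> KK. nrm k \<in> TC (n * Suc t)} (TU (Suc t))"
proof -
  let ?Z = "{y \<in> AA. del2 y \<in> commP (Suc (n * t))}"
  have Z: "del2 y \<in> commP (Suc (n * t)) \<longleftrightarrow> nrm (cf 0 y) \<in> TC (n * Suc t)" if "y \<in> AA" for y
    using commP1_iff[OF maps_closed(3)] small_del2[OF that] by simp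
  have "qiso ?Z (commA (Suc t)) {k \<in> KK. nrm k \<in> TC (n * Suc t)} (TU (Suc t))"
  proof (rule qiso_lin[OF lin_K(1)[of 0]])
    have "{k \<in> KK. nrm k \<in> TC (n * Suc t)} \<subseteq> cf 0 ` ?Z"
    proof
      fix k assume k: "k \<in> {k \<in> KK. nrm k \<in> TC (n * Suc t)}"
      then have "cf 0 (att 0 k) = k" "att 0 k \<in> AA" using n_pos by (simp_all add: at_AA cf_at)
      then show "k \<in> cf 0 ` ?Z" using k Z[of "att 0 k"] by (intro image_eqI[of _ _ "att 0 k"]) auto
    qed
    then show "cf 0 ` ?Z = {k \<in> KK. nrm k \<in> TC (n * Suc t)}" using Z cf_KK by auto
    have "fv.subspace (AA \<inter> {y. del2 y \<in> commP (Suc (n * t))})"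
      by (intro fv.subspace_inter subspaces subspace_vimage lin_maps subspace_comm)
    then show "fv.subspace ?Z" by (simp add: Int_def)
  qed (auto simp: commA_iff)
  then show ?thesis
    using qiso_trans[OF bimod_seq.homology_two[OF resolution]] by (simp add: HZ_def HB_def commA_def commP_def)
qed

lemma H_shift_iter:
  "qiso (HZ t (2 * m + j + 1)) (HB t (2 * m + j + 1)) (HZ (t + m) (j + 1)) (HB (t + m) (j + 1))"
proof (induction m arbitrary: t)
  case 0
  show ?case by (simp add: qiso_refl HZ_def bimod.subspace_cyc[OF bimod_A])
next
  case (Suc m)
  have "qiso (HZ t (2 * Suc m + j + 1)) (HB t (2 * Suc m + j + 1)) (HZ (Suc t) (2 * m + j + 1)) (HB (Suc t) (2 * m + j + 1))"
    using H_shift[of t "2 * m + j"] by (simp add: eval_nat_numeral)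
  then show ?case using qiso_trans[OF _ Suc[of "Suc t"]] by simp
qed

end

section \<open>Spaces of functions as modules\<close>

definition pointwise :: "'s set \<Rightarrow> ('k::field, 's \<Rightarrow> 'k) module \<Rightarrow> bool" where
  "pointwise S M \<longleftrightarrow> carrier M = fin_funs S \<and> ring.zero M = 0 \<and>
    (\<forall>x y. x \<oplus>\<^bsub>M\<^esub> y = x + y) \<and> (\<forall>c x. c \<odot>\<^bsub>M\<^esub> x = sc c x)"

lemma pointwise_free_space: "pointwise S (free_space S)"
  by (simp add: pointwise_def free_space_def zero_fun_def plus_fun_def sc_def)

lemma pointwise_group_algebra: "pointwise (carrier G) (group_algebra G)"
  by (simp add: pointwise_def group_algebra_def zero_fun_def plus_fun_def sc_def)

lemma pointwise_a_inv:
  assumes "pointwise S M" "x \<in> fin_funs S"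
  shows "\<ominus>\<^bsub>M\<^esub> x = - x"
  unfolding a_inv_def m_inv_def
proof (rule the_equality)
  have "- x \<in> fin_funs S" using fv.subspace_neg[OF fin_funs_subspace assms(2)] .
  then show "- x \<in> carrier (add_monoid M) \<and> x \<otimes>\<^bsub>add_monoid M\<^esub> - x = \<one>\<^bsub>add_monoid M\<^esub> \<and>
    - x \<otimes>\<^bsub>add_monoid M\<^esub> x = \<one>\<^bsub>add_monoid M\<^esub>"
    using assms(1) by (simp add: pointwise_def)
  fix y assume "y \<in> carrier (add_monoid M) \<and> x \<otimes>\<^bsub>add_monoid M\<^esub> y = \<one>\<^bsub>add_monoid M\<^esub> \<and>
    y \<otimes>\<^bsub>add_monoid M\<^esub> x = \<one>\<^bsub>add_monoid M\<^esub>"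
  then have "x + y = 0" using assms(1) by (simp add: pointwise_def)
  then show "y = - x" using minus_unique[of x y] by simp
qed

lemma pointwise_a_minus:
  "pointwise S M \<Longrightarrow> y \<in> fin_funs S \<Longrightarrow> x \<ominus>\<^bsub>M\<^esub> y = x - y"
  by (simp add: a_minus_def pointwise_a_inv) (simp add: pointwise_def)

text \<open>Scalars in the sense of modules over the ring made from a field type are field
  elements, so submodules are subspaces.\<close>

lemma pointwise_submodule:
  assumes M: "pointwise S (M :: ('k::field, 's \<Rightarrow> 'k) module)"
  shows "submodule W (ring_of_type_algebra :: 'k ring) M \<longleftrightarrow> W \<subseteq> fin_funs S \<and> fv.subspace W"
proof
  assume W: "submodule W (ring_of_type_algebra :: 'k ring) M"
  then interpret W: submodule W "ring_of_type_algebra :: 'k ring" M .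
  have "c \<odot>\<^bsub>M\<^esub> x \<in> W" if "x \<in> W" for c x
    using W.smult_closed[of c x] that by (simp add: ring_of_type_algebra_def)
  moreover have "x \<oplus>\<^bsub>M\<^esub> y \<in> W" if "x \<in> W" "y \<in> W" for x y
    using W.m_closed[of x y] that by simp
  moreover have "\<zero>\<^bsub>M\<^esub> \<in> W" "W \<subseteq> carrier M"
    using W.one_closed W.subset by simp_all
  ultimately show "W \<subseteq> fin_funs S \<and> fv.subspace W"
    using M by (simp add: fv.subspace_def pointwise_def)
next
  assume W: "W \<subseteq> fin_funs S \<and> fv.subspace W"
  show "submodule W (ring_of_type_algebra :: 'k ring) M"
  proof (intro submodule.intro subgroup.intro submodule_axioms.intro)
    show "inv\<^bsub>add_monoid M\<^esub> x \<in> W" if "x \<in> W" for x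
      using pointwise_a_inv[OF M, of x] W that fv.subspace_neg[of W x] by (auto simp: a_inv_def)
  qed (use W M in \<open>auto simp: fv.subspace_def pointwise_def\<close>)
qed

lemma pointwise_kspan:
  assumes M: "pointwise S M" and X: "T \<subseteq> fin_funs S"
  shows "kspan M T = fv.span T"
  unfolding kspan_def pointwise_submodule[OF M]
proof
  have "fv.span T \<subseteq> fin_funs S" using X by (intro fv.span_minimal fin_funs_subspace)
  then show "\<Inter> {W. (W \<subseteq> fin_funs S \<and> fv.subspace W) \<and> T \<subseteq> W} \<subseteq> fv.span T"
    by (intro Inter_lower) (auto intro: fv.span_base)
  show "fv.span T \<subseteq> \<Inter> {W. (W \<subseteq> fin_funs S \<and> fv.subspace W) \<and> T \<subseteq> W}"
    by (intro Inter_greatest fv.span_minimal) auto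
qed

lemma pointwise_presents: "pointwise S M \<Longrightarrow> presents (fin_funs S) {0} M (\<lambda>x. x)"
  by (auto simp: presents_def pointwise_def)

text \<open>Linear extension from a possibly infinite basis.\<close>

definition fsum :: "('s \<Rightarrow> 'j \<Rightarrow> 'k) \<Rightarrow> ('s \<Rightarrow> 'k::field) \<Rightarrow> 'j \<Rightarrow> 'k" where
  "fsum F f = (\<Sum>s\<in>{s. f s \<noteq> 0}. sc (f s) (F s))"

lemma fsum_superset:
  assumes "finite I" "{s. f s \<noteq> 0} \<subseteq> I"
  shows "fsum F f = (\<Sum>s\<in>I. sc (f s) (F s))"
  unfolding fsum_def by (rule sum.mono_neutral_left) (use assms in auto)

lemma fsum_add:
  assumes "f \<in> fin_funs S" "g \<in> fin_funs S"
  shows "fsum F (f + g) = fsum F f + fsum F g"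
proof -
  let ?I = "{s. f s \<noteq> 0} \<union> {s. g s \<noteq> 0}"
  have I: "finite ?I" using assms by (simp add: fin_funs_def)
  have "fsum F (f + g) = (\<Sum>s\<in>?I. sc ((f + g) s) (F s))"
    by (rule fsum_superset[OF I]) (auto simp: fun_ap)
  also have "\<dots> = (\<Sum>s\<in>?I. sc (f s) (F s)) + (\<Sum>s\<in>?I. sc (g s) (F s))"
    by (simp add: plus_fun_apply fv.scale_left_distrib sum.distrib)
  finally show ?thesis
    using fsum_superset[OF I, of f F] fsum_superset[OF I, of g F] by simp
qed

lemma fsum_sc:
  assumes "f \<in> fin_funs S"
  shows "fsum F (sc a f) = sc a (fsum F f)"
proof -
  have I: "finite {s. f s \<noteq> 0}" using assms by (simp add: fin_funs_def)
  have "fsum F (sc a f) = (\<Sum>s\<in>{s. f s \<noteq> 0}. sc (sc a f s) (F s))"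
    by (rule fsum_superset[OF I]) (auto simp: fun_ap)
  then show ?thesis by (simp add: fsum_def sc_apply fv.scale_sum_right)
qed

lemma fsum_zero [simp]: "fsum F 0 = 0"
  by (simp add: fsum_def zero_fun_apply)

lemma fsum_basis_elt [simp]: "fsum F (basis_elt s) = F s"
proof -
  have "fsum F (basis_elt s) = (\<Sum>t\<in>{s}. sc (basis_elt s t) (F t))"
    by (rule fsum_superset) (auto simp: basis_elt_def)
  then show ?thesis by (simp add: basis_elt_def)
qed

lemma fsum_diff:
  assumes "f \<in> fin_funs S" "g \<in> fin_funs S"
  shows "fsum F (f - g) = fsum F f - fsum F g"
proof -
  have "sc (- 1) g \<in> fin_funs S" using assms fin_funs_subspace fv.subspace_scale by blast
  then show ?thesis using fsum_add[OF assms(1), of "sc (- 1) g" F] fsum_sc[OF assms(2), of F "- 1"]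
    by simp
qed

lemma fsum_sum:
  assumes "\<And>i. i \<in> I \<Longrightarrow> f i \<in> fin_funs S"
  shows "fsum F (\<Sum>i\<in>I. f i) = (\<Sum>i\<in>I. fsum F (f i))"
  using assms
proof (induction I rule: infinite_finite_induct)
  case (insert x I)
  have "(\<Sum>i\<in>I. f i) \<in> fin_funs S"
    using insert by (intro fv.subspace_sum fin_funs_subspace) auto
  then show ?case using insert fsum_add[of "f x" S "\<Sum>i\<in>I. f i" F] by simp
qed simp_all

lemma fsum_induct:
  assumes "f \<in> fin_funs S" "fv.subspace {f \<in> fin_funs S. P f}" "\<And>s. s \<in> S \<Longrightarrow> P (basis_elt s)"
  shows "P f"
proof -
  have "fv.span (basis_elt ` S) \<subseteq> {f \<in> fin_funs S. P f}"
    by (intro fv.span_minimal assms) (auto intro: assms basis_elt_fin_funs)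
  then show ?thesis using assms(1) by (auto simp: fin_funs_eq_span)
qed

lemma fsum_image: "fsum F ` fin_funs S = fv.span (F ` S)" for F :: "'s \<Rightarrow> 'j \<Rightarrow> 'k::field"
proof
  show "fsum F ` fin_funs S \<subseteq> fv.span (F ` S)"
  proof (rule image_subsetI)
    fix f :: "'s \<Rightarrow> 'k" assume "f \<in> fin_funs S"
    then show "fsum F f \<in> fv.span (F ` S)"
      unfolding fsum_def by (intro fv.span_sum fv.span_scale fv.span_base) (auto simp: fin_funs_def)
  qed
  have "fv.subspace (fsum F ` fin_funs S)"
    unfolding fv.subspace_def
  proof (intro conjI ballI allI)
    show "0 \<in> fsum F ` fin_funs S"
      using fv.subspace_0[OF fin_funs_subspace] by (intro image_eqI[of _ _ 0]) simp_all
    show "x + y \<in> fsum F ` fin_funs S" if xy: "x \<in> fsum F ` fin_funs S" "y \<in> fsum F ` fin_funs S" for x y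
    proof -
      obtain f g where "f \<in> fin_funs S" "g \<in> fin_funs S" "x = fsum F f" "y = fsum F g" using xy by blast
      then show ?thesis using fsum_add[of f S g F] fv.subspace_add[OF fin_funs_subspace, of f S g]
        by (intro image_eqI[of _ _ "f + g"]) simp_all
    qed
    show "sc a x \<in> fsum F ` fin_funs S" if x: "x \<in> fsum F ` fin_funs S" for a x
    proof -
      obtain f where "f \<in> fin_funs S" "x = fsum F f" using x by blast
      then show ?thesis using fsum_sc[of f S F a] fv.subspace_scale[OF fin_funs_subspace, of f S a]
        by (intro image_eqI[of _ _ "sc a f"]) simp_all
    qed
  qed
  then show "fv.span (F ` S) \<subseteq> fsum F ` fin_funs S"
    by (intro fv.span_minimal) (auto intro!: image_eqI[of _ "fsum F" "basis_elt _"] basis_elt_fin_funs)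
qed

lemma fsum_subspace_vimage:
  assumes "fv.subspace V"
  shows "fv.subspace {f \<in> fin_funs S. fsum F f \<in> V}"
  using assms fin_funs_subspace[of S]
  by (auto simp: fv.subspace_def fsum_add[of _ S] fsum_sc[of _ S])

section \<open>Hochschild homology in terms of multilinear functionals\<close>

text \<open>The algebra \<open>R\<close> is identified with the subspace \<open>AA\<close> of a
  function space. The projection \<open>\<rho>\<close> onto \<open>AA\<close> turns functionals
  that are linear on \<open>AA\<close> only into globally linear ones.\<close>

locale alg_iso = alg AA mul for AA :: "('b \<Rightarrow> 'k::field) set" and mul +
  fixes R :: "('k, 'a) module" and \<theta> :: "'a \<Rightarrow> 'b \<Rightarrow> 'k" and \<rho> :: "('b \<Rightarrow> 'k) \<Rightarrow> 'b \<Rightarrow> 'k"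
  assumes bij: "bij_betw \<theta> (carrier R) AA"
    and closed: "a \<in> carrier R \<Longrightarrow> b \<in> carrier R \<Longrightarrow> a \<oplus>\<^bsub>R\<^esub> b \<in> carrier R"
      "a \<in> carrier R \<Longrightarrow> b \<in> carrier R \<Longrightarrow> a \<otimes>\<^bsub>R\<^esub> b \<in> carrier R"
      "a \<in> carrier R \<Longrightarrow> s \<odot>\<^bsub>R\<^esub> a \<in> carrier R"
    and add: "a \<in> carrier R \<Longrightarrow> b \<in> carrier R \<Longrightarrow> \<theta> (a \<oplus>\<^bsub>R\<^esub> b) = \<theta> a + \<theta> b"
    and mult: "a \<in> carrier R \<Longrightarrow> b \<in> carrier R \<Longrightarrow> \<theta> (a \<otimes>\<^bsub>R\<^esub> b) = mul (\<theta> a) (\<theta> b)"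
    and smult: "a \<in> carrier R \<Longrightarrow> \<theta> (s \<odot>\<^bsub>R\<^esub> a) = sc s (\<theta> a)"
    and rho: "lin \<rho>" "\<rho> x \<in> AA" "x \<in> AA \<Longrightarrow> \<rho> x = x"
begin

sublocale B: bimod AA mul AA mul mul
  by unfold_locales (auto simp: A_sub mul_closed mul_lin1 mul_lin2 mul_assoc)

text \<open>The tensor of a tuple: its first entry is the coefficient.\<close>

abbreviation "tau t \<equiv> ev (\<theta> (hd t)) (map \<theta> (tl t))"
abbreviation "TT \<equiv> fsum tau"
abbreviation "FF m \<equiv> fin_funs (tuples R m) :: ('a list \<Rightarrow> 'k) set"

lemma theta_AA: "a \<in> carrier R \<Longrightarrow> \<theta> a \<in> AA"
  using bij by (auto simp: bij_betw_def)

lemma ev_at: "ev p as \<phi> = (if ml \<phi> then \<phi> p as else 0)"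
  by (simp add: ev_def)

lemma TT_image: "TT ` FF (Suc m) = tens AA AA m"
proof -
  have "tau ` tuples R (Suc m) = {ev p as | p as. p \<in> AA \<and> set as \<subseteq> AA \<and> length as = m}"
  proof (intro subset_antisym subsetI)
    fix x assume "x \<in> tau ` tuples R (Suc m)"
    then obtain t where "t \<in> tuples R (Suc m)" "x = tau t" by blast
    moreover then obtain a as where "t = a # as" by (cases t) (auto simp: tuples_def)
    ultimately show "x \<in> {ev p as | p as. p \<in> AA \<and> set as \<subseteq> AA \<and> length as = m}"
      by (intro CollectI exI[of _ "\<theta> a"] exI[of _ "map \<theta> as"]) (auto simp: tuples_def theta_AA)
  next
    fix x assume "x \<in> {ev p as | p as. p \<in> AA \<and> set as \<subseteq> AA \<and> length as = m}"
    then obtain p as where x: "x = ev p as" "p \<in> AA" "set as \<subseteq> AA" "length as = m" by blast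
    let ?i = "inv_into (carrier R) \<theta>"
    have i: "\<theta> (?i y) = y" "?i y \<in> carrier R" if "y \<in> AA" for y
      using that bij by (auto simp: bij_betw_def f_inv_into_f inv_into_into)
    have "map \<theta> (map ?i as) = as" using x i by (auto simp: list_eq_iff_nth_eq subset_iff)
    then have "x = tau (?i p # map ?i as)" using x i by simp
    moreover have "?i p # map ?i as \<in> tuples R (Suc m)" using x i by (auto simp: tuples_def)
    ultimately show "x \<in> tau ` tuples R (Suc m)" by blast
  qed
  then show ?thesis by (simp add: fsum_image tens_def)
qed

definition "rel_gens m =
    {(\<lambda>t. basis_elt (us @ (a \<oplus>\<^bsub>R\<^esub> b) # vs) t - basis_elt (us @ a # vs) t
            - basis_elt (us @ b # vs) t) | us a b vs.
        us @ a # vs \<in> tuples R m \<and> b \<in> carrier R} \<union>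
     {(\<lambda>t. basis_elt (us @ (c \<odot>\<^bsub>R\<^esub> a) # vs) t - c * basis_elt (us @ a # vs) t) | us c a vs.
        us @ a # vs \<in> tuples R m}"

lemma rel_gens_cases:
  assumes "g \<in> (rel_gens m :: ('a list \<Rightarrow> 'k) set)"
  obtains us a b vs where "us @ a # vs \<in> tuples R m" "b \<in> carrier R"
      "g = basis_elt (us @ (a \<oplus>\<^bsub>R\<^esub> b) # vs) - basis_elt (us @ a # vs) - basis_elt (us @ b # vs)"
    | us s a vs where "us @ a # vs \<in> tuples R m"
      "g = basis_elt (us @ (s \<odot>\<^bsub>R\<^esub> a) # vs) - sc s (basis_elt (us @ a # vs))"
  using assms unfolding rel_gens_def by (auto simp: fun_diff_def sc_def)

lemma rel_gens_FF: "rel_gens m \<subseteq> FF m"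
proof
  fix g assume "g \<in> (rel_gens m :: ('a list \<Rightarrow> 'k) set)"
  then show "g \<in> FF m"
    by (cases rule: rel_gens_cases)
      (auto simp: tuples_def intro!: fv.subspace_diff fv.subspace_scale fin_funs_subspace basis_elt_fin_funs closed)
qed

lemma relations_span: "tensor_relations R m = fv.span (rel_gens m)"
  unfolding tensor_relations_def rel_gens_def[symmetric]
  by (rule pointwise_kspan[OF pointwise_free_space rel_gens_FF])

lemma subspace_relations: "fv.subspace (tensor_relations R m)"
  by (simp add: relations_span)

lemma relations_FF: "tensor_relations R m \<subseteq> FF m"
  unfolding relations_span by (intro fv.span_minimal rel_gens_FF fin_funs_subspace)

text \<open>The defining relations of the tensor power are visibly killed. Conversely, a
  combination outside their span is detected by a functional vanishing on them, and vanishing on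
  the relations means that its values on tuples are multilinear in the entries;
  \<open>\<rho>\<close> extends these values to arguments outside \<open>AA\<close>.\<close>

lemma relations_iff:
  assumes f: "f \<in> FF (Suc m)"
  shows "f \<in> tensor_relations R (Suc m) \<longleftrightarrow> TT f = 0"
proof
  have sub: "fv.subspace {f \<in> FF (Suc m). TT f \<in> {0}}"
    by (rule fsum_subspace_vimage) (simp add: fv.subspace_def)
  have "rel_gens (Suc m) \<subseteq> {f \<in> FF (Suc m). TT f \<in> {0}}"
  proof
    fix g assume g: "g \<in> (rel_gens (Suc m) :: ('a list \<Rightarrow> 'k) set)"
    then have gF: "g \<in> FF (Suc m)" using rel_gens_FF by blast
    have "TT g = 0" using g
    proof (cases rule: rel_gens_cases)
      case (1 us a b vs)
      have c: "a \<in> carrier R" using 1 by (auto simp: tuples_def)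
      have b: "basis_elt (us @ (a \<oplus>\<^bsub>R\<^esub> b) # vs) \<in> FF (Suc m)" "basis_elt (us @ a # vs) \<in> FF (Suc m)"
        "basis_elt (us @ b # vs) \<in> FF (Suc m)"
        using 1 c by (auto simp: tuples_def intro!: basis_elt_fin_funs closed)
      have "basis_elt (us @ (a \<oplus>\<^bsub>R\<^esub> b) # vs) - basis_elt (us @ a # vs) \<in> FF (Suc m)"
        using b by (intro fv.subspace_diff fin_funs_subspace)
      then have "TT g = tau (us @ (a \<oplus>\<^bsub>R\<^esub> b) # vs) - tau (us @ a # vs) - tau (us @ b # vs)"
        unfolding 1(3) by (simp add: fsum_diff[OF _ b(3)] fsum_diff[OF b(1,2)])
      also have "\<dots> = 0"
        by (cases us) (simp_all add: add c 1 lin_add[OF lin_ev_first] lin_add[OF lin_ev_rest])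
      finally show ?thesis .
    next
      case (2 us s a vs)
      have c: "a \<in> carrier R" using 2 by (auto simp: tuples_def)
      have b: "basis_elt (us @ (s \<odot>\<^bsub>R\<^esub> a) # vs) \<in> FF (Suc m)" "basis_elt (us @ a # vs) \<in> FF (Suc m)"
        using 2 c by (auto simp: tuples_def intro!: basis_elt_fin_funs closed)
      then have "sc s (basis_elt (us @ a # vs)) \<in> FF (Suc m)"
        by (intro fv.subspace_scale fin_funs_subspace)
      then have "TT g = tau (us @ (s \<odot>\<^bsub>R\<^esub> a) # vs) - sc s (tau (us @ a # vs))"
        unfolding 2(2) by (simp add: fsum_diff[OF b(1)] fsum_sc[OF b(2)])
      also have "\<dots> = 0"
        by (cases us) (simp_all add: smult c 2 lin_sc[OF lin_ev_first] lin_sc[OF lin_ev_rest])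
      finally show ?thesis .
    qed
    then show "g \<in> {f \<in> FF (Suc m). TT f \<in> {0}}" using gF by simp
  qed
  then have "tensor_relations R (Suc m) \<subseteq> {f \<in> FF (Suc m). TT f \<in> {0}}"
    unfolding relations_span by (intro fv.span_minimal sub)
  then show "f \<in> tensor_relations R (Suc m) \<Longrightarrow> TT f = 0" by auto
next
  assume T0: "TT f = 0"
  show "f \<in> tensor_relations R (Suc m)"
  proof (rule ccontr)
    assume nf: "f \<notin> tensor_relations R (Suc m)"
    obtain l :: "('a list \<Rightarrow> 'k) \<Rightarrow> 'k" where l: "\<And>x y. l (x + y) = l x + l y" "\<And>s x. l (sc s x) = s * l x"
      "\<And>w. w \<in> tensor_relations R (Suc m) \<Longrightarrow> l w = 0" "l f \<noteq> 0"
      by (rule functional_separates[OF subspace_relations nf], rule that) assumption+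
    have ldiff: "l (x - y) = l x - l y" for x y
      using l(1)[of x "sc (- 1) y"] l(2)[of "- 1" y] by simp
    have lsum: "l (\<Sum>i\<in>I. F i) = (\<Sum>i\<in>I. l (F i))" for F :: "'z \<Rightarrow> 'a list \<Rightarrow> 'k" and I
      by (rule linf_sum) (simp add: linf_def l)
    define \<kappa> where "\<kappa> x = inv_into (carrier R) \<theta> (\<rho> x)" for x
    have kc: "\<kappa> x \<in> carrier R" for x
      unfolding \<kappa>_def using rho(2)[of x] bij by (intro inv_into_into) (simp add: bij_betw_def)
    have tk: "\<theta> (\<kappa> x) = \<rho> x" for x
      unfolding \<kappa>_def using rho(2)[of x] bij by (intro f_inv_into_f) (simp add: bij_betw_def)
    have inj: "inj_on \<theta> (carrier R)" using bij by (simp add: bij_betw_def)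
    have kadd: "\<kappa> (x + y) = \<kappa> x \<oplus>\<^bsub>R\<^esub> \<kappa> y" for x y
      by (rule inj_onD[OF inj]) (simp_all add: add tk kc closed lin_add[OF rho(1)])
    have ksc: "\<kappa> (sc s x) = s \<odot>\<^bsub>R\<^esub> \<kappa> x" for s x
      by (rule inj_onD[OF inj]) (simp_all add: smult tk kc closed lin_sc[OF rho(1)])
    have kt: "\<kappa> (\<theta> a) = a" if "a \<in> carrier R" for a
      by (rule inj_onD[OF inj]) (simp_all add: tk kc that rho theta_AA)
    define \<phi> where "\<phi> p as = (if length as = m then l (basis_elt (map \<kappa> (p # as))) else 0)" for p as
    have entry: "linf (\<lambda>x. l (basis_elt (us @ \<kappa> x # vs)))" if "set us \<subseteq> carrier R" "set vs \<subseteq> carrier R"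
      "length us + length vs = m" for us vs
      unfolding linf_def
    proof (intro conjI allI)
      fix x y
      have "basis_elt (us @ (\<kappa> x \<oplus>\<^bsub>R\<^esub> \<kappa> y) # vs) - basis_elt (us @ \<kappa> x # vs) - basis_elt (us @ \<kappa> y # vs)
        \<in> (rel_gens (Suc m) :: ('a list \<Rightarrow> 'k) set)"
        unfolding rel_gens_def using that kc
        by (intro UnI1 CollectI exI[of _ us] exI[of _ "\<kappa> x"] exI[of _ "\<kappa> y"] exI[of _ vs])
          (auto simp: tuples_def fun_diff_def)
      then have "l (basis_elt (us @ (\<kappa> x \<oplus>\<^bsub>R\<^esub> \<kappa> y) # vs) - basis_elt (us @ \<kappa> x # vs) - basis_elt (us @ \<kappa> y # vs)) = 0"
        by (intro l(3)) (simp add: relations_span fv.span_base)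
      then show "l (basis_elt (us @ \<kappa> (x + y) # vs)) = l (basis_elt (us @ \<kappa> x # vs)) + l (basis_elt (us @ \<kappa> y # vs))"
        unfolding kadd ldiff by (simp only: diff_diff_eq right_minus_eq)
    next
      fix s x
      have "basis_elt (us @ (s \<odot>\<^bsub>R\<^esub> \<kappa> x) # vs) - sc s (basis_elt (us @ \<kappa> x # vs))
        \<in> (rel_gens (Suc m) :: ('a list \<Rightarrow> 'k) set)"
        unfolding rel_gens_def using that kc
        by (intro UnI2 CollectI exI[of _ us] exI[of _ s] exI[of _ "\<kappa> x"] exI[of _ vs])
          (auto simp: tuples_def fun_diff_def sc_def)
      then have "l (basis_elt (us @ (s \<odot>\<^bsub>R\<^esub> \<kappa> x) # vs) - sc s (basis_elt (us @ \<kappa> x # vs))) = 0"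
        by (intro l(3)) (simp add: relations_span fv.span_base)
      then show "l (basis_elt (us @ \<kappa> (sc s x) # vs)) = s * l (basis_elt (us @ \<kappa> x # vs))"
        by (simp add: ksc ldiff l(2))
    qed
    have ml: "ml \<phi>"
      unfolding ml_def
    proof (intro conjI allI)
      show "linf (\<lambda>p. \<phi> p as)" for as
        using entry[of "[]" "map \<kappa> as"] kc by (cases "length as = m") (auto simp: \<phi>_def linf_zero_fun)
      show "linf (\<lambda>a. \<phi> p (us @ a # vs))" for p us vs
        using entry[of "map \<kappa> (p # us)" "map \<kappa> vs"] kc
        by (cases "length (us @ undefined # vs) = m") (auto simp: \<phi>_def linf_zero_fun)
    qed
    have fin: "finite {s. f s \<noteq> 0}" and supp: "{s. f s \<noteq> 0} \<subseteq> tuples R (Suc m)"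
      using f by (auto simp: fin_funs_def)
    have "TT f \<phi> = (\<Sum>t\<in>{s. f s \<noteq> 0}. f t * l (basis_elt t))"
      unfolding fsum_def sum_fun_apply
    proof (intro sum.cong refl)
      fix t assume "t \<in> {s. f s \<noteq> 0}"
      then have t: "length t = Suc m" "set t \<subseteq> carrier R" using supp by (auto simp: tuples_def)
      then obtain a as where at: "t = a # as" by (cases t) auto
      have "map \<kappa> (map \<theta> t) = t" using t kt by (auto simp: list_eq_iff_nth_eq subset_iff)
      then show "sc (f t) (tau t) \<phi> = f t * l (basis_elt t)"
        using ml t at by (simp add: sc_apply ev_def \<phi>_def)
    qed
    also have "\<dots> = l (\<Sum>t\<in>{s. f s \<noteq> 0}. sc (f t) (basis_elt t))" by (simp add: lsum l)
    also have "(\<Sum>t\<in>{s. f s \<noteq> 0}. sc (f t) (basis_elt t)) = f"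
      using fin_funs_expand[OF fin, of f] by simp
    finally show False using T0 l(4) by (simp add: zero_fun_apply)
  qed
qed

text \<open>The alternating sum of faces is the recursively defined boundary: splitting off the
  first argument shifts the index of each face by one.\<close>

lemma faces_hQ:
  "as \<noteq> [] \<Longrightarrow> (\<Sum>i<length as. (- 1) ^ i * (\<lambda>t. \<phi> (hd t) (tl t)) (hochschild_face R (Suc i) (p # as))) =
    hQ (\<lambda>a b. a \<otimes>\<^bsub>R\<^esub> b) (\<lambda>a b. a \<otimes>\<^bsub>R\<^esub> b) \<phi> p as" for \<phi> :: "'a \<Rightarrow> 'a list \<Rightarrow> 'k"
proof (induction as arbitrary: \<phi> rule: induct_list012)
  case (2 a)
  show ?case by (simp add: hochschild_face_def)
next
  case (3 a b r)
  let ?F = "\<lambda>i. hochschild_face R i"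
  have step: "(\<lambda>t. \<phi> (hd t) (tl t)) (?F (Suc (Suc i)) (p # a # b # r)) =
      (\<lambda>t. \<phi> (hd t) (a # tl t)) (?F (Suc i) (p # b # r))" if "i < length (b # r)" for i
  proof (cases "Suc (Suc i) < length (p # b # r)")
    case True
    then show ?thesis by (auto simp: hochschild_face_def)
  next
    case False
    then have "i = length r" using that by simp
    then show ?thesis by (simp add: hochschild_face_def)
  qed
  have "(\<Sum>i<length (a # b # r). (- 1) ^ i * (\<lambda>t. \<phi> (hd t) (tl t)) (?F (Suc i) (p # a # b # r))) =
    (\<lambda>t. \<phi> (hd t) (tl t)) (?F (Suc 0) (p # a # b # r)) +
    (\<Sum>i<length (b # r). (- 1) ^ Suc i * (\<lambda>t. \<phi> (hd t) (tl t)) (?F (Suc (Suc i)) (p # a # b # r)))"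
    unfolding list.size(4)[of a "b # r"] add_Suc_right add_0_right sum.lessThan_Suc_shift by simp
  also have "\<dots> = \<phi> p ((a \<otimes>\<^bsub>R\<^esub> b) # r) -
    (\<Sum>i<length (b # r). (- 1) ^ i * (\<lambda>t. \<phi> (hd t) (a # tl t)) (?F (Suc i) (p # b # r)))"
  proof -
    have "(\<Sum>i<length (b # r). (- 1) ^ Suc i * (\<lambda>t. \<phi> (hd t) (tl t)) (?F (Suc (Suc i)) (p # a # b # r))) =
      (\<Sum>i<length (b # r). - ((- 1) ^ i * (\<lambda>t. \<phi> (hd t) (a # tl t)) (?F (Suc i) (p # b # r))))"
      by (intro sum.cong refl) (simp only: lessThan_iff step, simp)
    then show ?thesis by (simp add: hochschild_face_def sum_negf)
  qed
  also have "(\<Sum>i<length (b # r). (- 1) ^ i * (\<lambda>t. \<phi> (hd t) (a # tl t)) (?F (Suc i) (p # b # r))) =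
     hQ (\<lambda>a b. a \<otimes>\<^bsub>R\<^esub> b) (\<lambda>a b. a \<otimes>\<^bsub>R\<^esub> b) (\<lambda>q l. \<phi> q (a # l)) p (b # r)"
    using 3(2)[of "\<lambda>q l. \<phi> q (a # l)"] by simp
  finally show ?case by simp
qed simp

lemma hQ_theta:
  "p \<in> carrier R \<Longrightarrow> set as \<subseteq> carrier R \<Longrightarrow>
    hQ (\<lambda>a b. a \<otimes>\<^bsub>R\<^esub> b) (\<lambda>a b. a \<otimes>\<^bsub>R\<^esub> b) (\<lambda>q l. \<phi> (\<theta> q) (map \<theta> l)) p as = hQ mul mul \<phi> (\<theta> p) (map \<theta> as)"
  for \<phi> :: "('b \<Rightarrow> 'k) \<Rightarrow> ('b \<Rightarrow> 'k) list \<Rightarrow> 'k"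
proof (induction as arbitrary: \<phi> rule: induct_list012)
  case (3 a b r)
  then show ?case using 3(2)[of "\<lambda>q l. \<phi> q (\<theta> a # l)"] by (simp add: mult)
qed (simp_all add: mult)

lemma faces_ev:
  assumes "t \<in> tuples R (Suc (Suc m))"
  shows "(\<Sum>i<length t. sc ((- 1) ^ i) (tau (hochschild_face R i t))) = B.bd (tau t)"
proof
  fix \<phi>
  obtain p a r where t: "t = p # a # r" using assms by (auto simp: tuples_def length_Suc_conv)
  have c: "p \<in> carrier R" "a \<in> carrier R" "set r \<subseteq> carrier R" using assms t by (auto simp: tuples_def)
  show "(\<Sum>i<length t. sc ((- 1) ^ i) (tau (hochschild_face R i t))) \<phi> = B.bd (tau t) \<phi>"
  proof (cases "ml \<phi>")
    case False
    then show ?thesis by (simp add: B.bd_ev sum_fun_apply sc_apply ev_at)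
  next
    case True
    define \<psi> where "\<psi> q l = \<phi> (\<theta> q) (map \<theta> l)" for q l
    have "(\<Sum>i<length t. sc ((- 1) ^ i) (tau (hochschild_face R i t))) \<phi> =
       (\<Sum>i<Suc (length (a # r)). (- 1) ^ i * (\<lambda>t. \<psi> (hd t) (tl t)) (hochschild_face R i t))"
      using True by (simp add: fun_ap ev_at \<psi>_def t)
    also have "\<dots> = \<psi> (p \<otimes>\<^bsub>R\<^esub> a) r -
      (\<Sum>i<length (a # r). (- 1) ^ i * (\<lambda>t. \<psi> (hd t) (tl t)) (hochschild_face R (Suc i) t))"
      unfolding sum.lessThan_Suc_shift t by (simp add: hochschild_face_def sum_negf)
    also have "\<dots> = hD mul mul mul \<phi> (\<theta> p) (map \<theta> (a # r))"
      unfolding t using faces_hQ[of "a # r" \<psi> p] hQ_theta[of p "a # r" \<phi>] c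
      by (simp add: \<psi>_def[abs_def] mult)
    finally show ?thesis using True by (simp add: B.bd_ev t)
  qed
qed

abbreviation "dd \<equiv> hochschild_free_boundary R :: ('a list \<Rightarrow> 'k) \<Rightarrow> 'a list \<Rightarrow> 'k"

lemma dd_fsum: "dd = fsum (\<lambda>as. \<Sum>i<length as. sc ((- 1) ^ i) (basis_elt (hochschild_face R i as)))"
  by (intro ext) (simp add: hochschild_free_boundary_def fsum_def sum_fun_apply sc_apply)

lemma face_tuple:
  assumes "as \<in> tuples R (Suc (Suc m))" "i < length as"
  shows "hochschild_face R i as \<in> tuples R (Suc m)"
proof (cases "Suc i < length as")
  case True
  have "as ! i \<in> carrier R" "as ! Suc i \<in> carrier R" using assms True by (auto simp: tuples_def subset_iff)
  moreover have "set (take i as) \<subseteq> carrier R" "set (drop (i + 2) as) \<subseteq> carrier R"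
    using assms set_take_subset[of i as] set_drop_subset[of "i + 2" as] by (auto simp: tuples_def)
  ultimately show ?thesis using assms True by (auto simp: hochschild_face_def tuples_def closed)
next
  case False
  obtain a b r where t: "as = a # b # r" using assms by (auto simp: tuples_def length_Suc_conv)
  have "last as \<in> carrier R" using assms t last_in_set[of as] by (auto simp: tuples_def)
  moreover have "set (butlast (tl as)) \<subseteq> set (tl as)" by (auto dest: in_set_butlastD)
  then have "set (butlast (tl as)) \<subseteq> carrier R"
    using assms t by (auto simp: tuples_def)
  ultimately show ?thesis using assms t False by (auto simp: hochschild_face_def tuples_def closed)
qed

lemma dd_basis_FF:
  assumes "as \<in> tuples R (Suc (Suc m))"
  shows "(\<Sum>i<length as. sc ((- 1) ^ i) (basis_elt (hochschild_face R i as))) \<in> FF (Suc m)"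
  by (intro fv.subspace_sum fv.subspace_scale fin_funs_subspace basis_elt_fin_funs face_tuple[OF assms]) auto

lemma dd_FF:
  assumes "f \<in> FF (Suc (Suc m))"
  shows "dd f \<in> FF (Suc m)"
proof -
  have "dd f \<in> fv.span ((\<lambda>as. \<Sum>i<length as. sc ((- 1) ^ i) (basis_elt (hochschild_face R i as))) ` tuples R (Suc (Suc m)))"
    unfolding dd_fsum fsum_image[symmetric] using assms by blast
  moreover have "\<dots> \<subseteq> FF (Suc m)"
    by (intro fv.span_minimal fin_funs_subspace) (use dd_basis_FF in blast)
  ultimately show ?thesis by blast
qed

lemma TT_dd:
  assumes f: "f \<in> FF (Suc (Suc m))"
  shows "TT (dd f) = B.bd (TT f)"
proof (rule fsum_induct[OF f])
  show "fv.subspace {f \<in> FF (Suc (Suc m)). TT (dd f) = B.bd (TT f)}"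
    unfolding fv.subspace_def
  proof (intro conjI ballI allI)
    show "0 \<in> {f \<in> FF (Suc (Suc m)). TT (dd f) = B.bd (TT f)}"
      using fv.subspace_0[OF fin_funs_subspace] by (simp add: dd_fsum lin_zero[OF B.lin_bd])
    show "f + g \<in> {f \<in> FF (Suc (Suc m)). TT (dd f) = B.bd (TT f)}"
      if "f \<in> {f \<in> FF (Suc (Suc m)). TT (dd f) = B.bd (TT f)}"
        "g \<in> {f \<in> FF (Suc (Suc m)). TT (dd f) = B.bd (TT f)}" for f g
    proof -
      have fg: "f \<in> FF (Suc (Suc m))" "g \<in> FF (Suc (Suc m))" using that by auto
      have "dd (f + g) = dd f + dd g" unfolding dd_fsum using fg by (rule fsum_add)
      then show ?thesis using that fg fsum_add[OF dd_FF[OF fg(1)] dd_FF[OF fg(2)], of tau] fsum_add[OF fg, of tau]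
        by (simp add: lin_add[OF B.lin_bd] fv.subspace_add fin_funs_subspace)
    qed
    show "sc s f \<in> {f \<in> FF (Suc (Suc m)). TT (dd f) = B.bd (TT f)}"
      if "f \<in> {f \<in> FF (Suc (Suc m)). TT (dd f) = B.bd (TT f)}" for s f
    proof -
      have fg: "f \<in> FF (Suc (Suc m))" using that by auto
      have "dd (sc s f) = sc s (dd f)" unfolding dd_fsum using fg by (rule fsum_sc)
      then show ?thesis using that fg fsum_sc[OF dd_FF[OF fg], of tau s] fsum_sc[OF fg, of tau s]
        by (simp add: lin_sc[OF B.lin_bd] fv.subspace_scale fin_funs_subspace)
    qed
  qed
  fix t assume t: "t \<in> tuples R (Suc (Suc m))"
  have b: "basis_elt (hochschild_face R i t) \<in> FF (Suc m)" if "i < length t" for i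
    using face_tuple[OF t that] by (rule basis_elt_fin_funs)
  have "TT (dd (basis_elt t)) = (\<Sum>i<length t. TT (sc ((- 1) ^ i) (basis_elt (hochschild_face R i t))))"
    unfolding dd_fsum fsum_basis_elt
    by (rule fsum_sum) (auto intro!: fv.subspace_scale fin_funs_subspace b)
  also have "\<dots> = (\<Sum>i<length t. sc ((- 1) ^ i) (tau (hochschild_face R i t)))"
    by (intro sum.cong refl) (simp add: fsum_sc[OF b])
  also have "\<dots> = B.bd (TT (basis_elt t))" by (simp add: faces_ev[OF t])
  finally show "TT (dd (basis_elt t)) = B.bd (TT (basis_elt t))" .
qed

definition cst :: "nat \<Rightarrow> ('a list \<Rightarrow> 'k) \<Rightarrow> ('a list \<Rightarrow> 'k) set" where
  "cst m z = {b + z | b. b \<in> tensor_relations R m}"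

lemma tensor_presents: "presents (FF m) (tensor_relations R m) (tensor_power R m) (cst m)"
proof -
  have "presents (FF m) (tensor_relations R m)
    (ksubquot (free_space (tuples R m)) ((\<lambda>x. x) ` FF m) ((\<lambda>x. x) ` tensor_relations R m))
    (\<lambda>z. (\<lambda>x. x) ` {b + z | b. b \<in> tensor_relations R m})"
    by (rule presents_ksubquot[OF pointwise_presents[OF pointwise_free_space]])
      (auto simp: fin_funs_subspace subspace_relations relations_FF fv.subspace_0)
  moreover have "ksubquot (free_space (tuples R m)) (FF m) (tensor_relations R m) = tensor_power R m"
    unfolding tensor_power_def ksubquot_carrier[symmetric] by (simp add: free_space_def)
  ultimately show ?thesis by (simp add: cst_def[abs_def])
qed

lemma cst_eq_iff:
  "f \<in> FF m \<Longrightarrow> g \<in> FF m \<Longrightarrow> cst m f = cst m g \<longleftrightarrow> f - g \<in> tensor_relations R m"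
  using tensor_presents[of m] by (simp add: presents_def)

lemma boundary_cst:
  assumes f: "f \<in> FF (Suc (Suc m))"
  shows "hochschild_boundary R (Suc m) (cst (Suc (Suc m)) f) = cst (Suc m) (dd f)"
proof -
  have "hochschild_boundary R (Suc m) (cst (Suc (Suc m)) f) =
    (\<Union>g\<in>cst (Suc (Suc m)) f. cst (Suc m) (dd g))"
    by (auto simp: hochschild_boundary_def a_r_coset_def r_coset_def cst_def free_space_def plus_fun_def)
  also have "\<dots> = (\<Union>g\<in>cst (Suc (Suc m)) f. cst (Suc m) (dd f))"
  proof (intro SUP_cong refl)
    fix g assume "g \<in> cst (Suc (Suc m)) f"
    then obtain b where b: "b \<in> tensor_relations R (Suc (Suc m))" "g = b + f" by (auto simp: cst_def)
    have bF: "b \<in> FF (Suc (Suc m))" using b relations_FF by blast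
    have "dd g = dd b + dd f" unfolding dd_fsum b using fsum_add[OF bF f] by blast
    moreover have "dd b \<in> tensor_relations R (Suc m)"
      using b bF by (simp add: relations_iff dd_FF TT_dd lin_zero[OF B.lin_bd])
    ultimately show "cst (Suc m) (dd g) = cst (Suc m) (dd f)"
      using dd_FF[OF bF] dd_FF[OF f] by (simp add: cst_eq_iff fv.subspace_add fin_funs_subspace)
  qed
  also have "\<dots> = cst (Suc m) (dd f)"
    using fv.subspace_0[OF subspace_relations] by (auto simp: cst_def)
  finally show ?thesis .
qed

lemma cst_zero: "f \<in> FF m \<Longrightarrow> cst m f = \<zero>\<^bsub>tensor_power R m\<^esub> \<longleftrightarrow> f \<in> tensor_relations R m"
proof -
  assume f: "f \<in> FF m"
  have "\<zero>\<^bsub>tensor_power R m\<^esub> = cst m 0"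
    by (simp add: tensor_power_def kquot_def FactRing_def cst_def)
  then show ?thesis using cst_eq_iff[OF f fv.subspace_0[OF fin_funs_subspace]] by simp
qed

lemma HH_presents:
  "\<exists>(Z :: ('a list \<Rightarrow> 'k) set) B \<psi>. presents Z B (HH m R) \<psi> \<and> fv.subspace Z \<and> qiso Z B (B.cyc m) (B.bnd m)"
proof -
  let ?Z = "{f \<in> FF (Suc m). TT f \<in> B.cyc m}" and ?B = "{f \<in> FF (Suc m). TT f \<in> B.bnd m}"
  have Z: "fv.subspace ?Z" and B: "fv.subspace ?B"
    by (rule fsum_subspace_vimage, simp add: B.subspace_cyc B.subspace_bnd)+
  have cyc_iff: "f \<in> ?Z \<longleftrightarrow> f \<in> FF (Suc m) \<and> (m > 0 \<longrightarrow> dd f \<in> tensor_relations R m)" for f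
  proof (cases "f \<in> FF (Suc m)")
    case True
    then have T: "TT f \<in> tens AA AA m" using TT_image by blast
    show ?thesis
    proof (cases m)
      case 0
      then show ?thesis using True T B.bd_0 by (auto simp: B.cyc_def)
    next
      case (Suc m')
      then show ?thesis using True T dd_FF[of f m'] TT_dd[of f m']
        by (auto simp: B.cyc_def relations_iff)
    qed
  qed auto
  have car: "carrier (tensor_power R k) = cst k ` FF k" for k
    using tensor_presents[of k] by (simp add: presents_def)
  have cycles: "hochschild_cycles R m = cst (Suc m) ` ?Z"
  proof -
    have "hochschild_cycles R m = cst (Suc m) ` {f \<in> FF (Suc m). m > 0 \<longrightarrow> dd f \<in> tensor_relations R m}"
    proof -
      have "m > 0 \<longrightarrow> hochschild_boundary R m (cst (Suc m) f) = \<zero>\<^bsub>tensor_power R m\<^esub>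
        \<longleftrightarrow> dd f \<in> tensor_relations R m" if "f \<in> FF (Suc m)" for f
        using that by (cases m) (simp_all add: boundary_cst cst_zero dd_FF)
      then show ?thesis unfolding hochschild_cycles_def Suc_eq_plus1[symmetric] car by blast
    qed
    also have "{f \<in> FF (Suc m). m > 0 \<longrightarrow> dd f \<in> tensor_relations R m} = ?Z"
      using cyc_iff by blast
    finally show ?thesis .
  qed
  have boundaries: "hochschild_boundaries R m = cst (Suc m) ` ?B"
  proof -
    have "hochschild_boundaries R m = (\<lambda>f. cst (Suc m) (dd f)) ` FF (Suc (Suc m))"
      unfolding hochschild_boundaries_def by (simp add: car image_image boundary_cst cong: image_cong)
    also have "\<dots> = cst (Suc m) ` ?B"
    proof (intro subset_antisym subsetI)
      fix x assume "x \<in> (\<lambda>f. cst (Suc m) (dd f)) ` FF (Suc (Suc m))"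
      then obtain f where f: "f \<in> FF (Suc (Suc m))" "x = cst (Suc m) (dd f)" by blast
      then have "TT f \<in> tens AA AA (Suc m)" using TT_image by blast
      then have "dd f \<in> ?B" using f by (simp add: dd_FF TT_dd B.bnd_def)
      then show "x \<in> cst (Suc m) ` ?B" using f by blast
    next
      fix x assume "x \<in> cst (Suc m) ` ?B"
      then obtain f where f: "f \<in> FF (Suc m)" "TT f \<in> B.bnd m" "x = cst (Suc m) f" by blast
      then obtain \<sigma> where "\<sigma> \<in> tens AA AA (Suc m)" "TT f = B.bd \<sigma>" by (auto simp: B.bnd_def)
      then obtain g where g: "g \<in> FF (Suc (Suc m))" "TT f = B.bd (TT g)"
        using TT_image[of "Suc m"] by (metis (no_types, lifting) imageE)
      have "TT (f - dd g) = 0"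
        using fsum_diff[OF f(1) dd_FF[OF g(1)], of tau] g by (simp add: TT_dd)
      moreover have "f - dd g \<in> FF (Suc m)" using f dd_FF[OF g(1)] by (simp add: fv.subspace_diff fin_funs_subspace)
      ultimately have "cst (Suc m) f = cst (Suc m) (dd g)"
        using f dd_FF[OF g(1)] by (simp add: cst_eq_iff relations_iff)
      then show "x \<in> (\<lambda>f. cst (Suc m) (dd f)) ` FF (Suc (Suc m))" using f g by blast
    qed
    finally show ?thesis .
  qed
  have P: "presents ?Z ?B (ksubquot (tensor_power R (Suc m)) (cst (Suc m) ` ?Z) (cst (Suc m) ` ?B))
      (\<lambda>z. cst (Suc m) ` {b + z | b. b \<in> ?B})"
  proof (rule presents_ksubquot[OF tensor_presents fin_funs_subspace Z B])
    show "tensor_relations R (Suc m) \<subseteq> ?B"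
    proof
      fix f assume f: "f \<in> tensor_relations R (Suc m)"
      then have "f \<in> FF (Suc m)" using relations_FF by blast
      then show "f \<in> ?B" using f fv.subspace_0[OF B.subspace_bnd] by (simp add: relations_iff)
    qed
    show "?B \<subseteq> ?Z" using B.bnd_cyc by auto
  qed auto
  have Q: "qiso ?Z ?B (B.cyc m) (B.bnd m)"
  proof (rule qisoI[where Q = "\<lambda>x y. x \<in> ?Z \<and> y = TT x"])
    fix y assume y: "y \<in> B.cyc m"
    then have "y \<in> TT ` FF (Suc m)" by (simp add: TT_image B.cyc_def)
    then show "\<exists>x. x \<in> ?Z \<and> y = TT x" using y by blast
  next
    fix x y x' y' assume *: "x \<in> ?Z \<and> x' = TT x" "y \<in> ?Z \<and> y' = TT y"
    then show "x + y \<in> ?Z \<and> x' + y' = TT (x + y)"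
      using fv.subspace_add[OF Z, of x y] fsum_add[of x "tuples R (Suc m)" y tau] by simp
  next
    fix s x x' assume "x \<in> ?Z \<and> x' = TT x"
    then show "sc s x \<in> ?Z \<and> sc s x' = TT (sc s x)"
      using fv.subspace_scale[OF Z, of x s] fsum_sc[of x "tuples R (Suc m)" tau s] by simp
  qed auto
  show ?thesis
    unfolding HH_def cycles boundaries Suc_eq_plus1[symmetric]
    by (intro exI conjI) (rule P, rule Z, rule Q)
qed

end

section \<open>Ore extensions of group algebras\<close>

locale ore_group = group G for G :: "('g, 'h) monoid_scheme" (structure) +
  fixes \<chi> :: "'g \<Rightarrow> 'k::field_char_0"
  assumes fin: "finite (carrier G)"
    and chi_mult: "g \<in> carrier G \<Longrightarrow> h \<in> carrier G \<Longrightarrow> \<chi> (g \<otimes> h) = \<chi> g * \<chi> h"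
    and chi_nz: "g \<in> carrier G \<Longrightarrow> \<chi> g \<noteq> 0"
begin

lemma chi_one: "\<chi> \<one> = 1"
  using chi_mult[of \<one> \<one>] chi_nz[of \<one>] by simp

abbreviation "K \<equiv> (group_algebra G :: ('k, 'g \<Rightarrow> 'k) module)"
abbreviation "FG \<equiv> (fin_funs (carrier G) :: ('g \<Rightarrow> 'k) set)"
abbreviation "FO \<equiv> (fin_funs (UNIV \<times> carrier G) :: (nat \<times> 'g \<Rightarrow> 'k) set)"

lemma pwK: "pointwise (carrier G) K"
  by (rule pointwise_group_algebra)

lemma FO_0: "0 \<in> FO"
  and FO_add: "f \<in> FO \<Longrightarrow> h \<in> FO \<Longrightarrow> f + h \<in> FO"
  and FO_diff: "f \<in> FO \<Longrightarrow> h \<in> FO \<Longrightarrow> f - h \<in> FO"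
  and FO_neg: "f \<in> FO \<Longrightarrow> - f \<in> FO"
  and FO_sc: "f \<in> FO \<Longrightarrow> sc a f \<in> FO"
  by (simp_all add: fv.subspace_0 fv.subspace_add fv.subspace_diff fv.subspace_neg fv.subspace_scale
      fin_funs_subspace)

lemmas FO_sub = FO_0 FO_add FO_diff FO_neg FO_sc

text \<open>The product of \<open>k[G]\<close>, bilinear without side conditions.\<close>

definition cv :: "('g \<Rightarrow> 'k) \<Rightarrow> ('g \<Rightarrow> 'k) \<Rightarrow> 'g \<Rightarrow> 'k" where
  "cv f h = extend (carrier G) (\<lambda>y. extend (carrier G) (\<lambda>x. basis_elt (x \<otimes> y)) f) h"

lemma lin_cv: "lin (\<lambda>f. cv f h)" "lin (cv f)"
  unfolding cv_def[abs_def] by (intro lin_extend_family lin_extend)+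

lemma cv_basis: "x \<in> carrier G \<Longrightarrow> y \<in> carrier G \<Longrightarrow> cv (basis_elt x) (basis_elt y) = basis_elt (x \<otimes> y)"
  by (simp add: cv_def extend_basis_elt fin)

lemma K_mult:
  assumes "f \<in> FG" "h \<in> FG"
  shows "f \<otimes>\<^bsub>K\<^esub> h = cv f h"
proof
  fix z
  have fs: "{x. f x \<noteq> 0} \<subseteq> carrier G" "{x. h x \<noteq> 0} \<subseteq> carrier G" using assms by (auto simp: fin_funs_def)
  have "(f \<otimes>\<^bsub>K\<^esub> h) z = (\<Sum>x\<in>carrier G. \<Sum>y\<in>carrier G. if x \<otimes> y = z then f x * h y else 0)"
    unfolding group_algebra_def monoid.simps
  proof (rule sum.mono_neutral_cong_left[OF fin fs(1)])
    show "\<forall>i\<in>carrier G - {x. f x \<noteq> 0}. (\<Sum>y\<in>carrier G. if i \<otimes> y = z then f i * h y else 0) = 0"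
      by (intro ballI sum.neutral) auto
    show "(\<Sum>y\<in>{y. h y \<noteq> 0}. if x \<otimes> y = z then f x * h y else 0) =
        (\<Sum>y\<in>carrier G. if x \<otimes> y = z then f x * h y else 0)" for x
      by (rule sum.mono_neutral_left[OF fin fs(2)]) auto
  qed
  also have "\<dots> = (\<Sum>y\<in>carrier G. \<Sum>x\<in>carrier G. if x \<otimes> y = z then f x * h y else 0)"
    by (rule sum.swap)
  also have "\<dots> = cv f h z"
    unfolding cv_def extend_def sum_fun_apply sc_apply sum_distrib_left
    by (intro sum.cong refl) (auto simp: basis_elt_def)
  finally show "(f \<otimes>\<^bsub>K\<^esub> h) z = cv f h z" .
qed

lemma char_aut_pow: "(char_aut \<chi> ^^ i) f = (\<lambda>g. \<chi> g ^ i * f g)"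
  by (induction i) (auto simp: char_aut_def)

lemma char_aut_FG: "f \<in> FG \<Longrightarrow> (char_aut \<chi> ^^ i) f \<in> FG"
  unfolding char_aut_pow fin_funs_def by (auto intro: finite_subset)

lemma abelian_monoid_K: "abelian_monoid K"
  using pwK fin_funs_subspace[of "carrier G"]
  by (intro abelian_monoidI) (auto simp: pointwise_def fv.subspace_def add.assoc add.commute)

lemma finsum_K: "finite I \<Longrightarrow> (\<And>i. i \<in> I \<Longrightarrow> f i \<in> FG) \<Longrightarrow> finsum K f I = (\<Sum>i\<in>I. f i)"
proof (induction I rule: finite_induct)
  case empty
  interpret abelian_monoid K by (rule abelian_monoid_K)
  show ?case using pwK by (simp add: pointwise_def)
next
  case (insert x I)
  interpret abelian_monoid K by (rule abelian_monoid_K)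
  have "f \<in> I \<rightarrow> carrier K" "f x \<in> carrier K"
    using insert pwK by (auto simp: pointwise_def)
  then show ?case using insert pwK by (simp add: pointwise_def)
qed

text \<open>Ore polynomials are treated as functions on \<open>\<nat> \<times> G\<close>, with
  basis element \<open>(i, g)\<close> standing for \<open>g x\<^sup>i\<close>; \<open>om\<close>
  is their product. Identities are then verified on monomials.\<close>

definition sl :: "nat \<Rightarrow> (nat \<times> 'g \<Rightarrow> 'k) \<Rightarrow> 'g \<Rightarrow> 'k" where
  "sl i f = (\<lambda>g. f (i, g))"

definition om :: "(nat \<times> 'g \<Rightarrow> 'k) \<Rightarrow> (nat \<times> 'g \<Rightarrow> 'k) \<Rightarrow> nat \<times> 'g \<Rightarrow> 'k" where
  "om f h = (\<lambda>(m, z). (\<Sum>i\<le>m. cv (sl i f) ((char_aut \<chi> ^^ i) (sl (m - i) h))) z)"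

lemma lin_sl: "lin (sl i)"
  by (auto simp: lin_def sl_def fun_eq_iff fun_ap)

lemma lin_char_aut: "lin (char_aut \<chi> ^^ i)"
  by (auto simp: lin_def char_aut_pow fun_eq_iff fun_ap algebra_simps)

lemma lin_om: "lin (\<lambda>f. om f h)" "lin (om f)"
  unfolding lin_def
  by (auto simp: om_def fun_eq_iff plus_fun_apply sc_apply sum_fun_apply sum.distrib sum_distrib_left
      lin_add[OF lin_sl] lin_sc[OF lin_sl] lin_add[OF lin_cv(1)] lin_sc[OF lin_cv(1)]
      lin_add[OF lin_cv(2)] lin_sc[OF lin_cv(2)] lin_add[OF lin_char_aut] lin_sc[OF lin_char_aut])

lemma sl_basis: "sl i (basis_elt (j, g)) = (if i = j then basis_elt g else 0)"
  by (auto simp: sl_def basis_elt_def fun_eq_iff zero_fun_apply)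

lemma om_basis:
  assumes "g \<in> carrier G" "h \<in> carrier G"
  shows "om (basis_elt (i, g)) (basis_elt (l, h)) = sc (\<chi> h ^ i) (basis_elt (i + l, g \<otimes> h))"
proof
  fix x :: "nat \<times> 'g"
  obtain m z where x: "x = (m, z)" by (cases x)
  have ca: "(char_aut \<chi> ^^ j) (basis_elt h) = sc (\<chi> h ^ j) (basis_elt h)" for j
    by (auto simp: char_aut_pow basis_elt_def fun_eq_iff sc_apply)
  have "(\<Sum>j\<le>m. cv (sl j (basis_elt (i, g))) ((char_aut \<chi> ^^ j) (sl (m - j) (basis_elt (l, h))))) =
      (\<Sum>j\<le>m. if j = i then (if m - i = l then sc (\<chi> h ^ i) (basis_elt (g \<otimes> h)) else 0) else 0)"
    using assms by (intro sum.cong refl)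
      (auto simp: sl_basis ca lin_sc[OF lin_cv(2)] cv_basis lin_zero[OF lin_cv(1)] lin_zero[OF lin_cv(2)]
        lin_zero[OF lin_char_aut])
  also have "\<dots> = (if m = i + l then sc (\<chi> h ^ i) (basis_elt (g \<otimes> h)) else 0)"
    by (auto simp: sum.delta)
  finally show "om (basis_elt (i, g)) (basis_elt (l, h)) x = sc (\<chi> h ^ i) (basis_elt (i + l, g \<otimes> h)) x"
    by (auto simp: x om_def basis_elt_def sc_apply zero_fun_apply)
qed

lemma FO_basis: "g \<in> carrier G \<Longrightarrow> basis_elt (i, g) \<in> FO"
  by (simp add: basis_elt_fin_funs)

lemma FO_eq:
  assumes "lin F" "lin H" "\<And>i g. g \<in> carrier G \<Longrightarrow> F (basis_elt (i, g)) = H (basis_elt (i, g))" "f \<in> FO"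
  shows "F f = H f"
  by (rule lin_fin_funs_eq[OF assms(1,2) _ assms(4)]) (use assms(3) in auto)

lemma FO_in:
  assumes "lin F" "fv.subspace V" "\<And>i g. g \<in> carrier G \<Longrightarrow> F (basis_elt (i, g)) \<in> V" "f \<in> FO"
  shows "F f \<in> V"
  by (rule lin_fin_funs_in[OF assms(1,2) _ assms(4)]) (use assms(3) in auto)

lemma om_FO: "f \<in> FO \<Longrightarrow> h \<in> FO \<Longrightarrow> om f h \<in> FO"
proof (erule FO_in[OF lin_om(1) fin_funs_subspace, rotated])
  fix i g assume g: "g \<in> carrier G" and h: "h \<in> FO"
  show "om (basis_elt (i, g)) h \<in> FO"
    by (rule FO_in[OF lin_om(2) fin_funs_subspace _ h])
      (simp add: om_basis g fv.subspace_scale fin_funs_subspace FO_basis)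
qed

lemma om_assoc:
  assumes "f \<in> FO" "h \<in> FO" "k \<in> FO"
  shows "om (om f h) k = om f (om h k)"
proof (rule FO_eq[OF _ _ _ assms(1)])
  show "lin (\<lambda>f. om (om f h) k)" "lin (\<lambda>f. om f (om h k))"
    by (intro lin_comp[OF lin_om(1) lin_om(1)] lin_om)+
  fix i g assume g: "g \<in> carrier G"
  show "om (om (basis_elt (i, g)) h) k = om (basis_elt (i, g)) (om h k)"
  proof (rule FO_eq[OF _ _ _ assms(2)])
    show "lin (\<lambda>h. om (om (basis_elt (i, g)) h) k)" "lin (\<lambda>h. om (basis_elt (i, g)) (om h k))"
      by (intro lin_comp[OF lin_om(1) lin_om(2)] lin_comp[OF lin_om(2) lin_om(1)])+
    fix j h assume h: "h \<in> carrier G"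
    show "om (om (basis_elt (i, g)) (basis_elt (j, h))) k = om (basis_elt (i, g)) (om (basis_elt (j, h)) k)"
    proof (rule FO_eq[OF _ _ _ assms(3)])
      show "lin (om (om (basis_elt (i, g)) (basis_elt (j, h))))" by (rule lin_om)
      show "lin (\<lambda>k. om (basis_elt (i, g)) (om (basis_elt (j, h)) k))" by (rule lin_comp[OF lin_om(2) lin_om(2)])
      show "om (om (basis_elt (i, g)) (basis_elt (j, h))) (basis_elt (l, k)) =
          om (basis_elt (i, g)) (om (basis_elt (j, h)) (basis_elt (l, k)))" if "k \<in> carrier G" for l k
        using g h that
        by (simp add: om_basis lin_sc[OF lin_om(1)] lin_sc[OF lin_om(2)] m_assoc chi_mult power_add
            power_mult_distrib add.assoc mult_ac)
    qed
  qed
qed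

lemma om_one:
  assumes "f \<in> FO"
  shows "om (basis_elt (0, \<one>)) f = f" "om f (basis_elt (0, \<one>)) = f"
  by (rule FO_eq[OF _ lin_id _ assms]; simp add: lin_om om_basis chi_one)+

abbreviation "OE \<equiv> ore_extension K (char_aut \<chi>)"

text \<open>The translation from functions on pairs to sequences of elements of
  \<open>k[G]\<close>.\<close>

definition C :: "(nat \<times> 'g \<Rightarrow> 'k) \<Rightarrow> nat \<Rightarrow> 'g \<Rightarrow> 'k" where
  "C f = (\<lambda>i g. f (i, g))"

lemma C_eq_iff: "C f = C h \<longleftrightarrow> f = h"
  by (auto simp: C_def fun_eq_iff)

lemma C_surj: "\<exists>f. p = C f"
  by (rule exI[of _ "\<lambda>(i, g). p i g"]) (simp add: C_def)

lemma C_carrier: "C f \<in> carrier OE \<longleftrightarrow> f \<in> FO"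
proof
  assume "C f \<in> carrier OE"
  then obtain n where n: "bound (0 :: 'g \<Rightarrow> 'k) n (C f)" and c: "\<And>i. C f i \<in> FG"
    by (auto simp: ore_extension_def up_def group_algebra_def zero_fun_def Pi_def)
  have "f (i, g) = 0" if "i > n" for i g
    using bound.bound[OF n that] by (simp add: C_def fun_eq_iff zero_fun_apply)
  moreover have "g \<in> carrier G" if "f (i, g) \<noteq> 0" for i g
    using c[of i] that by (auto simp: fin_funs_def C_def)
  ultimately have "{s. f s \<noteq> 0} \<subseteq> {..n} \<times> carrier G"
    by (auto simp: not_less) (metis not_less)
  then show "f \<in> FO" using fin by (auto simp: fin_funs_def intro: finite_subset)
next
  assume f: "f \<in> FO"
  have "C f i \<in> FG" for i
    using f fin by (auto simp: fin_funs_def C_def intro: finite_subset)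
  moreover have "\<exists>n. bound (0 :: 'g \<Rightarrow> 'k) n (C f)"
  proof (intro exI bound.intro)
    have fs: "finite (fst ` {s. f s \<noteq> 0})" using f by (simp add: fin_funs_def)
    fix m assume m: "Max (insert 0 (fst ` {s. f s \<noteq> 0})) < m"
    have "f (m, g) = 0" for g
    proof (rule ccontr)
      assume "f (m, g) \<noteq> 0"
      then have "m \<in> fst ` {s. f s \<noteq> 0}" by force
      then have "m \<le> Max (insert 0 (fst ` {s. f s \<noteq> 0}))" using fs by (intro Max_ge) auto
      then show False using m by simp
    qed
    then show "C f m = 0" by (simp add: C_def fun_eq_iff zero_fun_apply)
  qed
  ultimately show "C f \<in> carrier OE"
    by (auto simp: ore_extension_def up_def group_algebra_def zero_fun_def)
qed

lemma C_add: "C f \<oplus>\<^bsub>OE\<^esub> C h = C (f + h)"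
  by (simp add: ore_extension_def group_algebra_def C_def fun_eq_iff plus_fun_apply)

lemma C_zero: "\<zero>\<^bsub>OE\<^esub> = C 0"
  by (simp add: ore_extension_def group_algebra_def C_def fun_eq_iff zero_fun_apply)

lemma C_one: "\<one>\<^bsub>OE\<^esub> = C (basis_elt (0, \<one>))"
  by (auto simp: ore_extension_def group_algebra_def C_def fun_eq_iff basis_elt_def)

lemma C_smult: "a \<odot>\<^bsub>OE\<^esub> C f = C (sc a f)"
  by (simp add: ore_extension_def group_algebra_def C_def fun_eq_iff sc_apply)

lemma C_monom: "ore_monom K j k = C (\<lambda>(i, g). if i = j then k g else 0)"
  by (auto simp: ore_monom_def C_def fun_eq_iff group_algebra_def)

lemma C_mult:
  assumes "f \<in> FO" "h \<in> FO"
  shows "C f \<otimes>\<^bsub>OE\<^esub> C h = C (om f h)"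
proof
  fix m
  have sl: "sl i f \<in> FG" "sl i h \<in> FG" for i
    using assms fin by (auto simp: fin_funs_def sl_def intro: finite_subset)
  have Ks: "cv u v \<in> FG" if "u \<in> FG" "v \<in> FG" for u v
    unfolding cv_def by (intro extend_in fin_funs_subspace basis_elt_fin_funs) auto
  have "(C f \<otimes>\<^bsub>OE\<^esub> C h) m = finsum K (\<lambda>i. sl i f \<otimes>\<^bsub>K\<^esub> (char_aut \<chi> ^^ i) (sl (m - i) h)) {..m}"
    by (simp add: ore_extension_def C_def sl_def)
  also have "(\<lambda>i. sl i f \<otimes>\<^bsub>K\<^esub> (char_aut \<chi> ^^ i) (sl (m - i) h)) =
      (\<lambda>i. cv (sl i f) ((char_aut \<chi> ^^ i) (sl (m - i) h)))"
    by (intro ext K_mult sl char_aut_FG)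
  also have "finsum K \<dots> {..m} = (\<Sum>i\<le>m. cv (sl i f) ((char_aut \<chi> ^^ i) (sl (m - i) h)))"
    by (rule finsum_K) (auto intro!: Ks sl char_aut_FG)
  finally show "(C f \<otimes>\<^bsub>OE\<^esub> C h) m = C (om f h) m"
    by (simp add: C_def om_def)
qed

lemma OE_carrierE: "p \<in> carrier OE \<Longrightarrow> (\<And>f. f \<in> FO \<Longrightarrow> p = C f \<Longrightarrow> P) \<Longrightarrow> P"
  using C_surj[of p] C_carrier by auto

lemma ring_OE: "ring OE"
proof (rule ringI)
  show "abelian_group OE"
  proof (rule abelian_groupI)
    show "\<exists>y\<in>carrier OE. y \<oplus>\<^bsub>OE\<^esub> x = \<zero>\<^bsub>OE\<^esub>" if "x \<in> carrier OE" for x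
      using that
    proof (rule OE_carrierE)
      fix f assume f: "f \<in> FO" "x = C f"
      then have "- f \<in> FO" by (intro fv.subspace_neg fin_funs_subspace)
      then show ?thesis using f by (intro bexI[of _ "C (- f)"]) (simp_all add: C_add C_zero C_carrier)
    qed
  qed (auto elim!: OE_carrierE simp: C_add C_zero C_carrier C_eq_iff add_ac FO_sub)
  show "Group.monoid OE"
    by (rule monoidI) (auto elim!: OE_carrierE simp: C_mult C_one C_carrier C_eq_iff om_FO om_assoc om_one FO_basis)
qed (auto elim!: OE_carrierE simp: C_mult C_add C_carrier C_eq_iff om_FO lin_add[OF lin_om(1)] lin_add[OF lin_om(2)]
    FO_sub)

lemma C_minus: "f \<in> FO \<Longrightarrow> h \<in> FO \<Longrightarrow> C f \<ominus>\<^bsub>OE\<^esub> C h = C (f - h)"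
proof -
  interpret ring OE by (rule ring_OE)
  assume f: "f \<in> FO" and h: "h \<in> FO"
  have m: "- h \<in> FO" "f - h \<in> FO" using f h by (auto intro: fv.subspace_neg fv.subspace_diff fin_funs_subspace)
  have "\<ominus>\<^bsub>OE\<^esub> C h = C (- h)"
    by (rule minus_equality) (use h m in \<open>simp_all add: C_add C_zero C_carrier\<close>)
  then show ?thesis by (simp add: a_minus_def C_add)
qed

lemma C_presents: "presents FO {0} OE C"
proof -
  have "C ` FO = carrier OE" by (auto simp: C_carrier elim!: OE_carrierE)
  then show ?thesis by (simp add: presents_def C_add C_smult C_eq_iff)
qed

end

text \<open>The rank one algebra of \<open>G\<close> is the model algebra of a quotient
  \<open>\<pi>: G \<rightarrow> G'\<close>. There are two situations. Either
  \<open>\<pi>\<close> is injective and \<open>\<xi>' = \<xi>\<close>; or \<open>\<xi> \<noteq>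
  0\<close> and \<open>\<chi>\<^sup>n\<close> is nontrivial, in which case \<open>c =
  g\<^sub>1\<^sup>n\<close> becomes 1 in the algebra, so that \<open>G' = G /
  \<langle>c\<rangle>\<close> and \<open>\<xi>' = 0\<close>.\<close>

locale ore_quotient = ore_group G \<chi> + M: model G' \<chi>' n "\<pi> g1" \<xi>'
  for G :: "('g, 'h) monoid_scheme" (structure) and \<chi> :: "'g \<Rightarrow> 'k::field_char_0"
    and G' :: "('g2, 'h2) monoid_scheme" and \<chi>' :: "'g2 \<Rightarrow> 'k" and n and g1 :: 'g and \<pi> :: "'g \<Rightarrow> 'g2" and \<xi>' +
  fixes \<xi> :: 'k
  assumes pi: "\<pi> \<in> hom G G'" "\<pi> ` carrier G = carrier G'"
    and chi_pi: "g \<in> carrier G \<Longrightarrow> \<chi> g = \<chi>' (\<pi> g)"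
    and g1G: "g1 \<in> carrier G"
    and kernel: "(\<xi>' = \<xi> \<and> inj_on \<pi> (carrier G)) \<or>
      (\<xi>' = 0 \<and> (\<forall>g\<in>carrier G. \<forall>h\<in>carrier G. \<pi> g = \<pi> h \<longrightarrow> inv g \<otimes> h \<in> generate G {g1 [^] n}) \<and>
        \<pi> (g1 [^] n) = \<one>\<^bsub>G'\<^esub> \<and> \<xi> \<noteq> 0 \<and> (\<exists>h\<in>carrier G. \<chi> h ^ n \<noteq> 1))"
    and g1c: "g \<in> carrier G \<Longrightarrow> g1 \<otimes> g = g \<otimes> g1"
begin

abbreviation "cc \<equiv> g1 [^] n"

lemma cc: "cc \<in> carrier G" by (simp add: g1G)

lemma pi_closed: "g \<in> carrier G \<Longrightarrow> \<pi> g \<in> carrier G'"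
  using pi(2) by auto

lemma pi_mult: "g \<in> carrier G \<Longrightarrow> h \<in> carrier G \<Longrightarrow> \<pi> (g \<otimes> h) = \<pi> g \<otimes>\<^bsub>G'\<^esub> \<pi> h"
  using pi(1) by (simp add: hom_def)

lemma pi_one: "\<pi> \<one> = \<one>\<^bsub>G'\<^esub>"
  using hom_one[OF pi(1) is_group M.is_group] .

lemma pi_cc: "\<pi> cc = M.c"
proof -
  have "\<pi> (g1 [^] m) = \<pi> g1 [^]\<^bsub>G'\<^esub> m" for m :: nat
    by (induction m) (simp_all add: pi_one pi_mult g1G)
  then show ?thesis by (simp add: M.c_def)
qed

lemma chi_cc: "\<chi> cc = 1"
  using chi_pi[OF cc] by (simp add: pi_cc)

lemma cc_central: "g \<in> carrier G \<Longrightarrow> cc \<otimes> g = g \<otimes> cc"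
proof -
  assume g: "g \<in> carrier G"
  have "g1 [^] m \<otimes> g = g \<otimes> g1 [^] m" for m :: nat
  proof (induction m)
    case (Suc m)
    have "g1 [^] Suc m \<otimes> g = g1 [^] m \<otimes> (g1 \<otimes> g)" using g g1G by (simp add: m_assoc)
    also have "\<dots> = (g1 [^] m \<otimes> g) \<otimes> g1" using g g1G by (simp add: g1c m_assoc)
    also have "\<dots> = g \<otimes> g1 [^] Suc m" using Suc g g1G by (simp add: m_assoc)
    finally show ?case .
  qed (use g in simp)
  then show ?thesis by simp
qed

definition rel :: "nat \<times> 'g \<Rightarrow> 'k" where
  "rel = basis_elt (n, \<one>) - sc \<xi> (basis_elt (0, cc) - basis_elt (0, \<one>))"

lemma rel_FO: "rel \<in> FO"
  unfolding rel_def by (intro fv.subspace_diff fv.subspace_scale fin_funs_subspace FO_basis cc one_closed)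

definition I where "I = Idl\<^bsub>OE\<^esub> {C rel}"

lemma ideal_I: "ideal I OE"
  unfolding I_def by (rule ring.genideal_ideal[OF ring_OE]) (simp add: C_carrier rel_FO)

lemma algebra_eq: "rank_one_algebra G \<chi> n g1 \<xi> = kquot OE I"
proof -
  let ?r = "\<xi> \<odot>\<^bsub>K\<^esub> (basis_elt cc \<ominus>\<^bsub>K\<^esub> \<one>\<^bsub>K\<^esub>)"
  let ?x = "ore_monom K 1 \<one>\<^bsub>K\<^esub>"
  have one: "\<one>\<^bsub>K\<^esub> = basis_elt \<one>" by (simp add: group_algebra_def)
  have "?r = sc \<xi> (basis_elt cc - basis_elt \<one>)"
    unfolding one using pointwise_a_minus[OF pwK, of "basis_elt \<one>" "basis_elt cc"] pwK
    by (simp add: pointwise_def basis_elt_fin_funs)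
  then have r: "ore_monom K 0 ?r = C (sc \<xi> (basis_elt (0, cc) - basis_elt (0, \<one>)))"
    unfolding C_monom C_eq_iff by (auto simp: fun_eq_iff fun_ap basis_elt_def)
  have x: "?x = C (basis_elt (1, \<one>))"
    unfolding C_monom one C_eq_iff by (auto simp: fun_eq_iff basis_elt_def)
  have "?x [^]\<^bsub>OE\<^esub> m = C (basis_elt (m, \<one>))" for m :: nat
  proof (induction m)
    case 0
    show ?case by (simp add: C_one)
  next
    case (Suc m)
    interpret O: ring OE by (rule ring_OE)
    show ?case unfolding O.nat_pow_Suc Suc unfolding x
      by (simp add: C_mult FO_basis om_basis chi_one)
  qed
  moreover have "sc \<xi> (basis_elt (0, cc) - basis_elt (0, \<one>)) \<in> FO"
    by (intro fv.subspace_diff fv.subspace_scale fin_funs_subspace FO_basis cc one_closed)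
  ultimately show ?thesis
    unfolding rank_one_algebra_def Let_def r
    by (simp add: I_def rel_def C_minus FO_basis)
qed

text \<open>The ideal of relations, seen in functions on \<open>\<nat> \<times> G\<close>. It is
  shown to be the kernel of the evaluation \<open>EV\<close> in the model, by means of the
  normal forms \<open>NF\<close>.\<close>

definition J where "J = {f \<in> FO. C f \<in> I}"

lemma J_FO: "J \<subseteq> FO" by (auto simp: J_def)

lemma J_left: "f \<in> FO \<Longrightarrow> h \<in> J \<Longrightarrow> om f h \<in> J"
  using ideal.I_l_closed[OF ideal_I, of "C h" "C f"] by (auto simp: J_def C_carrier C_mult om_FO)

lemma J_right: "f \<in> FO \<Longrightarrow> h \<in> J \<Longrightarrow> om h f \<in> J"
  using ideal.I_r_closed[OF ideal_I, of "C h" "C f"] by (auto simp: J_def C_carrier C_mult om_FO)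

lemma subspace_J: "fv.subspace J"
  unfolding fv.subspace_def
proof (intro conjI ballI allI)
  interpret I: ideal I OE by (rule ideal_I)
  have z: "0 \<in> FO" by (intro fv.subspace_0 fin_funs_subspace)
  show "0 \<in> J" using additive_subgroup.zero_closed[OF I.is_additive_subgroup] z
    by (simp add: J_def C_zero)
  show "x + y \<in> J" if "x \<in> J" "y \<in> J" for x y
    using additive_subgroup.a_closed[OF I.is_additive_subgroup, of "C x" "C y"] that
    by (auto simp: J_def C_add FO_sub)
  show "sc a x \<in> J" if "x \<in> J" for a x
  proof -
    have "om (sc a (basis_elt (0, \<one>))) x \<in> J"
      by (intro J_left that fv.subspace_scale fin_funs_subspace FO_basis one_closed)
    then show ?thesis using that J_FO by (simp add: lin_sc[OF lin_om(1)] om_one subset_iff)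
  qed
qed

lemma rel_J: "rel \<in> J"
  using ring.genideal_self'[OF ring_OE, of "C rel"] by (simp add: J_def I_def rel_FO C_carrier)

lemma C_J: "C ` J = I"
proof
  interpret I: ideal I OE by (rule ideal_I)
  show "I \<subseteq> C ` J"
  proof
    fix p assume p: "p \<in> I"
    then have "p \<in> carrier OE" using I.a_subset by blast
    then obtain f where "f \<in> FO" "p = C f" by (rule OE_carrierE)
    then show "p \<in> C ` J" using p by (auto simp: J_def)
  qed
qed (auto simp: J_def)

lemma quotient_presents:
  "presents FO J (rank_one_algebra G \<chi> n g1 \<xi>) (\<lambda>f. I +>\<^bsub>OE\<^esub> C f)"
proof -
  have "presents FO J (ksubquot OE (C ` FO) (C ` J)) (\<lambda>z. C ` {b + z | b. b \<in> J})"
    by (rule presents_ksubquot[OF C_presents])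
      (auto simp: fin_funs_subspace subspace_J J_FO fv.subspace_0)
  moreover have "C ` FO = carrier OE" using C_presents by (simp add: presents_def)
  moreover have "C ` {b + z | b. b \<in> J} = I +>\<^bsub>OE\<^esub> C z" for z
  proof -
    have "I +>\<^bsub>OE\<^esub> C z = (\<lambda>p. p \<oplus>\<^bsub>OE\<^esub> C z) ` C ` J"
      unfolding C_J by (auto simp: a_r_coset_def r_coset_def)
    also have "\<dots> = C ` {b + z | b. b \<in> J}"
      by (simp add: Setcompr_eq_image image_image C_add)
    finally show ?thesis ..
  qed
  ultimately show ?thesis by (simp add: algebra_eq C_J ksubquot_carrier)
qed

text \<open>Evaluation of an Ore polynomial in the model algebra, \<open>g x\<^sup>i \<mapsto>
  \<pi>(g) x\<^sup>i\<close>.\<close>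

definition EV :: "(nat \<times> 'g \<Rightarrow> 'k) \<Rightarrow> 'g2 \<times> nat \<Rightarrow> 'k" where
  "EV = fsum (\<lambda>(i, g). M.mon (\<pi> g) i)"

lemma EV_add: "f \<in> FO \<Longrightarrow> h \<in> FO \<Longrightarrow> EV (f + h) = EV f + EV h"
  unfolding EV_def by (rule fsum_add)

lemma EV_sc: "f \<in> FO \<Longrightarrow> EV (sc a f) = sc a (EV f)"
  unfolding EV_def by (rule fsum_sc)

lemma EV_diff: "f \<in> FO \<Longrightarrow> h \<in> FO \<Longrightarrow> EV (f - h) = EV f - EV h"
  unfolding EV_def by (rule fsum_diff)

lemma EV_basis: "EV (basis_elt (i, g)) = M.mon (\<pi> g) i"
  by (simp add: EV_def)

lemma FO_induct:
  assumes "f \<in> FO" "\<And>i g. g \<in> carrier G \<Longrightarrow> P (basis_elt (i, g))" "P 0"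
    "\<And>a f h. f \<in> FO \<Longrightarrow> h \<in> FO \<Longrightarrow> P f \<Longrightarrow> P h \<Longrightarrow> P (f + h)"
    "\<And>a f. f \<in> FO \<Longrightarrow> P f \<Longrightarrow> P (sc a f)"
  shows "P f"
proof (rule fsum_induct[OF assms(1)])
  show "fv.subspace {f \<in> FO. P f}"
    using assms(3-5) fin_funs_subspace[of "UNIV \<times> carrier G"] by (auto simp: fv.subspace_def)
qed (use assms(2) in auto)

lemma EV_zero: "EV 0 = 0"
  by (simp add: EV_def)

lemma EV_AA: "f \<in> FO \<Longrightarrow> EV f \<in> M.AA"
  by (rule FO_induct[where P = "\<lambda>f. EV f \<in> M.AA"])
    (auto simp: EV_basis EV_add EV_sc M.mon_AA pi_closed fv.subspace_add fv.subspace_scale M.subspaces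
      EV_zero fv.subspace_0)

lemma EV_om:
  assumes f: "f \<in> FO" and h: "h \<in> FO"
  shows "EV (om f h) = M.lA (EV f) (EV h)"
proof (rule FO_induct[OF f, where P = "\<lambda>f. EV (om f h) = M.lA (EV f) (EV h)"])
  fix i g assume g: "g \<in> carrier G"
  show "EV (om (basis_elt (i, g)) h) = M.lA (EV (basis_elt (i, g))) (EV h)"
  proof (rule FO_induct[OF h, where P = "\<lambda>h. EV (om (basis_elt (i, g)) h) = M.lA (EV (basis_elt (i, g))) (EV h)"])
    fix l h assume h: "h \<in> carrier G"
    show "EV (om (basis_elt (i, g)) (basis_elt (l, h))) = M.lA (EV (basis_elt (i, g))) (EV (basis_elt (l, h)))"
      using g h by (simp add: om_basis EV_sc FO_basis EV_basis M.lA_mon pi_closed pi_mult chi_pi)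
  qed (auto simp: lin_add[OF lin_om(2)] lin_sc[OF lin_om(2)] lin_zero[OF lin_om(2)] EV_add EV_sc EV_zero
      om_FO FO_basis g lin_add[OF M.lin_lA(2)[OF lin_id]] lin_sc[OF M.lin_lA(2)[OF lin_id]]
      lin_zero[OF M.lin_lA(2)[OF lin_id]])
qed (auto simp: lin_add[OF lin_om(1)] lin_sc[OF lin_om(1)] lin_zero[OF lin_om(1)] EV_add EV_sc EV_zero
      om_FO h lin_add[OF M.lin_lA(1)[OF lin_id]] lin_sc[OF M.lin_lA(1)[OF lin_id]]
      lin_zero[OF M.lin_lA(1)[OF lin_id]])

lemma EV_rel: "EV rel = 0"
proof -
  have b: "basis_elt (0, cc) - basis_elt (0, \<one>) \<in> FO"
    by (intro fv.subspace_diff fin_funs_subspace FO_basis cc one_closed)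
  then have b': "sc \<xi> (basis_elt (0, cc) - basis_elt (0, \<one>)) \<in> FO"
    by (intro fv.subspace_scale fin_funs_subspace)
  have "EV rel = M.mon \<one>\<^bsub>G'\<^esub> n - sc \<xi> (M.mon M.c 0 - M.mon \<one>\<^bsub>G'\<^esub> 0)"
    unfolding rel_def
    by (simp add: EV_diff[OF FO_basis b'] EV_sc[OF b] EV_diff FO_basis cc EV_basis pi_one pi_cc)
  also have "\<dots> = 0"
    using kernel M.mon_add_n[of "\<one>\<^bsub>G'\<^esub>" 0] by (auto simp: pi_cc)
  finally show ?thesis .
qed

text \<open>The kernel of \<open>EV\<close> is a two-sided ideal containing the
  relation.\<close>

lemma J_kernel: "J \<subseteq> {f \<in> FO. EV f = 0}"
proof -
  let ?N = "C ` {f \<in> FO. EV f = 0}"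
  interpret O: ring OE by (rule ring_OE)
  have "ideal ?N OE"
  proof (rule idealI[OF ring_OE])
    show "subgroup ?N (add_monoid OE)"
    proof (rule O.add.subgroupI)
      show "?N \<subseteq> carrier OE" by (auto simp: C_carrier)
      have "0 \<in> FO" by (intro fv.subspace_0 fin_funs_subspace)
      then show "?N \<noteq> {}" using EV_zero by blast
      show "\<ominus>\<^bsub>OE\<^esub> a \<in> ?N" if a: "a \<in> ?N" for a
      proof -
        obtain f where f: "f \<in> FO" "EV f = 0" "a = C f" using a by blast
        have z: "0 \<in> FO" by (intro fv.subspace_0 fin_funs_subspace)
        have "\<ominus>\<^bsub>OE\<^esub> a = \<zero>\<^bsub>OE\<^esub> \<ominus>\<^bsub>OE\<^esub> a"
          using f by (simp add: a_minus_def C_carrier)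
        also have "\<dots> = C (0 - f)" unfolding C_zero f(3) using z f(1) by (rule C_minus)
        finally show ?thesis using f z EV_diff[OF z f(1)] fv.subspace_diff[OF fin_funs_subspace z f(1)]
          by (auto simp: EV_zero)
      qed
      show "a \<oplus>\<^bsub>OE\<^esub> b \<in> ?N" if a: "a \<in> ?N" "b \<in> ?N" for a b
        using a by (auto simp: C_add EV_add intro!: imageI fv.subspace_add fin_funs_subspace)
    qed
    show "x \<otimes>\<^bsub>OE\<^esub> a \<in> ?N" "a \<otimes>\<^bsub>OE\<^esub> x \<in> ?N" if a: "a \<in> ?N" and x: "x \<in> carrier OE" for a x
      using a x
      by (auto elim!: OE_carrierE simp: C_mult EV_om om_FO lin_zero[OF M.lin_lA(1)[OF lin_id]]
          lin_zero[OF M.lin_lA(2)[OF lin_id]] intro!: imageI)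
  qed
  moreover have "C rel \<in> ?N" using EV_rel rel_FO by blast
  ultimately have "I \<subseteq> ?N" unfolding I_def by (intro O.genideal_minimal) auto
  then show ?thesis by (auto simp: J_def C_eq_iff)
qed

lemma reduce_J: "g \<in> carrier G \<Longrightarrow>
  basis_elt (i + n, g) - sc \<xi> (basis_elt (i, g \<otimes> cc) - basis_elt (i, g)) \<in> J"
  using J_left[OF FO_basis rel_J, of g i] cc
  by (simp add: rel_def lin_diff[OF lin_om(2)] lin_sc[OF lin_om(2)] om_basis chi_one chi_cc)

text \<open>If \<open>\<pi>\<close> is not injective, choose \<open>k\<close> in
  \<open>G\<close> with \<open>\<chi>(k)\<^sup>n \<noteq> 1\<close>. Modulo the relation
  \<open>x\<^sup>n\<close> equals \<open>\<xi> (c - 1)\<close>, which commutes with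
  \<open>k\<close>, whereas \<open>x\<^sup>n k = \<chi>(k)\<^sup>n k x\<^sup>n\<close>. Hence
  \<open>(\<chi>(k)\<^sup>n - 1) \<xi> k (c - 1)\<close> is a relation, and so is \<open>c -
  1\<close>.\<close>

lemma same_image_J:
  assumes g: "g \<in> carrier G" "h \<in> carrier G" and eq: "\<pi> g = \<pi> h"
  shows "basis_elt (i, g) - basis_elt (i, h) \<in> J"
  using kernel
proof
  assume "\<xi>' = \<xi> \<and> inj_on \<pi> (carrier G)"
  then have "g = h" using g eq by (auto dest: inj_onD)
  then show ?thesis using fv.subspace_0[OF subspace_J] by simp
next
  assume k0: "\<xi>' = 0 \<and> (\<forall>g\<in>carrier G. \<forall>h\<in>carrier G. \<pi> g = \<pi> h \<longrightarrow> inv g \<otimes> h \<in> generate G {cc}) \<and>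
        \<pi> cc = \<one>\<^bsub>G'\<^esub> \<and> \<xi> \<noteq> 0 \<and> (\<exists>h\<in>carrier G. \<chi> h ^ n \<noteq> 1)"
  then obtain k where k: "k \<in> carrier G" "\<chi> k ^ n \<noteq> 1" "\<xi> \<noteq> 0" by blast
  have "om rel (basis_elt (0, k)) - sc (\<chi> k ^ n) (om (basis_elt (0, k)) rel) \<in> J"
    by (intro fv.subspace_diff fv.subspace_scale subspace_J J_left J_right rel_J FO_basis k)
  moreover have "om rel (basis_elt (0, k)) - sc (\<chi> k ^ n) (om (basis_elt (0, k)) rel) =
      sc (\<xi> * (\<chi> k ^ n - 1)) (basis_elt (0, k \<otimes> cc) - basis_elt (0, k))"
  proof -
    let ?D = "basis_elt (0, k \<otimes> cc) - basis_elt (0, k) :: nat \<times> 'g \<Rightarrow> 'k"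
    have "om rel (basis_elt (0, k)) = sc (\<chi> k ^ n) (basis_elt (n, k)) - sc \<xi> ?D"
      using k cc cc_central[OF k(1)]
      by (simp add: rel_def lin_diff[OF lin_om(1)] lin_sc[OF lin_om(1)] om_basis)
    moreover have "om (basis_elt (0, k)) rel = basis_elt (n, k) - sc \<xi> ?D"
      using k cc by (simp add: rel_def lin_diff[OF lin_om(2)] lin_sc[OF lin_om(2)] om_basis)
    moreover have "sc a N - sc \<xi> D - sc a (N - sc \<xi> D) = sc (\<xi> * (a - 1)) D" for a and N D :: "nat \<times> 'g \<Rightarrow> 'k"
      by (auto simp: fun_eq_iff fun_ap algebra_simps)
    ultimately show ?thesis by simp
  qed
  ultimately have killed: "sc (inverse (\<xi> * (\<chi> k ^ n - 1))) (sc (\<xi> * (\<chi> k ^ n - 1)) (basis_elt (0, k \<otimes> cc) - basis_elt (0, k))) \<in> J"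
    using fv.subspace_scale[OF subspace_J] by metis
  then have kJ: "basis_elt (0, k \<otimes> cc) - basis_elt (0, k) \<in> J"
  proof -
    have "\<xi> * (\<chi> k ^ n - 1) \<noteq> 0" using k by simp
    note inv = left_inverse[OF this]
    have "sc (inverse (\<xi> * (\<chi> k ^ n - 1))) (sc (\<xi> * (\<chi> k ^ n - 1)) y) = y" for y :: "nat \<times> 'g \<Rightarrow> 'k"
      unfolding fv.scale_scale inv by simp
    then show ?thesis using killed by simp
  qed
  have cJ: "basis_elt (i, g \<otimes> cc) - basis_elt (i, g) \<in> J" if g: "g \<in> carrier G" for g
  proof -
    have "om (basis_elt (0, g \<otimes> inv k)) (basis_elt (0, k \<otimes> cc) - basis_elt (0, k)) \<in> J"
      by (intro J_left kJ FO_basis) (use g k in auto)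
    moreover have "g \<otimes> inv k \<otimes> (k \<otimes> cc) = g \<otimes> cc" "g \<otimes> inv k \<otimes> k = g"
    proof -
      have "inv k \<otimes> (k \<otimes> cc) = cc" using k cc by (simp flip: m_assoc)
      then show "g \<otimes> inv k \<otimes> (k \<otimes> cc) = g \<otimes> cc" using g k cc by (simp add: m_assoc)
      show "g \<otimes> inv k \<otimes> k = g" using g k by (simp add: m_assoc)
    qed
    ultimately have 1: "basis_elt (0, g \<otimes> cc) - basis_elt (0, g) \<in> J"
      using g k cc by (simp add: lin_diff[OF lin_om(2)] om_basis)
    have "om (basis_elt (0, g \<otimes> cc) - basis_elt (0, g)) (basis_elt (i, \<one>)) \<in> J"
      by (intro J_right 1 FO_basis one_closed)
    then show ?thesis using g cc by (simp add: lin_diff[OF lin_om(1)] om_basis)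
  qed
  have gen: "y \<in> carrier G \<and> (\<forall>g\<in>carrier G. basis_elt (i, g \<otimes> y) - basis_elt (i, g) \<in> J)"
    if "y \<in> generate G {cc}" for y
    using that
  proof (induction rule: generate.induct)
    case one
    then show ?case using fv.subspace_0[OF subspace_J] by simp
  next
    case (incl h)
    then show ?case using cJ cc by simp
  next
    case (inv h)
    have "basis_elt (i, g \<otimes> inv cc) - basis_elt (i, g) \<in> J" if g: "g \<in> carrier G" for g
      using fv.subspace_neg[OF subspace_J cJ[of "g \<otimes> inv cc"]] g cc by (simp add: m_assoc)
    then show ?case using inv cc by simp
  next
    case (eng h1 h2)
    have "basis_elt (i, g \<otimes> (h1 \<otimes> h2)) - basis_elt (i, g) \<in> J" if g: "g \<in> carrier G" for g
    proof -
      have "(basis_elt (i, g \<otimes> h1 \<otimes> h2) - basis_elt (i, g \<otimes> h1)) + (basis_elt (i, g \<otimes> h1) - basis_elt (i, g)) \<in> J"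
        by (intro fv.subspace_add subspace_J) (use eng g in auto)
      then show ?thesis using eng g by (simp add: m_assoc)
    qed
    then show ?case using eng by simp
  qed
  have "inv g \<otimes> h \<in> generate G {cc}" using k0 g eq by blast
  from gen[OF this] have "basis_elt (i, g \<otimes> (inv g \<otimes> h)) - basis_elt (i, g) \<in> J" using g by blast
  moreover have "g \<otimes> (inv g \<otimes> h) = h" using g by (simp flip: m_assoc)
  ultimately have "basis_elt (i, h) - basis_elt (i, g) \<in> J" by simp
  from fv.subspace_neg[OF subspace_J this] show ?thesis by simp
qed

definition sect :: "'g2 \<Rightarrow> 'g" where
  "sect = inv_into (carrier G) \<pi>"

lemma sect: "x \<in> carrier G' \<Longrightarrow> sect x \<in> carrier G" "x \<in> carrier G' \<Longrightarrow> \<pi> (sect x) = x"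
  unfolding sect_def pi(2)[symmetric] by (auto intro: inv_into_into f_inv_into_f)

definition NF :: "('g2 \<times> nat \<Rightarrow> 'k) \<Rightarrow> nat \<times> 'g \<Rightarrow> 'k" where
  "NF = extend M.B1 (\<lambda>(x, i). basis_elt (i, sect x))"

lemma lin_NF: "lin NF"
  by (simp add: NF_def lin_extend)

lemma NF_FO: "NF a \<in> FO"
  unfolding NF_def by (intro extend_in fin_funs_subspace) (auto simp: M.B1_def FO_basis sect)

lemma NF_mon: "x \<in> carrier G' \<Longrightarrow> i < n \<Longrightarrow> NF (M.mon x i) = basis_elt (i, sect x)"
  by (simp add: NF_def M.mon_small extend_basis_elt M.B1_def M.fin)

lemma EV_NF: "a \<in> M.AA \<Longrightarrow> EV (NF a) = a"
proof -
  assume a: "a \<in> M.AA"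
  have "M.AA \<subseteq> {a. EV (NF a) = a}"
    unfolding M.AA_def fin_funs_eq_span
  proof (rule fv.span_minimal)
    show "basis_elt ` M.B1 \<subseteq> {a. EV (NF a) = a}"
      by (auto simp: M.B1_def NF_mon EV_basis sect simp flip: M.mon_small)
    show "fv.subspace {a. EV (NF a) = a}"
      by (auto simp: fv.subspace_def lin_zero[OF lin_NF] lin_add[OF lin_NF] lin_sc[OF lin_NF] EV_zero EV_add EV_sc NF_FO)
  qed
  then show ?thesis using a by blast
qed

text \<open>Reducing \<open>x\<^sup>n\<close> by the relation in the Ore extension matches the
  recursion of \<open>M.mon\<close>; if \<open>\<xi>' = 0\<close>, both \<open>x\<^sup>n\<close>
  and \<open>\<xi> (c - 1)\<close> vanish.\<close>

lemma normal_form_basis: "g \<in> carrier G \<Longrightarrow> basis_elt (i, g) - NF (M.mon (\<pi> g) i) \<in> J"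
proof (induction i arbitrary: g rule: M.n_induct)
  case (small i)
  then show ?case by (simp add: NF_mon pi_closed same_image_J sect)
next
  case (step i)
  note g = step(2)
  let ?d = "\<lambda>g. basis_elt (i, g) - NF (M.mon (\<pi> g) i)"
  have gc: "g \<otimes> cc \<in> carrier G" using g cc by simp
  have d: "?d (g \<otimes> cc) - ?d g \<in> J"
    using step.IH[OF gc] step.IH[OF g] subspace_J by (simp add: fv.subspace_diff)
  have N: "NF (M.mon (\<pi> g) (i + n)) = sc \<xi>' (NF (M.mon (\<pi> (g \<otimes> cc)) i) - NF (M.mon (\<pi> g) i))"
    using g cc by (simp add: M.mon_add_n lin_sc[OF lin_NF] lin_diff[OF lin_NF] pi_mult pi_cc)
  have key: "sc \<xi> (basis_elt (i, g \<otimes> cc) - basis_elt (i, g)) - NF (M.mon (\<pi> g) (i + n)) \<in> J"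
    using kernel
  proof
    assume "\<xi>' = \<xi> \<and> inj_on \<pi> (carrier G)"
    then have "sc \<xi> (basis_elt (i, g \<otimes> cc) - basis_elt (i, g)) - NF (M.mon (\<pi> g) (i + n)) = sc \<xi> (?d (g \<otimes> cc) - ?d g)"
      unfolding N by (simp add: fv.scale_right_diff_distrib algebra_simps)
    then show ?thesis using fv.subspace_scale[OF subspace_J d] by simp
  next
    assume k: "\<xi>' = 0 \<and> (\<forall>g\<in>carrier G. \<forall>h\<in>carrier G. \<pi> g = \<pi> h \<longrightarrow> inv g \<otimes> h \<in> generate G {cc}) \<and>
        \<pi> cc = \<one>\<^bsub>G'\<^esub> \<and> \<xi> \<noteq> 0 \<and> (\<exists>h\<in>carrier G. \<chi> h ^ n \<noteq> 1)"
    then have "\<pi> (g \<otimes> cc) = \<pi> g" using g cc by (simp add: pi_mult pi_closed)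
    then have "basis_elt (i, g \<otimes> cc) - basis_elt (i, g) \<in> J" by (intro same_image_J gc g)
    moreover have "NF (M.mon (\<pi> g) (i + n)) = 0" unfolding N using k by simp
    ultimately show ?thesis by (simp add: fv.subspace_scale[OF subspace_J])
  qed
  have "(basis_elt (i + n, g) - sc \<xi> (basis_elt (i, g \<otimes> cc) - basis_elt (i, g))) +
     (sc \<xi> (basis_elt (i, g \<otimes> cc) - basis_elt (i, g)) - NF (M.mon (\<pi> g) (i + n))) \<in> J"
    by (intro fv.subspace_add subspace_J reduce_J g key)
  then show ?case by simp
qed

lemma normal_form: "f \<in> FO \<Longrightarrow> f - NF (EV f) \<in> J"
proof (erule FO_induct)
  fix a f h assume *: "f \<in> FO" "h \<in> FO" "f - NF (EV f) \<in> J" "h - NF (EV h) \<in> J"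
  have "f + h - NF (EV (f + h)) = (f - NF (EV f)) + (h - NF (EV h))"
    using * by (simp add: EV_add lin_add[OF lin_NF])
  then show "f + h - NF (EV (f + h)) \<in> J" using fv.subspace_add[OF subspace_J *(3,4)] by (simp only:)
next
  fix a f assume *: "f \<in> FO" "f - NF (EV f) \<in> J"
  then show "sc a f - NF (EV (sc a f)) \<in> J"
    using fv.subspace_scale[OF subspace_J *(2), of a]
    by (simp add: EV_sc lin_sc[OF lin_NF] fv.scale_right_diff_distrib)
qed (auto simp: EV_basis normal_form_basis EV_zero lin_zero[OF lin_NF] fv.subspace_0 subspace_J)

lemma J_iff: "f \<in> FO \<Longrightarrow> f \<in> J \<longleftrightarrow> EV f = 0"
  using J_kernel normal_form[of f] by (auto simp: lin_zero[OF lin_NF])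

text \<open>The isomorphism from the quotient algebra to the model, well defined since
  \<open>J\<close> is the kernel of \<open>EV\<close>.\<close>

definition TH :: "(nat \<Rightarrow> 'g \<Rightarrow> 'k) set \<Rightarrow> 'g2 \<times> nat \<Rightarrow> 'k" where
  "TH Y = EV (SOME f. f \<in> FO \<and> I +>\<^bsub>OE\<^esub> C f = Y)"

abbreviation "Alg \<equiv> rank_one_algebra G \<chi> n g1 \<xi>"

lemma coset_eq: "f \<in> FO \<Longrightarrow> h \<in> FO \<Longrightarrow> I +>\<^bsub>OE\<^esub> C f = I +>\<^bsub>OE\<^esub> C h \<longleftrightarrow> EV f = EV h"
  using quotient_presents J_iff[of "f - h"] fv.subspace_diff[OF fin_funs_subspace, of f _ h]
  by (simp add: presents_def EV_diff)

lemma TH_coset: "f \<in> FO \<Longrightarrow> TH (I +>\<^bsub>OE\<^esub> C f) = EV f"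
proof -
  assume f: "f \<in> FO"
  define s where "s = (SOME h. h \<in> FO \<and> I +>\<^bsub>OE\<^esub> C h = I +>\<^bsub>OE\<^esub> C f)"
  have "s \<in> FO \<and> I +>\<^bsub>OE\<^esub> C s = I +>\<^bsub>OE\<^esub> C f"
    unfolding s_def by (rule someI[of _ f]) (simp add: f)
  then have "EV s = EV f" using coset_eq[of s f] f by simp
  then show ?thesis by (simp add: TH_def s_def)
qed

lemma Alg_carrier: "carrier Alg = (\<lambda>f. I +>\<^bsub>OE\<^esub> C f) ` FO"
  using quotient_presents by (simp add: presents_def)

lemma Alg_mult: "f \<in> FO \<Longrightarrow> h \<in> FO \<Longrightarrow>
  (I +>\<^bsub>OE\<^esub> C f) \<otimes>\<^bsub>Alg\<^esub> (I +>\<^bsub>OE\<^esub> C h) = I +>\<^bsub>OE\<^esub> C (om f h)"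
  using ideal.rcoset_mult_add[OF ideal_I, of "C f" "C h"]
  by (simp add: algebra_eq kquot_def FactRing_def C_carrier C_mult)

lemma Alg_add: "f \<in> FO \<Longrightarrow> h \<in> FO \<Longrightarrow>
  (I +>\<^bsub>OE\<^esub> C f) \<oplus>\<^bsub>Alg\<^esub> (I +>\<^bsub>OE\<^esub> C h) = I +>\<^bsub>OE\<^esub> C (f + h)"
  using quotient_presents by (simp add: presents_def)

lemma Alg_smult: "f \<in> FO \<Longrightarrow> a \<odot>\<^bsub>Alg\<^esub> (I +>\<^bsub>OE\<^esub> C f) = I +>\<^bsub>OE\<^esub> C (sc a f)"
  using quotient_presents by (simp add: presents_def)

lemma alg_iso: "alg_iso M.AA M.lA Alg TH (restr M.B1)"
proof -
  interpret A: bimod M.AA M.lA M.AA M.lA "M.rA 0" by (rule M.bimod_A)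
  show ?thesis
  proof unfold_locales
    show "bij_betw TH (carrier Alg) M.AA"
    proof (rule bij_betw_imageI)
      show "inj_on TH (carrier Alg)"
      proof (rule inj_onI)
        fix a b assume "a \<in> carrier Alg" "b \<in> carrier Alg" "TH a = TH b"
        moreover then obtain f h where "f \<in> FO" "h \<in> FO" "a = I +>\<^bsub>OE\<^esub> C f" "b = I +>\<^bsub>OE\<^esub> C h"
          unfolding Alg_carrier by blast
        ultimately show "a = b" using coset_eq[of f h] by (simp add: TH_coset)
      qed
      show "TH ` carrier Alg = M.AA"
      proof
        show "M.AA \<subseteq> TH ` carrier Alg"
        proof
          fix a assume "a \<in> M.AA"
          then have "a = TH (I +>\<^bsub>OE\<^esub> C (NF a))" by (simp add: TH_coset NF_FO EV_NF)
          then show "a \<in> TH ` carrier Alg" using NF_FO by (auto simp: Alg_carrier)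
        qed
      qed (auto simp: Alg_carrier TH_coset EV_AA)
    qed
    show "a \<oplus>\<^bsub>Alg\<^esub> b \<in> carrier Alg" "TH (a \<oplus>\<^bsub>Alg\<^esub> b) = TH a + TH b"
      "a \<otimes>\<^bsub>Alg\<^esub> b \<in> carrier Alg" "TH (a \<otimes>\<^bsub>Alg\<^esub> b) = M.lA (TH a) (TH b)"
      if ab: "a \<in> carrier Alg" "b \<in> carrier Alg" for a b
    proof -
      obtain f h where fh: "f \<in> FO" "h \<in> FO" "a = I +>\<^bsub>OE\<^esub> C f" "b = I +>\<^bsub>OE\<^esub> C h"
        using ab unfolding Alg_carrier by blast
      have s: "f + h \<in> FO" using fh by (simp add: fv.subspace_add fin_funs_subspace)
      show "a \<oplus>\<^bsub>Alg\<^esub> b \<in> carrier Alg" "a \<otimes>\<^bsub>Alg\<^esub> b \<in> carrier Alg"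
        using fh s by (auto simp: Alg_add Alg_mult om_FO Alg_carrier)
      show "TH (a \<oplus>\<^bsub>Alg\<^esub> b) = TH a + TH b" "TH (a \<otimes>\<^bsub>Alg\<^esub> b) = M.lA (TH a) (TH b)"
        using fh s by (simp_all add: Alg_add Alg_mult om_FO TH_coset EV_add EV_om)
    qed
    show "s \<odot>\<^bsub>Alg\<^esub> a \<in> carrier Alg" "TH (s \<odot>\<^bsub>Alg\<^esub> a) = sc s (TH a)" if a: "a \<in> carrier Alg" for a s
    proof -
      obtain f where f: "f \<in> FO" "a = I +>\<^bsub>OE\<^esub> C f" using a unfolding Alg_carrier by blast
      have s: "sc s f \<in> FO" using f by (simp add: fv.subspace_scale fin_funs_subspace)
      show "s \<odot>\<^bsub>Alg\<^esub> a \<in> carrier Alg" "TH (s \<odot>\<^bsub>Alg\<^esub> a) = sc s (TH a)"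
        using f s by (auto simp: Alg_smult Alg_carrier TH_coset EV_sc)
    qed
    show "lin (restr M.B1)" by (simp add: restr_def lin_extend)
    show "restr M.B1 x \<in> M.AA" for x
      unfolding restr_def M.AA_def by (intro extend_in fin_funs_subspace basis_elt_fin_funs)
    show "restr M.B1 x = x" if "x \<in> M.AA" for x
      by (rule M.eqA[OF _ lin_id _ that])
        (auto simp: restr_def lin_extend M.mon_small extend_basis_elt M.B1_def M.fin)
  qed
qed

lemma HH_model:
  "\<exists>(Z :: ((nat \<Rightarrow> 'g \<Rightarrow> 'k) set list \<Rightarrow> 'k) set) B \<psi>.
     presents Z B (HH m Alg) \<psi> \<and> fv.subspace Z \<and> qiso Z B (M.HZ 0 m) (M.HB 0 m)"
  using alg_iso.HH_presents[OF alg_iso, of m] by (simp add: M.HZ_def M.HB_def M.lA_def)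

end

section \<open>Eigenspace decompositions\<close>

lemma finite_nth_roots: "0 < n \<Longrightarrow> finite (nth_roots_of_one n :: 'k::field set)"
proof -
  assume n: "0 < n"
  let ?p = "Polynomial.monom 1 n - 1 :: 'k poly"
  have "poly.coeff ?p n = 1" using n by simp
  have "?p \<noteq> 0"
  proof
    assume z: "?p = 0"
    show False using \<open>poly.coeff ?p n = 1\<close> unfolding z by simp
  qed
  then have "finite {x. poly ?p x = 0}" by (rule poly_roots_finite)
  then show ?thesis by (simp add: nth_roots_of_one_def poly_monom)
qed

lemma set_add_eq: "pointwise S M \<Longrightarrow> U <+>\<^bsub>M\<^esub> V = {x + y | x y. x \<in> U \<and> y \<in> V}"
  by (auto simp: set_add_def set_mult_def pointwise_def)

context model
begin

sublocale O: ore_group G \<chi>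
  by unfold_locales (auto simp: fin chi_mult chi_nz)

abbreviation "Kr \<equiv> (group_algebra G :: ('k, 'g \<Rightarrow> 'k) module)"

text \<open>The operator \<open>\<phi>(\<alpha>)\<close>, for an arbitrary function
  \<open>\<phi>\<close> on the eigenvalues of the diagonal automorphism \<open>\<alpha>\<close>.
  The norm, \<open>\<alpha> - 1\<close> and the projections to eigenspaces are of this form, and
  all of them preserve twisted commutators, which are spanned by eigenvectors.\<close>

definition dg :: "('k \<Rightarrow> 'k) \<Rightarrow> ('g \<Rightarrow> 'k) \<Rightarrow> 'g \<Rightarrow> 'k" where
  "dg \<phi> k = (\<lambda>g. \<phi> (\<chi> g) * k g)"

lemma lin_dg: "lin (dg \<phi>)"
  by (auto simp: lin_def dg_def fun_eq_iff fun_ap algebra_simps)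

lemma dg_basis: "dg \<phi> (basis_elt g) = sc (\<phi> (\<chi> g)) (basis_elt g)"
  by (auto simp: dg_def basis_elt_def fun_eq_iff fun_ap)

lemma dg_dg: "dg \<phi> (dg \<psi> k) = dg (\<lambda>x. \<phi> x * \<psi> x) k"
  by (simp add: dg_def mult.assoc)

lemma nrm_dg: "nrm = dg (\<lambda>x. \<Sum>i<n. x ^ i)"
  by (simp add: nrm_def dg_def fun_eq_iff)

lemma aut_minus_dg: "aut_minus = dg (\<lambda>x. x - 1)"
  by (simp add: aut_minus_def dg_def fun_eq_iff)

lemma dg_KK: "k \<in> KK \<Longrightarrow> dg \<phi> k \<in> KK"
  by (erule inK[OF lin_dg subspaces(3), rotated])
    (auto simp: dg_basis intro!: fv.subspace_scale subspaces basis_KK)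

lemma dg_Wu: "k \<in> KK \<Longrightarrow> dg \<phi> (Wu k) = Wu (dg \<phi> k)"
  by (rule eqK[OF lin_comp[OF lin_dg lin_K(2)] lin_comp[OF lin_K(2) lin_dg]])
    (auto simp: Wu_basis dg_basis lin_sc[OF lin_dg] lin_sc[OF lin_K(2)] lin_diff[OF lin_dg] chi_mult
      mult.commute fv.scale_right_diff_distrib)

lemma dg_TC: "k \<in> TC j \<Longrightarrow> dg \<phi> k \<in> TC j"
  unfolding TC_def
proof (erule lin_span_image[OF lin_dg _ fv.subspace_span, rotated])
  fix x assume "x \<in> {tc_gen j g h | g h. g \<in> carrier G \<and> h \<in> carrier G}"
  then obtain g h where gh: "g \<in> carrier G" "h \<in> carrier G" "x = tc_gen j g h" by blast
  have "dg \<phi> x = sc (\<phi> (\<chi> g * \<chi> h)) x"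
    using gh by (simp add: tc_gen_def lin_diff[OF lin_dg] lin_sc[OF lin_dg] dg_basis chi_mult
        mult.commute fv.scale_right_diff_distrib)
  then show "dg \<phi> x \<in> fv.span {tc_gen j g h | g h. g \<in> carrier G \<and> h \<in> carrier G}"
    by (simp only:) (intro fv.span_scale fv.span_base, use gh in blast)
qed

lemma TU_I: "x \<in> TC (n * t) \<Longrightarrow> k \<in> KK \<Longrightarrow> x + Wu (aut_minus k) \<in> TU t"
  unfolding TU_def by blast

lemma dg_TU: "k \<in> TU t \<Longrightarrow> dg \<phi> k \<in> TU t"
proof -
  assume "k \<in> TU t"
  then obtain x l where k: "k = x + Wu (aut_minus l)" "x \<in> TC (n * t)" "l \<in> KK" by (auto simp: TU_def)
  have "dg \<phi> k = dg \<phi> x + Wu (aut_minus (dg \<phi> l))"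
    using k aut_minus_KK by (simp add: lin_add[OF lin_dg] dg_Wu aut_minus_dg dg_dg mult.commute)
  then show ?thesis using TU_I[OF dg_TC[OF k(2)] dg_KK[OF k(3)]] by simp
qed

text \<open>The projection to the eigenspace of \<open>w\<close>.\<close>

definition comp :: "'k \<Rightarrow> ('g \<Rightarrow> 'k) \<Rightarrow> 'g \<Rightarrow> 'k" where
  "comp w = dg (\<lambda>x. if x = w then 1 else 0)"

definition Eig :: "'k \<Rightarrow> ('g \<Rightarrow> 'k) set" where
  "Eig w = {l \<in> KK. comp w l = l}"

lemma lin_comp_w: "lin (comp w)"
  by (simp add: comp_def lin_dg)

lemma subspace_Eig: "fv.subspace (Eig w)"
proof -
  have "Eig w = KK \<inter> {l. comp w l - l = 0}" by (auto simp: Eig_def)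
  moreover have "lin (\<lambda>l. comp w l - l)" by (intro lin_diff_fun lin_comp_w lin_id)
  ultimately show ?thesis by (simp only:) (intro fv.subspace_inter subspaces(3) subspace_kernel)
qed

lemma dg_Eig: "l \<in> Eig w \<Longrightarrow> dg \<phi> l = sc (\<phi> w) l"
proof
  fix g assume "l \<in> Eig w"
  then have "(if \<chi> g = w then 1 else 0) * l g = l g" by (auto simp: Eig_def comp_def dg_def fun_eq_iff)
  then show "dg \<phi> l g = sc (\<phi> w) l g" by (auto simp: dg_def sc_apply split: if_splits)
qed

lemma comp_Eig: "k \<in> KK \<Longrightarrow> comp w k \<in> Eig w"
proof -
  assume k: "k \<in> KK"
  have "comp w (comp w k) = comp w k"
    by (rule ext) (simp add: comp_def dg_def)
  moreover have "comp w k \<in> KK" using k by (simp add: comp_def dg_KK)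
  ultimately show ?thesis by (simp add: Eig_def)
qed

lemma comp_other: "l \<in> Eig v \<Longrightarrow> comp w l = (if v = w then l else 0)"
  unfolding comp_def by (simp add: dg_Eig)

lemma Eig_KK: "Eig w \<subseteq> KK"
  by (auto simp: Eig_def)

lemma Wu_Eig: "l \<in> Eig w \<Longrightarrow> Wu l \<in> Eig w"
  by (auto simp: Eig_def comp_def Wu_KK dg_Wu)

lemma eigenspace_Eig:
  assumes "\<And>f. f \<in> KK \<Longrightarrow> \<alpha> f = char_aut \<chi> f"
  shows "eigenspace Kr \<alpha> w = Eig w"
proof -
  have "char_aut \<chi> l = w \<odot>\<^bsub>Kr\<^esub> l \<longleftrightarrow> comp w l = l" for l
    using O.pwK by (auto simp: pointwise_def char_aut_def fun_eq_iff comp_def dg_def sc_apply)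
  moreover have "carrier Kr = KK" using O.pwK by (simp add: pointwise_def KK_def)
  ultimately show ?thesis using assms by (auto simp: eigenspace_def Eig_def)
qed

lemma funpow_aut:
  assumes "\<And>f. f \<in> KK \<Longrightarrow> \<alpha> f = char_aut \<chi> f" and "f \<in> KK"
  shows "(\<alpha> ^^ j) f = (char_aut \<chi> ^^ j) f"
proof (induction j)
  case (Suc j)
  have "(char_aut \<chi> ^^ j) f \<in> KK" using O.char_aut_FG assms(2) by (simp add: KK_def)
  then show ?case using Suc assms by simp
qed simp

text \<open>Bilinearity reduces the commutators of arbitrary elements to those of group
  elements.\<close>

lemma twisted_commutators_TC:
  assumes al: "\<And>f. f \<in> KK \<Longrightarrow> \<alpha> f = char_aut \<chi> f"
  shows "twisted_commutators Kr (\<alpha> ^^ j) = TC j"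
proof -
  let ?S = "{(l' \<otimes>\<^bsub>Kr\<^esub> (\<alpha> ^^ j) l) \<ominus>\<^bsub>Kr\<^esub> (l \<otimes>\<^bsub>Kr\<^esub> l') | l l'. l \<in> carrier Kr \<and> l' \<in> carrier Kr}"
  let ?c = "\<lambda>l l'. O.cv l' ((char_aut \<chi> ^^ j) l) - O.cv l l'"
  have car: "carrier Kr = KK" using O.pwK by (simp add: pointwise_def KK_def)
  have cvK: "O.cv u v \<in> KK" if "u \<in> KK" "v \<in> KK" for u v
    unfolding O.cv_def KK_def by (intro extend_in fin_funs_subspace basis_elt_fin_funs) auto
  have caK: "(char_aut \<chi> ^^ j) l \<in> KK" if "l \<in> KK" for l
    using O.char_aut_FG that by (simp add: KK_def)
  have eq: "(l' \<otimes>\<^bsub>Kr\<^esub> (\<alpha> ^^ j) l) \<ominus>\<^bsub>Kr\<^esub> (l \<otimes>\<^bsub>Kr\<^esub> l') = ?c l l'" if "l \<in> KK" "l' \<in> KK" for l l'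
    using that cvK[of l l'] caK[of l] funpow_aut[of \<alpha> l j, OF al]
    by (simp add: KK_def O.K_mult pointwise_a_minus[OF O.pwK])
  have S: "?S = {?c l l' | l l'. l \<in> KK \<and> l' \<in> KK}"
    unfolding car using eq by (auto; metis)
  have "?S \<subseteq> fin_funs (carrier G)"
    unfolding S using cvK caK subspaces(3) by (auto simp: KK_def[symmetric] intro!: fv.subspace_diff)
  then have "twisted_commutators Kr (\<alpha> ^^ j) = fv.span ?S"
    unfolding twisted_commutators_def by (rule pointwise_kspan[OF O.pwK])
  also have "\<dots> = TC j"
  proof
    have basis: "?c (basis_elt h) (basis_elt g) = tc_gen j g h" if "g \<in> carrier G" "h \<in> carrier G" for g h
    proof -
      have "(char_aut \<chi> ^^ j) (basis_elt h) = sc (\<chi> h ^ j) (basis_elt h)"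
        by (auto simp: O.char_aut_pow basis_elt_def fun_eq_iff sc_apply)
      then show ?thesis using that by (simp add: tc_gen_def lin_sc[OF O.lin_cv(2)] O.cv_basis)
    qed
    have "?c l l' \<in> TC j" if l: "l \<in> KK" "l' \<in> KK" for l l'
    proof (rule inK[OF _ subspace_TC _ l(1)])
      show "lin (\<lambda>l. ?c l l')"
        by (intro lin_diff_fun lin_comp[OF O.lin_cv(2) O.lin_char_aut] O.lin_cv)
      show "?c (basis_elt h) l' \<in> TC j" if h: "h \<in> carrier G" for h
      proof (rule inK[OF _ subspace_TC _ l(2)])
        show "lin (\<lambda>l'. ?c (basis_elt h) l')" by (intro lin_diff_fun O.lin_cv)
        show "?c (basis_elt h) (basis_elt g) \<in> TC j" if "g \<in> carrier G" for g
          using basis[OF that h] TC_gen[OF that h] by simp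
      qed
    qed
    then show "fv.span ?S \<subseteq> TC j"
      unfolding S by (intro fv.span_minimal subspace_TC) auto
    show "TC j \<subseteq> fv.span ?S"
      unfolding TC_def
    proof (rule fv.span_minimal[OF _ fv.subspace_span], rule subsetI)
      fix x assume "x \<in> {tc_gen j g h | g h. g \<in> carrier G \<and> h \<in> carrier G}"
      then obtain g h where gh: "g \<in> carrier G" "h \<in> carrier G" "x = tc_gen j g h" by blast
      have "x \<in> ?S" unfolding S
        by (intro CollectI exI[of _ "basis_elt h"] exI[of _ "basis_elt g"])
          (simp add: basis gh basis_KK)
      then show "x \<in> fv.span ?S" by (rule fv.span_base)
    qed
  qed
  finally show ?thesis .
qed

abbreviation "C' \<equiv> nth_roots_of_one n - {1 :: 'k}"

lemma finC: "finite C'"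
  using finite_nth_roots[OF n_pos] by blast

lemma subquot_K:
  assumes "fv.subspace V" "fv.subspace U" "U \<subseteq> V" "V \<subseteq> KK"
  shows "\<exists>\<psi>. presents V U (ksubquot Kr V U) \<psi>"
proof -
  have "presents V U (ksubquot Kr ((\<lambda>x. x) ` V) ((\<lambda>x. x) ` U)) (\<lambda>z. (\<lambda>x. x) ` {b + z | b. b \<in> U})"
    by (rule presents_ksubquot[OF pointwise_presents[OF O.pwK]])
      (use assms in \<open>auto simp: KK_def fin_funs_subspace fv.subspace_0\<close>)
  then show ?thesis by auto
qed

lemma quot_K:
  assumes "fv.subspace U" "U \<subseteq> KK"
  shows "\<exists>\<psi>. presents KK U (kquot Kr U) \<psi>"
proof -
  have "carrier Kr = KK" using O.pwK by (simp add: pointwise_def KK_def)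
  then show ?thesis using subquot_K[OF subspaces(3) assms order_refl] ksubquot_carrier[of Kr U] by simp
qed

lemma subquot_ore:
  assumes "fv.subspace V" "fv.subspace U" "U \<subseteq> V" "V \<subseteq> KK"
  shows "\<exists>\<psi>. presents V U (ksubquot (ore_extension Kr \<alpha>) (ore_monom Kr r ` V) (ore_monom Kr r ` U)) \<psi>"
proof -
  let ?M = "(ore_extension Kr \<alpha>)\<lparr>carrier := ore_monom Kr r ` KK\<rparr>"
  have "presents KK {0} ?M (ore_monom Kr r)"
  proof -
    have K: "\<And>x y. x \<oplus>\<^bsub>Kr\<^esub> y = x + y" "\<zero>\<^bsub>Kr\<^esub> = 0" "\<And>a x. a \<odot>\<^bsub>Kr\<^esub> x = sc a x"
      using O.pwK by (simp_all add: pointwise_def)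
    have "ore_monom Kr r z = ore_monom Kr r z' \<longleftrightarrow> z - z' = 0" for z z'
    proof
      assume eq: "ore_monom Kr r z = ore_monom Kr r z'"
      show "z - z' = 0" using fun_cong[OF eq, of r] by (simp add: ore_monom_def)
    next
      assume "z - z' = 0"
      then show "ore_monom Kr r z = ore_monom Kr r z'" by simp
    qed
    then show ?thesis
      by (auto simp: presents_def ore_extension_def ore_monom_def K)
  qed
  then have "presents V U (ksubquot ?M (ore_monom Kr r ` V) (ore_monom Kr r ` U))
      (\<lambda>z. ore_monom Kr r ` {b + z | b. b \<in> U})"
    by (rule presents_ksubquot) (use assms in \<open>auto simp: subspaces fv.subspace_0\<close>)
  then show ?thesis by (auto simp: ksubquot_def)
qed

text \<open>A pair \<open>B \<subseteq> Z\<close> stable under the projections decomposes into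
  its intersections with eigenspaces. The eigenvalues outside \<open>C'\<close> contribute
  nothing as soon as the complementary component of \<open>Z\<close> lies in
  \<open>B\<close>.\<close>

lemma direct_sum:
  fixes N :: "'k \<Rightarrow> ('k, 'v) module"
  assumes Z: "fv.subspace Z" "Z \<subseteq> KK" and B: "fv.subspace B"
    and Zc: "\<And>z w. z \<in> Z \<Longrightarrow> comp w z \<in> Z" and Bc: "\<And>z w. z \<in> B \<Longrightarrow> comp w z \<in> B"
    and rest: "\<And>z. z \<in> Z \<Longrightarrow> z - (\<Sum>w\<in>C'. comp w z) \<in> B"
    and N: "\<And>w. w \<in> C' \<Longrightarrow> \<exists>\<psi>. presents (Z \<inter> Eig w) (B \<inter> Eig w) (N w) \<psi>"
  shows "\<exists>\<psi>. presents Z B (kdirect_sum C' N) \<psi>"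
proof -
  obtain \<psi> where \<psi>: "\<And>w. w \<in> C' \<Longrightarrow> presents (Z \<inter> Eig w) (B \<inter> Eig w) (N w) (\<psi> w)"
    using bchoice[of C' "\<lambda>w \<psi>. presents (Z \<inter> Eig w) (B \<inter> Eig w) (N w) \<psi>"] N by auto
  let ?f = "\<lambda>z. \<lambda>w\<in>C'. \<psi> w (comp w z)"
  have cz: "comp w z \<in> Z \<inter> Eig w" if "z \<in> Z" for z w
    using that Zc Z(2) comp_Eig by blast
  have "presents Z B (kdirect_sum C' N) ?f"
    unfolding presents_def
  proof (intro conjI ballI allI)
    show "?f ` Z = carrier (kdirect_sum C' N)"
    proof
      show "?f ` Z \<subseteq> carrier (kdirect_sum C' N)"
      proof (rule image_subsetI)
        fix z assume z: "z \<in> Z"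
        have "\<psi> w (comp w z) \<in> carrier (N w)" if "w \<in> C'" for w
          using \<psi>[OF that] cz[OF z, of w] unfolding presents_def by blast
        then show "?f z \<in> carrier (kdirect_sum C' N)"
          using finC by (auto simp: kdirect_sum_def intro: finite_subset)
      qed
      show "carrier (kdirect_sum C' N) \<subseteq> ?f ` Z"
      proof
        fix f assume "f \<in> carrier (kdirect_sum C' N)"
        then have f: "f \<in> (\<Pi>\<^sub>E w\<in>C'. carrier (N w))" by (simp add: kdirect_sum_def)
        have "\<forall>w\<in>C'. \<exists>z. z \<in> Z \<inter> Eig w \<and> \<psi> w z = f w"
        proof
          fix w assume w: "w \<in> C'"
          then have "f w \<in> \<psi> w ` (Z \<inter> Eig w)"
            using PiE_mem[OF f w] \<psi>[OF w] by (simp only: presents_def)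
          then obtain z where "f w = \<psi> w z" "z \<in> Z \<inter> Eig w" by (rule imageE)
          then show "\<exists>z. z \<in> Z \<inter> Eig w \<and> \<psi> w z = f w" by (intro exI[of _ z]) simp
        qed
        then obtain zz where zz: "\<And>w. w \<in> C' \<Longrightarrow> zz w \<in> Z \<inter> Eig w \<and> \<psi> w (zz w) = f w"
          using bchoice[of C' "\<lambda>w z. z \<in> Z \<inter> Eig w \<and> \<psi> w z = f w"] by auto
        define z where "z = (\<Sum>w\<in>C'. zz w)"
        have "z \<in> Z" unfolding z_def using zz by (intro fv.subspace_sum Z) auto
        moreover have "comp w z = zz w" if w: "w \<in> C'" for w
        proof -
          have "comp w z = (\<Sum>v\<in>C'. if v = w then zz v else 0)"
            unfolding z_def lin_sum[OF lin_comp_w] using zz by (intro sum.cong refl comp_other) auto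
          then show ?thesis using w finC by (simp add: sum.delta)
        qed
        then have "?f z w = f w" for w
          using zz[of w] PiE_arb[OF f, of w] by (cases "w \<in> C'") auto
        then have "?f z = f" by blast
        ultimately show "f \<in> ?f ` Z" by blast
      qed
    qed
  next
    fix z z' assume z: "z \<in> Z" "z' \<in> Z"
    show "?f (z + z') = ?f z \<oplus>\<^bsub>kdirect_sum C' N\<^esub> ?f z'"
    proof
      fix w
      show "?f (z + z') w = (?f z \<oplus>\<^bsub>kdirect_sum C' N\<^esub> ?f z') w"
        using \<psi>[of w] cz[OF z(1), of w] cz[OF z(2), of w]
        by (cases "w \<in> C'") (auto simp: kdirect_sum_def presents_def lin_add[OF lin_comp_w])
    qed
    have iff: "\<psi> w (comp w z) = \<psi> w (comp w z') \<longleftrightarrow> comp w (z - z') \<in> B" if "w \<in> C'" for w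
    proof -
      have "comp w z - comp w z' \<in> Eig w"
        using cz z subspace_Eig by (blast intro: fv.subspace_diff)
      then show ?thesis
        using \<psi>[OF that] cz[OF z(1), of w] cz[OF z(2), of w] unfolding presents_def
        by (simp add: lin_diff[OF lin_comp_w])
    qed
    have zd: "z - z' \<in> Z" using z Z by (simp add: fv.subspace_diff)
    show "?f z = ?f z' \<longleftrightarrow> z - z' \<in> B"
    proof
      assume eq: "?f z = ?f z'"
      have "\<psi> w (comp w z) = \<psi> w (comp w z')" if "w \<in> C'" for w
        using fun_cong[OF eq, of w] that by simp
      then have "(\<Sum>w\<in>C'. comp w (z - z')) \<in> B" using iff by (intro fv.subspace_sum B) auto
      from fv.subspace_add[OF B rest[OF zd] this] show "z - z' \<in> B" by simp
    next
      assume "z - z' \<in> B"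
      then show "?f z = ?f z'" using iff Bc by (auto simp: restrict_def fun_eq_iff)
    qed
  next
    fix a z assume z: "z \<in> Z"
    show "?f (sc a z) = a \<odot>\<^bsub>kdirect_sum C' N\<^esub> ?f z"
    proof
      fix w
      show "?f (sc a z) w = (a \<odot>\<^bsub>kdirect_sum C' N\<^esub> ?f z) w"
        using \<psi>[of w] cz[OF z, of w]
        by (cases "w \<in> C'") (auto simp: kdirect_sum_def presents_def lin_sc[OF lin_comp_w])
    qed
  qed
  then show ?thesis by blast
qed

text \<open>The map to the first summand factors through \<open>e\<close>; the assumption
  \<open>surj\<close> says that its value and the class in the second summand can be prescribed
  independently.\<close>

lemma plus_presents:
  assumes M1: "presents V1 U1 M1 \<psi>1" and M2: "presents Z U2 M2 \<psi>2"
    and e: "lin e" "\<And>z. z \<in> Z \<Longrightarrow> e z \<in> V1"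
    and surj: "\<And>v z. v \<in> V1 \<Longrightarrow> z \<in> Z \<Longrightarrow> \<exists>y\<in>Z. e y = v \<and> y - z \<in> U2"
    and B: "\<And>z. z \<in> Z \<Longrightarrow> z \<in> B \<longleftrightarrow> e z \<in> U1 \<and> z \<in> U2" and Z: "fv.subspace Z"
  shows "presents Z B (M1 \<oplus>\<^sub>k M2) (\<lambda>z. (\<psi>1 (e z), \<psi>2 z))"
  unfolding presents_def
proof (intro conjI ballI allI)
  show "(\<lambda>z. (\<psi>1 (e z), \<psi>2 z)) ` Z = carrier (M1 \<oplus>\<^sub>k M2)"
  proof
    show "(\<lambda>z. (\<psi>1 (e z), \<psi>2 z)) ` Z \<subseteq> carrier (M1 \<oplus>\<^sub>k M2)"
      using M1 M2 e(2) unfolding presents_def kplus_def by auto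
    show "carrier (M1 \<oplus>\<^sub>k M2) \<subseteq> (\<lambda>z. (\<psi>1 (e z), \<psi>2 z)) ` Z"
    proof
      fix p assume "p \<in> carrier (M1 \<oplus>\<^sub>k M2)"
      then have "fst p \<in> \<psi>1 ` V1" "snd p \<in> \<psi>2 ` Z"
        using M1 M2 by (auto simp: kplus_def presents_def)
      then obtain v z where v: "v \<in> V1" "z \<in> Z" "fst p = \<psi>1 v" "snd p = \<psi>2 z" by blast
      then obtain y where y: "y \<in> Z" "e y = v" "y - z \<in> U2" using surj by blast
      then have "\<psi>2 y = \<psi>2 z" using M2 v unfolding presents_def by blast
      then have "p = (\<psi>1 (e y), \<psi>2 y)" using y v by (simp add: prod_eq_iff)
      then show "p \<in> (\<lambda>z. (\<psi>1 (e z), \<psi>2 z)) ` Z" using y by blast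
    qed
  qed
next
  fix z z' assume z: "z \<in> Z" "z' \<in> Z"
  have m: "e z \<in> V1" "e z' \<in> V1" "z - z' \<in> Z" using z e Z by (auto intro: fv.subspace_diff)
  show "(\<psi>1 (e (z + z')), \<psi>2 (z + z')) = (\<psi>1 (e z), \<psi>2 z) \<oplus>\<^bsub>M1 \<oplus>\<^sub>k M2\<^esub> (\<psi>1 (e z'), \<psi>2 z')"
    using M1 M2 z m by (simp add: kplus_def presents_def lin_add[OF e(1)])
  show "(\<psi>1 (e z), \<psi>2 z) = (\<psi>1 (e z'), \<psi>2 z') \<longleftrightarrow> z - z' \<in> B"
    using M1 M2 z m B[OF m(3)] by (simp add: presents_def lin_diff[OF e(1)])
next
  fix a z assume z: "z \<in> Z"
  show "(\<psi>1 (e (sc a z)), \<psi>2 (sc a z)) = a \<odot>\<^bsub>M1 \<oplus>\<^sub>k M2\<^esub> (\<psi>1 (e z), \<psi>2 z)"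
    using M1 M2 z e(2)[OF z] by (simp add: kplus_def presents_def lin_sc[OF e(1)])
qed

text \<open>An inverse of the norm on the eigenspaces outside \<open>C'\<close>, where
  \<open>\<Sum> w\<^sup>i\<close> over \<open>i < n\<close> is nonzero, and zero on the
  others.\<close>

definition nrm_inv :: "('g \<Rightarrow> 'k) \<Rightarrow> 'g \<Rightarrow> 'k" where
  "nrm_inv = dg (\<lambda>x. if x \<in> C' then 0 else inverse (\<Sum>i<n. x ^ i))"

lemma norm_factor: "x \<in> C' \<longleftrightarrow> (\<Sum>i<n. x ^ i) = 0" for x :: 'k
proof (cases "x = 1")
  case True
  then show ?thesis using n_pos by simp
next
  case False
  have "x ^ n - 1 = (x - 1) * (\<Sum>i<n. x ^ i)" by (rule power_diff_1_eq)
  then show ?thesis using False by (auto simp: nth_roots_of_one_def)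
qed

lemma rest_eq: "z - (\<Sum>w\<in>C'. comp w z) = nrm (nrm_inv z)"
proof
  fix g
  have "(\<Sum>w\<in>C'. comp w z g) = (if \<chi> g \<in> C' then z g else 0)"
  proof -
    have "(\<Sum>w\<in>C'. comp w z g) = (\<Sum>w\<in>C'. if w = \<chi> g then z g else 0)"
      by (intro sum.cong refl) (auto simp: comp_def dg_def)
    then show ?thesis using finC by (simp add: sum.delta)
  qed
  then show "(z - (\<Sum>w\<in>C'. comp w z)) g = nrm (nrm_inv z) g"
    using norm_factor[of "\<chi> g"]
    by (auto simp: fun_ap nrm_inv_def nrm_def dg_def)
qed

lemma nrm_nrm_inv: "nrm (nrm_inv z) = nrm_inv (nrm z)"
  unfolding nrm_dg nrm_inv_def dg_dg by (simp add: mult.commute)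

lemma nrm_Eig: "w \<in> C' \<Longrightarrow> l \<in> Eig w \<Longrightarrow> nrm l = 0"
  using norm_factor[of w] by (simp add: nrm_dg dg_Eig)

lemma aut_minus_Eig: "l \<in> Eig w \<Longrightarrow> aut_minus l = sc (w - 1) l"
  by (simp add: aut_minus_dg dg_Eig)

abbreviation "Zodd t \<equiv> {k \<in> KK. Wu (aut_minus k) \<in> TC (n * t)}"
abbreviation "Bodd t \<equiv> {nrm k + x | k x. k \<in> KK \<and> x \<in> TC (n * Suc t)}"
abbreviation "Zev t \<equiv> {k \<in> KK. nrm k \<in> TC (n * Suc t)}"

lemma subspace_Z: "fv.subspace (Zodd t)" "fv.subspace (Zev t)"
proof -
  have "Zodd t = KK \<inter> {k. Wu (aut_minus k) \<in> TC (n * t)}" "Zev t = KK \<inter> {k. nrm k \<in> TC (n * Suc t)}"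
    by auto
  then show "fv.subspace (Zodd t)" "fv.subspace (Zev t)"
    using fv.subspace_inter[OF subspaces(3) subspace_vimage[OF lin_comp[OF lin_K(2,3)] subspace_TC]]
      fv.subspace_inter[OF subspaces(3) subspace_vimage[OF lin_K(4) subspace_TC]] by simp_all
qed

lemma subspace_Bodd: "fv.subspace (Bodd t)"
proof -
  have "Bodd t = {x + y | x y. x \<in> nrm ` KK \<and> y \<in> TC (n * Suc t)}" by auto
  then show ?thesis using fv.subspace_sums[OF subspace_image[OF lin_K(4) subspaces(3)] subspace_TC] by simp
qed

text \<open>On the eigenspaces in \<open>C'\<close> the norm vanishes and the boundaries reduce
  to commutators; on the remaining ones the norm is onto, so everything bounds.\<close>

lemma odd_presents:
  assumes N: "\<And>w. w \<in> C' \<Longrightarrow> \<exists>\<psi>. presents (Zodd t \<inter> Eig w) (TC (n * Suc t) \<inter> Eig w) (N w) \<psi>"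
  shows "\<exists>\<psi>. presents (Zodd t) (Bodd t) (kdirect_sum C' N) \<psi>"
proof (rule direct_sum[OF subspace_Z(1) _ subspace_Bodd])
  show "comp w z \<in> Zodd t" if "z \<in> Zodd t" for z w
  proof -
    have "Wu (aut_minus (comp w z)) = comp w (Wu (aut_minus z))"
      using that aut_minus_KK[of z] by (simp add: comp_def dg_Wu aut_minus_dg dg_dg mult.commute)
    then show ?thesis using that by (auto simp: comp_def dg_KK dg_TC)
  qed
  show "comp w z \<in> Bodd t" if "z \<in> Bodd t" for z w
  proof -
    obtain k x where "z = nrm k + x" "k \<in> KK" "x \<in> TC (n * Suc t)" using \<open>z \<in> Bodd t\<close> by blast
    then have "comp w z = nrm (comp w k) + comp w x" "comp w k \<in> KK" "comp w x \<in> TC (n * Suc t)"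
      by (auto simp: comp_def lin_add[OF lin_dg] nrm_dg dg_dg mult.commute dg_KK dg_TC)
    then show ?thesis by blast
  qed
  show "z - (\<Sum>w\<in>C'. comp w z) \<in> Bodd t" if "z \<in> Zodd t" for z
    unfolding rest_eq using that fv.subspace_0[OF subspace_TC]
    by (intro CollectI exI[of _ "nrm_inv z"] exI[of _ 0]) (simp add: nrm_inv_def dg_KK)
  show "\<exists>\<psi>. presents (Zodd t \<inter> Eig w) (Bodd t \<inter> Eig w) (N w) \<psi>" if w: "w \<in> C'" for w
  proof -
    have "Bodd t \<inter> Eig w = TC (n * Suc t) \<inter> Eig w"
    proof (intro subset_antisym subsetI)
      fix b assume b: "b \<in> Bodd t \<inter> Eig w"
      then obtain k x where k: "b = nrm k + x" "k \<in> KK" "x \<in> TC (n * Suc t)" by blast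
      have "b = comp w b" using b by (simp add: Eig_def)
      also have "\<dots> = nrm (comp w k) + comp w x"
        by (simp add: k(1) comp_def lin_add[OF lin_dg] nrm_dg dg_dg mult.commute)
      also have "\<dots> = comp w x" using nrm_Eig[OF w comp_Eig[OF k(2)]] by simp
      finally show "b \<in> TC (n * Suc t) \<inter> Eig w" using b k dg_TC by (simp add: comp_def)
    next
      fix b assume b: "b \<in> TC (n * Suc t) \<inter> Eig w"
      then show "b \<in> Bodd t \<inter> Eig w"
        by (intro IntI CollectI exI[of _ 0] exI[of _ b])
          (auto simp: lin_zero[OF lin_K(4)] fv.subspace_0[OF subspaces(3)])
    qed
    then show ?thesis using N[OF w] by simp
  qed
qed auto

text \<open>On the eigenspaces in \<open>C'\<close> every element is a cycle, the norm being
  zero; on the remaining ones the norm is invertible and preserves commutators, so all cycles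
  are commutators.\<close>

lemma even_presents:
  assumes N: "\<And>w. w \<in> C' \<Longrightarrow> \<exists>\<psi>. presents (Eig w) (TU (Suc t) \<inter> Eig w) (N w) \<psi>"
  shows "\<exists>\<psi>. presents (Zev t) (TU (Suc t)) (kdirect_sum C' N) \<psi>"
proof (rule direct_sum[OF subspace_Z(2) _ subspace_TU])
  show "comp w z \<in> Zev t" if "z \<in> Zev t" for z w
  proof -
    have "nrm (comp w z) = comp w (nrm z)" by (simp add: comp_def nrm_dg dg_dg mult.commute)
    then show ?thesis using that by (auto simp: comp_def dg_KK dg_TC)
  qed
  show "comp w z \<in> TU (Suc t)" if "z \<in> TU (Suc t)" for z w
    using dg_TU[OF that] by (simp add: comp_def)
  show "z - (\<Sum>w\<in>C'. comp w z) \<in> TU (Suc t)" if "z \<in> Zev t" for z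
  proof -
    have "nrm_inv (nrm z) \<in> TC (n * Suc t)" unfolding nrm_inv_def by (rule dg_TC) (use that in blast)
    then show ?thesis unfolding rest_eq nrm_nrm_inv by (rule TC_TU)
  qed
  show "\<exists>\<psi>. presents (Zev t \<inter> Eig w) (TU (Suc t) \<inter> Eig w) (N w) \<psi>" if w: "w \<in> C'" for w
  proof -
    have "Zev t \<inter> Eig w = Eig w"
      using nrm_Eig[OF w] fv.subspace_0[OF subspace_TC] Eig_KK by auto
    then show ?thesis using N[OF w] by simp
  qed
qed auto

lemma Wu_zero: assumes "\<xi> = 0" shows "Wu k = 0"
  unfolding Wu_def extend_def by (simp add: assms)

lemma TU_TC: assumes "\<xi> = 0" shows "TU t = TC (n * t)"
  using TC_TU by (auto simp: TU_def Wu_zero[OF assms])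

lemma EigTC: "fv.subspace (Eig w \<inter> TC j)" "Eig w \<inter> TC j \<subseteq> Eig w"
  using fv.subspace_inter[OF subspace_Eig subspace_TC] by auto

lemma zero_odd:
  assumes xi0: "\<xi> = 0" and al: "\<And>f. f \<in> KK \<Longrightarrow> \<alpha> f = char_aut \<chi> f"
  shows "\<exists>\<psi>. presents (Zodd m) (Bodd m) (kdirect_sum C' (\<lambda>w. ksubquot (ore_extension Kr \<alpha>)
    (ore_monom Kr (n - 1) ` eigenspace Kr \<alpha> w)
    (ore_monom Kr (n - 1) ` (eigenspace Kr \<alpha> w \<inter> twisted_commutators Kr (\<alpha> ^^ ((m + 1) * n)))))) \<psi>"
proof (rule odd_presents)
  fix w
  have "Zodd m = KK" using fv.subspace_0[OF subspace_TC] by (auto simp: Wu_zero[OF xi0])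
  then have "Zodd m \<inter> Eig w = Eig w" using Eig_KK by auto
  moreover have "(m + 1) * n = n * Suc m" by simp
  ultimately show "\<exists>\<psi>. presents (Zodd m \<inter> Eig w) (TC (n * Suc m) \<inter> Eig w) (ksubquot (ore_extension Kr \<alpha>)
    (ore_monom Kr (n - 1) ` eigenspace Kr \<alpha> w)
    (ore_monom Kr (n - 1) ` (eigenspace Kr \<alpha> w \<inter> twisted_commutators Kr (\<alpha> ^^ ((m + 1) * n))))) \<psi>"
    using subquot_ore[OF subspace_Eig EigTC Eig_KK, of w "n * Suc m" \<alpha> "n - 1"]
    by (simp only: eigenspace_Eig[of \<alpha>, OF al] twisted_commutators_TC[of \<alpha>, OF al] Int_commute)
qed

lemma zero_even:
  assumes xi0: "\<xi> = 0" and al: "\<And>f. f \<in> KK \<Longrightarrow> \<alpha> f = char_aut \<chi> f"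
  shows "\<exists>\<psi>. presents (Zev m) (TU (Suc m)) (kdirect_sum C' (\<lambda>w. ksubquot Kr (eigenspace Kr \<alpha> w)
    (eigenspace Kr \<alpha> w \<inter> twisted_commutators Kr (\<alpha> ^^ ((m + 1) * n))))) \<psi>"
proof (rule even_presents)
  fix w
  have "(m + 1) * n = n * Suc m" by simp
  then show "\<exists>\<psi>. presents (Eig w) (TU (Suc m) \<inter> Eig w) (ksubquot Kr (eigenspace Kr \<alpha> w)
    (eigenspace Kr \<alpha> w \<inter> twisted_commutators Kr (\<alpha> ^^ ((m + 1) * n)))) \<psi>"
    using subquot_K[OF subspace_Eig EigTC Eig_KK, of w "n * Suc m"]
    by (simp only: eigenspace_Eig[of \<alpha>, OF al] twisted_commutators_TC[of \<alpha>, OF al] TU_TC[OF xi0] Int_commute)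
qed

lemma commutators_TC: "commutators Kr = TC 0"
  using twisted_commutators_TC[of "char_aut \<chi>" 0] by (simp add: commutators_def)

lemma zero_zero:
  assumes "\<xi> = 0"
  shows "\<exists>\<psi>. presents KK (TU 0) (kquot Kr (commutators Kr)) \<psi>"
  using quot_K[OF subspace_TC[of 0] TC_KK] by (simp add: TU_TC[OF assms] commutators_TC)

text \<open>The twist by \<open>\<alpha>\<^sup>n\<close> is trivial in this case.\<close>

lemma TC_pow:
  assumes "\<And>g. g \<in> carrier G \<Longrightarrow> \<chi> g ^ n = 1"
  shows "TC (n * t) = TC 0"
proof -
  have "tc_gen (n * t) g h = tc_gen 0 g h" if "h \<in> carrier G" for g h
    using assms[OF that] by (simp add: tc_gen_def power_mult)
  then have "{tc_gen (n * t) g h | g h. g \<in> carrier G \<and> h \<in> carrier G} = {tc_gen 0 g h | g h. g \<in> carrier G \<and> h \<in> carrier G}"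
    by (auto; metis)
  then show ?thesis unfolding TC_def by simp
qed

abbreviation "u \<equiv> basis_elt (g1 [^] n) \<ominus>\<^bsub>Kr\<^esub> \<one>\<^bsub>Kr\<^esub>"

lemma mult_u: "l \<in> KK \<Longrightarrow> sc \<xi> (l \<otimes>\<^bsub>Kr\<^esub> u) = Wu l"
proof -
  assume l: "l \<in> KK"
  have u: "u = basis_elt c - basis_elt \<one>"
    using pointwise_a_minus[OF O.pwK, of "\<one>\<^bsub>Kr\<^esub>" "basis_elt (g1 [^] n)"]
    by (simp add: group_algebra_def basis_elt_fin_funs c_def)
  have uK: "basis_elt c - basis_elt \<one> \<in> fin_funs (carrier G)"
    by (intro fv.subspace_diff fin_funs_subspace basis_elt_fin_funs) auto
  have "l \<otimes>\<^bsub>Kr\<^esub> u = O.cv l (basis_elt c - basis_elt \<one>)"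
    unfolding u using O.K_mult[OF _ uK] l by (simp add: KK_def)
  moreover have "sc \<xi> (O.cv l (basis_elt c - basis_elt \<one>)) = Wu l"
    by (rule eqK[OF lin_sc_fun[OF O.lin_cv(1)] lin_K(2) _ l])
      (simp add: Wu_basis lin_diff[OF O.lin_cv(2)] O.cv_basis)
  ultimately show ?thesis by simp
qed

context
  assumes xi_nz: "\<xi> \<noteq> 0" and chi_n: "\<And>g. g \<in> carrier G \<Longrightarrow> \<chi> g ^ n = 1"
begin

lemma TCn: "TC (n * t) = TC 0"
  by (rule TC_pow) (rule chi_n)

lemma mult_u': "l \<in> KK \<Longrightarrow> l \<otimes>\<^bsub>Kr\<^esub> u = sc (inverse \<xi>) (Wu l)"
  using mult_u[of l, symmetric] xi_nz by simp

lemma Eig_chi: "eigenspace Kr (char_aut \<chi>) w = Eig w"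
  by (rule eigenspace_Eig) simp

text \<open>On the eigenspace of \<open>w \<noteq> 1\<close> the operator \<open>\<alpha> -
  1\<close> is an invertible scalar, so the image of \<open>k \<mapsto> \<xi> (c - 1)
  (\<alpha>(k) - k)\<close> is all multiples of \<open>c - 1\<close>.\<close>

lemma TU_Eig:
  assumes w: "w \<in> C'"
  shows "TU t \<inter> Eig w = (Eig w \<inter> TC 0) <+>\<^bsub>Kr\<^esub> {l \<otimes>\<^bsub>Kr\<^esub> u | l. l \<in> Eig w}"
proof -
  have w1: "w - 1 \<noteq> 0" using w by simp
  show ?thesis
    unfolding set_add_eq[OF O.pwK]
  proof (intro subset_antisym subsetI)
    fix b assume b: "b \<in> TU t \<inter> Eig w"
    then obtain x k where k: "b = x + Wu (aut_minus k)" "x \<in> TC 0" "k \<in> KK"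
      by (auto simp: TU_def TCn)
    let ?k = "comp w k"
    have E: "?k \<in> Eig w" by (rule comp_Eig[OF k(3)])
    then have E': "sc (\<xi> * (w - 1)) ?k \<in> Eig w" by (intro fv.subspace_scale subspace_Eig)
    have "b = comp w b" using b by (simp add: Eig_def)
    also have "\<dots> = comp w x + Wu (aut_minus ?k)"
      using aut_minus_KK[OF k(3)] by (simp add: k(1) comp_def lin_add[OF lin_dg] dg_Wu aut_minus_dg dg_dg mult.commute)
    also have "Wu (aut_minus ?k) = sc (\<xi> * (w - 1)) ?k \<otimes>\<^bsub>Kr\<^esub> u"
      using E E' Eig_KK xi_nz by (simp add: mult_u' subset_iff aut_minus_Eig lin_sc[OF lin_K(2)])
    finally have bb: "b = comp w x + sc (\<xi> * (w - 1)) ?k \<otimes>\<^bsub>Kr\<^esub> u" .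
    have "comp w x \<in> Eig w \<inter> TC 0"
      using k dg_TC[of x 0] TC_KK comp_Eig[of x w] by (auto simp: comp_def)
    then show "b \<in> {x + y | x y. x \<in> Eig w \<inter> TC 0 \<and> y \<in> {l \<otimes>\<^bsub>Kr\<^esub> u | l. l \<in> Eig w}}"
      using bb E' by blast
  next
    fix b assume "b \<in> {x + y | x y. x \<in> Eig w \<inter> TC 0 \<and> y \<in> {l \<otimes>\<^bsub>Kr\<^esub> u | l. l \<in> Eig w}}"
    then obtain x l where b: "b = x + l \<otimes>\<^bsub>Kr\<^esub> u" "x \<in> Eig w" "x \<in> TC 0" "l \<in> Eig w" by blast
    have lK: "l \<in> KK" using b Eig_KK by auto
    have lu: "l \<otimes>\<^bsub>Kr\<^esub> u \<in> Eig w"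
      unfolding mult_u'[OF lK] by (intro fv.subspace_scale subspace_Eig Wu_Eig b)
    define k where "k = sc (inverse (\<xi> * (w - 1))) l"
    have kK: "k \<in> KK" unfolding k_def by (intro fv.subspace_scale subspaces lK)
    have "Wu (aut_minus k) = l \<otimes>\<^bsub>Kr\<^esub> u"
      using xi_nz w1 b by (simp add: k_def lin_sc[OF lin_K(3)] lin_sc[OF lin_K(2)] aut_minus_Eig mult_u'[OF lK])
    then have "b \<in> TU t" using TU_I[of x t k] b(1,3) kK by (simp add: TCn)
    then show "b \<in> TU t \<inter> Eig w" using b lu subspace_Eig by (auto intro: fv.subspace_add)
  qed
qed

abbreviation "Eg \<equiv> eigenspace Kr (char_aut \<chi>)"

lemma unit_even_family:
  assumes w: "w \<in> C'"
  shows "\<exists>\<psi>. presents (Eig w) (TU t \<inter> Eig w)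
    (ksubquot Kr (Eg w) ((Eg w \<inter> commutators Kr) <+>\<^bsub>Kr\<^esub> {l \<otimes>\<^bsub>Kr\<^esub> u | l. l \<in> Eg w})) \<psi>"
  unfolding Eig_chi commutators_TC TU_Eig[OF w, of t, symmetric]
  by (rule subquot_K[OF subspace_Eig fv.subspace_inter[OF subspace_TU subspace_Eig] _ Eig_KK]) auto

lemma unit_even:
  "\<exists>\<psi>. presents (Zev m) (TU (Suc m)) (kdirect_sum C' (\<lambda>w. ksubquot Kr (Eg w)
     ((Eg w \<inter> commutators Kr) <+>\<^bsub>Kr\<^esub> {l \<otimes>\<^bsub>Kr\<^esub> u | l. l \<in> Eg w}))) \<psi>"
  by (rule even_presents) (rule unit_even_family)

lemma unit_odd:
  "\<exists>\<psi>. presents (Zodd m) (Bodd m) (kdirect_sum C' (\<lambda>w. ksubquot (ore_extension Kr (char_aut \<chi>))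
     (ore_monom Kr (n - 1) ` {l \<in> Eg w. l \<otimes>\<^bsub>Kr\<^esub> u \<in> Eg w \<inter> commutators Kr})
     (ore_monom Kr (n - 1) ` (Eg w \<inter> commutators Kr)))) \<psi>"
proof (rule odd_presents)
  fix w assume w: "w \<in> C'"
  have w1: "w - 1 \<noteq> 0" using w by simp
  have sc_iff: "sc a x \<in> TC 0 \<longleftrightarrow> x \<in> TC 0" if "a \<noteq> 0" for a x
    using fv.subspace_scale[OF subspace_TC, of x 0 a] fv.subspace_scale[OF subspace_TC, of "sc a x" 0 "inverse a"] that
    by auto
  have eq: "{l \<in> Eig w. l \<otimes>\<^bsub>Kr\<^esub> u \<in> Eig w \<inter> TC 0} = Zodd m \<inter> Eig w"
  proof -
    have "l \<otimes>\<^bsub>Kr\<^esub> u \<in> Eig w \<inter> TC 0 \<longleftrightarrow> Wu (aut_minus l) \<in> TC (n * m)" if l: "l \<in> Eig w" for l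
    proof -
      have lK: "l \<in> KK" using l Eig_KK by auto
      have "l \<otimes>\<^bsub>Kr\<^esub> u \<in> Eig w"
        unfolding mult_u'[OF lK] by (intro fv.subspace_scale subspace_Eig Wu_Eig l)
      moreover have "l \<otimes>\<^bsub>Kr\<^esub> u \<in> TC 0 \<longleftrightarrow> Wu l \<in> TC 0"
        unfolding mult_u'[OF lK] using xi_nz by (intro sc_iff) simp
      moreover have "Wu (aut_minus l) \<in> TC (n * m) \<longleftrightarrow> Wu l \<in> TC 0"
        unfolding TCn aut_minus_Eig[OF l] lin_sc[OF lin_K(2)] by (rule sc_iff[OF w1])
      ultimately show ?thesis by blast
    qed
    then show ?thesis using Eig_KK by auto
  qed
  have "\<exists>\<psi>. presents (Zodd m \<inter> Eig w) (Eig w \<inter> TC 0) (ksubquot (ore_extension Kr (char_aut \<chi>))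
     (ore_monom Kr (n - 1) ` (Zodd m \<inter> Eig w)) (ore_monom Kr (n - 1) ` (Eig w \<inter> TC 0))) \<psi>"
  proof (rule subquot_ore)
    show "Eig w \<inter> TC 0 \<subseteq> Zodd m \<inter> Eig w"
    proof
      fix x assume x: "x \<in> Eig w \<inter> TC 0"
      have "Wu x \<in> TC 0"
      proof -
        have "Wu x \<in> TC 0" if "x \<in> TC 0"
          unfolding TC_def
        proof (rule lin_span_image[OF lin_K(2) _ fv.subspace_span that[unfolded TC_def]])
          fix y assume "y \<in> {tc_gen 0 g h | g h. g \<in> carrier G \<and> h \<in> carrier G}"
          then obtain g h where gh: "g \<in> carrier G" "h \<in> carrier G" "y = tc_gen 0 g h" by blast
          have "h \<otimes> (g \<otimes> c) = h \<otimes> g \<otimes> c" using gh by (simp add: m_assoc)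
          then have "Wu y = sc \<xi> (tc_gen 0 (g \<otimes> c) h - tc_gen 0 g h)"
            using gh c_swap[OF gh(1,2)] by (simp add: tc_gen_def lin_diff[OF lin_K(2)] Wu_basis fv.scale_right_diff_distrib)
          then show "Wu y \<in> fv.span {tc_gen 0 g h | g h. g \<in> carrier G \<and> h \<in> carrier G}"
            using fv.subspace_scale[OF subspace_TC fv.subspace_diff[OF subspace_TC TC_gen TC_gen]] gh
            by (simp add: TC_def[symmetric])
        qed
        then show ?thesis using x by blast
      qed
      then show "x \<in> Zodd m \<inter> Eig w"
        using x Eig_KK sc_iff[OF w1, of "Wu x"]
        by (auto simp: TCn aut_minus_Eig lin_sc[OF lin_K(2)])
    qed
  qed (auto intro: fv.subspace_inter subspace_Z subspace_Eig subspace_TC)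
  then show "\<exists>\<psi>. presents (Zodd m \<inter> Eig w) (TC (n * Suc m) \<inter> Eig w) (ksubquot (ore_extension Kr (char_aut \<chi>))
     (ore_monom Kr (n - 1) ` {l \<in> Eg w. l \<otimes>\<^bsub>Kr\<^esub> u \<in> Eg w \<inter> commutators Kr})
     (ore_monom Kr (n - 1) ` (Eg w \<inter> commutators Kr))) \<psi>"
    unfolding Eig_chi commutators_TC eq TCn by (simp add: Int_commute)
qed

text \<open>On the eigenspace of 1 the operator \<open>\<alpha> - 1\<close> vanishes and only
  commutators are divided out. Eigenvalues \<open>w\<close> with \<open>w\<^sup>n \<noteq>
  1\<close> do not occur, since \<open>\<chi>\<^sup>n\<close> is trivial.\<close>

lemma unit_zero:
  "\<exists>\<psi>. presents KK (TU 0) (ksubquot Kr (Eg 1) (Eg 1 \<inter> commutators Kr) \<oplus>\<^sub>k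
     kdirect_sum C' (\<lambda>w. ksubquot Kr (Eg w)
       ((Eg w \<inter> commutators Kr) <+>\<^bsub>Kr\<^esub> {l \<otimes>\<^bsub>Kr\<^esub> u | l. l \<in> Eg w}))) \<psi>"
proof -
  let ?N = "\<lambda>w. ksubquot Kr (Eg w) ((Eg w \<inter> commutators Kr) <+>\<^bsub>Kr\<^esub> {l \<otimes>\<^bsub>Kr\<^esub> u | l. l \<in> Eg w})"
  let ?B = "{k \<in> KK. k - comp 1 k \<in> TU 0}"
  have linr: "lin (\<lambda>k. k - comp 1 k)" by (intro lin_diff_fun lin_id lin_comp_w)
  have "?B = KK \<inter> {k. k - comp 1 k \<in> TU 0}" by auto
  then have subB: "fv.subspace ?B"
    using fv.subspace_inter[OF subspaces(3) subspace_vimage[OF linr subspace_TU]] by simp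
  have rest: "z - (\<Sum>w\<in>C'. comp w z) = comp 1 z" if z: "z \<in> KK" for z
  proof
    fix g
    have "(\<Sum>w\<in>C'. comp w z g) = (\<Sum>w\<in>C'. if w = \<chi> g then z g else 0)"
      by (intro sum.cong refl) (auto simp: comp_def dg_def)
    also have "\<dots> = (if \<chi> g \<in> C' then z g else 0)" using finC by (simp add: sum.delta)
    finally have s: "(\<Sum>w\<in>C'. comp w z g) = (if \<chi> g \<in> C' then z g else 0)" .
    show "(z - (\<Sum>w\<in>C'. comp w z)) g = comp 1 z g"
    proof (cases "g \<in> carrier G")
      case True
      then show ?thesis using chi_n[OF True] s
        by (auto simp: fun_ap comp_def dg_def nth_roots_of_one_def)
    next
      case False
      then have "z g = 0" using z by (auto simp: KK_def fin_funs_def)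
      then show ?thesis using s by (auto simp: fun_ap comp_def dg_def)
    qed
  qed
  have cc: "comp w (comp 1 z) = comp 1 (comp w z)" for w z
    by (simp add: comp_def dg_dg mult.commute)
  have c11: "comp 1 (comp 1 z) = comp 1 z" for z
    by (auto simp: comp_def dg_dg dg_def fun_eq_iff)
  have M2: "\<exists>\<psi>. presents KK ?B (kdirect_sum C' ?N) \<psi>"
  proof (rule direct_sum[OF subspaces(3) order_refl subB])
    show "comp w z \<in> KK" if "z \<in> KK" for z w using dg_KK[OF that] by (simp add: comp_def)
    show "comp w z \<in> ?B" if "z \<in> ?B" for z w
    proof -
      have "comp w z - comp 1 (comp w z) = comp w (z - comp 1 z)"
        by (simp add: lin_diff[OF lin_comp_w] cc)
      then show ?thesis using that dg_TU[of "z - comp 1 z" 0] dg_KK[of z] by (simp add: comp_def)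
    qed
    show "z - (\<Sum>w\<in>C'. comp w z) \<in> ?B" if "z \<in> KK" for z
      unfolding rest[OF that] using that dg_KK[of z] fv.subspace_0[OF subspace_TU]
      by (simp add: c11) (simp add: comp_def)
    show "\<exists>\<psi>. presents (KK \<inter> Eig w) (?B \<inter> Eig w) (?N w) \<psi>" if w: "w \<in> C'" for w
    proof -
      have "comp 1 k = 0" if "k \<in> Eig w" for k using comp_other[OF that, of 1] w by auto
      then have "?B \<inter> Eig w = TU 0 \<inter> Eig w" "KK \<inter> Eig w = Eig w" using Eig_KK by auto
      then show ?thesis using unit_even_family[OF w, of 0] by simp
    qed
  qed
  have M1: "\<exists>\<psi>. presents (Eig 1) (Eig 1 \<inter> TC 0) (ksubquot Kr (Eg 1) (Eg 1 \<inter> commutators Kr)) \<psi>"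
    unfolding Eig_chi commutators_TC by (rule subquot_K[OF subspace_Eig EigTC Eig_KK])
  obtain \<psi>1 where p1: "presents (Eig 1) (Eig 1 \<inter> TC 0) (ksubquot Kr (Eg 1) (Eg 1 \<inter> commutators Kr)) \<psi>1"
    using M1 by blast
  obtain \<psi>2 where p2: "presents KK ?B (kdirect_sum C' ?N) \<psi>2" using M2 by blast
  have "presents KK (TU 0) (ksubquot Kr (Eg 1) (Eg 1 \<inter> commutators Kr) \<oplus>\<^sub>k kdirect_sum C' ?N)
      (\<lambda>z. (\<psi>1 (comp 1 z), \<psi>2 z))"
  proof (rule plus_presents[OF p1 p2 lin_comp_w comp_Eig _ _ subspaces(3)])
    fix v z assume v: "v \<in> Eig 1" and z: "z \<in> KK"
    let ?y = "v + (z - comp 1 z)"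
    have vK: "v \<in> KK" and cv: "comp 1 v = v" using v by (auto simp: Eig_def)
    have zK: "comp 1 z \<in> KK" using dg_KK[OF z] by (simp add: comp_def)
    have "comp 1 ?y = v" by (simp add: lin_add[OF lin_comp_w] lin_diff[OF lin_comp_w] c11 cv)
    moreover have "?y - z - comp 1 (?y - z) = 0"
      by (simp add: lin_add[OF lin_comp_w] lin_diff[OF lin_comp_w] c11 cv)
    ultimately show "\<exists>y\<in>KK. comp 1 y = v \<and> y - z \<in> ?B"
      using vK zK z fv.subspace_0[OF subspace_TU, of 0]
      by (intro bexI[of _ ?y]) (auto simp: subspaces fv.subspace_add fv.subspace_diff)
  next
    fix z assume z: "z \<in> KK"
    have one: "comp 1 z \<in> TC 0" if "z \<in> TU 0"
    proof -
      obtain x k where k: "z = x + Wu (aut_minus k)" "x \<in> TC 0" "k \<in> KK"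
        using \<open>z \<in> TU 0\<close> by (auto simp: TU_def)
      have "comp 1 z = comp 1 x + Wu (aut_minus (comp 1 k))"
        using aut_minus_KK[OF k(3)] by (simp add: k(1) comp_def lin_add[OF lin_dg] dg_Wu aut_minus_dg dg_dg mult.commute)
      also have "aut_minus (comp 1 k) = 0" using aut_minus_Eig[OF comp_Eig[OF k(3)], of 1] by simp
      finally show ?thesis using dg_TC[OF k(2)] by (simp add: lin_zero[OF lin_K(2)] comp_def)
    qed
    show "z \<in> TU 0 \<longleftrightarrow> comp 1 z \<in> Eig 1 \<inter> TC 0 \<and> z \<in> ?B"
    proof
      assume t: "z \<in> TU 0"
      have "comp 1 z \<in> TU 0" using dg_TU[OF t] by (simp add: comp_def)
      then show "comp 1 z \<in> Eig 1 \<inter> TC 0 \<and> z \<in> ?B"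
        using one[OF t] comp_Eig[OF z] z t subspace_TU by (simp add: fv.subspace_diff)
    next
      assume "comp 1 z \<in> Eig 1 \<inter> TC 0 \<and> z \<in> ?B"
      then have "(z - comp 1 z) + comp 1 z \<in> TU 0"
        using TC_TU[of "comp 1 z" 0] by (intro fv.subspace_add subspace_TU) auto
      then show "z \<in> TU 0" by simp
    qed
  qed
  then show ?thesis by blast
qed

end

end

section \<open>The three cases\<close>

context ore_quotient
begin

lemma HH_iso:
  assumes q: "qiso (M.HZ 0 m) (M.HB 0 m) Z' B'" and Z': "fv.subspace Z'"
    and N: "\<exists>\<psi>. presents Z' B' N \<psi>"
  shows "HH m (rank_one_algebra G \<chi> n g1 \<xi>) \<cong>\<^sub>k N"
proof -
  obtain Z :: "((nat \<Rightarrow> 'g \<Rightarrow> 'k) set list \<Rightarrow> 'k) set" and B \<psi>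
    where Z: "presents Z B (HH m (rank_one_algebra G \<chi> n g1 \<xi>)) \<psi>" "fv.subspace Z"
      "qiso Z B (M.HZ 0 m) (M.HB 0 m)"
    using HH_model[of m] by blast
  obtain \<psi>' where "presents Z' B' N \<psi>'" using N by blast
  then show ?thesis using kiso_of_presents[OF Z(1) _ qiso_trans[OF Z(3) q] Z(2) Z'] by blast
qed

lemma HH_zero:
  "\<exists>\<psi>. presents M.KK (M.TU 0) N \<psi> \<Longrightarrow> HH 0 (rank_one_algebra G \<chi> n g1 \<xi>) \<cong>\<^sub>k N"
  by (rule HH_iso[OF M.H_zero M.subspaces(3)])

lemma HH_odd:
  "\<exists>\<psi>. presents (M.Zodd m) (M.Bodd m) N \<psi> \<Longrightarrow> HH (2 * m + 1) (rank_one_algebra G \<chi> n g1 \<xi>) \<cong>\<^sub>k N"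
proof (rule HH_iso[OF _ M.subspace_Z(1)])
  show "qiso (M.HZ 0 (2 * m + 1)) (M.HB 0 (2 * m + 1)) (M.Zodd m) (M.Bodd m)"
    by (rule qiso_trans[OF _ M.H_one]) (use M.H_shift_iter[of 0 m 0] in simp)
qed

lemma HH_even:
  "\<exists>\<psi>. presents (M.Zev m) (M.TU (Suc m)) N \<psi> \<Longrightarrow> HH (2 * m + 2) (rank_one_algebra G \<chi> n g1 \<xi>) \<cong>\<^sub>k N"
proof (rule HH_iso[OF _ M.subspace_Z(2)])
  show "qiso (M.HZ 0 (2 * m + 2)) (M.HB 0 (2 * m + 2)) (M.Zev m) (M.TU (Suc m))"
    by (rule qiso_trans[OF _ M.H_two]) (use M.H_shift_iter[of 0 m 1] in \<open>simp add: numeral_2_eq_2\<close>)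
qed

text \<open>Both the case \<open>\<xi> = 0\<close>, with \<open>G' = G\<close>, and the case of
  nontrivial \<open>\<chi>\<^sup>n\<close>, with \<open>G' = G / \<langle>c\<rangle>\<close>,
  are instances. Only the values of \<open>\<alpha>\<close> on the group algebra matter; the
  induced automorphism of the quotient is unspecified elsewhere.\<close>

lemma HH_graded:
  assumes "\<xi>' = 0" and al: "\<And>f. f \<in> fin_funs (carrier G') \<Longrightarrow> \<alpha> f = char_aut \<chi>' f"
  shows "HH 0 (rank_one_algebra G \<chi> n g1 \<xi>) \<cong>\<^sub>k
      kquot (group_algebra G') (commutators (group_algebra G'))"
    and "HH (2 * m + 1) (rank_one_algebra G \<chi> n g1 \<xi>) \<cong>\<^sub>k
      kdirect_sum (nth_roots_of_one n - {1}) (\<lambda>w. ksubquot (ore_extension (group_algebra G') \<alpha>)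
        (ore_monom (group_algebra G') (n - 1) ` eigenspace (group_algebra G') \<alpha> w)
        (ore_monom (group_algebra G') (n - 1) ` (eigenspace (group_algebra G') \<alpha> w \<inter>
          twisted_commutators (group_algebra G') (\<alpha> ^^ ((m + 1) * n)))))"
    and "HH (2 * m + 2) (rank_one_algebra G \<chi> n g1 \<xi>) \<cong>\<^sub>k
      kdirect_sum (nth_roots_of_one n - {1}) (\<lambda>w. ksubquot (group_algebra G')
        (eigenspace (group_algebra G') \<alpha> w)
        (eigenspace (group_algebra G') \<alpha> w \<inter>
          twisted_commutators (group_algebra G') (\<alpha> ^^ ((m + 1) * n))))"
proof -
  have al': "\<And>f. f \<in> M.KK \<Longrightarrow> \<alpha> f = char_aut \<chi>' f" using al by (simp add: M.KK_def)
  show "HH 0 (rank_one_algebra G \<chi> n g1 \<xi>) \<cong>\<^sub>k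
      kquot (group_algebra G') (commutators (group_algebra G'))"
    by (rule HH_zero) (rule M.zero_zero[OF assms(1)])
  show "HH (2 * m + 1) (rank_one_algebra G \<chi> n g1 \<xi>) \<cong>\<^sub>k
      kdirect_sum (nth_roots_of_one n - {1}) (\<lambda>w. ksubquot (ore_extension (group_algebra G') \<alpha>)
        (ore_monom (group_algebra G') (n - 1) ` eigenspace (group_algebra G') \<alpha> w)
        (ore_monom (group_algebra G') (n - 1) ` (eigenspace (group_algebra G') \<alpha> w \<inter>
          twisted_commutators (group_algebra G') (\<alpha> ^^ ((m + 1) * n)))))"
    by (rule HH_odd) (rule M.zero_odd[OF assms(1) al'])
  show "HH (2 * m + 2) (rank_one_algebra G \<chi> n g1 \<xi>) \<cong>\<^sub>k
      kdirect_sum (nth_roots_of_one n - {1}) (\<lambda>w. ksubquot (group_algebra G')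
        (eigenspace (group_algebra G') \<alpha> w)
        (eigenspace (group_algebra G') \<alpha> w \<inter>
          twisted_commutators (group_algebra G') (\<alpha> ^^ ((m + 1) * n))))"
    by (rule HH_even) (rule M.zero_even[OF assms(1) al'])
qed

end

locale rank_one_datum = ore_group G \<chi> for G :: "('g, 'h) monoid_scheme" (structure)
    and \<chi> :: "'g \<Rightarrow> 'k::field_char_0" +
  fixes n :: nat and g1 :: 'g
  assumes n2: "2 \<le> n"
    and g1: "g1 \<in> carrier G"
    and g1_central: "g \<in> carrier G \<Longrightarrow> g1 \<otimes> g = g \<otimes> g1"
    and chi_g1: "\<chi> g1 ^ n = 1" "0 < j \<Longrightarrow> j < n \<Longrightarrow> \<chi> g1 ^ j \<noteq> 1"
begin

abbreviation "N \<equiv> generate G {g1 [^] n}"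
abbreviation "cls \<equiv> (\<lambda>g. N #> g)"

text \<open>The character of \<open>G / \<langle>c\<rangle>\<close> induced by
  \<open>\<chi>\<close>, which exists because \<open>\<chi>(c) = \<chi>(g\<^sub>1)\<^sup>n =
  1\<close>.\<close>

definition chi_quot :: "'g set \<Rightarrow> 'k" where
  "chi_quot Y = \<chi> (SOME g. g \<in> Y)"

lemma ore_quotient_id:
  assumes "\<And>g. g \<in> carrier G \<Longrightarrow> \<xi> = 0 \<or> \<chi> g ^ n = 1"
  shows "ore_quotient G \<chi> G \<chi> n g1 (\<lambda>g. g) \<xi> \<xi>"
proof unfold_locales
  show "0 < n" using n2 by simp
  show "\<chi> g1 ^ n = 1" by (rule chi_g1)
  show "\<And>j. 0 < j \<Longrightarrow> j < n \<Longrightarrow> \<chi> g1 ^ j \<noteq> 1" by (rule chi_g1)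
  show "(\<lambda>g. g) \<in> hom G G" by (auto simp: hom_def)
qed (use assms in \<open>auto simp: fin chi_mult chi_nz g1 g1_central\<close>)

lemma chi_1: "\<chi> \<one> = 1"
  using chi_mult[of \<one> \<one>] chi_nz[of \<one>] by simp

lemma chi_pow: "g \<in> carrier G \<Longrightarrow> \<chi> (g [^] (i::nat)) = \<chi> g ^ i"
  by (induction i) (auto simp: chi_1 chi_mult)

lemma g1_pow_central: "g \<in> carrier G \<Longrightarrow> g1 [^] (i::nat) \<otimes> g = g \<otimes> g1 [^] i"
proof (induction i)
  case (Suc i)
  have "g1 [^] i \<otimes> g1 \<otimes> g = g1 [^] i \<otimes> g \<otimes> g1"
    using Suc.prems g1 by (simp add: m_assoc g1_central)
  also have "\<dots> = g \<otimes> (g1 [^] i \<otimes> g1)"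
    using Suc g1 by (simp add: m_assoc)
  finally show ?case by simp
qed (use g1 in simp)

lemma N_props:
  assumes "h \<in> N"
  shows "h \<in> carrier G \<and> (\<forall>g\<in>carrier G. h \<otimes> g = g \<otimes> h) \<and> \<chi> h = 1"
  using assms
proof (induction rule: generate.induct)
  case one
  show ?case by (simp add: chi_1)
next
  case (incl h)
  then show ?case using g1 chi_g1(1) by (auto simp: g1_pow_central chi_pow)
next
  case (inv h)
  then have h: "h = g1 [^] n" "h \<in> carrier G" using g1 by auto
  have "\<chi> (inv h) = 1"
    using chi_mult[of h "inv h"] h(2) chi_1 chi_g1(1) g1 by (simp add: h(1) chi_pow)
  moreover have "inv h \<otimes> g = g \<otimes> inv h" if g: "g \<in> carrier G" for g
  proof -
    have "h \<otimes> g = g \<otimes> h" using g1_pow_central[OF g] h(1) by simp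
    then show ?thesis
      using h(2) g inv_solve_left[of "g \<otimes> inv h" h g] by (simp add: m_assoc[symmetric]) (simp add: m_assoc)
  qed
  ultimately show ?case using h by auto
next
  case (eng h1 h2)
  have hc: "h1 \<in> carrier G" "h2 \<in> carrier G" and chi: "\<chi> h1 = 1" "\<chi> h2 = 1"
    using eng.IH by blast+
  have "h1 \<otimes> h2 \<otimes> g = g \<otimes> (h1 \<otimes> h2)" if g: "g \<in> carrier G" for g
  proof -
    have c: "h1 \<otimes> g = g \<otimes> h1" "h2 \<otimes> g = g \<otimes> h2" using eng.IH g by blast+
    have "h1 \<otimes> h2 \<otimes> g = h1 \<otimes> (g \<otimes> h2)" using hc g c(2) by (simp only: m_assoc)
    also have "\<dots> = g \<otimes> h1 \<otimes> h2" using hc g by (simp only: m_assoc[symmetric] c(1))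
    also have "\<dots> = g \<otimes> (h1 \<otimes> h2)" using hc g by (simp only: m_assoc)
    finally show ?thesis .
  qed
  then show ?case using hc chi by (simp add: chi_mult)
qed

lemma N_normal: "N \<lhd> G"
  unfolding normal_inv_iff
proof (intro conjI ballI)
  show "subgroup N G" by (rule generate_is_subgroup) (use g1 in auto)
  fix x h assume x: "x \<in> carrier G" and h: "h \<in> N"
  have hc: "h \<in> carrier G" and "h \<otimes> x = x \<otimes> h" using N_props[OF h] x by blast+
  then have "x \<otimes> h \<otimes> inv x = h \<otimes> x \<otimes> inv x" by simp
  also have "\<dots> = h" using hc x by (simp add: m_assoc)
  finally have "x \<otimes> h \<otimes> inv x = h" .
  then show "x \<otimes> h \<otimes> inv x \<in> N" using h by simp
qed

lemma carrier_Mod: "carrier (G Mod N) = cls ` carrier G"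
  by (auto simp: FactGroup_def RCOSETS_def)

lemma chi_quot_cls: 
  assumes "g \<in> carrier G"
  shows "chi_quot (cls g) = \<chi> g"
proof -
  interpret NN: normal N G by (rule N_normal)
  have "g \<in> cls g" by (rule rcos_self[OF assms NN.subgroup_axioms])
  then have "(SOME h. h \<in> cls g) \<in> cls g" by (rule someI)
  then obtain h where "h \<in> N" "(SOME h. h \<in> cls g) = h \<otimes> g" by (auto simp: r_coset_def)
  moreover from this have "h \<in> carrier G" "\<chi> h = 1" using N_props[of h] by blast+
  ultimately show ?thesis using assms by (simp add: chi_quot_def chi_mult)
qed

lemma mem_class:
  assumes "Y \<in> carrier (G Mod N)" "g \<in> Y"
  shows "g \<in> carrier G \<and> cls g = Y"
proof -
  interpret NN: normal N G by (rule N_normal)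
  obtain h where h: "h \<in> carrier G" "Y = cls h" using assms(1) carrier_Mod by auto
  have "cls h = cls g" using repr_independence[OF _ h(1) NN.subgroup_axioms] assms(2) h(2) by simp
  then show ?thesis using assms(2) h r_coset_subset_G[OF NN.subset h(1)] by auto
qed

lemma ore_quotient_Mod:
  assumes "\<xi> \<noteq> 0" "h \<in> carrier G" "\<chi> h ^ n \<noteq> 1"
  shows "ore_quotient G \<chi> (G Mod N) chi_quot n g1 cls 0 \<xi>"
proof -
  interpret NN: normal N G by (rule N_normal)
  interpret Q: group "G Mod N" by (rule NN.factorgroup_is_group)
  have hom: "cls \<in> hom G (G Mod N)" by (rule NN.r_coset_hom_Mod)
  have mult: "cls a <#> cls b = cls (a \<otimes> b)" if "a \<in> carrier G" "b \<in> carrier G" for a b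
    using hom_mult[OF hom that] by simp
  have sep: "inv a \<otimes> b \<in> N" if "a \<in> carrier G" "b \<in> carrier G" "cls a = cls b" for a b
  proof -
    have "b \<in> cls a" using rcos_self[OF that(2) NN.subgroup_axioms] that(3) by simp
    then obtain z where z: "z \<in> N" "b = z \<otimes> a" by (auto simp: r_coset_def)
    have zc: "z \<in> carrier G" and "z \<otimes> a = a \<otimes> z" using N_props[OF z(1)] that(1) by blast+
    then have "inv a \<otimes> b = z" using that(1) z(2) by (simp add: m_assoc[symmetric])
    then show ?thesis using z(1) by simp
  qed
  have triv: "cls (g1 [^] n) = \<one>\<^bsub>G Mod N\<^esub>"
    using coset_join2[of "g1 [^] n" N] generate.incl[of "g1 [^] n" "{g1 [^] n}" G] g1 NN.subgroup_axioms
    by (simp add: FactGroup_def)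
  show ?thesis
  proof unfold_locales
    show "finite (carrier (G Mod N))" using fin by (simp add: carrier_Mod)
    show "0 < n" using n2 by simp
    show "cls g1 \<in> carrier (G Mod N)" using g1 by (simp add: carrier_Mod)
    show "cls \<in> hom G (G Mod N)" by (rule hom)
    show "cls ` carrier G = carrier (G Mod N)" by (simp add: carrier_Mod)
    show "chi_quot (x \<otimes>\<^bsub>G Mod N\<^esub> y) = chi_quot x * chi_quot y"
      if "x \<in> carrier (G Mod N)" "y \<in> carrier (G Mod N)" for x y
      using that by (auto simp: carrier_Mod mult chi_quot_cls chi_mult)
    show "chi_quot x \<noteq> 0" if "x \<in> carrier (G Mod N)" for x
      using that by (auto simp: carrier_Mod chi_quot_cls chi_nz)
    show "cls g1 \<otimes>\<^bsub>G Mod N\<^esub> x = x \<otimes>\<^bsub>G Mod N\<^esub> cls g1" if "x \<in> carrier (G Mod N)" for x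
      using that by (auto simp: carrier_Mod mult g1 g1_central)
    show "chi_quot (cls g1) ^ n = 1" using chi_g1(1) by (simp add: chi_quot_cls g1)
    show "chi_quot (cls g1) ^ j \<noteq> 1" if "0 < j" "j < n" for j
      using chi_g1(2)[OF that] by (simp add: chi_quot_cls g1)
    show "((0::'k) = \<xi> \<and> inj_on cls (carrier G)) \<or>
      ((0::'k) = 0 \<and> (\<forall>g\<in>carrier G. \<forall>h\<in>carrier G. cls g = cls h \<longrightarrow> inv g \<otimes> h \<in> N) \<and>
        cls (g1 [^] n) = \<one>\<^bsub>G Mod N\<^esub> \<and> \<xi> \<noteq> 0 \<and> (\<exists>h\<in>carrier G. \<chi> h ^ n \<noteq> 1))"
      using sep triv assms by blast
  qed (auto simp: chi_quot_cls g1 g1_central)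
qed

text \<open>A preimage spreads the value on a coset evenly over its elements.\<close>

lemma proj_surj:
  assumes F: "(F :: 'g set \<Rightarrow> 'k) \<in> fin_funs (carrier (G Mod N))"
  shows "F \<in> group_algebra_proj G N ` carrier (group_algebra G)"
proof -
  interpret NN: normal N G by (rule N_normal)
  let ?f = "\<lambda>g. if g \<in> carrier G then F (cls g) / of_nat (card N) else 0"
  have finN: "finite N" using fin NN.subset by (rule finite_subset[rotated])
  have "N \<noteq> {}" using subgroup.one_closed[OF NN.subgroup_axioms] by (metis empty_iff)
  then have N0: "of_nat (card N) \<noteq> (0 :: 'k)" using finN by simp
  have "?f \<in> fin_funs (carrier G)"
  proof -
    have "{s. ?f s \<noteq> 0} \<subseteq> carrier G" by auto
    then show ?thesis using finite_subset[OF _ fin] unfolding fin_funs_def by blast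
  qed
  moreover have "group_algebra_proj G N ?f = F"
  proof
    fix Y
    show "group_algebra_proj G N ?f Y = F Y"
    proof (cases "Y \<in> carrier (G Mod N)")
      case True
      have CG: "Y \<subseteq> carrier G" and eq: "\<And>g. g \<in> Y \<Longrightarrow> ?f g = F Y / of_nat (card N)"
        using mem_class[OF True] by auto
      have "(\<Sum>g\<in>{g \<in> Y. ?f g \<noteq> 0}. ?f g) = (\<Sum>g\<in>Y. ?f g)"
        by (rule sum.mono_neutral_left) (use finite_subset[OF CG fin] in auto)
      also have "\<dots> = of_nat (card Y) * (F Y / of_nat (card N))" by (simp only: sum.cong[OF refl eq] sum_constant)
      also have "card Y = card N"
        using card_rcosets_equal[of Y N] True NN.subset by (simp add: FactGroup_def)
      finally show ?thesis using N0 True by (simp add: group_algebra_proj_def)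
    next
      case False
      then show ?thesis using F by (auto simp: group_algebra_proj_def fin_funs_def)
    qed
  qed
  ultimately show ?thesis by (intro image_eqI[of _ _ ?f]) (auto simp: group_algebra_def)
qed

text \<open>Every preimage gives the same result: \<open>\<chi>\<close> is constant on cosets,
  so the multiplication by \<open>\<chi>\<close> commutes with summation over a coset. As
  \<open>\<chi>\<close> never vanishes, the supports over which the sums are taken
  agree.\<close>

lemma induced_char_aut:
  assumes F: "(F :: 'g set \<Rightarrow> 'k) \<in> fin_funs (carrier (G Mod N))"
  shows "induced_on_quotient G N (char_aut \<chi>) F = char_aut chi_quot F"
proof
  fix Y
  let ?f = "inv_into (carrier (group_algebra G)) (group_algebra_proj G N) F"
  have f: "group_algebra_proj G N ?f = F" by (rule f_inv_into_f[OF proj_surj[OF F]])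
  show "induced_on_quotient G N (char_aut \<chi>) F Y = char_aut chi_quot F Y"
  proof (cases "Y \<in> carrier (G Mod N)")
    case True
    have c: "\<chi> g = chi_quot Y" "\<chi> g \<noteq> 0" if "g \<in> Y" for g
      using mem_class[OF True that] chi_quot_cls[of g] chi_nz[of g] by auto
    have "induced_on_quotient G N (char_aut \<chi>) F Y = (\<Sum>g\<in>{g \<in> Y. \<chi> g * ?f g \<noteq> 0}. \<chi> g * ?f g)"
      using True by (simp add: induced_on_quotient_def group_algebra_proj_def char_aut_def)
    also have "\<dots> = (\<Sum>g\<in>{g \<in> Y. ?f g \<noteq> 0}. chi_quot Y * ?f g)"
      by (rule sum.cong) (use c in auto)
    also have "\<dots> = chi_quot Y * group_algebra_proj G N ?f Y"
      using True by (simp add: group_algebra_proj_def sum_distrib_left)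
    finally show ?thesis by (simp only: f char_aut_def)
  next
    case False
    then have "F Y = 0" using F by (auto simp: fin_funs_def)
    then show ?thesis using False by (simp add: induced_on_quotient_def group_algebra_proj_def char_aut_def)
  qed
qed

end

lemma ore_unit_cases:
  assumes q: "ore_quotient G \<chi> G \<chi> n g1 (\<lambda>g. g) \<xi> \<xi>" and xi: "\<xi> \<noteq> 0"
    and chi: "\<And>g. g \<in> carrier G \<Longrightarrow> \<chi> g ^ n = 1"
  defines "K \<equiv> group_algebra G" and "E \<equiv> eigenspace (group_algebra G) (char_aut \<chi>)"
    and "u \<equiv> basis_elt (g1 [^]\<^bsub>G\<^esub> n) \<ominus>\<^bsub>group_algebra G\<^esub> \<one>\<^bsub>group_algebra G\<^esub>"
  shows "HH 0 (rank_one_algebra G \<chi> n g1 \<xi>) \<cong>\<^sub>k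
      ksubquot K (E 1) (E 1 \<inter> commutators K) \<oplus>\<^sub>k kdirect_sum (nth_roots_of_one n - {1})
        (\<lambda>w. ksubquot K (E w) ((E w \<inter> commutators K) <+>\<^bsub>K\<^esub> {l \<otimes>\<^bsub>K\<^esub> u | l. l \<in> E w}))"
    and "HH (2 * m + 1) (rank_one_algebra G \<chi> n g1 \<xi>) \<cong>\<^sub>k
      kdirect_sum (nth_roots_of_one n - {1}) (\<lambda>w. ksubquot (ore_extension K (char_aut \<chi>))
        (ore_monom K (n - 1) ` {l \<in> E w. l \<otimes>\<^bsub>K\<^esub> u \<in> E w \<inter> commutators K})
        (ore_monom K (n - 1) ` (E w \<inter> commutators K)))"
    and "HH (2 * m + 2) (rank_one_algebra G \<chi> n g1 \<xi>) \<cong>\<^sub>k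
      kdirect_sum (nth_roots_of_one n - {1})
        (\<lambda>w. ksubquot K (E w) ((E w \<inter> commutators K) <+>\<^bsub>K\<^esub> {l \<otimes>\<^bsub>K\<^esub> u | l. l \<in> E w}))"
proof -
  have md: "model G \<chi> n g1 \<xi>" using q by (simp add: ore_quotient_def)
  note lm = K_def E_def u_def
  note zr = model.unit_zero[OF md xi chi] and od = model.unit_odd[OF md xi chi]
    and ev = model.unit_even[OF md xi chi]
  show "HH 0 (rank_one_algebra G \<chi> n g1 \<xi>) \<cong>\<^sub>k
      ksubquot K (E 1) (E 1 \<inter> commutators K) \<oplus>\<^sub>k kdirect_sum (nth_roots_of_one n - {1})
        (\<lambda>w. ksubquot K (E w) ((E w \<inter> commutators K) <+>\<^bsub>K\<^esub> {l \<otimes>\<^bsub>K\<^esub> u | l. l \<in> E w}))"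
    unfolding lm by (rule ore_quotient.HH_zero[OF q]) (rule zr)
  show "HH (2 * m + 1) (rank_one_algebra G \<chi> n g1 \<xi>) \<cong>\<^sub>k
      kdirect_sum (nth_roots_of_one n - {1}) (\<lambda>w. ksubquot (ore_extension K (char_aut \<chi>))
        (ore_monom K (n - 1) ` {l \<in> E w. l \<otimes>\<^bsub>K\<^esub> u \<in> E w \<inter> commutators K})
        (ore_monom K (n - 1) ` (E w \<inter> commutators K)))"
    unfolding lm by (rule ore_quotient.HH_odd[OF q]) (rule od)
  show "HH (2 * m + 2) (rank_one_algebra G \<chi> n g1 \<xi>) \<cong>\<^sub>k
      kdirect_sum (nth_roots_of_one n - {1})
        (\<lambda>w. ksubquot K (E w) ((E w \<inter> commutators K) <+>\<^bsub>K\<^esub> {l \<otimes>\<^bsub>K\<^esub> u | l. l \<in> E w}))"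
    unfolding lm by (rule ore_quotient.HH_even[OF q]) (rule ev)
qed

theorem mainTheorem9:
  fixes G :: "('g, 'b) monoid_scheme"
    and \<chi> :: "'g \<Rightarrow> 'k::field_char_0"
    and n :: nat and g\<^sub>1 :: 'g and \<xi> :: 'k
  assumes "group G" and "finite (carrier G)"
    and "\<chi> \<in> hom G (units_of (ring_of_type_algebra :: 'k ring))"
    and "n \<ge> 2"
    and "g\<^sub>1 \<in> carrier G" and "\<forall>g\<in>carrier G. g\<^sub>1 \<otimes>\<^bsub>G\<^esub> g = g \<otimes>\<^bsub>G\<^esub> g\<^sub>1"
    and "\<chi> g\<^sub>1 ^ n = 1" and "\<forall>j. 0 < j \<and> j < n \<longrightarrow> \<chi> g\<^sub>1 ^ j \<noteq> 1"
  shows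
    "let A = rank_one_algebra G \<chi> n g\<^sub>1 \<xi>;
         C = nth_roots_of_one n :: 'k set
     in
      (\<xi> = 0 \<longrightarrow>
        (let K = group_algebra G; \<alpha> = char_aut \<chi>;
             KK = commutators K;
             E = eigenspace K \<alpha>;
             T = (\<lambda>j w. eigenspace K \<alpha> w \<inter> twisted_commutators K (\<alpha> ^^ j))
         in
          HH 0 A \<cong>\<^sub>k kquot K KK \<and>
          (\<forall>m.
            HH (2 * m + 1) A \<cong>\<^sub>k
              kdirect_sum (C - {1}) (\<lambda>w. ksubquot (ore_extension K \<alpha>)
                (ore_monom K (n - 1) ` E w) (ore_monom K (n - 1) ` T ((m + 1) * n) w)) \<and>
            HH (2 * m + 2) A \<cong>\<^sub>k
              kdirect_sum (C - {1}) (\<lambda>w. ksubquot K (E w) (T ((m + 1) * n) w)))))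
      \<and>
      (\<xi> \<noteq> 0 \<and> (\<forall>g\<in>carrier G. \<chi> g ^ n = 1) \<longrightarrow>
        (let K = group_algebra G; \<alpha> = char_aut \<chi>;
             u = basis_elt (g\<^sub>1 [^]\<^bsub>G\<^esub> n) \<ominus>\<^bsub>K\<^esub> \<one>\<^bsub>K\<^esub>;
             E = eigenspace K \<alpha>;
             KK = (\<lambda>w. eigenspace K \<alpha> w \<inter> commutators K);
             Eu = (\<lambda>w. {l \<otimes>\<^bsub>K\<^esub> u | l. l \<in> E w});
             Z = (\<lambda>w. {l \<in> E w. l \<otimes>\<^bsub>K\<^esub> u \<in> KK w})
         in
          HH 0 A \<cong>\<^sub>k ksubquot K (E 1) (KK 1) \<oplus>\<^sub>k
            kdirect_sum (C - {1}) (\<lambda>w. ksubquot K (E w) (KK w <+>\<^bsub>K\<^esub> Eu w)) \<and>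
          (\<forall>m.
            HH (2 * m + 1) A \<cong>\<^sub>k
              kdirect_sum (C - {1}) (\<lambda>w. ksubquot (ore_extension K \<alpha>)
                (ore_monom K (n - 1) ` Z w) (ore_monom K (n - 1) ` KK w)) \<and>
            HH (2 * m + 2) A \<cong>\<^sub>k
              kdirect_sum (C - {1}) (\<lambda>w. ksubquot K (E w) (KK w <+>\<^bsub>K\<^esub> Eu w)))))
      \<and>
      (\<xi> \<noteq> 0 \<and> \<not> (\<forall>g\<in>carrier G. \<chi> g ^ n = 1) \<longrightarrow>
        (let N = generate G {g\<^sub>1 [^]\<^bsub>G\<^esub> n};
             K = group_algebra (G Mod N);
             \<alpha> = induced_on_quotient G N (char_aut \<chi>);
             KK = commutators K;
             E = eigenspace K \<alpha>;
             T = (\<lambda>j w. eigenspace K \<alpha> w \<inter> twisted_commutators K (\<alpha> ^^ j))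
         in
          HH 0 A \<cong>\<^sub>k kquot K KK \<and>
          (\<forall>m.
            HH (2 * m + 1) A \<cong>\<^sub>k
              kdirect_sum (C - {1}) (\<lambda>w. ksubquot (ore_extension K \<alpha>)
                (ore_monom K (n - 1) ` E w) (ore_monom K (n - 1) ` T ((m + 1) * n) w)) \<and>
            HH (2 * m + 2) A \<cong>\<^sub>k
              kdirect_sum (C - {1}) (\<lambda>w. ksubquot K (E w) (T ((m + 1) * n) w)))))"
proof -
  have nz: "\<chi> g \<noteq> 0" if "g \<in> carrier G" for g
    using hom_in_carrier[OF assms(3) that] by (auto simp: units_of_def Units_def ring_of_type_algebra_def)
  have mu: "\<chi> (g \<otimes>\<^bsub>G\<^esub> h) = \<chi> g * \<chi> h" if "g \<in> carrier G" "h \<in> carrier G" for g h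
    using hom_mult[OF assms(3) that] by (simp add: units_of_def ring_of_type_algebra_def)
  have og: "ore_group G \<chi>"
    unfolding ore_group_def ore_group_axioms_def using assms(1,2) nz mu by blast
  have rd: "rank_one_datum G \<chi> n g\<^sub>1"
    unfolding rank_one_datum_def rank_one_datum_axioms_def using og assms(4-8) by blast
  note graded = ore_quotient.HH_graded[OF rank_one_datum.ore_quotient_id[OF rd] _ refl]
  show ?thesis
    unfolding Let_def
  proof (intro conjI impI allI, goal_cases)
    case 1
    then show ?case by (intro graded(1)) auto
  next
    case (2 m)
    then show ?case by (intro graded(2)) auto
  next
    case (3 m)
    then show ?case by (intro graded(3)) auto
  next
    case 4
    then have q: "ore_quotient G \<chi> G \<chi> n g\<^sub>1 (\<lambda>g. g) \<xi> \<xi>"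
      by (intro rank_one_datum.ore_quotient_id[OF rd]) auto
    show ?case by (rule ore_unit_cases(1)[OF q]) (use 4 in auto)
  next
    case (5 m)
    then have q: "ore_quotient G \<chi> G \<chi> n g\<^sub>1 (\<lambda>g. g) \<xi> \<xi>"
      by (intro rank_one_datum.ore_quotient_id[OF rd]) auto
    show ?case by (rule ore_unit_cases(2)[OF q]) (use 5 in auto)
  next
    case (6 m)
    then have q: "ore_quotient G \<chi> G \<chi> n g\<^sub>1 (\<lambda>g. g) \<xi> \<xi>"
      by (intro rank_one_datum.ore_quotient_id[OF rd]) auto
    show ?case by (rule ore_unit_cases(3)[OF q]) (use 6 in auto)
  next
    case 7
    then obtain h where h: "\<xi> \<noteq> 0" "h \<in> carrier G" "\<chi> h ^ n \<noteq> 1" by auto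
    show ?case
      by (rule ore_quotient.HH_graded(1)[OF rank_one_datum.ore_quotient_Mod[OF rd h] refl])
        (rule rank_one_datum.induced_char_aut[OF rd])
  next
    case (8 m)
    then obtain h where h: "\<xi> \<noteq> 0" "h \<in> carrier G" "\<chi> h ^ n \<noteq> 1" by auto
    show ?case
      by (rule ore_quotient.HH_graded(2)[OF rank_one_datum.ore_quotient_Mod[OF rd h] refl])
        (rule rank_one_datum.induced_char_aut[OF rd])
  next
    case (9 m)
    then obtain h where h: "\<xi> \<noteq> 0" "h \<in> carrier G" "\<chi> h ^ n \<noteq> 1" by auto
    show ?case
      by (rule ore_quotient.HH_graded(3)[OF rank_one_datum.ore_quotient_Mod[OF rd h] refl])
        (rule rank_one_datum.induced_char_aut[OF rd])
  qed
qed

end
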